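(* Let $f^*:\mathscr{T}\to\mathscr{S}$ be a fully faithful geometric functor between rigidly-compactly generated tt-categories such that $\varphi=\mathrm{Spc}(f^* ):\mathrm{Spc}(\mathscr{S}^c)\to\mathrm{Spc}(\mathscr{T}^c)$ is a homeomorphism. Assume $\mathrm{Spc}(\mathscr{S}^c)$ is noetherian. If $\mathscr{S}$ is locally unigenic then $f^*$ is an equivalence.
   Context: A rigidly-compactly generated tt-category is a triangulated category with compatible closed symmetric monoidal structure $(\otimes,\mathbb{1})$ and all small coproducts, which is compactly generated and whose compact objects coincide with its dualizable objects; $\mathscr{T}^c$ denotes the compact objects. A geometric functor is a coproduct-preserving tensor-triangulated functor between such categories; it restricts to compact objects and induces a spectral map on Balmer spectra $\mathscr{Q}\mapsto(f^* )^{-1}(\mathscr{Q})\cap\mathscr{T}^c$. $\mathrm{Spc}(\mathscr{K})$ is the set of prime thick tensor-ideals with basis of closed sets $\mathrm{supp}(a)=\{\mathscr{P}:a\notin\mathscr{P}\}$. A rigidly-compactly generated tt-category is unigenic if it is generated by its unit as a localizing subcategory: $\mathscr{T}=\mathrm{Loc}\langle\mathbb{1}\rangle$. For $\mathscr{P}\in\mathrm{Spc}(\mathscr{T}^c)$, the local category $\mathscr{T}_{\mathscr{P}}=\mathscr{T}|_{\mathrm{gen}(\mathscr{P})}$ is the finite localization $\mathscr{T}/\mathrm{Loc}\langle\mathscr{P}\rangle$, which is again a rigidly-compactly generated tt-category, with spectrum $\mathrm{gen}(\mathscr{P})=\{\mathscr{Q}:\mathscr{P}\in\overline{\{\mathscr{Q}\}}\}$.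 $\mathscr{T}$ is locally unigenic if $\mathscr{T}_{\mathscr{P}}$ is unigenic for every $\mathscr{P}\in\mathrm{Spc}(\mathscr{T}^c)$. *)

theory Defs
  imports "HOL-Algebra.Free_Abelian_Groups" "HOL-Algebra.Product_Groups"
    "HOL-Analysis.Abstract_Topology"
begin

unbundle cardinal_syntax

section \<open>Smallness\<close>

text \<open>
  "Small" is relative to an inaccessible cardinal (a Grothendieck universe) \<open>\<kappa>\<close>: a set is small
  if its cardinality is less than \<open>\<kappa>\<close>. Every small set is in bijection with a set of elements of
  the type underlying \<open>\<kappa>\<close>, so it suffices to consider small families indexed by that type.
\<close>

definition inaccessible :: "'u rel \<Rightarrow> bool" where
  "inaccessible \<kappa> \<longleftrightarrow>
     Card_order \<kappa> \<and> natLeq <o \<kappa> \<and> regularCard \<kappa> \<and>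
     (\<forall>A :: 'u set. |A| <o \<kappa> \<longrightarrow> |Pow A| <o \<kappa>)"

definition small :: "'u rel \<Rightarrow> 'a set \<Rightarrow> bool" where
  "small \<kappa> A \<longleftrightarrow> |A| <o \<kappa>"


section \<open>Categories\<close>

record ('o, 'm) cat =
  Ob :: "'o set"
  Arr :: "'m set"
  Dom :: "'m \<Rightarrow> 'o"
  Cod :: "'m \<Rightarrow> 'o"
  Ident :: "'o \<Rightarrow> 'm"
  Comp :: "'m \<Rightarrow> 'm \<Rightarrow> 'm" (infixr \<open>\<cdot>\<index>\<close> 75)

definition Hom :: "('o, 'm, 'x) cat_scheme \<Rightarrow> 'o \<Rightarrow> 'o \<Rightarrow> 'm set" where
  "Hom C X Y = {f \<in> Arr C. Dom C f = X \<and> Cod C f = Y}"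

locale category =
  fixes C :: "('o, 'm, 'x) cat_scheme" (structure)
  assumes Dom_in_Ob: "f \<in> Arr C \<Longrightarrow> Dom C f \<in> Ob C"
    and Cod_in_Ob: "f \<in> Arr C \<Longrightarrow> Cod C f \<in> Ob C"
    and Ident_in_Hom: "X \<in> Ob C \<Longrightarrow> Ident C X \<in> Hom C X X"
    and Comp_in_Hom: "f \<in> Hom C X Y \<Longrightarrow> g \<in> Hom C Y Z \<Longrightarrow> g \<cdot> f \<in> Hom C X Z"
    and Comp_Ident: "f \<in> Hom C X Y \<Longrightarrow> f \<cdot> Ident C X = f"
    and Ident_Comp: "f \<in> Hom C X Y \<Longrightarrow> Ident C Y \<cdot> f = f"
    and Comp_assoc: "f \<in> Hom C W X \<Longrightarrow> g \<in> Hom C X Y \<Longrightarrow> h \<in> Hom C Y Z \<Longrightarrow>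
        (h \<cdot> g) \<cdot> f = h \<cdot> (g \<cdot> f)"

definition inverse_arrows :: "('o, 'm, 'x) cat_scheme \<Rightarrow> 'm \<Rightarrow> 'm \<Rightarrow> bool" where
  "inverse_arrows C f g \<longleftrightarrow>
     f \<in> Arr C \<and> g \<in> Hom C (Cod C f) (Dom C f) \<and>
     g \<cdot>\<^bsub>C\<^esub> f = Ident C (Dom C f) \<and> f \<cdot>\<^bsub>C\<^esub> g = Ident C (Cod C f)"

definition isomorphism :: "('o, 'm, 'x) cat_scheme \<Rightarrow> 'm \<Rightarrow> bool" where
  "isomorphism C f \<longleftrightarrow> (\<exists>g. inverse_arrows C f g)"

definition inverse_arrow :: "('o, 'm, 'x) cat_scheme \<Rightarrow> 'm \<Rightarrow> 'm" where
  "inverse_arrow C f = (THE g. inverse_arrows C f g)"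

definition isomorphic :: "('o, 'm, 'x) cat_scheme \<Rightarrow> 'o \<Rightarrow> 'o \<Rightarrow> bool" where
  "isomorphic C X Y \<longleftrightarrow> (\<exists>f \<in> Hom C X Y. isomorphism C f)"

definition zero_object :: "('o, 'm, 'x) cat_scheme \<Rightarrow> 'o \<Rightarrow> bool" where
  "zero_object C Z \<longleftrightarrow>
     Z \<in> Ob C \<and> (\<forall>X \<in> Ob C. (\<exists>!f. f \<in> Hom C Z X) \<and> (\<exists>!f. f \<in> Hom C X Z))"

definition coproduct ::
  "('o, 'm, 'x) cat_scheme \<Rightarrow> 'i set \<Rightarrow> ('i \<Rightarrow> 'o) \<Rightarrow> 'o \<Rightarrow> ('i \<Rightarrow> 'm) \<Rightarrow> bool" where
  "coproduct C I X A \<iota> \<longleftrightarrow>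
     A \<in> Ob C \<and> (\<forall>i \<in> I. \<iota> i \<in> Hom C (X i) A) \<and>
     (\<forall>Y \<in> Ob C. \<forall>g. (\<forall>i \<in> I. g i \<in> Hom C (X i) Y) \<longrightarrow>
        (\<exists>!h. h \<in> Hom C A Y \<and> (\<forall>i \<in> I. h \<cdot>\<^bsub>C\<^esub> \<iota> i = g i)))"

definition has_small_coproducts :: "'u rel \<Rightarrow> ('o, 'm, 'x) cat_scheme \<Rightarrow> bool" where
  "has_small_coproducts \<kappa> C \<longleftrightarrow>
     (\<forall>(I :: 'u set) X. small \<kappa> I \<longrightarrow> X ` I \<subseteq> Ob C \<longrightarrow> (\<exists>A \<iota>. coproduct C I X A \<iota>))"

definition locally_small :: "'u rel \<Rightarrow> ('o, 'm, 'x) cat_scheme \<Rightarrow> bool" where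
  "locally_small \<kappa> C \<longleftrightarrow> (\<forall>X \<in> Ob C. \<forall>Y \<in> Ob C. small \<kappa> (Hom C X Y))"


section \<open>Functors\<close>

record ('o, 'm, 'p, 'n) cat_fun =
  FOb :: "'o \<Rightarrow> 'p"
  FArr :: "'m \<Rightarrow> 'n"

definition id_fun :: "('o, 'm, 'o, 'm) cat_fun" where
  "id_fun = \<lparr>FOb = (\<lambda>X. X), FArr = (\<lambda>f. f)\<rparr>"

definition comp_fun ::
  "('p, 'n, 'q, 'k, 'y) cat_fun_scheme \<Rightarrow> ('o, 'm, 'p, 'n, 'x) cat_fun_scheme \<Rightarrow>
   ('o, 'm, 'q, 'k) cat_fun" where
  "comp_fun G F = \<lparr>FOb = FOb G \<circ> FOb F, FArr = FArr G \<circ> FArr F\<rparr>"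

definition is_functor ::
  "('o, 'm, 'x) cat_scheme \<Rightarrow> ('p, 'n, 'y) cat_scheme \<Rightarrow>
   ('o, 'm, 'p, 'n, 'z) cat_fun_scheme \<Rightarrow> bool" where
  "is_functor C D F \<longleftrightarrow>
     (\<forall>X \<in> Ob C. FOb F X \<in> Ob D \<and> FArr F (Ident C X) = Ident D (FOb F X)) \<and>
     (\<forall>X \<in> Ob C. \<forall>Y \<in> Ob C. \<forall>f \<in> Hom C X Y. FArr F f \<in> Hom D (FOb F X) (FOb F Y)) \<and>
     (\<forall>f \<in> Arr C. \<forall>g \<in> Arr C. Cod C f = Dom C g \<longrightarrow>
        FArr F (g \<cdot>\<^bsub>C\<^esub> f) = FArr F g \<cdot>\<^bsub>D\<^esub> FArr F f)"

definition natural_isomorphism ::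
  "('o, 'm, 'x) cat_scheme \<Rightarrow> ('p, 'n, 'y) cat_scheme \<Rightarrow>
   ('o, 'm, 'p, 'n, 'z) cat_fun_scheme \<Rightarrow> ('o, 'm, 'p, 'n, 'w) cat_fun_scheme \<Rightarrow>
   ('o \<Rightarrow> 'n) \<Rightarrow> bool" where
  "natural_isomorphism C D F G \<eta> \<longleftrightarrow>
     (\<forall>X \<in> Ob C. \<eta> X \<in> Hom D (FOb F X) (FOb G X) \<and> isomorphism D (\<eta> X)) \<and>
     (\<forall>f \<in> Arr C. \<eta> (Cod C f) \<cdot>\<^bsub>D\<^esub> FArr F f = FArr G f \<cdot>\<^bsub>D\<^esub> \<eta> (Dom C f))"

definition fully_faithful ::
  "('o, 'm, 'x) cat_scheme \<Rightarrow> ('p, 'n, 'y) cat_scheme \<Rightarrow>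
   ('o, 'm, 'p, 'n, 'z) cat_fun_scheme \<Rightarrow> bool" where
  "fully_faithful C D F \<longleftrightarrow>
     (\<forall>X \<in> Ob C. \<forall>Y \<in> Ob C. bij_betw (FArr F) (Hom C X Y) (Hom D (FOb F X) (FOb F Y)))"

definition is_equivalence ::
  "('o, 'm, 'x) cat_scheme \<Rightarrow> ('p, 'n, 'y) cat_scheme \<Rightarrow>
   ('o, 'm, 'p, 'n, 'z) cat_fun_scheme \<Rightarrow> bool" where
  "is_equivalence C D F \<longleftrightarrow>
     is_functor C D F \<and>
     (\<exists>(G :: ('p, 'n, 'o, 'm) cat_fun) \<eta> \<epsilon>.
        is_functor D C G \<and>
        natural_isomorphism C C id_fun (comp_fun G F) \<eta> \<and>
        natural_isomorphism D D (comp_fun F G) id_fun \<epsilon>)"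

definition preserves_small_coproducts ::
  "'u rel \<Rightarrow> ('o, 'm, 'x) cat_scheme \<Rightarrow> ('p, 'n, 'y) cat_scheme \<Rightarrow>
   ('o, 'm, 'p, 'n, 'z) cat_fun_scheme \<Rightarrow> bool" where
  "preserves_small_coproducts \<kappa> C D F \<longleftrightarrow>
     (\<forall>(I :: 'u set) X A \<iota>. small \<kappa> I \<longrightarrow> coproduct C I X A \<iota> \<longrightarrow>
        coproduct D I (FOb F \<circ> X) (FOb F A) (FArr F \<circ> \<iota>))"


section \<open>Triangulated categories\<close>

text \<open>
  A triangle \<open>X \<rightarrow> Y \<rightarrow> Z \<rightarrow> \<Sigma>X\<close> is encoded as the triple of its arrows; \<open>Zero X Y\<close> is the zero
  arrow. The suspension is allowed to be an autoequivalence rather than an automorphism.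
\<close>

record ('o, 'm) tri_cat = "('o, 'm) cat" +
  Add :: "'m \<Rightarrow> 'm \<Rightarrow> 'm" (infixl \<open>\<boxplus>\<index>\<close> 65)
  Zero :: "'o \<Rightarrow> 'o \<Rightarrow> 'm"
  Sh :: "'o \<Rightarrow> 'o"
  ShA :: "'m \<Rightarrow> 'm"
  Tri :: "('m \<times> 'm \<times> 'm) set"

definition hom_group :: "('o, 'm, 'x) tri_cat_scheme \<Rightarrow> 'o \<Rightarrow> 'o \<Rightarrow> 'm monoid" where
  "hom_group C X Y = \<lparr>carrier = Hom C X Y, mult = Add C, one = Zero C X Y\<rparr>"

definition neg :: "('o, 'm, 'x) tri_cat_scheme \<Rightarrow> 'm \<Rightarrow> 'm" where
  "neg C f = inv\<^bsub>hom_group C (Dom C f) (Cod C f)\<^esub> f"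

definition biproduct :: "('o, 'm, 'x) tri_cat_scheme \<Rightarrow> 'o \<Rightarrow> 'o \<Rightarrow> 'o \<Rightarrow> bool" where
  "biproduct C X Y B \<longleftrightarrow>
     (\<exists>i \<in> Hom C X B. \<exists>j \<in> Hom C Y B. \<exists>p \<in> Hom C B X. \<exists>q \<in> Hom C B Y.
        p \<cdot>\<^bsub>C\<^esub> i = Ident C X \<and> q \<cdot>\<^bsub>C\<^esub> j = Ident C Y \<and>
        q \<cdot>\<^bsub>C\<^esub> i = Zero C X Y \<and> p \<cdot>\<^bsub>C\<^esub> j = Zero C Y X \<and>
        (i \<cdot>\<^bsub>C\<^esub> p) \<boxplus>\<^bsub>C\<^esub> (j \<cdot>\<^bsub>C\<^esub> q) = Ident C B)"

locale additive_category = category C for C :: "('o, 'm, 'x) tri_cat_scheme" (structure) +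
  assumes hom_comm_group: "X \<in> Ob C \<Longrightarrow> Y \<in> Ob C \<Longrightarrow> comm_group (hom_group C X Y)"
    and Comp_Add: "f \<in> Hom C X Y \<Longrightarrow> f' \<in> Hom C X Y \<Longrightarrow> g \<in> Hom C Y Z \<Longrightarrow>
        g \<cdot> (f \<boxplus> f') = (g \<cdot> f) \<boxplus> (g \<cdot> f')"
    and Add_Comp: "f \<in> Hom C X Y \<Longrightarrow> g \<in> Hom C Y Z \<Longrightarrow> g' \<in> Hom C Y Z \<Longrightarrow>
        (g \<boxplus> g') \<cdot> f = (g \<cdot> f) \<boxplus> (g' \<cdot> f)"
    and ex_zero_object: "\<exists>Z. zero_object C Z"
    and ex_biproduct: "X \<in> Ob C \<Longrightarrow> Y \<in> Ob C \<Longrightarrow> \<exists>B \<in> Ob C. biproduct C X Y B"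

definition shift_fun :: "('o, 'm, 'x) tri_cat_scheme \<Rightarrow> ('o, 'm, 'o, 'm) cat_fun" where
  "shift_fun C = \<lparr>FOb = Sh C, FArr = ShA C\<rparr>"

definition candidate_triangle ::
  "('o, 'm, 'x) tri_cat_scheme \<Rightarrow> 'm \<times> 'm \<times> 'm \<Rightarrow> bool" where
  "candidate_triangle C = (\<lambda>(f, g, h).
     f \<in> Arr C \<and> g \<in> Arr C \<and> h \<in> Arr C \<and>
     Cod C f = Dom C g \<and> Cod C g = Dom C h \<and> Cod C h = Sh C (Dom C f))"

definition triangles_isomorphic ::
  "('o, 'm, 'x) tri_cat_scheme \<Rightarrow> 'm \<times> 'm \<times> 'm \<Rightarrow> 'm \<times> 'm \<times> 'm \<Rightarrow> bool" where
  "triangles_isomorphic C = (\<lambda>(f, g, h) (f', g', h').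
     candidate_triangle C (f, g, h) \<and> candidate_triangle C (f', g', h') \<and>
     (\<exists>u \<in> Hom C (Dom C f) (Dom C f').
      \<exists>v \<in> Hom C (Dom C g) (Dom C g').
      \<exists>w \<in> Hom C (Dom C h) (Dom C h').
        isomorphism C u \<and> isomorphism C v \<and> isomorphism C w \<and>
        v \<cdot>\<^bsub>C\<^esub> f = f' \<cdot>\<^bsub>C\<^esub> u \<and> w \<cdot>\<^bsub>C\<^esub> g = g' \<cdot>\<^bsub>C\<^esub> v \<and> ShA C u \<cdot>\<^bsub>C\<^esub> h = h' \<cdot>\<^bsub>C\<^esub> w))"

locale triangulated_category = additive_category C
  for C :: "('o, 'm, 'x) tri_cat_scheme" (structure) +
  assumes shift_equivalence: "is_equivalence C C (shift_fun C)"
    and Tri_candidate: "t \<in> Tri C \<Longrightarrow> candidate_triangle C t"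
    and TR1_iso: "t \<in> Tri C \<Longrightarrow> triangles_isomorphic C t t' \<Longrightarrow> t' \<in> Tri C"
    and TR1_Ident: "X \<in> Ob C \<Longrightarrow> zero_object C Z \<Longrightarrow>
        (Ident C X, Zero C X Z, Zero C Z (Sh C X)) \<in> Tri C"
    and TR1_complete: "f \<in> Arr C \<Longrightarrow> \<exists>g h. (f, g, h) \<in> Tri C"
    and TR2: "candidate_triangle C (f, g, h) \<Longrightarrow>
        (f, g, h) \<in> Tri C \<longleftrightarrow> (g, h, neg C (ShA C f)) \<in> Tri C"
    and TR3: "(f, g, h) \<in> Tri C \<Longrightarrow> (f', g', h') \<in> Tri C \<Longrightarrow>
        u \<in> Hom C (Dom C f) (Dom C f') \<Longrightarrow> v \<in> Hom C (Cod C f) (Cod C f') \<Longrightarrow>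
        v \<cdot> f = f' \<cdot> u \<Longrightarrow>
        \<exists>w \<in> Hom C (Cod C g) (Cod C g'). w \<cdot> g = g' \<cdot> v \<and> ShA C u \<cdot> h = h' \<cdot> w"
    and TR4: "Cod C f = Dom C g \<Longrightarrow>
        (f, a, b) \<in> Tri C \<Longrightarrow> (g, c, d) \<in> Tri C \<Longrightarrow> (g \<cdot> f, p, q) \<in> Tri C \<Longrightarrow>
        \<exists>u \<in> Hom C (Cod C a) (Cod C p). \<exists>v \<in> Hom C (Cod C p) (Cod C c).
          (u, v, ShA C a \<cdot> d) \<in> Tri C \<and>
          u \<cdot> a = p \<cdot> g \<and> q \<cdot> u = b \<and> v \<cdot> p = c \<and> d \<cdot> v = ShA C f \<cdot> q"

definition exact_functor ::
  "('o, 'm, 'x) tri_cat_scheme \<Rightarrow> ('p, 'n, 'y) tri_cat_scheme \<Rightarrow>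
   ('o, 'm, 'p, 'n, 'z) cat_fun_scheme \<Rightarrow> ('o \<Rightarrow> 'n) \<Rightarrow> bool" where
  "exact_functor C D F \<sigma> \<longleftrightarrow>
     is_functor C D F \<and>
     (\<forall>X \<in> Ob C. \<forall>Y \<in> Ob C. FArr F \<in> hom (hom_group C X Y) (hom_group D (FOb F X) (FOb F Y))) \<and>
     natural_isomorphism C D (comp_fun F (shift_fun C)) (comp_fun (shift_fun D) F) \<sigma> \<and>
     (\<forall>f g h. (f, g, h) \<in> Tri C \<longrightarrow>
        (FArr F f, FArr F g, \<sigma> (Dom C f) \<cdot>\<^bsub>D\<^esub> FArr F h) \<in> Tri D)"

text \<open>All subcategories are full and replete, and are given by their sets of objects.\<close>

definition triangulated_subcategory :: "('o, 'm, 'x) tri_cat_scheme \<Rightarrow> 'o set \<Rightarrow> bool" where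
  "triangulated_subcategory C A \<longleftrightarrow>
     A \<subseteq> Ob C \<and>
     (\<forall>Z. zero_object C Z \<longrightarrow> Z \<in> A) \<and>
     (\<forall>X \<in> A. \<forall>Y \<in> Ob C. isomorphic C X Y \<longrightarrow> Y \<in> A) \<and>
     (\<forall>X \<in> Ob C. X \<in> A \<longleftrightarrow> Sh C X \<in> A) \<and>
     (\<forall>f g h. (f, g, h) \<in> Tri C \<longrightarrow> Dom C f \<in> A \<longrightarrow> Cod C f \<in> A \<longrightarrow> Cod C g \<in> A)"

definition thick :: "('o, 'm, 'x) tri_cat_scheme \<Rightarrow> 'o set \<Rightarrow> bool" where
  "thick C A \<longleftrightarrow>
     triangulated_subcategory C A \<and>
     (\<forall>X \<in> Ob C. \<forall>Y \<in> Ob C. \<forall>B \<in> A. biproduct C X Y B \<longrightarrow> X \<in> A \<and> Y \<in> A)"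

definition localizing :: "'u rel \<Rightarrow> ('o, 'm, 'x) tri_cat_scheme \<Rightarrow> 'o set \<Rightarrow> bool" where
  "localizing \<kappa> C A \<longleftrightarrow>
     triangulated_subcategory C A \<and>
     (\<forall>(I :: 'u set) X B \<iota>. small \<kappa> I \<longrightarrow> X ` I \<subseteq> A \<longrightarrow> coproduct C I X B \<iota> \<longrightarrow> B \<in> A)"

definition Loc :: "'u rel \<Rightarrow> ('o, 'm, 'x) tri_cat_scheme \<Rightarrow> 'o set \<Rightarrow> 'o set" where
  "Loc \<kappa> C G = \<Inter>{A. localizing \<kappa> C A \<and> G \<subseteq> A}"

text \<open>
  \<open>X\<close> is compact if for every small coproduct \<open>A\<close> of objects \<open>Y i\<close> the canonical map from the
  direct sum of the groups \<open>Hom X (Y i)\<close> to \<open>Hom X A\<close> is an isomorphism.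
\<close>

definition compact_objects :: "'u rel \<Rightarrow> ('o, 'm, 'x) tri_cat_scheme \<Rightarrow> 'o set" where
  "compact_objects \<kappa> C =
     {X \<in> Ob C. \<forall>(I :: 'u set) Y A \<iota>. small \<kappa> I \<longrightarrow> coproduct C I Y A \<iota> \<longrightarrow>
        (\<lambda>\<phi>. gfinprod (hom_group C X A) (\<lambda>i. \<iota> i \<cdot>\<^bsub>C\<^esub> \<phi> i) I)
          \<in> iso (sum_group I (\<lambda>i. hom_group C X (Y i))) (hom_group C X A)}"

definition compactly_generated :: "'u rel \<Rightarrow> ('o, 'm, 'x) tri_cat_scheme \<Rightarrow> bool" where
  "compactly_generated \<kappa> C \<longleftrightarrow>
     (\<exists>G. small \<kappa> G \<and> G \<subseteq> compact_objects \<kappa> C \<and> Loc \<kappa> C G = Ob C)"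


section \<open>Tensor-triangulated categories\<close>

record ('o, 'm) tt_cat = "('o, 'm) tri_cat" +
  Tens :: "'o \<Rightarrow> 'o \<Rightarrow> 'o" (infixr \<open>\<boxtimes>\<index>\<close> 80)
  TensA :: "'m \<Rightarrow> 'm \<Rightarrow> 'm" (infixr \<open>\<star>\<index>\<close> 80)
  Unit :: "'o"
  Assoc :: "'o \<Rightarrow> 'o \<Rightarrow> 'o \<Rightarrow> 'm"
  LUnit :: "'o \<Rightarrow> 'm"
  RUnit :: "'o \<Rightarrow> 'm"
  Braid :: "'o \<Rightarrow> 'o \<Rightarrow> 'm"
  Susp :: "'o \<Rightarrow> 'o \<Rightarrow> 'm"

definition tensor_right :: "('o, 'm, 'x) tt_cat_scheme \<Rightarrow> 'o \<Rightarrow> ('o, 'm, 'o, 'm) cat_fun" where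
  "tensor_right C W = \<lparr>FOb = (\<lambda>X. X \<boxtimes>\<^bsub>C\<^esub> W), FArr = (\<lambda>f. f \<star>\<^bsub>C\<^esub> Ident C W)\<rparr>"

locale symmetric_monoidal_category = category C
  for C :: "('o, 'm, 'x) tt_cat_scheme" (structure) +
  assumes Unit_in_Ob: "Unit C \<in> Ob C"
    and Tens_in_Ob: "X \<in> Ob C \<Longrightarrow> Y \<in> Ob C \<Longrightarrow> X \<boxtimes> Y \<in> Ob C"
    and TensA_in_Hom: "f \<in> Hom C X X' \<Longrightarrow> g \<in> Hom C Y Y' \<Longrightarrow>
        f \<star> g \<in> Hom C (X \<boxtimes> Y) (X' \<boxtimes> Y')"
    and TensA_Ident: "X \<in> Ob C \<Longrightarrow> Y \<in> Ob C \<Longrightarrow> Ident C X \<star> Ident C Y = Ident C (X \<boxtimes> Y)"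
    and TensA_Comp: "f \<in> Hom C X X' \<Longrightarrow> f' \<in> Hom C X' X'' \<Longrightarrow>
        g \<in> Hom C Y Y' \<Longrightarrow> g' \<in> Hom C Y' Y'' \<Longrightarrow>
        (f' \<cdot> f) \<star> (g' \<cdot> g) = (f' \<star> g') \<cdot> (f \<star> g)"
    and Assoc_in_Hom: "X \<in> Ob C \<Longrightarrow> Y \<in> Ob C \<Longrightarrow> Z \<in> Ob C \<Longrightarrow>
        Assoc C X Y Z \<in> Hom C ((X \<boxtimes> Y) \<boxtimes> Z) (X \<boxtimes> (Y \<boxtimes> Z)) \<and> isomorphism C (Assoc C X Y Z)"
    and Assoc_natural: "f \<in> Hom C X X' \<Longrightarrow> g \<in> Hom C Y Y' \<Longrightarrow> h \<in> Hom C Z Z' \<Longrightarrow>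
        Assoc C X' Y' Z' \<cdot> ((f \<star> g) \<star> h) = (f \<star> (g \<star> h)) \<cdot> Assoc C X Y Z"
    and LUnit_in_Hom: "X \<in> Ob C \<Longrightarrow>
        LUnit C X \<in> Hom C (Unit C \<boxtimes> X) X \<and> isomorphism C (LUnit C X)"
    and LUnit_natural: "f \<in> Hom C X Y \<Longrightarrow> LUnit C Y \<cdot> (Ident C (Unit C) \<star> f) = f \<cdot> LUnit C X"
    and RUnit_in_Hom: "X \<in> Ob C \<Longrightarrow>
        RUnit C X \<in> Hom C (X \<boxtimes> Unit C) X \<and> isomorphism C (RUnit C X)"
    and RUnit_natural: "f \<in> Hom C X Y \<Longrightarrow> RUnit C Y \<cdot> (f \<star> Ident C (Unit C)) = f \<cdot> RUnit C X"
    and Braid_in_Hom: "X \<in> Ob C \<Longrightarrow> Y \<in> Ob C \<Longrightarrow> Braid C X Y \<in> Hom C (X \<boxtimes> Y) (Y \<boxtimes> X)"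
    and Braid_natural: "f \<in> Hom C X X' \<Longrightarrow> g \<in> Hom C Y Y' \<Longrightarrow>
        Braid C X' Y' \<cdot> (f \<star> g) = (g \<star> f) \<cdot> Braid C X Y"
    and Braid_symmetric: "X \<in> Ob C \<Longrightarrow> Y \<in> Ob C \<Longrightarrow>
        Braid C Y X \<cdot> Braid C X Y = Ident C (X \<boxtimes> Y)"
    and pentagon: "W \<in> Ob C \<Longrightarrow> X \<in> Ob C \<Longrightarrow> Y \<in> Ob C \<Longrightarrow> Z \<in> Ob C \<Longrightarrow>
        Assoc C W X (Y \<boxtimes> Z) \<cdot> Assoc C (W \<boxtimes> X) Y Z =
        (Ident C W \<star> Assoc C X Y Z) \<cdot> Assoc C W (X \<boxtimes> Y) Z \<cdot> (Assoc C W X Y \<star> Ident C Z)"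
    and triangle: "X \<in> Ob C \<Longrightarrow> Y \<in> Ob C \<Longrightarrow>
        (Ident C X \<star> LUnit C Y) \<cdot> Assoc C X (Unit C) Y = RUnit C X \<star> Ident C Y"
    and hexagon: "X \<in> Ob C \<Longrightarrow> Y \<in> Ob C \<Longrightarrow> Z \<in> Ob C \<Longrightarrow>
        Assoc C Y Z X \<cdot> Braid C X (Y \<boxtimes> Z) \<cdot> Assoc C X Y Z =
        (Ident C Y \<star> Braid C X Z) \<cdot> Assoc C Y X Z \<cdot> (Braid C X Y \<star> Ident C Z)"

text \<open>Every functor \<open>- \<boxtimes> Y\<close> has a right adjoint, given by universal arrows \<open>H \<boxtimes> Y \<rightarrow> Z\<close>.\<close>

definition closed_monoidal :: "('o, 'm, 'x) tt_cat_scheme \<Rightarrow> bool" where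
  "closed_monoidal C \<longleftrightarrow>
     (\<forall>Y \<in> Ob C. \<forall>Z \<in> Ob C. \<exists>H \<in> Ob C. \<exists>e \<in> Hom C (H \<boxtimes>\<^bsub>C\<^esub> Y) Z.
        \<forall>W \<in> Ob C. \<forall>g \<in> Hom C (W \<boxtimes>\<^bsub>C\<^esub> Y) Z.
          \<exists>!k. k \<in> Hom C W H \<and> e \<cdot>\<^bsub>C\<^esub> (k \<star>\<^bsub>C\<^esub> Ident C Y) = g)"

text \<open>
  Compatibility of the symmetric monoidal structure with the triangulation, as in Appendix A.2 of
  Hovey, Palmieri and Strickland, "Axiomatic stable homotopy theory": the tensor product is exact
  by means of a coherent isomorphism \<open>Susp X Y : \<Sigma>X \<boxtimes> Y \<rightarrow> \<Sigma>(X \<boxtimes> Y)\<close>, and the symmetry of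
  \<open>\<Sigma>\<^sup>r\<one> \<boxtimes> \<Sigma>\<^sup>s\<one>\<close> is multiplication by \<open>-1\<close> to the power \<open>r s\<close>, for which the case \<open>r = s = 1\<close> suffices. Exactness of
  the internal hom in its contravariant variable is not required.
\<close>

locale tt_category = triangulated_category C + symmetric_monoidal_category C
  for C :: "('o, 'm, 'x) tt_cat_scheme" (structure) +
  assumes closed: "closed_monoidal C"
    and Tens_exact: "W \<in> Ob C \<Longrightarrow> exact_functor C C (tensor_right C W) (\<lambda>X. Susp C X W)"
    and Susp_natural: "X \<in> Ob C \<Longrightarrow> g \<in> Hom C Y Y' \<Longrightarrow>
        Susp C X Y' \<cdot> (Ident C (Sh C X) \<star> g) = ShA C (Ident C X \<star> g) \<cdot> Susp C X Y"
    and Susp_RUnit: "X \<in> Ob C \<Longrightarrow> ShA C (RUnit C X) \<cdot> Susp C X (Unit C) = RUnit C (Sh C X)"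
    and Susp_Assoc: "X \<in> Ob C \<Longrightarrow> Y \<in> Ob C \<Longrightarrow> Z \<in> Ob C \<Longrightarrow>
        ShA C (Assoc C X Y Z) \<cdot> Susp C (X \<boxtimes> Y) Z \<cdot> (Susp C X Y \<star> Ident C Z) =
        Susp C X (Y \<boxtimes> Z) \<cdot> Assoc C (Sh C X) Y Z"
    and Braid_Susp: "Braid C (Sh C (Unit C)) (Sh C (Unit C)) =
        neg C (Ident C (Sh C (Unit C) \<boxtimes> Sh C (Unit C)))"

definition dualizable_objects :: "('o, 'm, 'x) tt_cat_scheme \<Rightarrow> 'o set" where
  "dualizable_objects C =
     {X \<in> Ob C. \<exists>D \<in> Ob C.
        \<exists>\<eta> \<in> Hom C (Unit C) (X \<boxtimes>\<^bsub>C\<^esub> D). \<exists>\<epsilon> \<in> Hom C (D \<boxtimes>\<^bsub>C\<^esub> X) (Unit C).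
          RUnit C X \<cdot>\<^bsub>C\<^esub> (Ident C X \<star>\<^bsub>C\<^esub> \<epsilon>) \<cdot>\<^bsub>C\<^esub> Assoc C X D X \<cdot>\<^bsub>C\<^esub> (\<eta> \<star>\<^bsub>C\<^esub> Ident C X)
            = LUnit C X \<and>
          LUnit C D \<cdot>\<^bsub>C\<^esub> (\<epsilon> \<star>\<^bsub>C\<^esub> Ident C D) \<cdot>\<^bsub>C\<^esub> inverse_arrow C (Assoc C D X D) \<cdot>\<^bsub>C\<^esub>
              (Ident C D \<star>\<^bsub>C\<^esub> \<eta>)
            = RUnit C D}"

definition rigidly_compactly_generated :: "'u rel \<Rightarrow> ('o, 'm, 'x) tt_cat_scheme \<Rightarrow> bool" where
  "rigidly_compactly_generated \<kappa> C \<longleftrightarrow>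
     tt_category C \<and> locally_small \<kappa> C \<and> has_small_coproducts \<kappa> C \<and>
     compactly_generated \<kappa> C \<and> compact_objects \<kappa> C = dualizable_objects C"

text \<open>\<open>compacts \<kappa> C\<close> is the tt-category usually written \<open>C\<^sup>c\<close>.\<close>

definition full_subcategory ::
  "('o, 'm, 'x) tt_cat_scheme \<Rightarrow> 'o set \<Rightarrow> ('o, 'm, 'x) tt_cat_scheme" where
  "full_subcategory C A = C\<lparr>
     Ob := A,
     Arr := {f \<in> Arr C. Dom C f \<in> A \<and> Cod C f \<in> A},
     Tri := {(f, g, h) \<in> Tri C. Dom C f \<in> A \<and> Cod C f \<in> A \<and> Cod C g \<in> A}\<rparr>"

definition compacts :: "'u rel \<Rightarrow> ('o, 'm, 'x) tt_cat_scheme \<Rightarrow> ('o, 'm, 'x) tt_cat_scheme" where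
  "compacts \<kappa> C = full_subcategory C (compact_objects \<kappa> C)"


section \<open>Geometric functors\<close>

text \<open>
  A tensor-triangulated functor \<open>F\<close> carries isomorphisms \<open>F(\<Sigma>X) \<rightarrow> \<Sigma>(F X)\<close>,
  \<open>F X \<boxtimes> F Y \<rightarrow> F(X \<boxtimes> Y)\<close> and \<open>\<one> \<rightarrow> F \<one>\<close>.
\<close>

record ('o, 'm, 'p, 'n) tt_fun = "('o, 'm, 'p, 'n) cat_fun" +
  FSh :: "'o \<Rightarrow> 'n"
  FTens :: "'o \<Rightarrow> 'o \<Rightarrow> 'n"
  FUnit :: "'n"

definition strong_symmetric_monoidal ::
  "('o, 'm, 'x) tt_cat_scheme \<Rightarrow> ('p, 'n, 'y) tt_cat_scheme \<Rightarrow>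
   ('o, 'm, 'p, 'n, 'z) tt_fun_scheme \<Rightarrow> bool" where
  "strong_symmetric_monoidal C D F \<longleftrightarrow>
     is_functor C D F \<and>
     FUnit F \<in> Hom D (Unit D) (FOb F (Unit C)) \<and> isomorphism D (FUnit F) \<and>
     (\<forall>X \<in> Ob C. \<forall>Y \<in> Ob C.
        FTens F X Y \<in> Hom D (FOb F X \<boxtimes>\<^bsub>D\<^esub> FOb F Y) (FOb F (X \<boxtimes>\<^bsub>C\<^esub> Y)) \<and>
        isomorphism D (FTens F X Y)) \<and>
     (\<forall>f \<in> Arr C. \<forall>g \<in> Arr C.
        FTens F (Cod C f) (Cod C g) \<cdot>\<^bsub>D\<^esub> (FArr F f \<star>\<^bsub>D\<^esub> FArr F g) =
        FArr F (f \<star>\<^bsub>C\<^esub> g) \<cdot>\<^bsub>D\<^esub> FTens F (Dom C f) (Dom C g)) \<and>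
     (\<forall>X \<in> Ob C. \<forall>Y \<in> Ob C. \<forall>Z \<in> Ob C.
        FArr F (Assoc C X Y Z) \<cdot>\<^bsub>D\<^esub> FTens F (X \<boxtimes>\<^bsub>C\<^esub> Y) Z \<cdot>\<^bsub>D\<^esub>
          (FTens F X Y \<star>\<^bsub>D\<^esub> Ident D (FOb F Z)) =
        FTens F X (Y \<boxtimes>\<^bsub>C\<^esub> Z) \<cdot>\<^bsub>D\<^esub> (Ident D (FOb F X) \<star>\<^bsub>D\<^esub> FTens F Y Z) \<cdot>\<^bsub>D\<^esub>
          Assoc D (FOb F X) (FOb F Y) (FOb F Z)) \<and>
     (\<forall>X \<in> Ob C.
        FArr F (LUnit C X) \<cdot>\<^bsub>D\<^esub> FTens F (Unit C) X \<cdot>\<^bsub>D\<^esub> (FUnit F \<star>\<^bsub>D\<^esub> Ident D (FOb F X)) =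
        LUnit D (FOb F X)) \<and>
     (\<forall>X \<in> Ob C.
        FArr F (RUnit C X) \<cdot>\<^bsub>D\<^esub> FTens F X (Unit C) \<cdot>\<^bsub>D\<^esub> (Ident D (FOb F X) \<star>\<^bsub>D\<^esub> FUnit F) =
        RUnit D (FOb F X)) \<and>
     (\<forall>X \<in> Ob C. \<forall>Y \<in> Ob C.
        FArr F (Braid C X Y) \<cdot>\<^bsub>D\<^esub> FTens F X Y =
        FTens F Y X \<cdot>\<^bsub>D\<^esub> Braid D (FOb F X) (FOb F Y))"

definition geometric_functor ::
  "'u rel \<Rightarrow> ('o, 'm, 'x) tt_cat_scheme \<Rightarrow> ('p, 'n, 'y) tt_cat_scheme \<Rightarrow>
   ('o, 'm, 'p, 'n, 'z) tt_fun_scheme \<Rightarrow> bool" where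
  "geometric_functor \<kappa> C D F \<longleftrightarrow>
     exact_functor C D F (FSh F) \<and> strong_symmetric_monoidal C D F \<and>
     preserves_small_coproducts \<kappa> C D F"


section \<open>The Balmer spectrum\<close>

definition thick_ideal :: "('o, 'm, 'x) tt_cat_scheme \<Rightarrow> 'o set \<Rightarrow> bool" where
  "thick_ideal K A \<longleftrightarrow> thick K A \<and> (\<forall>X \<in> Ob K. \<forall>Y \<in> A. X \<boxtimes>\<^bsub>K\<^esub> Y \<in> A)"

definition primes :: "('o, 'm, 'x) tt_cat_scheme \<Rightarrow> 'o set set" where
  "primes K =
     {P. thick_ideal K P \<and> P \<noteq> Ob K \<and>
         (\<forall>X \<in> Ob K. \<forall>Y \<in> Ob K. X \<boxtimes>\<^bsub>K\<^esub> Y \<in> P \<longrightarrow> X \<in> P \<or> Y \<in> P)}"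

definition supp :: "('o, 'm, 'x) tt_cat_scheme \<Rightarrow> 'o \<Rightarrow> 'o set set" where
  "supp K X = {P \<in> primes K. X \<notin> P}"

text \<open>The complements of the sets \<open>supp K X\<close> are a basis of open sets.\<close>

definition Spc :: "('o, 'm, 'x) tt_cat_scheme \<Rightarrow> 'o set topology" where
  "Spc K = topology (arbitrary union_of (\<lambda>U. \<exists>X \<in> Ob K. U = primes K - supp K X))"

definition Spc_map ::
  "'u rel \<Rightarrow> ('o, 'm, 'x) tt_cat_scheme \<Rightarrow> ('o, 'm, 'p, 'n, 'z) cat_fun_scheme \<Rightarrow>
   'p set \<Rightarrow> 'o set" where
  "Spc_map \<kappa> C F Q = FOb F -` Q \<inter> compact_objects \<kappa> C"

definition noetherian_space :: "'a topology \<Rightarrow> bool" where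
  "noetherian_space X \<longleftrightarrow>
     (\<forall>Z :: nat \<Rightarrow> 'a set. (\<forall>n. closedin X (Z n)) \<longrightarrow> decseq Z \<longrightarrow>
        (\<exists>N. \<forall>n \<ge> N. Z n = Z N))"


section \<open>Verdier quotients and local categories\<close>

text \<open>
  An arrow \<open>X \<rightarrow> Y\<close> of the quotient \<open>C / L\<close> is an equivalence class of roofs \<open>X \<leftarrow> Z \<rightarrow> Y\<close>, that is, of
  pairs \<open>(s, f)\<close> with \<open>s : Z \<rightarrow> X\<close>, \<open>f : Z \<rightarrow> Y\<close> and the cone of \<open>s\<close> in \<open>L\<close>.
\<close>

definition cone_in :: "('o, 'm, 'x) tri_cat_scheme \<Rightarrow> 'o set \<Rightarrow> 'm set" where
  "cone_in C L = {s \<in> Arr C. \<exists>g h. (s, g, h) \<in> Tri C \<and> Cod C g \<in> L}"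

definition roofs :: "('o, 'm, 'x) tri_cat_scheme \<Rightarrow> 'o set \<Rightarrow> ('m \<times> 'm) set" where
  "roofs C L = {(s, f). s \<in> cone_in C L \<and> f \<in> Arr C \<and> Dom C s = Dom C f}"

definition roof_rel :: "('o, 'm, 'x) tri_cat_scheme \<Rightarrow> 'o set \<Rightarrow> ('m \<times> 'm) rel" where
  "roof_rel C L =
     {((s, f), (s', f')).
        (s, f) \<in> roofs C L \<and> (s', f') \<in> roofs C L \<and>
        Cod C s = Cod C s' \<and> Cod C f = Cod C f' \<and>
        (\<exists>W \<in> Ob C. \<exists>u \<in> Hom C W (Dom C s). \<exists>u' \<in> Hom C W (Dom C s').
           s \<cdot>\<^bsub>C\<^esub> u = s' \<cdot>\<^bsub>C\<^esub> u' \<and> s \<cdot>\<^bsub>C\<^esub> u \<in> cone_in C L \<and> f \<cdot>\<^bsub>C\<^esub> u = f' \<cdot>\<^bsub>C\<^esub> u')}"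

definition roof_class :: "('o, 'm, 'x) tri_cat_scheme \<Rightarrow> 'o set \<Rightarrow> 'm \<Rightarrow> 'm \<Rightarrow> ('m \<times> 'm) set" where
  "roof_class C L s f = roof_rel C L `` {(s, f)}"

definition quotient_arrow :: "('o, 'm, 'x) tri_cat_scheme \<Rightarrow> 'o set \<Rightarrow> 'm \<Rightarrow> ('m \<times> 'm) set" where
  "quotient_arrow C L f = roof_class C L (Ident C (Dom C f)) f"

text \<open>
  Operations on classes are unions over representatives. Two roofs \<open>(s, f)\<close> and \<open>(t, g)\<close> are
  composed by means of a square \<open>f \<cdot> t' = t \<cdot> f'\<close> with the cone of \<open>t'\<close> in \<open>L\<close>, and added when they
  have a common denominator. The distinguished triangles are those isomorphic, in the quotient, to
  images of distinguished triangles; as this refers to the remaining structure of the quotient, they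
  are added in a second step. The tensor product is meaningful if \<open>L\<close> is a tensor-ideal.
\<close>

definition pre_verdier_quotient ::
  "('o, 'm, 'x) tt_cat_scheme \<Rightarrow> 'o set \<Rightarrow> ('o, ('m \<times> 'm) set) tt_cat" where
  "pre_verdier_quotient C L = \<lparr>
     Ob = Ob C,
     Arr = roofs C L // roof_rel C L,
     Dom = (\<lambda>a. the_elem ((\<lambda>(s, f). Cod C s) ` a)),
     Cod = (\<lambda>a. the_elem ((\<lambda>(s, f). Cod C f) ` a)),
     Ident = (\<lambda>X. quotient_arrow C L (Ident C X)),
     Comp = (\<lambda>b a. \<Union>(s, f) \<in> a. \<Union>(t, g) \<in> b.
       \<Union>(t', f') \<in> {(t', f'). t' \<in> cone_in C L \<and> Cod C t' = Dom C f \<and>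
                       f' \<in> Hom C (Dom C t') (Dom C t) \<and> f \<cdot>\<^bsub>C\<^esub> t' = t \<cdot>\<^bsub>C\<^esub> f'}.
         roof_class C L (s \<cdot>\<^bsub>C\<^esub> t') (g \<cdot>\<^bsub>C\<^esub> f')),
     Add = (\<lambda>a b. \<Union>(s, f, g) \<in> {(s, f, g). (s, f) \<in> a \<and> (s, g) \<in> b}.
       roof_class C L s (f \<boxplus>\<^bsub>C\<^esub> g)),
     Zero = (\<lambda>X Y. quotient_arrow C L (Zero C X Y)),
     Sh = Sh C,
     ShA = (\<lambda>a. \<Union>(s, f) \<in> a. roof_class C L (ShA C s) (ShA C f)),
     Tri = {},
     Tens = Tens C,
     TensA = (\<lambda>a b. \<Union>(s, f) \<in> a. \<Union>(t, g) \<in> b. roof_class C L (s \<star>\<^bsub>C\<^esub> t) (f \<star>\<^bsub>C\<^esub> g)),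
     Unit = Unit C,
     Assoc = (\<lambda>X Y Z. quotient_arrow C L (Assoc C X Y Z)),
     LUnit = (\<lambda>X. quotient_arrow C L (LUnit C X)),
     RUnit = (\<lambda>X. quotient_arrow C L (RUnit C X)),
     Braid = (\<lambda>X Y. quotient_arrow C L (Braid C X Y)),
     Susp = (\<lambda>X Y. quotient_arrow C L (Susp C X Y))\<rparr>"

definition verdier_quotient ::
  "('o, 'm, 'x) tt_cat_scheme \<Rightarrow> 'o set \<Rightarrow> ('o, ('m \<times> 'm) set) tt_cat" where
  "verdier_quotient C L = (pre_verdier_quotient C L)\<lparr>
     Tri := {t. \<exists>f g h. (f, g, h) \<in> Tri C \<and>
       triangles_isomorphic (pre_verdier_quotient C L)
         (quotient_arrow C L f, quotient_arrow C L g, quotient_arrow C L h) t}\<rparr>"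

definition local_category ::
  "'u rel \<Rightarrow> ('o, 'm, 'x) tt_cat_scheme \<Rightarrow> 'o set \<Rightarrow> ('o, ('m \<times> 'm) set) tt_cat" where
  "local_category \<kappa> C P = verdier_quotient C (Loc \<kappa> C P)"

definition unigenic :: "'u rel \<Rightarrow> ('o, 'm, 'x) tt_cat_scheme \<Rightarrow> bool" where
  "unigenic \<kappa> C \<longleftrightarrow> Loc \<kappa> C {Unit C} = Ob C"

definition locally_unigenic :: "'u rel \<Rightarrow> ('o, 'm, 'x) tt_cat_scheme \<Rightarrow> bool" where
  "locally_unigenic \<kappa> C \<longleftrightarrow>
     (\<forall>P \<in> primes (compacts \<kappa> C). unigenic \<kappa> (local_category \<kappa> C P))"

end

theory Submission
  imports Defs
begin

text \<open>
  Write \<open>F\<close> for the functor and \<open>N\<close> for the right orthogonal of its image. A telescope construction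
  with the compact generators of the source shows that \<open>F\<close> is essentially surjective as soon as \<open>N\<close>
  vanishes. The compact objects \<open>p\<close> with \<open>p \<boxtimes> W\<close> left orthogonal to \<open>N\<close> for all \<open>W\<close> form a thick
  ideal of \<open>S\<^sup>c\<close>. If it does not contain the unit, noetherianity provides a compact \<open>a\<close> in the source
  with \<open>F a\<close> outside the ideal and with minimal support; let \<open>P\<close> be a point of this support that
  contains the ideal. By minimality \<open>F b \<boxtimes> F a\<close> lies in the ideal for every \<open>b \<in> \<phi> P\<close>, and as \<open>\<phi>\<close>
  is a homeomorphism, \<open>P\<close> is the smallest radical ideal containing \<open>F (\<phi> P)\<close>, so \<open>p \<boxtimes> F a\<close> lies in
  the ideal for all \<open>p \<in> P\<close>. Hence the internal hom from \<open>F a\<close> to an object of \<open>N\<close> is right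
  orthogonal to \<open>P\<close> and to the suspensions of the unit, and therefore vanishes because the local
  category at \<open>P\<close> is unigenic. So \<open>F a\<close> lies in the ideal after all, a contradiction.
\<close>

section \<open>Categories and functors\<close>

text \<open>Unigenicity speaks about a category of roofs, while the object to be killed lives in
  \<open>S\<close>. The bridge is locality: arrows into an object right orthogonal to
  \<open>Loc \<kappa> S P\<close> are not changed by the quotient, so a left orthogonal of such
  objects is localizing in the quotient as well; once it contains the unit it contains everything,
  and each of these objects is orthogonal to itself.

  The object \<open>a\<close> has to come from the source because \<open>F X \<boxtimes> F a\<close>
  is isomorphic to \<open>F (X \<boxtimes> a)\<close>: this keeps the internal hom out of
  \<open>F a\<close> inside N. Objects of \<open>P\<close> that do not come from the source are
  controlled by the topology. Open sets of the spectrum are stable under enlarging primes, so a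
  homeomorphism reflects inclusions: \<open>\<phi> P \<subseteq> \<phi> P'\<close> forces
  \<open>P \<subseteq> P'\<close>. By rigidity every thick ideal of compact objects is radical,
  hence an intersection of primes, so that an inclusion of \<open>P\<close> in an ideal can be
  tested on the primes above the ideal.

  Finally, F preserves compact objects because it preserves duals; this is why duality is handled
  explicitly.\<close>

context category
begin

lemma HomD: "f \<in> Hom C X Y \<Longrightarrow> f \<in> Arr C" "f \<in> Hom C X Y \<Longrightarrow> Dom C f = X"
  "f \<in> Hom C X Y \<Longrightarrow> Cod C f = Y"
  by (auto simp: Hom_def)

lemma Hom_Ob: "f \<in> Hom C X Y \<Longrightarrow> X \<in> Ob C" "f \<in> Hom C X Y \<Longrightarrow> Y \<in> Ob C"
  by (auto simp: Hom_def Dom_in_Ob Cod_in_Ob)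

lemma Arr_Comp: "f \<in> Arr C \<Longrightarrow> g \<in> Arr C \<Longrightarrow> Dom C g = Cod C f \<Longrightarrow> g \<cdot> f \<in> Arr C"
  and Dom_Comp: "f \<in> Arr C \<Longrightarrow> g \<in> Arr C \<Longrightarrow> Dom C g = Cod C f \<Longrightarrow> Dom C (g \<cdot> f) = Dom C f"
  and Cod_Comp: "f \<in> Arr C \<Longrightarrow> g \<in> Arr C \<Longrightarrow> Dom C g = Cod C f \<Longrightarrow> Cod C (g \<cdot> f) = Cod C g"
  using Comp_in_Hom[of f "Dom C f" "Cod C f" g "Cod C g"] by (auto simp: Hom_def)

lemma Arr_Ident: "X \<in> Ob C \<Longrightarrow> Ident C X \<in> Arr C"
  and Dom_Ident: "X \<in> Ob C \<Longrightarrow> Dom C (Ident C X) = X"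
  and Cod_Ident: "X \<in> Ob C \<Longrightarrow> Cod C (Ident C X) = X"
  using Ident_in_Hom[of X] by (auto simp: Hom_def)

lemma Comp_assoc_Arr: "f \<in> Arr C \<Longrightarrow> g \<in> Arr C \<Longrightarrow> h \<in> Arr C \<Longrightarrow> Dom C g = Cod C f \<Longrightarrow>
    Dom C h = Cod C g \<Longrightarrow> (h \<cdot> g) \<cdot> f = h \<cdot> (g \<cdot> f)"
  using Comp_assoc[of f "Dom C f" "Cod C f" g "Cod C g" h "Cod C h"] by (auto simp: Hom_def)

lemma Comp_Ident_Arr: "f \<in> Arr C \<Longrightarrow> Dom C f = X \<Longrightarrow> f \<cdot> Ident C X = f"
  and Ident_Comp_Arr: "f \<in> Arr C \<Longrightarrow> Cod C f = X \<Longrightarrow> Ident C X \<cdot> f = f"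
  using Comp_Ident[of f "Dom C f" "Cod C f"] Ident_Comp[of f "Dom C f" "Cod C f"]
  by (auto simp: Hom_def)

lemmas cat_simps = Dom_in_Ob Cod_in_Ob Arr_Comp Dom_Comp Cod_Comp Arr_Ident Dom_Ident Cod_Ident
  Comp_assoc_Arr Comp_Ident_Arr Ident_Comp_Arr

text \<open>Simplification associates composites to the right, so an equation for
  \<open>g \<cdot> f\<close> no longer matches once something is composed on the right. This form
  carries the tail \<open>e\<close>; long diagram chases rewrite with it.\<close>

lemma Comp_rewrite:
  assumes "g \<cdot> f = k" "f \<in> Arr C" "g \<in> Arr C" "e \<in> Arr C" "Dom C g = Cod C f" "Dom C f = Cod C e"
  shows "g \<cdot> (f \<cdot> e) = k \<cdot> e"
  using Comp_assoc_Arr[of e f g] assms by simp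

lemma isomorphismE:
  assumes "isomorphism C f" "f \<in> Hom C X Y"
  obtains g where "g \<in> Hom C Y X" "g \<cdot> f = Ident C X" "f \<cdot> g = Ident C Y" "isomorphism C g"
proof -
  obtain g where g: "inverse_arrows C f g" using assms by (auto simp: isomorphism_def)
  then have "inverse_arrows C g f"
    using assms by (auto simp: inverse_arrows_def Hom_def)
  then show thesis using that[of g] g assms by (auto simp: inverse_arrows_def Hom_def isomorphism_def)
qed

lemma isomorphismI:
  assumes "f \<in> Hom C X Y" "g \<in> Hom C Y X" "g \<cdot> f = Ident C X" "f \<cdot> g = Ident C Y"
  shows "isomorphism C f"
  using assms by (auto simp: isomorphism_def inverse_arrows_def Hom_def)

text \<open>The second duality identity in \<open>dualizable_objects\<close> mentions
  \<open>inverse_arrow\<close>, a definite description; this evaluates it at any known two-sided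
  inverse.\<close>

lemma inverse_arrow_eqI:
  assumes "f \<in> Hom C X Y" "g \<in> Hom C Y X" "g \<cdot> f = Ident C X" "f \<cdot> g = Ident C Y"
  shows "inverse_arrow C f = g"
proof -
  have g: "inverse_arrows C f g" using assms by (auto simp: inverse_arrows_def Hom_def)
  have "g' = g" if "inverse_arrows C f g'" for g'
  proof -
    have g': "g' \<in> Hom C Y X" "g' \<cdot> f = Ident C X" "f \<cdot> g' = Ident C Y"
      using that assms by (auto simp: inverse_arrows_def Hom_def)
    have "(g' \<cdot> f) \<cdot> g = g' \<cdot> (f \<cdot> g)" using Comp_assoc[OF assms(2,1) g'(1)] .
    then show ?thesis using g' assms by (simp add: Comp_Ident[OF g'(1)] Ident_Comp[OF assms(2)])
  qed
  then show ?thesis using g unfolding inverse_arrow_def by blast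
qed

lemma isomorphism_Ident: "X \<in> Ob C \<Longrightarrow> isomorphism C (Ident C X)"
  by (rule isomorphismI[of _ X X "Ident C X"]) (simp_all add: Hom_def cat_simps)

lemma isomorphism_Comp:
  assumes "isomorphism C f" "isomorphism C g" "f \<in> Hom C X Y" "g \<in> Hom C Y Z"
  shows "isomorphism C (g \<cdot> f)"
proof -
  obtain f' where f': "f' \<in> Hom C Y X" "f' \<cdot> f = Ident C X" "f \<cdot> f' = Ident C Y"
    using isomorphismE assms by metis
  obtain g' where g': "g' \<in> Hom C Z Y" "g' \<cdot> g = Ident C Y" "g \<cdot> g' = Ident C Z"
    using isomorphismE assms by metis
  note r = Comp_rewrite[OF f'(2)] Comp_rewrite[OF f'(3)] Comp_rewrite[OF g'(2)] Comp_rewrite[OF g'(3)]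
  show ?thesis
    by (rule isomorphismI[of _ X Z "f' \<cdot> g'"])
      (use assms f' g' in \<open>simp_all add: Hom_def cat_simps r\<close>)
qed

lemma isomorphism_left_cancel:
  assumes "isomorphism C k" "k \<in> Hom C Y Z" "f \<in> Hom C X Y" "g \<in> Hom C X Y" "k \<cdot> f = k \<cdot> g"
  shows "f = g"
proof -
  obtain l where l: "l \<in> Hom C Z Y" "l \<cdot> k = Ident C Y" using isomorphismE[OF assms(1,2)] by metis
  have "l \<cdot> (k \<cdot> f) = l \<cdot> (k \<cdot> g)" using assms by simp
  then show ?thesis
    using Comp_assoc[OF assms(3,2) l(1)] Comp_assoc[OF assms(4,2) l(1)] l(2) Ident_Comp[OF assms(3)] Ident_Comp[OF assms(4)]
    by simp
qed

lemma isomorphism_right_cancel: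
  assumes "isomorphism C k" "k \<in> Hom C X Y" "f \<in> Hom C Y Z" "g \<in> Hom C Y Z" "f \<cdot> k = g \<cdot> k"
  shows "f = g"
proof -
  obtain l where l: "l \<in> Hom C Y X" "k \<cdot> l = Ident C Y" using isomorphismE[OF assms(1,2)] by metis
  have "(f \<cdot> k) \<cdot> l = (g \<cdot> k) \<cdot> l" using assms by simp
  then show ?thesis
    using Comp_assoc[OF l(1) assms(2,3)] Comp_assoc[OF l(1) assms(2,4)] l(2) Comp_Ident[OF assms(3)] Comp_Ident[OF assms(4)]
    by simp
qed

lemma isomorphic_refl: "X \<in> Ob C \<Longrightarrow> isomorphic C X X"
  using isomorphism_Ident Ident_in_Hom by (auto simp: isomorphic_def)

lemma isomorphic_sym: "isomorphic C X Y \<Longrightarrow> isomorphic C Y X"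
  unfolding isomorphic_def by (metis isomorphismE)

lemma isomorphic_trans: "isomorphic C X Y \<Longrightarrow> isomorphic C Y Z \<Longrightarrow> isomorphic C X Z"
  unfolding isomorphic_def by (metis isomorphism_Comp Comp_in_Hom)

lemma isomorphic_Ob: "isomorphic C X Y \<Longrightarrow> X \<in> Ob C" "isomorphic C X Y \<Longrightarrow> Y \<in> Ob C"
  unfolding isomorphic_def using Hom_Ob by auto

lemma isomorphicI: "f \<in> Hom C X Y \<Longrightarrow> isomorphism C f \<Longrightarrow> isomorphic C X Y"
  by (auto simp: isomorphic_def)

section \<open>Coproducts by their universal property\<close>

lemma coproductD:
  assumes "coproduct C I X A \<iota>"
  shows "A \<in> Ob C" "i \<in> I \<Longrightarrow> \<iota> i \<in> Hom C (X i) A"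
  using assms by (auto simp: coproduct_def)

lemma coproduct_arrow:
  assumes "coproduct C I X A \<iota>" "Y \<in> Ob C" "\<And>i. i \<in> I \<Longrightarrow> g i \<in> Hom C (X i) Y"
  obtains h where "h \<in> Hom C A Y" "\<And>i. i \<in> I \<Longrightarrow> h \<cdot> \<iota> i = g i"
  using assms unfolding coproduct_def by metis

lemma coproduct_eqI:
  assumes "coproduct C I X A \<iota>" "h \<in> Hom C A Y" "h' \<in> Hom C A Y"
    and "\<And>i. i \<in> I \<Longrightarrow> h \<cdot> \<iota> i = h' \<cdot> \<iota> i"
  shows "h = h'"
proof -
  have "\<forall>i\<in>I. h' \<cdot> \<iota> i \<in> Hom C (X i) Y"
    using assms by (auto intro: Comp_in_Hom coproductD)
  then have "\<exists>!k. k \<in> Hom C A Y \<and> (\<forall>i\<in>I. k \<cdot> \<iota> i = h' \<cdot> \<iota> i)"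
    using assms(1)[unfolded coproduct_def, THEN conjunct2, THEN conjunct2,
        rule_format, OF Hom_Ob(2)[OF assms(2)], of "\<lambda>i. h' \<cdot> \<iota> i"] by blast
  then show ?thesis using assms by blast
qed

lemma coproductI:
  assumes "A \<in> Ob C" "\<And>i. i \<in> I \<Longrightarrow> \<iota> i \<in> Hom C (X i) A"
    and "\<And>Y g. Y \<in> Ob C \<Longrightarrow> (\<And>i. i \<in> I \<Longrightarrow> g i \<in> Hom C (X i) Y) \<Longrightarrow>
      \<exists>h \<in> Hom C A Y. \<forall>i\<in>I. h \<cdot> \<iota> i = g i"
    and "\<And>Y h h'. Y \<in> Ob C \<Longrightarrow> h \<in> Hom C A Y \<Longrightarrow> h' \<in> Hom C A Y \<Longrightarrow>
      (\<And>i. i \<in> I \<Longrightarrow> h \<cdot> \<iota> i = h' \<cdot> \<iota> i) \<Longrightarrow> h = h'"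
  shows "coproduct C I X A \<iota>"
  unfolding coproduct_def
proof (intro conjI ballI allI impI)
  fix Y g assume Y: "Y \<in> Ob C" and g: "\<forall>i\<in>I. g i \<in> Hom C (X i) Y"
  obtain h where h: "h \<in> Hom C A Y" "\<forall>i\<in>I. h \<cdot> \<iota> i = g i" using assms(3)[of Y g] Y g by blast
  show "\<exists>!h. h \<in> Hom C A Y \<and> (\<forall>i\<in>I. h \<cdot> \<iota> i = g i)"
  proof (rule ex1I[of _ h])
    show "h' = h" if "h' \<in> Hom C A Y \<and> (\<forall>i\<in>I. h' \<cdot> \<iota> i = g i)" for h'
      using assms(4)[OF Y, of h' h] h that by simp
  qed (use h in simp)
qed (use assms in auto)

text \<open>Used to absorb braidings and chosen isomorphisms: left tensor products and objects of
  the essential image are identified with coproducts only up to such a change.\<close>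

lemma coproduct_cong_iso:
  assumes A: "coproduct C I X A \<iota>"
    and k: "\<And>i. i \<in> I \<Longrightarrow> k i \<in> Hom C (X' i) (X i)" "\<And>i. i \<in> I \<Longrightarrow> isomorphism C (k i)"
    and m: "m \<in> Hom C A A'" "isomorphism C m"
  shows "coproduct C I X' A' (\<lambda>i. m \<cdot> (\<iota> i \<cdot> k i))"
proof -
  have "\<exists>l. l \<in> Hom C (X i) (X' i) \<and> l \<cdot> k i = Ident C (X' i) \<and> k i \<cdot> l = Ident C (X i)" if "i \<in> I" for i
    using isomorphismE[OF k(2) k(1)] that by metis
  then obtain l where l: "\<And>i. i \<in> I \<Longrightarrow> l i \<in> Hom C (X i) (X' i)"
    "\<And>i. i \<in> I \<Longrightarrow> l i \<cdot> k i = Ident C (X' i)" "\<And>i. i \<in> I \<Longrightarrow> k i \<cdot> l i = Ident C (X i)" by metis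
  obtain n where n: "n \<in> Hom C A' A" "n \<cdot> m = Ident C A" "m \<cdot> n = Ident C A'"
    using isomorphismE[OF m(2,1)] by metis
  have \<iota>: "\<iota> i \<in> Hom C (X i) A" if "i \<in> I" for i using coproductD[OF A] that by simp
  show ?thesis
  proof (rule coproductI)
    show "A' \<in> Ob C" using m Hom_Ob by simp
    show "m \<cdot> (\<iota> i \<cdot> k i) \<in> Hom C (X' i) A'" if "i \<in> I" for i
      using \<iota>[OF that] k(1)[OF that] m by (simp add: Hom_def cat_simps)
  next
    fix Y g assume Y: "Y \<in> Ob C" and g: "\<And>i. i \<in> I \<Longrightarrow> g i \<in> Hom C (X' i) Y"
    obtain h where h: "h \<in> Hom C A Y" "\<And>i. i \<in> I \<Longrightarrow> h \<cdot> \<iota> i = g i \<cdot> l i"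
      using coproduct_arrow[OF A Y, of "\<lambda>i. g i \<cdot> l i"] g l(1) Comp_in_Hom by metis
    have "(h \<cdot> n) \<cdot> (m \<cdot> (\<iota> i \<cdot> k i)) = g i" if i: "i \<in> I" for i
    proof -
      have "(h \<cdot> n) \<cdot> (m \<cdot> (\<iota> i \<cdot> k i)) = h \<cdot> (\<iota> i \<cdot> k i)"
        using \<iota>[OF i] k(1)[OF i] m n h(1) by (simp add: Hom_def cat_simps Comp_rewrite[OF n(2)])
      also have "\<dots> = g i \<cdot> (l i \<cdot> k i)"
        using \<iota>[OF i] k(1)[OF i] h(1) l(1)[OF i] g[OF i]
        by (simp add: Hom_def cat_simps Comp_rewrite[OF h(2)[OF i]])
      finally show ?thesis using l(2)[OF i] g[OF i] by (simp add: Comp_Ident)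
    qed
    moreover have "h \<cdot> n \<in> Hom C A' Y" using h n Comp_in_Hom by blast
    ultimately show "\<exists>h\<in>Hom C A' Y. \<forall>i\<in>I. h \<cdot> (m \<cdot> (\<iota> i \<cdot> k i)) = g i" by blast
  next
    fix Y h h' assume Y: "Y \<in> Ob C" and h: "h \<in> Hom C A' Y" "h' \<in> Hom C A' Y"
      and e: "\<And>i. i \<in> I \<Longrightarrow> h \<cdot> (m \<cdot> (\<iota> i \<cdot> k i)) = h' \<cdot> (m \<cdot> (\<iota> i \<cdot> k i))"
    have "h \<cdot> m = h' \<cdot> m"
    proof (rule coproduct_eqI[OF A])
      fix i assume i: "i \<in> I"
      have x: "u \<cdot> (m \<cdot> (\<iota> i \<cdot> (k i \<cdot> l i))) = (u \<cdot> m) \<cdot> \<iota> i" if "u \<in> Hom C A' Y" for u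
        using \<iota>[OF i] k(1)[OF i] m l(1)[OF i] that l(3)[OF i] by (simp add: Hom_def cat_simps)
      have "(h \<cdot> (m \<cdot> (\<iota> i \<cdot> k i))) \<cdot> l i = (h' \<cdot> (m \<cdot> (\<iota> i \<cdot> k i))) \<cdot> l i" using e[OF i] by simp
      then have "h \<cdot> (m \<cdot> (\<iota> i \<cdot> (k i \<cdot> l i))) = h' \<cdot> (m \<cdot> (\<iota> i \<cdot> (k i \<cdot> l i)))"
        using \<iota>[OF i] k(1)[OF i] m l(1)[OF i] h by (simp add: Hom_def cat_simps)
      then show "(h \<cdot> m) \<cdot> \<iota> i = (h' \<cdot> m) \<cdot> \<iota> i" using x h by simp
    qed (use h m Comp_in_Hom in blast)+
    then have "(h \<cdot> m) \<cdot> n = (h' \<cdot> m) \<cdot> n" by simp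
    then show "h = h'" using h m n by (simp add: Hom_def cat_simps)
  qed
qed

end

section \<open>Functors, natural isomorphisms and equivalences of categories\<close>

lemma functor_Hom:
  assumes "category C" "is_functor C D F" "f \<in> Hom C X Y"
  shows "FArr F f \<in> Hom D (FOb F X) (FOb F Y)"
  using assms category.Hom_Ob[OF assms(1,3)] by (auto simp: is_functor_def)

lemma functor_Comp:
  assumes "is_functor C D F" "f \<in> Hom C X Y" "g \<in> Hom C Y Z"
  shows "FArr F (g \<cdot>\<^bsub>C\<^esub> f) = FArr F g \<cdot>\<^bsub>D\<^esub> FArr F f"
  using assms by (auto simp: is_functor_def Hom_def)

lemma functor_Ident: "is_functor C D F \<Longrightarrow> X \<in> Ob C \<Longrightarrow> FArr F (Ident C X) = Ident D (FOb F X)"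
  and functor_Ob: "is_functor C D F \<Longrightarrow> X \<in> Ob C \<Longrightarrow> FOb F X \<in> Ob D"
  by (auto simp: is_functor_def)

lemma functor_isomorphism:
  assumes "category C" "category D" "is_functor C D F" "f \<in> Hom C X Y" "isomorphism C f"
  shows "isomorphism D (FArr F f)"
proof -
  obtain g where g: "g \<in> Hom C Y X" "g \<cdot>\<^bsub>C\<^esub> f = Ident C X" "f \<cdot>\<^bsub>C\<^esub> g = Ident C Y"
    using category.isomorphismE[OF assms(1,5,4)] by metis
  have X: "X \<in> Ob C" "Y \<in> Ob C" using category.Hom_Ob[OF assms(1,4)] by auto
  show ?thesis
  proof (rule category.isomorphismI[OF assms(2) functor_Hom[OF assms(1,3,4)] functor_Hom[OF assms(1,3) g(1)]])
    show "FArr F g \<cdot>\<^bsub>D\<^esub> FArr F f = Ident D (FOb F X)"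
      using functor_Comp[OF assms(3,4) g(1)] g(2) functor_Ident[OF assms(3) X(1)] by simp
    show "FArr F f \<cdot>\<^bsub>D\<^esub> FArr F g = Ident D (FOb F Y)"
      using functor_Comp[OF assms(3) g(1) assms(4)] g(3) functor_Ident[OF assms(3) X(2)] by simp
  qed
qed

lemma functor_isomorphic:
  assumes "category C" "category D" "is_functor C D F" "isomorphic C X Y"
  shows "isomorphic D (FOb F X) (FOb F Y)"
proof -
  obtain f where "f \<in> Hom C X Y" "isomorphism C f" using assms(4) by (auto simp: isomorphic_def)
  then show ?thesis
    using functor_isomorphism[OF assms(1-3)] functor_Hom[OF assms(1,3)]
    unfolding isomorphic_def by blast
qed

lemma natural_isomorphismD:
  assumes "natural_isomorphism C D F G \<eta>"
  shows "X \<in> Ob C \<Longrightarrow> \<eta> X \<in> Hom D (FOb F X) (FOb G X)" "X \<in> Ob C \<Longrightarrow> isomorphism D (\<eta> X)"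
    and "f \<in> Hom C X Y \<Longrightarrow> \<eta> Y \<cdot>\<^bsub>D\<^esub> FArr F f = FArr G f \<cdot>\<^bsub>D\<^esub> \<eta> X"
  using assms by (auto simp: natural_isomorphism_def Hom_def)

lemma equivalence_essentially_surjective:
  fixes C :: "('o, 'm, 'x) cat_scheme" and D :: "('p, 'n, 'y) cat_scheme"
  assumes "is_equivalence C D F" "Y \<in> Ob D"
  shows "\<exists>X \<in> Ob C. isomorphic D (FOb F X) Y"
proof -
  obtain G :: "('p, 'n, 'o, 'm) cat_fun" and \<epsilon> where
    G: "is_functor D C G" "natural_isomorphism D D (comp_fun F G) id_fun \<epsilon>"
    using assms unfolding is_equivalence_def by blast
  then show ?thesis
    using assms(2) natural_isomorphismD(1,2)[OF G(2) assms(2)] functor_Ob[OF G(1) assms(2)]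
    by (intro bexI[of _ "FOb G Y"]) (auto simp: comp_fun_def id_fun_def isomorphic_def)
qed

text \<open>By naturality, \<open>f\<close> is recovered from its image under \<open>L\<close> and
  \<open>K\<close> by conjugation with \<open>\<tau>\<close>. The disjunction covers the unit and
  the counit of an equivalence, which point in opposite directions relative to the identity.\<close>

lemma faithful_of_left_inverse:
  assumes A: "category A" and f: "f \<in> Hom A X Y" "f' \<in> Hom A X Y"
    and n: "natural_isomorphism A A (comp_fun L K) id_fun \<tau> \<or> natural_isomorphism A A id_fun (comp_fun L K) \<tau>"
    and e: "FArr K f = FArr K f'"
  shows "f = f'"
proof -
  interpret A: category A by fact
  have X: "X \<in> Ob A" "Y \<in> Ob A" using A.Hom_Ob[OF f(1)] by auto
  show ?thesis using n
  proof
    assume n: "natural_isomorphism A A (comp_fun L K) id_fun \<tau>"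
    have \<tau>: "\<tau> X \<in> Hom A (FOb L (FOb K X)) X" "isomorphism A (\<tau> X)"
      "f \<cdot>\<^bsub>A\<^esub> \<tau> X = \<tau> Y \<cdot>\<^bsub>A\<^esub> FArr L (FArr K f)" "f' \<cdot>\<^bsub>A\<^esub> \<tau> X = \<tau> Y \<cdot>\<^bsub>A\<^esub> FArr L (FArr K f')"
      using natural_isomorphismD[OF n] X f by (simp_all add: comp_fun_def id_fun_def)
    obtain s where s: "s \<in> Hom A X (FOb L (FOb K X))" "\<tau> X \<cdot>\<^bsub>A\<^esub> s = Ident A X"
      using A.isomorphismE[OF \<tau>(2,1)] by metis
    have "(f \<cdot>\<^bsub>A\<^esub> \<tau> X) \<cdot>\<^bsub>A\<^esub> s = (f' \<cdot>\<^bsub>A\<^esub> \<tau> X) \<cdot>\<^bsub>A\<^esub> s" unfolding \<tau> e ..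
    then show ?thesis using s f
      by (simp add: A.Comp_assoc[OF s(1) \<tau>(1) f(1)] A.Comp_assoc[OF s(1) \<tau>(1) f(2)] A.Comp_Ident[of _ X Y])
  next
    assume n: "natural_isomorphism A A id_fun (comp_fun L K) \<tau>"
    have \<tau>: "\<tau> Y \<in> Hom A Y (FOb L (FOb K Y))" "isomorphism A (\<tau> Y)"
      "\<tau> Y \<cdot>\<^bsub>A\<^esub> f = FArr L (FArr K f) \<cdot>\<^bsub>A\<^esub> \<tau> X" "\<tau> Y \<cdot>\<^bsub>A\<^esub> f' = FArr L (FArr K f') \<cdot>\<^bsub>A\<^esub> \<tau> X"
      using natural_isomorphismD[OF n] X f by (simp_all add: comp_fun_def id_fun_def)
    obtain s where s: "s \<in> Hom A (FOb L (FOb K Y)) Y" "s \<cdot>\<^bsub>A\<^esub> \<tau> Y = Ident A Y"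
      using A.isomorphismE[OF \<tau>(2,1)] by metis
    have "s \<cdot>\<^bsub>A\<^esub> (\<tau> Y \<cdot>\<^bsub>A\<^esub> f) = s \<cdot>\<^bsub>A\<^esub> (\<tau> Y \<cdot>\<^bsub>A\<^esub> f')" unfolding \<tau> e ..
    then show ?thesis using s f
      by (simp add: A.Comp_assoc[OF f(1) \<tau>(1) s(1), symmetric] A.Comp_assoc[OF f(2) \<tau>(1) s(1), symmetric]
          A.Ident_Comp[of _ X Y])
  qed
qed

lemma equivalence_fully_faithful:
  fixes C :: "('o, 'm, 'x) cat_scheme" and D :: "('p, 'n, 'y) cat_scheme"
  assumes C: "category C" and D: "category D" and F: "is_equivalence C D F"
  shows "fully_faithful C D F"
proof -
  interpret C: category C by fact
  interpret D: category D by fact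
  obtain G :: "('p, 'n, 'o, 'm) cat_fun" and \<eta> \<epsilon> where G: "is_functor D C G" and \<eta>: "natural_isomorphism C C id_fun (comp_fun G F) \<eta>"
    and \<epsilon>: "natural_isomorphism D D (comp_fun F G) id_fun \<epsilon>"
    using F unfolding is_equivalence_def by blast
  have Ff: "is_functor C D F" using F by (simp add: is_equivalence_def)
  have full: "\<exists>f \<in> Hom C X Y. FArr F f = g" if X: "X \<in> Ob C" "Y \<in> Ob C" and g: "g \<in> Hom D (FOb F X) (FOb F Y)" for X Y g
  proof -
    have \<eta>X: "\<eta> X \<in> Hom C X (FOb G (FOb F X))" and \<eta>Y: "\<eta> Y \<in> Hom C Y (FOb G (FOb F Y))"
      and iX: "isomorphism C (\<eta> X)" and iY: "isomorphism C (\<eta> Y)"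
      using natural_isomorphismD[OF \<eta>] X by (simp_all add: comp_fun_def id_fun_def)
    have Gg: "FArr G g \<in> Hom C (FOb G (FOb F X)) (FOb G (FOb F Y))" using functor_Hom[OF D G g] .
    obtain s where s: "s \<in> Hom C (FOb G (FOb F Y)) Y" "\<eta> Y \<cdot>\<^bsub>C\<^esub> s = Ident C (FOb G (FOb F Y))"
      using C.isomorphismE[OF iY \<eta>Y] by metis
    obtain r where r: "r \<in> Hom C (FOb G (FOb F X)) X" "\<eta> X \<cdot>\<^bsub>C\<^esub> r = Ident C (FOb G (FOb F X))"
      using C.isomorphismE[OF iX \<eta>X] by metis
    \<comment> \<open>The naturality square of \<open>\<eta>\<close> at a preimage of
      \<open>g\<close> forces this value. It yields \<open>FArr G (FArr F f) = FArr G g\<close>, and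
      \<open>G\<close> is faithful because of \<open>\<epsilon>\<close>.\<close>
    define f where "f = s \<cdot>\<^bsub>C\<^esub> (FArr G g \<cdot>\<^bsub>C\<^esub> \<eta> X)"
    have f: "f \<in> Hom C X Y" unfolding f_def using s Gg \<eta>X by (simp add: Hom_def C.cat_simps)
    have "\<eta> Y \<cdot>\<^bsub>C\<^esub> f = FArr G (FArr F f) \<cdot>\<^bsub>C\<^esub> \<eta> X"
      using natural_isomorphismD(3)[OF \<eta> f] by (simp add: comp_fun_def id_fun_def)
    moreover have "\<eta> Y \<cdot>\<^bsub>C\<^esub> f = FArr G g \<cdot>\<^bsub>C\<^esub> \<eta> X"
      unfolding f_def using s Gg \<eta>X \<eta>Y by (simp add: Hom_def C.cat_simps C.Comp_rewrite[OF s(2)])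
    ultimately have "(FArr G (FArr F f) \<cdot>\<^bsub>C\<^esub> \<eta> X) \<cdot>\<^bsub>C\<^esub> r = (FArr G g \<cdot>\<^bsub>C\<^esub> \<eta> X) \<cdot>\<^bsub>C\<^esub> r" by simp
    moreover have "FArr G (FArr F f) \<in> Hom C (FOb G (FOb F X)) (FOb G (FOb F Y))"
      using functor_Hom[OF D G functor_Hom[OF C Ff f]] .
    ultimately have "FArr G (FArr F f) = FArr G g"
      using Gg \<eta>X r by (simp add: Hom_def C.cat_simps)
    then have "FArr F f = g"
      using faithful_of_left_inverse[OF D functor_Hom[OF C Ff f] g] \<epsilon> by blast
    then show ?thesis using f by blast
  qed
  show ?thesis unfolding fully_faithful_def
  proof (intro ballI)
    fix X Y assume X: "X \<in> Ob C" "Y \<in> Ob C"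
    have "inj_on (FArr F) (Hom C X Y)"
      using faithful_of_left_inverse[OF C] \<eta> by (intro inj_onI) blast
    then show "bij_betw (FArr F) (Hom C X Y) (Hom D (FOb F X) (FOb F Y))"
      using full X functor_Hom[OF C Ff] unfolding bij_betw_def by blast
  qed
qed

lemma fully_faithfulD:
  assumes "fully_faithful C D F" "X \<in> Ob C" "Y \<in> Ob C"
  shows "f \<in> Hom C X Y \<Longrightarrow> f' \<in> Hom C X Y \<Longrightarrow> FArr F f = FArr F f' \<Longrightarrow> f = f'"
    and "g \<in> Hom D (FOb F X) (FOb F Y) \<Longrightarrow> \<exists>f \<in> Hom C X Y. FArr F f = g"
proof -
  have "bij_betw (FArr F) (Hom C X Y) (Hom D (FOb F X) (FOb F Y))"
    using assms by (simp add: fully_faithful_def)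
  then have "inj_on (FArr F) (Hom C X Y)" "FArr F ` Hom C X Y = Hom D (FOb F X) (FOb F Y)"
    by (auto simp: bij_betw_def)
  then show "f \<in> Hom C X Y \<Longrightarrow> f' \<in> Hom C X Y \<Longrightarrow> FArr F f = FArr F f' \<Longrightarrow> f = f'"
    and "g \<in> Hom D (FOb F X) (FOb F Y) \<Longrightarrow> \<exists>f \<in> Hom C X Y. FArr F f = g"
    by (auto dest: inj_onD) (metis imageE)
qed

lemma fully_faithful_equivalence:
  assumes C: "category C" and D: "category D" and F: "is_functor C D F" "fully_faithful C D F"
    and ess: "\<And>Y. Y \<in> Ob D \<Longrightarrow> \<exists>X \<in> Ob C. isomorphic D (FOb F X) Y"
  shows "is_equivalence C D F"
proof -
  interpret C: category C by fact
  interpret D: category D by fact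
  have "\<exists>X e e'. X \<in> Ob C \<and> e \<in> Hom D (FOb F X) Y \<and> e' \<in> Hom D Y (FOb F X) \<and>
      e' \<cdot>\<^bsub>D\<^esub> e = Ident D (FOb F X) \<and> e \<cdot>\<^bsub>D\<^esub> e' = Ident D Y" if "Y \<in> Ob D" for Y
    using ess[OF that] D.isomorphismE unfolding isomorphic_def by metis
  then obtain g e e' where g: "\<And>Y. Y \<in> Ob D \<Longrightarrow> g Y \<in> Ob C"
    and e: "\<And>Y. Y \<in> Ob D \<Longrightarrow> e Y \<in> Hom D (FOb F (g Y)) Y"
    and e': "\<And>Y. Y \<in> Ob D \<Longrightarrow> e' Y \<in> Hom D Y (FOb F (g Y))"
    and ee: "\<And>Y. Y \<in> Ob D \<Longrightarrow> e' Y \<cdot>\<^bsub>D\<^esub> e Y = Ident D (FOb F (g Y))"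
    and ee': "\<And>Y. Y \<in> Ob D \<Longrightarrow> e Y \<cdot>\<^bsub>D\<^esub> e' Y = Ident D Y"
    by metis
  have FO: "FOb F X \<in> Ob D" if "X \<in> Ob C" for X using functor_Ob[OF F(1) that] .
  \<comment> \<open>Full faithfulness lifts the conjugate of \<open>k\<close> by the chosen
    isomorphisms; functoriality and naturality then follow by comparing images under
    \<open>F\<close>.\<close>
  define G where "G = (\<lambda>k. SOME l. l \<in> Hom C (g (Dom D k)) (g (Cod D k)) \<and>
    FArr F l = e' (Cod D k) \<cdot>\<^bsub>D\<^esub> k \<cdot>\<^bsub>D\<^esub> e (Dom D k))"
  have G: "G k \<in> Hom C (g X) (g Y) \<and> FArr F (G k) = e' Y \<cdot>\<^bsub>D\<^esub> k \<cdot>\<^bsub>D\<^esub> e X" if k: "k \<in> Hom D X Y" for k X Y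
  proof -
    have X: "X \<in> Ob D" "Y \<in> Ob D" using D.Hom_Ob[OF k] by auto
    have "e' Y \<cdot>\<^bsub>D\<^esub> k \<cdot>\<^bsub>D\<^esub> e X \<in> Hom D (FOb F (g X)) (FOb F (g Y))"
      using k X e[of X] e'[of Y] by (simp add: Hom_def D.cat_simps)
    then have "\<exists>l. l \<in> Hom C (g X) (g Y) \<and> FArr F l = e' Y \<cdot>\<^bsub>D\<^esub> k \<cdot>\<^bsub>D\<^esub> e X"
      using fully_faithfulD(2)[OF F(2) g g] X by blast
    then show ?thesis
      using someI_ex[of "\<lambda>l. l \<in> Hom C (g X) (g Y) \<and> FArr F l = e' Y \<cdot>\<^bsub>D\<^esub> k \<cdot>\<^bsub>D\<^esub> e X"] D.HomD(2,3)[OF k]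
      unfolding G_def by simp
  qed
  have fG: "is_functor D C \<lparr>FOb = g, FArr = G\<rparr>"
    unfolding is_functor_def
  proof (intro conjI ballI impI)
    fix X assume X: "X \<in> Ob D"
    show "FOb \<lparr>FOb = g, FArr = G\<rparr> X \<in> Ob C" using g X by simp
    have "FArr F (G (Ident D X)) = FArr F (Ident C (g X))"
      using G[OF D.Ident_in_Hom[OF X]] ee[OF X] e[OF X] functor_Ident[OF F(1) g[OF X]]
      by (simp add: D.Ident_Comp)
    then have "G (Ident D X) = Ident C (g X)"
      using fully_faithfulD(1)[OF F(2) g[OF X] g[OF X] _ C.Ident_in_Hom[OF g[OF X]]] G[OF D.Ident_in_Hom[OF X]] by simp
    then show "FArr \<lparr>FOb = g, FArr = G\<rparr> (Ident D X) = Ident C (FOb \<lparr>FOb = g, FArr = G\<rparr> X)" by simp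
  next
    fix k l assume k: "k \<in> Arr D" "l \<in> Arr D" "Cod D k = Dom D l"
    define X Y Z where "X = Dom D k" "Y = Dom D l" "Z = Cod D l"
    have kl: "k \<in> Hom D X Y" "l \<in> Hom D Y Z" using k by (auto simp: Hom_def X_Y_Z_def)
    have X: "X \<in> Ob D" "Y \<in> Ob D" "Z \<in> Ob D" using D.Hom_Ob kl by auto
    have "FArr F (G (l \<cdot>\<^bsub>D\<^esub> k)) = e' Z \<cdot>\<^bsub>D\<^esub> (l \<cdot>\<^bsub>D\<^esub> k) \<cdot>\<^bsub>D\<^esub> e X"
      using G[OF D.Comp_in_Hom[OF kl]] by simp
    also have "\<dots> = (e' Z \<cdot>\<^bsub>D\<^esub> l \<cdot>\<^bsub>D\<^esub> e Y) \<cdot>\<^bsub>D\<^esub> (e' Y \<cdot>\<^bsub>D\<^esub> k \<cdot>\<^bsub>D\<^esub> e X)"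
      using kl e[of X] e'[of Y] e[of Y] e'[of Z] X
      by (simp add: Hom_def D.cat_simps D.Comp_rewrite[OF ee'[OF X(2)]])
    also have "\<dots> = FArr F (G l) \<cdot>\<^bsub>D\<^esub> FArr F (G k)" using G[OF kl(1)] G[OF kl(2)] by simp
    also have "\<dots> = FArr F (G l \<cdot>\<^bsub>C\<^esub> G k)"
      using functor_Comp[OF F(1), of "G k" "g X" "g Y" "G l" "g Z"] G[OF kl(1)] G[OF kl(2)] by simp
    finally show "FArr \<lparr>FOb = g, FArr = G\<rparr> (l \<cdot>\<^bsub>D\<^esub> k) =
        FArr \<lparr>FOb = g, FArr = G\<rparr> l \<cdot>\<^bsub>C\<^esub> FArr \<lparr>FOb = g, FArr = G\<rparr> k"
      using fully_faithfulD(1)[OF F(2) g[OF X(1)] g[OF X(3)], of "G (l \<cdot>\<^bsub>D\<^esub> k)" "G l \<cdot>\<^bsub>C\<^esub> G k"]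
        G[OF D.Comp_in_Hom[OF kl]] C.Comp_in_Hom[of "G k" "g X" "g Y" "G l" "g Z"] G[OF kl(1)] G[OF kl(2)] by simp

  qed (use G in simp)
  have n\<epsilon>: "natural_isomorphism D D (comp_fun F \<lparr>FOb = g, FArr = G\<rparr>) id_fun e"
    unfolding natural_isomorphism_def
  proof (intro conjI ballI)
    fix k assume "k \<in> Arr D"
    then obtain X Y where k: "k \<in> Hom D X Y" by (auto simp: Hom_def)
    have X: "X \<in> Ob D" "Y \<in> Ob D" using D.Hom_Ob[OF k] by auto
    have "e Y \<cdot>\<^bsub>D\<^esub> FArr F (G k) = k \<cdot>\<^bsub>D\<^esub> e X"
      using G[OF k] e[of X] e'[of Y] e[of Y] X k
      by (simp add: Hom_def D.cat_simps D.Comp_rewrite[OF ee'[OF X(2)]])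
    then show "e (Cod D k) \<cdot>\<^bsub>D\<^esub> FArr (comp_fun F \<lparr>FOb = g, FArr = G\<rparr>) k = FArr id_fun k \<cdot>\<^bsub>D\<^esub> e (Dom D k)"
      using D.HomD[OF k] by (simp add: comp_fun_def id_fun_def)
  next
    fix X assume X: "X \<in> Ob D"
    show "e X \<in> Hom D (FOb (comp_fun F \<lparr>FOb = g, FArr = G\<rparr>) X) (FOb id_fun X)"
      using e[OF X] by (simp add: comp_fun_def id_fun_def)
    show "isomorphism D (e X)" using D.isomorphismI[OF e e' ee ee'] X by blast
  qed
  \<comment> \<open>The unit at \<open>X\<close> lifts the inverse \<open>e'\<close> of the counit
    at \<open>FOb F X\<close>; it is invertible because the counit \<open>e\<close> lifts
    too.\<close>
  define h where "h = (\<lambda>X. SOME l. l \<in> Hom C X (g (FOb F X)) \<and> FArr F l = e' (FOb F X))"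
  have h: "h X \<in> Hom C X (g (FOb F X)) \<and> FArr F (h X) = e' (FOb F X)" if X: "X \<in> Ob C" for X
    using someI_ex[of "\<lambda>l. l \<in> Hom C X (g (FOb F X)) \<and> FArr F l = e' (FOb F X)"]
      fully_faithfulD(2)[OF F(2) X g[OF FO[OF X]] e'[OF FO[OF X]]] unfolding h_def by blast
  have n\<eta>: "natural_isomorphism C C id_fun (comp_fun \<lparr>FOb = g, FArr = G\<rparr> F) h"
    unfolding natural_isomorphism_def
  proof (intro conjI ballI)
    fix X assume X: "X \<in> Ob C"
    note FX = FO[OF X]
    show "h X \<in> Hom C (FOb id_fun X) (FOb (comp_fun \<lparr>FOb = g, FArr = G\<rparr> F) X)"
      using h[OF X] by (simp add: comp_fun_def id_fun_def)
    obtain l where l: "l \<in> Hom C (g (FOb F X)) X" "FArr F l = e (FOb F X)"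
      using fully_faithfulD(2)[OF F(2) g[OF FX] X e[OF FX]] by blast
    have hX: "h X \<in> Hom C X (g (FOb F X))" "FArr F (h X) = e' (FOb F X)" using h[OF X] by auto
    have "FArr F (l \<cdot>\<^bsub>C\<^esub> h X) = FArr F (Ident C X)"
      using functor_Comp[OF F(1) hX(1) l(1)] l hX ee'[OF FX] functor_Ident[OF F(1) X] by simp
    then have 1: "l \<cdot>\<^bsub>C\<^esub> h X = Ident C X"
      using fully_faithfulD(1)[OF F(2) X X C.Comp_in_Hom[OF hX(1) l(1)] C.Ident_in_Hom[OF X]] by simp
    have "FArr F (h X \<cdot>\<^bsub>C\<^esub> l) = FArr F (Ident C (g (FOb F X)))"
      using functor_Comp[OF F(1) l(1) hX(1)] hX l ee[OF FX] functor_Ident[OF F(1) g[OF FX]] by simp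
    then have 2: "h X \<cdot>\<^bsub>C\<^esub> l = Ident C (g (FOb F X))"
      using fully_faithfulD(1)[OF F(2) g[OF FX] g[OF FX] C.Comp_in_Hom[OF l(1) hX(1)] C.Ident_in_Hom[OF g[OF FX]]]
      by simp
    show "isomorphism C (h X)" using C.isomorphismI[OF _ l(1) 1 2] h[OF X] by blast
  next
    fix k assume "k \<in> Arr C"
    then obtain X Y where k: "k \<in> Hom C X Y" by (auto simp: Hom_def)
    have X: "X \<in> Ob C" "Y \<in> Ob C" using C.Hom_Ob[OF k] by auto
    note Fk = functor_Hom[OF C F(1) k]
    have GF: "G (FArr F k) \<in> Hom C (g (FOb F X)) (g (FOb F Y))" using G[OF Fk] by simp
    have "FArr F (h Y \<cdot>\<^bsub>C\<^esub> k) = e' (FOb F Y) \<cdot>\<^bsub>D\<^esub> FArr F k"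
      using functor_Comp[OF F(1) k conjunct1[OF h[OF X(2)]]] h[OF X(2)] by simp
    also have "\<dots> = FArr F (G (FArr F k)) \<cdot>\<^bsub>D\<^esub> FArr F (h X)"
      using G[OF Fk] h[OF X(1)] ee'[OF FO[OF X(1)]] Fk e[OF FO[OF X(1)]] e'[OF FO[OF X(1)]] e'[OF FO[OF X(2)]]
      by (simp add: Hom_def D.cat_simps)
    also have "\<dots> = FArr F (G (FArr F k) \<cdot>\<^bsub>C\<^esub> h X)"
      using functor_Comp[OF F(1) conjunct1[OF h[OF X(1)]] GF] h[OF X(1)] by simp
    finally have "h Y \<cdot>\<^bsub>C\<^esub> k = G (FArr F k) \<cdot>\<^bsub>C\<^esub> h X"
      using fully_faithfulD(1)[OF F(2) X(1) g[OF FO[OF X(2)]], of "h Y \<cdot>\<^bsub>C\<^esub> k" "G (FArr F k) \<cdot>\<^bsub>C\<^esub> h X"]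
        C.Comp_in_Hom[OF k conjunct1[OF h[OF X(2)]]] C.Comp_in_Hom[OF conjunct1[OF h[OF X(1)]] GF] by simp
    then show "h (Cod C k) \<cdot>\<^bsub>C\<^esub> FArr id_fun k = FArr (comp_fun \<lparr>FOb = g, FArr = G\<rparr> F) k \<cdot>\<^bsub>C\<^esub> h (Dom C k)"
      using C.HomD[OF k] by (simp add: comp_fun_def id_fun_def)
  qed
  show ?thesis unfolding is_equivalence_def
    by (intro conjI exI[of _ "\<lparr>FOb = g, FArr = G\<rparr>"] exI[of _ h] exI[of _ e] F(1) fG n\<eta> n\<epsilon>)
qed

section \<open>Additive categories\<close>

lemma carrier_hom_group: "carrier (hom_group C X Y) = Hom C X Y"
  and mult_hom_group: "mult (hom_group C X Y) = Add C"
  and one_hom_group: "one (hom_group C X Y) = Zero C X Y"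
  by (simp_all add: hom_group_def)

context additive_category
begin

lemma Zero_in_Hom: "X \<in> Ob C \<Longrightarrow> Y \<in> Ob C \<Longrightarrow> Zero C X Y \<in> Hom C X Y"
  using monoid.one_closed[of "hom_group C X Y"] hom_comm_group[of X Y]
  by (simp add: comm_group_def group_def hom_group_def)

lemma Add_in_Hom: "f \<in> Hom C X Y \<Longrightarrow> g \<in> Hom C X Y \<Longrightarrow> f \<boxplus> g \<in> Hom C X Y"
  using monoid.m_closed[of "hom_group C X Y" f g] hom_comm_group[of X Y] Hom_Ob[of f X Y]
  by (simp add: comm_group_def group_def hom_group_def)

lemma Add_assoc: "f \<in> Hom C X Y \<Longrightarrow> g \<in> Hom C X Y \<Longrightarrow> h \<in> Hom C X Y \<Longrightarrow>
    (f \<boxplus> g) \<boxplus> h = f \<boxplus> (g \<boxplus> h)"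
  using monoid.m_assoc[of "hom_group C X Y" f g h] hom_comm_group[of X Y] Hom_Ob[of f X Y]
  by (simp add: comm_group_def group_def hom_group_def)

lemma Add_commute: "f \<in> Hom C X Y \<Longrightarrow> g \<in> Hom C X Y \<Longrightarrow> f \<boxplus> g = g \<boxplus> f"
  using comm_monoid.m_comm[of "hom_group C X Y" f g] hom_comm_group[of X Y] Hom_Ob[of f X Y]
  by (simp add: comm_group_def hom_group_def)

lemma Add_Zero: "f \<in> Hom C X Y \<Longrightarrow> f \<boxplus> Zero C X Y = f"
  using monoid.r_one[of "hom_group C X Y" f] hom_comm_group[of X Y] Hom_Ob[of f X Y]
  by (simp add: comm_group_def group_def hom_group_def)

lemma Zero_Add: "f \<in> Hom C X Y \<Longrightarrow> Zero C X Y \<boxplus> f = f"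
  using monoid.l_one[of "hom_group C X Y" f] hom_comm_group[of X Y] Hom_Ob[of f X Y]
  by (simp add: comm_group_def group_def hom_group_def)

lemma neg_in_Hom: "f \<in> Hom C X Y \<Longrightarrow> neg C f \<in> Hom C X Y"
  using group.inv_closed[of "hom_group C X Y" f] hom_comm_group[of X Y] Hom_Ob[of f X Y]
  unfolding comm_group_def neg_def by (simp add: HomD carrier_hom_group)

lemma Add_neg: "f \<in> Hom C X Y \<Longrightarrow> f \<boxplus> neg C f = Zero C X Y"
  using group.r_inv[of "hom_group C X Y" f] hom_comm_group[of X Y] Hom_Ob[of f X Y]
  unfolding comm_group_def neg_def by (simp add: HomD carrier_hom_group mult_hom_group one_hom_group)

lemma Add_right_cancel:
  assumes "f \<in> Hom C X Y" "g \<in> Hom C X Y" "h \<in> Hom C X Y" "f \<boxplus> h = g \<boxplus> h"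
  shows "f = g"
proof -
  have "(f \<boxplus> h) \<boxplus> neg C h = (g \<boxplus> h) \<boxplus> neg C h" using assms by simp
  then show ?thesis
    using Add_assoc[OF assms(1,3) neg_in_Hom[OF assms(3)]] Add_assoc[OF assms(2,3) neg_in_Hom[OF assms(3)]]
      Add_neg[OF assms(3)] Add_Zero[OF assms(1)] Add_Zero[OF assms(2)] by simp
qed

lemma diff_eq_Zero:
  assumes "f \<in> Hom C X Y" "g \<in> Hom C X Y" "f \<boxplus> neg C g = Zero C X Y"
  shows "f = g"
  using Add_right_cancel[of f X Y g "neg C g"] assms by (simp add: neg_in_Hom Add_neg)

lemma Comp_Zero:
  assumes "X \<in> Ob C" "g \<in> Hom C Y Z"
  shows "g \<cdot> Zero C X Y = Zero C X Z"
proof -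
  have z: "Zero C X Y \<in> Hom C X Y" using Zero_in_Hom assms Hom_Ob by blast
  have gz: "g \<cdot> Zero C X Y \<in> Hom C X Z" using Comp_in_Hom z assms by blast
  have "g \<cdot> Zero C X Y \<boxplus> g \<cdot> Zero C X Y = g \<cdot> Zero C X Y"
    using Comp_Add[OF z z assms(2)] Add_Zero[OF z] by simp
  then show ?thesis using Add_right_cancel[OF gz _ gz, of "Zero C X Z"] Zero_Add[OF gz]
      Zero_in_Hom Hom_Ob gz by metis
qed

lemma Zero_Comp:
  assumes "Z \<in> Ob C" "f \<in> Hom C X Y"
  shows "Zero C Y Z \<cdot> f = Zero C X Z"
proof -
  have z: "Zero C Y Z \<in> Hom C Y Z" using Zero_in_Hom assms Hom_Ob by blast
  have gz: "Zero C Y Z \<cdot> f \<in> Hom C X Z" using Comp_in_Hom z assms by blast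
  have "Zero C Y Z \<cdot> f \<boxplus> Zero C Y Z \<cdot> f = Zero C Y Z \<cdot> f"
    using Add_Comp[OF assms(2) z z] Add_Zero[OF z] by simp
  then show ?thesis using Add_right_cancel[OF gz _ gz, of "Zero C X Z"] Zero_Add[OF gz]
      Zero_in_Hom Hom_Ob gz by metis
qed

lemma neg_unique:
  assumes "f \<in> Hom C X Y" "g \<in> Hom C X Y" "g \<boxplus> f = Zero C X Y"
  shows "neg C f = g"
  using Add_right_cancel[of "neg C f" X Y g f] assms
  by (simp add: neg_in_Hom Add_neg Add_commute[of "neg C f" X Y f])

lemma Comp_neg:
  assumes "f \<in> Hom C X Y" "g \<in> Hom C Y Z"
  shows "g \<cdot> neg C f = neg C (g \<cdot> f)"
proof -
  have "g \<cdot> neg C f \<boxplus> g \<cdot> f = g \<cdot> (neg C f \<boxplus> f)"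
    using Comp_Add[OF neg_in_Hom assms(1) assms(2)] assms by simp
  also have "\<dots> = Zero C X Z"
    using assms Add_commute[OF neg_in_Hom assms(1)] Add_neg Comp_Zero Hom_Ob by metis
  finally show ?thesis
    using neg_unique[of "g \<cdot> f" X Z "g \<cdot> neg C f"] assms Comp_in_Hom neg_in_Hom by metis
qed

lemma neg_Comp:
  assumes "f \<in> Hom C X Y" "g \<in> Hom C Y Z"
  shows "neg C g \<cdot> f = neg C (g \<cdot> f)"
proof -
  have "neg C g \<cdot> f \<boxplus> g \<cdot> f = (neg C g \<boxplus> g) \<cdot> f"
    using Add_Comp[OF assms(1) neg_in_Hom assms(2)] assms by simp
  also have "\<dots> = Zero C X Z"
    using assms Add_commute[OF neg_in_Hom assms(2)] Add_neg Zero_Comp Hom_Ob by metis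
  finally show ?thesis
    using neg_unique[of "g \<cdot> f" X Z "neg C g \<cdot> f"] assms Comp_in_Hom neg_in_Hom by metis
qed

lemma neg_neg: "f \<in> Hom C X Y \<Longrightarrow> neg C (neg C f) = f"
  using neg_unique[of "neg C f" X Y f] neg_in_Hom[of f X Y] Add_neg[of f X Y] by simp

lemma neg_Zero: "X \<in> Ob C \<Longrightarrow> Y \<in> Ob C \<Longrightarrow> neg C (Zero C X Y) = Zero C X Y"
  by (simp add: neg_unique[OF Zero_in_Hom Zero_in_Hom] Zero_Add[OF Zero_in_Hom])

lemma neg_eq_Zero:
  assumes "f \<in> Hom C X Y" "neg C f = Zero C X Y"
  shows "f = Zero C X Y"
  using assms neg_neg[OF assms(1)] neg_Zero Hom_Ob by metis

lemma zero_object_iff: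
  assumes "Z \<in> Ob C"
  shows "zero_object C Z \<longleftrightarrow> Ident C Z = Zero C Z Z"
proof
  assume z: "zero_object C Z"
  then show "Ident C Z = Zero C Z Z"
    using Ident_in_Hom[OF assms] Zero_in_Hom[OF assms assms] assms unfolding zero_object_def by blast
next
  assume e: "Ident C Z = Zero C Z Z"
  have 1: "f = Zero C Z X" if "f \<in> Hom C Z X" for f X
    using Comp_Ident[OF that] Comp_Zero[OF assms that] e by simp
  have 2: "f = Zero C X Z" if "f \<in> Hom C X Z" for f X
    using Ident_Comp[OF that] Zero_Comp[OF assms that] e by simp
  show "zero_object C Z" unfolding zero_object_def
    using assms Zero_in_Hom 1 2 by blast
qed

lemma zero_object_Hom:
  assumes "zero_object C Z"
  shows "f \<in> Hom C Z X \<Longrightarrow> f = Zero C Z X" "g \<in> Hom C X Z \<Longrightarrow> g = Zero C X Z"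
  using assms Zero_in_Hom Hom_Ob unfolding zero_object_def by metis+

lemma zero_object_isomorphic:
  assumes "zero_object C Z" "zero_object C Z'"
  shows "isomorphic C Z Z'"
proof -
  have Z: "Z \<in> Ob C" "Z' \<in> Ob C" using assms by (auto simp: zero_object_def)
  show ?thesis
    by (rule isomorphicI[OF Zero_in_Hom isomorphismI[OF Zero_in_Hom Zero_in_Hom]])
      (use Z assms zero_object_Hom[OF assms(1)] zero_object_Hom[OF assms(2)] Ident_in_Hom Comp_in_Hom
        Zero_in_Hom in metis)+
qed

text \<open>The projections come from the universal property applied to an identity and zero arrows.
  They do not make an infinite coproduct a product, but they separate the summands of finite
  sums.\<close>

lemma coproduct_projections:
  assumes A: "coproduct C I X A \<iota>" and X: "\<And>i. i \<in> I \<Longrightarrow> X i \<in> Ob C"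
  obtains p where "\<And>i. i \<in> I \<Longrightarrow> p i \<in> Hom C A (X i)"
    "\<And>i. i \<in> I \<Longrightarrow> p i \<cdot> \<iota> i = Ident C (X i)"
    "\<And>i j. i \<in> I \<Longrightarrow> j \<in> I \<Longrightarrow> i \<noteq> j \<Longrightarrow> p i \<cdot> \<iota> j = Zero C (X j) (X i)"
proof -
  have "\<exists>h. h \<in> Hom C A (X i) \<and> (\<forall>j\<in>I. h \<cdot> \<iota> j = (if j = i then Ident C (X i) else Zero C (X j) (X i)))"
    if i: "i \<in> I" for i
    using coproduct_arrow[OF A X[OF i], of "\<lambda>j. if j = i then Ident C (X i) else Zero C (X j) (X i)"]
      X i Ident_in_Hom Zero_in_Hom by (smt (verit, best))
  then obtain p where "\<And>i. i \<in> I \<Longrightarrow> p i \<in> Hom C A (X i) \<and>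
      (\<forall>j\<in>I. p i \<cdot> \<iota> j = (if j = i then Ident C (X i) else Zero C (X j) (X i)))" by metis
  then show thesis using that[of p] by (metis (no_types))
qed

end

section \<open>Triangulated categories\<close>

context triangulated_category
begin

lemma Sh_in_Ob: "X \<in> Ob C \<Longrightarrow> Sh C X \<in> Ob C"
  and ShA_in_Hom: "f \<in> Hom C X Y \<Longrightarrow> ShA C f \<in> Hom C (Sh C X) (Sh C Y)"
  and ShA_Ident: "X \<in> Ob C \<Longrightarrow> ShA C (Ident C X) = Ident C (Sh C X)"
  and ShA_Comp: "f \<in> Hom C X Y \<Longrightarrow> g \<in> Hom C Y Z \<Longrightarrow> ShA C (g \<cdot> f) = ShA C g \<cdot> ShA C f"
proof -
  have F: "is_functor C C (shift_fun C)" using shift_equivalence by (simp add: is_equivalence_def)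
  show "X \<in> Ob C \<Longrightarrow> Sh C X \<in> Ob C" using functor_Ob[OF F] by (simp add: shift_fun_def)
  show "f \<in> Hom C X Y \<Longrightarrow> ShA C f \<in> Hom C (Sh C X) (Sh C Y)"
    using functor_Hom[OF category_axioms F] by (simp add: shift_fun_def)
  show "X \<in> Ob C \<Longrightarrow> ShA C (Ident C X) = Ident C (Sh C X)"
    using functor_Ident[OF F] by (simp add: shift_fun_def)
  show "f \<in> Hom C X Y \<Longrightarrow> g \<in> Hom C Y Z \<Longrightarrow> ShA C (g \<cdot> f) = ShA C g \<cdot> ShA C f"
    using functor_Comp[OF F] by (simp add: shift_fun_def)
qed

lemma shift_isomorphic: "isomorphic C X Y \<Longrightarrow> isomorphic C (Sh C X) (Sh C Y)"
  using functor_isomorphic[of C C "shift_fun C" X Y] category_axioms shift_equivalence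
  by (simp add: is_equivalence_def shift_fun_def)

lemma shift_isomorphism:
  assumes "f \<in> Hom C X Y" "isomorphism C f" shows "isomorphism C (ShA C f)"
  using functor_isomorphism[of C C "shift_fun C" f X Y] category_axioms shift_equivalence assms
  by (simp add: is_equivalence_def shift_fun_def)

lemma shift_fully_faithful: "fully_faithful C C (shift_fun C)"
  using equivalence_fully_faithful[OF category_axioms category_axioms shift_equivalence] .

lemma ShA_inj: "f \<in> Hom C X Y \<Longrightarrow> f' \<in> Hom C X Y \<Longrightarrow> ShA C f = ShA C f' \<Longrightarrow> f = f'"
  using fully_faithfulD(1)[OF shift_fully_faithful, of X Y f f'] Hom_Ob[of f X Y]
  by (simp add: shift_fun_def)

lemma ShA_full:
  assumes "X \<in> Ob C" "Y \<in> Ob C" "g \<in> Hom C (Sh C X) (Sh C Y)"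
  obtains f where "f \<in> Hom C X Y" "ShA C f = g"
  using fully_faithfulD(2)[OF shift_fully_faithful assms(1,2), of g] assms(3)
  by (auto simp: shift_fun_def)

lemma ex_desuspension: "X \<in> Ob C \<Longrightarrow> \<exists>Y \<in> Ob C. isomorphic C (Sh C Y) X"
  using equivalence_essentially_surjective[OF shift_equivalence, of X] by (simp add: shift_fun_def)

lemma isomorphic_desuspension:
  assumes "X \<in> Ob C" "Y \<in> Ob C" "isomorphic C (Sh C X) (Sh C Y)"
  shows "isomorphic C X Y"
proof -
  obtain f where f: "f \<in> Hom C (Sh C X) (Sh C Y)" "isomorphism C f" using assms by (auto simp: isomorphic_def)
  obtain g where g: "g \<in> Hom C (Sh C Y) (Sh C X)" "g \<cdot> f = Ident C (Sh C X)" "f \<cdot> g = Ident C (Sh C Y)"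
    using isomorphismE[OF f(2,1)] by metis
  obtain k where k: "k \<in> Hom C X Y" "ShA C k = f" using ShA_full[OF assms(1,2) f(1)] .
  obtain l where l: "l \<in> Hom C Y X" "ShA C l = g" using ShA_full[OF assms(2,1) g(1)] .
  have "l \<cdot> k = Ident C X"
    by (rule ShA_inj[of _ X X]) (use k l g assms in \<open>simp_all add: ShA_Comp[OF k(1) l(1)] ShA_Ident Comp_in_Hom[OF k(1) l(1)] Ident_in_Hom\<close>)
  moreover have "k \<cdot> l = Ident C Y"
    by (rule ShA_inj[of _ Y Y]) (use k l g assms in \<open>simp_all add: ShA_Comp[OF l(1) k(1)] ShA_Ident Comp_in_Hom[OF l(1) k(1)] Ident_in_Hom\<close>)
  ultimately show ?thesis using isomorphicI[OF k(1) isomorphismI[OF k(1) l(1)]] by simp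
qed

text \<open>By fullness every endomorphism of the suspension is suspended from \<open>Z\<close>,
  hence equals the identity, the zero endomorphism included.\<close>

lemma zero_object_shift: "zero_object C Z \<Longrightarrow> zero_object C (Sh C Z)"
proof -
  assume z: "zero_object C Z"
  then have Z: "Z \<in> Ob C" by (simp add: zero_object_def)
  have z1: "f = Ident C (Sh C Z)" if f: "f \<in> Hom C (Sh C Z) (Sh C Z)" for f
  proof -
    obtain k where k: "k \<in> Hom C Z Z" "ShA C k = f" using ShA_full[OF Z Z f] .
    have "k = Ident C Z" using zero_object_Hom(1)[OF z] k Ident_in_Hom[OF Z] by metis
    then show ?thesis using k ShA_Ident[OF Z] by simp
  qed
  show ?thesis using z1[OF Zero_in_Hom[OF Sh_in_Ob[OF Z] Sh_in_Ob[OF Z]]] zero_object_iff[OF Sh_in_Ob[OF Z]] by simp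
qed

text \<open>A zero arrow factors through a zero object, and suspension preserves zero objects.
  Additivity of the suspension comes only later, through the tensor product, so zero arrows are
  treated on their own.\<close>

lemma ShA_Zero:
  assumes "X \<in> Ob C" "Y \<in> Ob C" shows "ShA C (Zero C X Y) = Zero C (Sh C X) (Sh C Y)"
proof -
  obtain Z where Z: "zero_object C Z" using ex_zero_object by blast
  then have ZO: "Z \<in> Ob C" by (simp add: zero_object_def)
  have "Zero C X Y = Zero C Z Y \<cdot> Zero C X Z" using Zero_Comp[OF assms(2) Zero_in_Hom[OF assms(1) ZO]] by simp
  then have "ShA C (Zero C X Y) = ShA C (Zero C Z Y) \<cdot> ShA C (Zero C X Z)"
    using ShA_Comp Zero_in_Hom assms ZO by metis
  also have "ShA C (Zero C Z Y) = Zero C (Sh C Z) (Sh C Y)"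
    using zero_object_Hom(1)[OF zero_object_shift[OF Z]] ShA_in_Hom Zero_in_Hom ZO assms by metis
  finally show ?thesis
    using Zero_Comp[OF Sh_in_Ob[OF assms(2)] ShA_in_Hom[OF Zero_in_Hom[OF assms(1) ZO]]] by simp
qed

lemma ShA_eq_Zero:
  assumes "f \<in> Hom C X Y" "ShA C f = Zero C (Sh C X) (Sh C Y)"
  shows "f = Zero C X Y"
  using ShA_inj[OF assms(1) Zero_in_Hom] ShA_Zero assms(2) Hom_Ob[OF assms(1)] by simp

lemma TriD:
  assumes "(f, g, h) \<in> Tri C"
  obtains X Y Z where "f \<in> Hom C X Y" "g \<in> Hom C Y Z" "h \<in> Hom C Z (Sh C X)"
  using Tri_candidate[OF assms] by (auto simp: candidate_triangle_def Hom_def)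

lemma Tri_Hom:
  assumes "(f, g, h) \<in> Tri C" "f \<in> Hom C X Y"
  shows "g \<in> Hom C Y (Cod C g)" "h \<in> Hom C (Cod C g) (Sh C X)"
  using Tri_candidate[OF assms(1)] assms(2) by (auto simp: candidate_triangle_def Hom_def)

lemma Tri_rotate:
  assumes "(f, g, h) \<in> Tri C" shows "(g, h, neg C (ShA C f)) \<in> Tri C"
  using TR2[OF Tri_candidate[OF assms]] assms by simp

lemma complete_triangle:
  assumes "f \<in> Hom C X Y"
  obtains Z g h where "(f, g, h) \<in> Tri C" "g \<in> Hom C Y Z" "h \<in> Hom C Z (Sh C X)"
proof -
  obtain g h where t: "(f, g, h) \<in> Tri C" using TR1_complete assms HomD by blast
  show thesis using that[OF t] Tri_Hom[OF t assms] by blast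
qed

text \<open>Rotating this triangle gives the trivial one with cone \<open>Sh C Z\<close>, so TR2
  read backwards applies. As a target in TR3 it extends arrows that vanish on the first object of a
  triangle.\<close>

lemma Ident_triangle:
  assumes "X \<in> Ob C" "zero_object C Z"
  shows "(Zero C Z X, Ident C X, Zero C X (Sh C Z)) \<in> Tri C"
proof -
  have Z: "Z \<in> Ob C" using assms by (simp add: zero_object_def)
  have c: "candidate_triangle C (Zero C Z X, Ident C X, Zero C X (Sh C Z))"
    using Zero_in_Hom[OF Z assms(1)] Ident_in_Hom[OF assms(1)] Zero_in_Hom[OF assms(1) Sh_in_Ob[OF Z]]
    by (simp add: candidate_triangle_def Hom_def)
  have "neg C (ShA C (Zero C Z X)) = Zero C (Sh C Z) (Sh C X)"
    using ShA_Zero Z assms neg_Zero Sh_in_Ob by simp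
  then show ?thesis using TR2[OF c] TR1_Ident[OF assms(1) zero_object_shift[OF assms(2)]] by simp
qed

text \<open>TR3 maps the triangle of \<open>Ident C X\<close> to the given one; the third component
  starts at a zero object.\<close>

lemma Tri_Comp_Zero:
  assumes t: "(f, g, h) \<in> Tri C" and f: "f \<in> Hom C X Y" "g \<in> Hom C Y Z"
  shows "g \<cdot> f = Zero C X Z"
proof -
  obtain O' where z: "zero_object C O'" using ex_zero_object by blast
  then have O': "O' \<in> Ob C" by (simp add: zero_object_def)
  have X: "X \<in> Ob C" using Hom_Ob f by blast
  have i: "Dom C (Ident C X) = X" "Cod C (Ident C X) = X" "Dom C f = X" "Cod C f = Y" "Cod C g = Z"
    "Cod C (Zero C X O') = O'"
    using X f Zero_in_Hom[OF X O'] by (auto simp: Hom_def cat_simps)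
  obtain w where w: "w \<in> Hom C O' Z" "w \<cdot> Zero C X O' = g \<cdot> f"
    using TR3[OF TR1_Ident[OF X z] t, of "Ident C X" f] f Ident_in_Hom[OF X] unfolding i by auto
  then show ?thesis using Comp_Zero[OF X w(1)] by simp
qed

text \<open>TR3 maps the triangle to the one of \<open>Ident_triangle\<close> at \<open>W\<close>;
  the third component is the extension.\<close>

lemma Tri_weak_cokernel:
  assumes t: "(f, g, h) \<in> Tri C" and f: "f \<in> Hom C X Y" "g \<in> Hom C Y Z"
    and k: "k \<in> Hom C Y W" "k \<cdot> f = Zero C X W"
  obtains l where "l \<in> Hom C Z W" "l \<cdot> g = k"
proof -
  obtain O' where z: "zero_object C O'" using ex_zero_object by blast
  then have O': "O' \<in> Ob C" by (simp add: zero_object_def)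
  have X: "X \<in> Ob C" "W \<in> Ob C" using Hom_Ob f k by blast+
  have i: "Dom C (Zero C O' W) = O'" "Cod C (Zero C O' W) = W" "Dom C f = X" "Cod C f = Y" "Cod C g = Z"
    "Cod C (Ident C W) = W"
    using X f Zero_in_Hom[OF O' X(2)] by (auto simp: Hom_def cat_simps)
  have "k \<cdot> f = Zero C O' W \<cdot> Zero C X O'"
    using k Zero_Comp[OF X(2) Zero_in_Hom[OF X(1) O']] by simp
  then obtain w where w: "w \<in> Hom C Z W" "w \<cdot> g = Ident C W \<cdot> k"
    using TR3[OF t Ident_triangle[OF X(2) z], of "Zero C X O'" k] f k Zero_in_Hom[OF X(1) O'] unfolding i by auto
  then show thesis using that k Ident_Comp by metis
qed

text \<open>TR3 completes from the first two components only, so both triangles are rotated once.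
  The lift appears between suspensions and is desuspended by full faithfulness; the signs from TR2
  occur on both sides and cancel.\<close>

lemma Tri_weak_kernel:
  assumes t: "(f, g, h) \<in> Tri C" and f: "f \<in> Hom C X Y" "g \<in> Hom C Y Z"
    and k: "k \<in> Hom C W Y" "g \<cdot> k = Zero C W Z"
  obtains l where "l \<in> Hom C W X" "f \<cdot> l = k"
proof -
  obtain O' where z: "zero_object C O'" using ex_zero_object by blast
  then have O': "O' \<in> Ob C" by (simp add: zero_object_def)
  have X: "X \<in> Ob C" "W \<in> Ob C" "Z \<in> Ob C" using Hom_Ob f k by blast+
  have zz: "Zero C W O' \<in> Hom C W O'" "Zero C O' Z \<in> Hom C O' Z" using Zero_in_Hom X O' by auto
  note Sf = ShA_in_Hom[OF f(1)]
  note h = Tri_Hom[OF t f(1)]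
  have i: "Dom C (Zero C W O') = W" "Cod C (Zero C W O') = O'" "Dom C g = Y" "Cod C g = Z"
    "Cod C h = Sh C X" "Cod C (Zero C O' (Sh C W)) = Sh C W"
    using X f zz h Zero_in_Hom[OF O' Sh_in_Ob[OF X(2)]] by (auto simp: Hom_def cat_simps)
  have "Zero C O' Z \<cdot> Zero C W O' = g \<cdot> k"
    using k Zero_Comp[OF X(3) zz(1)] by simp
  then obtain w where w: "w \<in> Hom C (Sh C W) (Sh C X)"
    "ShA C k \<cdot> neg C (ShA C (Ident C W)) = neg C (ShA C f) \<cdot> w"
    using TR3[OF Tri_rotate[OF TR1_Ident[OF X(2) z]] Tri_rotate[OF t], of k "Zero C O' Z"] f k zz unfolding i by auto
  obtain l where l: "l \<in> Hom C W X" "ShA C l = w" using ShA_full[OF X(2,1) w(1)] .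
  have "neg C (ShA C k) = neg C (ShA C (f \<cdot> l))"
    using w(2) l ShA_Comp[OF l(1) f(1)] neg_Comp[OF w(1) Sf] ShA_Ident[OF X(2)]
      Comp_neg[OF Ident_in_Hom[OF Sh_in_Ob[OF X(2)]] ShA_in_Hom[OF k(1)]]
      Comp_Ident[OF ShA_in_Hom[OF k(1)]] by simp
  then have "ShA C k = ShA C (f \<cdot> l)"
    using neg_neg ShA_in_Hom k(1) Comp_in_Hom[OF l(1) f(1)] by metis
  then have "f \<cdot> l = k" using ShA_inj[OF k(1) Comp_in_Hom[OF l(1) f(1)]] by simp
  then show thesis using that l by blast
qed

lemma Tri_Comp_Zero':
  assumes t: "(f, g, h) \<in> Tri C" and f: "f \<in> Hom C X Y" "g \<in> Hom C Y Z"
  shows "h \<cdot> g = Zero C Y (Sh C X)" "ShA C f \<cdot> h = Zero C Z (Sh C Y)"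
proof -
  have h: "h \<in> Hom C Z (Sh C X)" using Tri_Hom[OF t f(1)] f(2) HomD by metis
  show "h \<cdot> g = Zero C Y (Sh C X)" using Tri_Comp_Zero[OF Tri_rotate[OF t] f(2) h] .
  have "neg C (ShA C f) \<cdot> h = Zero C Z (Sh C Y)"
    using Tri_Comp_Zero[OF Tri_rotate[OF Tri_rotate[OF t]] h neg_in_Hom[OF ShA_in_Hom[OF f(1)]]] .
  then show "ShA C f \<cdot> h = Zero C Z (Sh C Y)"
    using neg_eq_Zero[OF Comp_in_Hom[OF h ShA_in_Hom[OF f(1)]]] neg_Comp[OF h ShA_in_Hom[OF f(1)]] by simp
qed

lemma Tri_weak_cokernel':
  assumes t: "(f, g, h) \<in> Tri C" and f: "f \<in> Hom C X Y" "g \<in> Hom C Y Z"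
    and k: "k \<in> Hom C Z W" "k \<cdot> g = Zero C Y W"
  obtains l where "l \<in> Hom C (Sh C X) W" "l \<cdot> h = k"
proof -
  have h: "h \<in> Hom C Z (Sh C X)" using Tri_Hom[OF t f(1)] f(2) HomD by metis
  show thesis using Tri_weak_cokernel[OF Tri_rotate[OF t] f(2) h k] that by blast
qed

lemma Tri_weak_kernel':
  assumes t: "(f, g, h) \<in> Tri C" and f: "f \<in> Hom C X Y" "g \<in> Hom C Y Z"
    and k: "k \<in> Hom C W Z" "h \<cdot> k = Zero C W (Sh C X)"
  obtains l where "l \<in> Hom C W Y" "g \<cdot> l = k"
proof -
  have h: "h \<in> Hom C Z (Sh C X)" using Tri_Hom[OF t f(1)] f(2) HomD by metis
  show thesis using Tri_weak_kernel[OF Tri_rotate[OF t] f(2) h k] that by blast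
qed

text \<open>Suspension is only an autoequivalence, so the cone of \<open>g\<close> is a suspension
  merely up to an isomorphism \<open>e\<close>; the triangle is replaced by an isomorphic one before
  it is rotated back.\<close>

lemma desuspension_triangle:
  assumes "g \<in> Hom C Y Z"
  obtains X f h where "(f, g, h) \<in> Tri C" "f \<in> Hom C X Y" "h \<in> Hom C Z (Sh C X)"
proof -
  obtain W k l where t: "(g, k, l) \<in> Tri C" "k \<in> Hom C Z W" "l \<in> Hom C W (Sh C Y)"
    using complete_triangle[OF assms] .
  obtain X where X: "X \<in> Ob C" "isomorphic C (Sh C X) W" using ex_desuspension Hom_Ob t by blast
  obtain e where e: "e \<in> Hom C (Sh C X) W" "isomorphism C e" using X by (auto simp: isomorphic_def)
  obtain e' where e': "e' \<in> Hom C W (Sh C X)" "e' \<cdot> e = Ident C (Sh C X)" "e \<cdot> e' = Ident C W" "isomorphism C e'"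
    using isomorphismE[OF e(2,1)] .
  have Y: "Y \<in> Ob C" "Z \<in> Ob C" using Hom_Ob[OF assms] by auto
  obtain f0 where f0: "f0 \<in> Hom C X Y" "ShA C f0 = l \<cdot> e"
    using ShA_full[OF X(1) Y(1) Comp_in_Hom[OF e(1) t(3)]] .
  \<comment> \<open>The sign is chosen to cancel the negation in TR2.\<close>
  obtain f where f: "f \<in> Hom C X Y" "ShA C f = neg C (l \<cdot> e)"
    using ShA_full[OF X(1) Y(1) neg_in_Hom[OF Comp_in_Hom[OF e(1) t(3)]]] .
  define h where "h = e' \<cdot> k"
  have h: "h \<in> Hom C Z (Sh C X)" unfolding h_def using Comp_in_Hom t e' by blast
  have nf: "neg C (ShA C f) = l \<cdot> e" using f neg_neg Comp_in_Hom[OF e(1) t(3)] by metis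
  have "candidate_triangle C (g, h, l \<cdot> e)"
    using assms h Comp_in_Hom[OF e(1) t(3)] by (auto simp: candidate_triangle_def Hom_def)
  moreover have "Ident C Z \<cdot> g = g \<cdot> Ident C Y" "e' \<cdot> k = h \<cdot> Ident C Z"
    "ShA C (Ident C Y) \<cdot> l = (l \<cdot> e) \<cdot> e'"
    using assms h t e' e Y by (simp_all add: Comp_Ident[of _ Y Z] Ident_Comp[of _ Y Z] Comp_Ident[OF h] h_def[symmetric]
        ShA_Ident Ident_Comp[OF t(3)] Comp_assoc[OF e'(1) e(1) t(3)] Comp_Ident[OF t(3)])
  ultimately have "triangles_isomorphic C (g, k, l) (g, h, l \<cdot> e)"
    unfolding triangles_isomorphic_def
    using Tri_candidate[OF t(1)] HomD[OF assms] HomD[OF t(2)] HomD[OF t(3)] HomD[OF h]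
      HomD[OF Comp_in_Hom[OF e(1) t(3)]] Ident_in_Hom[OF Y(1)] Ident_in_Hom[OF Y(2)] e'
      isomorphism_Ident[OF Y(1)] isomorphism_Ident[OF Y(2)] by auto
  then have "(g, h, neg C (ShA C f)) \<in> Tri C" using TR1_iso[OF t(1)] nf by simp
  moreover have "candidate_triangle C (f, g, h)"
    using f h assms by (auto simp: candidate_triangle_def Hom_def)
  ultimately show thesis using that TR2 f h by metis
qed

text \<open>The connecting arrow of a split monomorphism vanishes.\<close>

lemma split_triangle:
  assumes t: "(i, g, h) \<in> Tri C" and i: "i \<in> Hom C X B" "g \<in> Hom C B Z" and p: "p \<in> Hom C B X" "p \<cdot> i = Ident C X"
  obtains s where "s \<in> Hom C Z B" "g \<cdot> s = Ident C Z" "p \<cdot> s = Zero C Z X"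
    "i \<cdot> p \<boxplus> s \<cdot> g = Ident C B"
    "\<And>W d d'. d \<in> Hom C Z W \<Longrightarrow> d' \<in> Hom C Z W \<Longrightarrow> d \<cdot> g = d' \<cdot> g \<Longrightarrow> d = d'"
proof -
  have O': "X \<in> Ob C" "B \<in> Ob C" "Z \<in> Ob C" using Hom_Ob i by auto
  have h: "h \<in> Hom C Z (Sh C X)" using Tri_Hom[OF t i(1)] i(2) HomD by metis
  have "h = ShA C p \<cdot> (ShA C i \<cdot> h)"
    using Comp_assoc[OF h ShA_in_Hom[OF i(1)] ShA_in_Hom[OF p(1)]] ShA_Comp[OF i(1) p(1)] p(2)
      ShA_Ident[OF O'(1)] Ident_Comp[OF h] by simp
  then have h0: "h = Zero C Z (Sh C X)"
    using Tri_Comp_Zero'(2)[OF t i] Comp_Zero[OF O'(3) ShA_in_Hom[OF p(1)]] by simp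
  \<comment> \<open>A difference that vanishes after \<open>g\<close> factors through
    \<open>h\<close>, which is zero.\<close>
  have epi: "d = d'" if d: "d \<in> Hom C Z W" "d' \<in> Hom C Z W" "d \<cdot> g = d' \<cdot> g" for d d' W
  proof -
    have W: "W \<in> Ob C" using Hom_Ob d by blast
    have dd: "d \<boxplus> neg C d' \<in> Hom C Z W" using d Add_in_Hom neg_in_Hom by blast
    have "(d \<boxplus> neg C d') \<cdot> g = Zero C B W"
      using Add_Comp[OF i(2) d(1) neg_in_Hom[OF d(2)]] neg_Comp[OF i(2) d(2)] d(3) Add_neg[OF Comp_in_Hom[OF i(2) d(2)]] by simp
    then obtain l where l: "l \<in> Hom C (Sh C X) W" "l \<cdot> h = d \<boxplus> neg C d'"
      using Tri_weak_cokernel'[OF t i dd] by blast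
    then have "d \<boxplus> neg C d' = Zero C Z W" using h0 Comp_Zero[OF O'(3) l(1)] by simp
    then show ?thesis using diff_eq_Zero d by blast
  qed
  have ip: "i \<cdot> p \<in> Hom C B B" using Comp_in_Hom i p by blast
  \<comment> \<open>The complementary idempotent \<open>1 - i \<cdot> p\<close> kills
    \<open>i\<close>, so it factors through the cone; the factor is the section
    \<open>s\<close>.\<close>
  define e where "e = Ident C B \<boxplus> neg C (i \<cdot> p)"
  have e: "e \<in> Hom C B B" unfolding e_def using Add_in_Hom neg_in_Hom ip Ident_in_Hom O' by blast
  have "e \<cdot> i = i \<boxplus> neg C ((i \<cdot> p) \<cdot> i)" unfolding e_def
    using Add_Comp[OF i(1) Ident_in_Hom[OF O'(2)] neg_in_Hom[OF ip]] Ident_Comp[OF i(1)] neg_Comp[OF i(1) ip] by simp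
  also have "(i \<cdot> p) \<cdot> i = i" using Comp_assoc[OF i(1) p(1) i(1)] p(2) Comp_Ident[OF i(1)] by simp
  finally have "e \<cdot> i = Zero C X B" using Add_neg[OF i(1)] by simp
  then obtain s where s: "s \<in> Hom C Z B" "s \<cdot> g = e" using Tri_weak_cokernel[OF t i e] by blast
  have 1: "i \<cdot> p \<boxplus> s \<cdot> g = Ident C B"
  proof -
    have "i \<cdot> p \<boxplus> e = (Ident C B \<boxplus> neg C (i \<cdot> p)) \<boxplus> i \<cdot> p" unfolding e_def
      using Add_commute[OF ip] e e_def by simp
    also have "\<dots> = Ident C B" using Add_assoc[OF Ident_in_Hom[OF O'(2)] neg_in_Hom[OF ip] ip]
      Add_commute[OF neg_in_Hom[OF ip] ip] Add_neg[OF ip] Add_Zero[OF Ident_in_Hom[OF O'(2)]] by simp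
    finally show ?thesis using s by simp
  qed
  have "(g \<cdot> s) \<cdot> g = g \<cdot> e" using Comp_assoc[OF i(2) s(1) i(2)] s(2) by simp
  also have "\<dots> = g \<boxplus> neg C (g \<cdot> (i \<cdot> p))" unfolding e_def
    using Comp_Add[OF Ident_in_Hom[OF O'(2)] neg_in_Hom[OF ip] i(2)] Comp_neg[OF ip i(2)] Comp_Ident[OF i(2)] by simp
  also have "g \<cdot> (i \<cdot> p) = Zero C B Z"
    using Comp_assoc[OF p(1) i] Tri_Comp_Zero[OF t i] Zero_Comp[OF O'(3) p(1)] by simp
  finally have "(g \<cdot> s) \<cdot> g = Ident C Z \<cdot> g"
    using neg_Zero[OF O'(2,3)] Add_Zero[OF i(2)] Ident_Comp[OF i(2)] by simp
  then have 2: "g \<cdot> s = Ident C Z" using epi Comp_in_Hom[OF s(1) i(2)] Ident_in_Hom[OF O'(3)] by blast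
  have pip: "p \<cdot> (i \<cdot> p) = p" using Comp_assoc[OF p(1) i(1) p(1)] p(2) Ident_Comp[OF p(1)] by simp
  have "(p \<cdot> s) \<cdot> g = p \<cdot> e" using Comp_assoc[OF i(2) s(1) p(1)] s(2) by simp
  also have "\<dots> = p \<boxplus> neg C (p \<cdot> (i \<cdot> p))" unfolding e_def
    using Comp_Add[OF Ident_in_Hom[OF O'(2)] neg_in_Hom[OF ip] p(1)] Comp_neg[OF ip p(1)] Comp_Ident[OF p(1)] by simp
  also have "\<dots> = Zero C Z X \<cdot> g" using pip Add_neg[OF p(1)] Zero_Comp[OF O'(1) i(2)] by simp
  finally have 3: "p \<cdot> s = Zero C Z X" using epi[OF Comp_in_Hom[OF s(1) p(1)] Zero_in_Hom[OF O'(3,1)]] by blast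
  show thesis using that s(1) 1 2 3 epi by blast
qed

text \<open>The cone of the split monomorphism is the complement. This links retracts with the
  direct summands in the definition of \<open>thick\<close>.\<close>

lemma retract_biproduct:
  assumes i: "i \<in> Hom C X B" and p: "p \<in> Hom C B X" "p \<cdot> i = Ident C X"
  obtains Z i' p' where "biproduct C X Z B" "i' \<in> Hom C Z B" "p' \<in> Hom C B Z" "p' \<cdot> i' = Ident C Z"
proof -
  obtain Z g h where t: "(i, g, h) \<in> Tri C" "g \<in> Hom C B Z" "h \<in> Hom C Z (Sh C X)"
    using complete_triangle[OF i] .
  obtain s where s: "s \<in> Hom C Z B" "g \<cdot> s = Ident C Z" "p \<cdot> s = Zero C Z X" "i \<cdot> p \<boxplus> s \<cdot> g = Ident C B"
    using split_triangle[OF t(1) i t(2) p] by metis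
  have "biproduct C X Z B" unfolding biproduct_def
    using i t(2) p s Tri_Comp_Zero[OF t(1) i t(2)] by blast
  then show thesis using that s t by blast
qed

lemma biproduct_triangle:
  assumes "biproduct C X Y B"
  obtains i g h where "(i, g, h) \<in> Tri C" "Dom C i = X" "Cod C i = B" "isomorphic C (Cod C g) Y"
proof -
  obtain i j p q where i: "i \<in> Hom C X B" and j: "j \<in> Hom C Y B" and p: "p \<in> Hom C B X" and q: "q \<in> Hom C B Y"
    and e: "p \<cdot> i = Ident C X" "q \<cdot> j = Ident C Y" "q \<cdot> i = Zero C X Y" "p \<cdot> j = Zero C Y X"
      "i \<cdot> p \<boxplus> j \<cdot> q = Ident C B"
    using assms unfolding biproduct_def by blast
  obtain Z g h where t: "(i, g, h) \<in> Tri C" "g \<in> Hom C B Z" "h \<in> Hom C Z (Sh C X)"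
    using complete_triangle[OF i] .
  obtain s where s: "s \<in> Hom C Z B" "g \<cdot> s = Ident C Z" "p \<cdot> s = Zero C Z X" "i \<cdot> p \<boxplus> s \<cdot> g = Ident C B"
    using split_triangle[OF t(1) i t(2) p e(1)] by metis
  have O': "X \<in> Ob C" "Y \<in> Ob C" "Z \<in> Ob C" "B \<in> Ob C" using Hom_Ob i j s by auto
  \<comment> \<open>The two complements of \<open>i\<close> are compared by
    \<open>g \<cdot> j\<close> and \<open>q \<cdot> s\<close>; each composite is computed by
    inserting one of the two decompositions of the identity of \<open>B\<close>.\<close>
  have gj: "g \<cdot> j \<in> Hom C Y Z" and qs: "q \<cdot> s \<in> Hom C Z Y" using Comp_in_Hom t j q s by blast+
  have "(q \<cdot> s) \<cdot> (g \<cdot> j) = q \<cdot> ((s \<cdot> g) \<cdot> j)"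
    using q s t j by (simp add: Hom_def cat_simps)
  also have "(s \<cdot> g) \<cdot> j = j"
  proof -
    have "j = (i \<cdot> p \<boxplus> s \<cdot> g) \<cdot> j" using s(4) Ident_Comp[OF j] by simp
    also have "\<dots> = (i \<cdot> p) \<cdot> j \<boxplus> (s \<cdot> g) \<cdot> j"
      using Add_Comp[OF j Comp_in_Hom[OF p i] Comp_in_Hom[OF t(2) s(1)]] .
    also have "(i \<cdot> p) \<cdot> j = Zero C Y B"
      using Comp_assoc[OF j p i] e(4) Comp_Zero[OF O'(2) i] by simp
    finally show ?thesis using Zero_Add[OF Comp_in_Hom[OF j Comp_in_Hom[OF t(2) s(1)]]] by simp
  qed
  finally have 1: "(q \<cdot> s) \<cdot> (g \<cdot> j) = Ident C Y" using e by simp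
  have "(g \<cdot> j) \<cdot> (q \<cdot> s) = g \<cdot> ((j \<cdot> q) \<cdot> s)"
    using q s t j by (simp add: Hom_def cat_simps)
  also have "(j \<cdot> q) \<cdot> s = s"
  proof -
    have "s = (i \<cdot> p \<boxplus> j \<cdot> q) \<cdot> s" using e(5) Ident_Comp[OF s(1)] by simp
    also have "\<dots> = (i \<cdot> p) \<cdot> s \<boxplus> (j \<cdot> q) \<cdot> s"
      using Add_Comp[OF s(1) Comp_in_Hom[OF p i] Comp_in_Hom[OF q j]] .
    also have "(i \<cdot> p) \<cdot> s = Zero C Z B"
      using Comp_assoc[OF s(1) p i] s(3) Comp_Zero[OF O'(3) i] by simp
    finally show ?thesis using Zero_Add[OF Comp_in_Hom[OF s(1) Comp_in_Hom[OF q j]]] by simp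
  qed
  finally have 2: "(g \<cdot> j) \<cdot> (q \<cdot> s) = Ident C Z" using s by simp
  have "isomorphic C Z Y" using isomorphicI[OF qs isomorphismI[OF qs gj 2 1]] .
  then show thesis using that[OF t(1)] HomD[OF i] HomD[OF t(2)] by simp
qed

end

section \<open>Small sets and coproducts\<close>

text \<open>An infinite regular cardinal is stable, that is, closed under small sums of small
  sets.\<close>

lemma small_Sigma:
  assumes "inaccessible \<kappa>" "small \<kappa> A" "\<And>a. a \<in> A \<Longrightarrow> small \<kappa> (F a)"
  shows "small \<kappa> (Sigma A F)"
proof -
  have \<kappa>: "Card_order \<kappa>" "natLeq <o \<kappa>" "regularCard \<kappa>" using assms by (auto simp: inaccessible_def)
  have "cinfinite \<kappa>" using \<kappa>(2) natLeq_Cinfinite cinfinite_mono ordLess_imp_ordLeq by blast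
  then have "stable \<kappa>" using regularCard_stable \<kappa> unfolding cinfinite_def by blast
  then show ?thesis using assms stable_elim unfolding small_def by blast
qed

lemma small_image: "small \<kappa> A \<Longrightarrow> small \<kappa> (f ` A)"
  unfolding small_def using card_of_image ordLeq_ordLess_trans by blast

lemma small_nat: "inaccessible \<kappa> \<Longrightarrow> small \<kappa> (A :: nat set)"
  unfolding small_def inaccessible_def
  using card_of_mono1[of A UNIV] card_of_nat ordLeq_ordIso_trans ordLeq_ordLess_trans by blast

text \<open>Coproducts and compactness are defined for families indexed by the type underlying
  \<open>\<kappa>\<close>, while families indexed by natural numbers or by pairs occur below; a
  small index set is renumbered inside \<open>Field \<kappa>\<close>.\<close>

lemma small_index:
  fixes \<kappa> :: "'u rel" and J :: "'j set"
  assumes "inaccessible \<kappa>" "small \<kappa> J"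
  obtains I :: "'u set" and b where "small \<kappa> I" "bij_betw b I J"
proof -
  have "|J| \<le>o |Field \<kappa>|"
    using assms card_of_Field_ordIso unfolding small_def inaccessible_def
    by (meson ordIso_symmetric ordLess_imp_ordLeq ordLeq_ordIso_trans)
  then obtain f where f: "inj_on f J" "f ` J \<subseteq> Field \<kappa>" using card_of_ordLeq by (metis (no_types))
  show thesis
  proof
    show "small \<kappa> (f ` J)" using small_image assms by blast
    show "bij_betw (inv_into J f) (f ` J) J" using f(1) by (simp add: bij_betw_inv_into inj_on_imp_bij_betw)
  qed
qed

lemma (in category) coproduct_reindex:
  assumes A: "coproduct C J X A \<iota>" and b: "bij_betw b I J"
  shows "coproduct C I (X \<circ> b) A (\<iota> \<circ> b)"
proof (rule coproductI)
  have bI: "b i \<in> J" if "i \<in> I" for i using b that by (auto simp: bij_betw_def)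
  define c where "c = inv_into I b"
  have c: "c j \<in> I" "b (c j) = j" if "j \<in> J" for j
    using b that by (auto simp: c_def bij_betw_def inv_into_into f_inv_into_f)
  have cb: "c (b i) = i" if "i \<in> I" for i using b that by (simp add: c_def bij_betw_def)
  show "A \<in> Ob C" using coproductD[OF A] by simp
  show "(\<iota> \<circ> b) i \<in> Hom C ((X \<circ> b) i) A" if "i \<in> I" for i using coproductD[OF A] bI[OF that] by simp
  fix Y assume Y: "Y \<in> Ob C"
  show "\<exists>h\<in>Hom C A Y. \<forall>i\<in>I. h \<cdot> (\<iota> \<circ> b) i = g i" if g: "\<And>i. i \<in> I \<Longrightarrow> g i \<in> Hom C ((X \<circ> b) i) Y" for g
  proof -
    have "g (c j) \<in> Hom C (X j) Y" if "j \<in> J" for j using g[OF c(1)[OF that]] c(2)[OF that] by simp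
    then obtain h where "h \<in> Hom C A Y" "\<And>j. j \<in> J \<Longrightarrow> h \<cdot> \<iota> j = g (c j)"
      using coproduct_arrow[OF A Y, of "\<lambda>j. g (c j)"] by metis
    then show ?thesis using bI cb by (intro bexI[of _ h]) auto
  qed
  show "h = h'" if "h \<in> Hom C A Y" "h' \<in> Hom C A Y" "\<And>i. i \<in> I \<Longrightarrow> h \<cdot> (\<iota> \<circ> b) i = h' \<cdot> (\<iota> \<circ> b) i" for h h'
    using coproduct_eqI[OF A that(1,2)] that(3)[OF c(1)] c(2) by simp
qed

lemma (in category) ex_coproduct:
  fixes J :: "'j set" and \<kappa> :: "'u rel"
  assumes \<kappa>: "inaccessible \<kappa>" and C: "has_small_coproducts \<kappa> C" and J: "small \<kappa> J"
    and X: "\<And>j. j \<in> J \<Longrightarrow> X j \<in> Ob C"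
  obtains A \<iota> where "coproduct C J X A \<iota>"
proof -
  obtain I :: "'u set" and b where I: "small \<kappa> I" "bij_betw b I J" using small_index[OF \<kappa> J] .
  have "(X \<circ> b) ` I \<subseteq> Ob C" using X I(2) by (auto simp: bij_betw_def)
  then obtain A \<iota> where A: "coproduct C I (X \<circ> b) A \<iota>"
    using C I(1) unfolding has_small_coproducts_def by blast
  have b: "bij_betw (inv_into I b) J I" using I(2) by (rule bij_betw_inv_into)
  have "coproduct C J ((X \<circ> b) \<circ> inv_into I b) A (\<iota> \<circ> inv_into I b)" using coproduct_reindex[OF A b] .
  moreover have "((X \<circ> b) \<circ> inv_into I b) j = X j" if "j \<in> J" for j
    using I(2) that by (simp add: bij_betw_def f_inv_into_f)
  ultimately have "coproduct C J X A (\<iota> \<circ> inv_into I b)" unfolding coproduct_def by simp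
  then show thesis using that by blast
qed

lemma localizing_coproduct:
  fixes J :: "'j set" and \<kappa> :: "'u rel"
  assumes C: "category C" and \<kappa>: "inaccessible \<kappa>" and L: "localizing \<kappa> C L" and J: "small \<kappa> J"
    and X: "\<And>j. j \<in> J \<Longrightarrow> X j \<in> L" and A: "coproduct C J X A \<iota>"
  shows "A \<in> L"
proof -
  obtain I :: "'u set" and b where I: "small \<kappa> I" "bij_betw b I J" using small_index[OF \<kappa> J] .
  have "coproduct C I (X \<circ> b) A (\<iota> \<circ> b)" using category.coproduct_reindex[OF C A I(2)] .
  moreover have "(X \<circ> b) ` I \<subseteq> L" using X I(2) by (auto simp: bij_betw_def)
  ultimately show ?thesis using L I(1) unfolding localizing_def by blast
qed

section \<open>Orthogonality\<close>

definition orthogonal :: "('o, 'm, 'x) tri_cat_scheme \<Rightarrow> 'o \<Rightarrow> 'o \<Rightarrow> bool" where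
  "orthogonal C X Y \<longleftrightarrow> (\<forall>f \<in> Hom C X Y. f = Zero C X Y)"

definition left_orthogonal :: "('o, 'm, 'x) tri_cat_scheme \<Rightarrow> 'o set \<Rightarrow> 'o set" where
  "left_orthogonal C B = {X \<in> Ob C. \<forall>Y \<in> B. orthogonal C X Y}"

definition right_orthogonal :: "('o, 'm, 'x) tri_cat_scheme \<Rightarrow> 'o set \<Rightarrow> 'o set" where
  "right_orthogonal C A = {Y \<in> Ob C. \<forall>X \<in> A. orthogonal C X Y}"

text \<open>Stability holds only up to isomorphism: images of objects under a functor are not closed
  under isomorphism, and the suspension has no strict inverse.\<close>

definition shift_stable :: "('o, 'm, 'x) tri_cat_scheme \<Rightarrow> 'o set \<Rightarrow> bool" where
  "shift_stable C B \<longleftrightarrow> B \<subseteq> Ob C \<and>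
     (\<forall>Y \<in> B. (\<exists>Y' \<in> B. isomorphic C (Sh C Y) Y') \<and> (\<exists>Y' \<in> B. isomorphic C (Sh C Y') Y))"

context triangulated_category
begin

lemma zero_object_orthogonal: "X \<in> Ob C \<Longrightarrow> zero_object C X \<longleftrightarrow> orthogonal C X X"
  using zero_object_iff[of X] Ident_in_Hom[of X] zero_object_Hom(1)[of X _ X] unfolding orthogonal_def by blast

lemma orthogonal_retract:
  assumes o: "orthogonal C X Y" and i: "i \<in> Hom C X' X" "p \<in> Hom C X X'" "p \<cdot> i = Ident C X'"
  shows "orthogonal C X' Y"
  unfolding orthogonal_def
proof
  fix f assume f: "f \<in> Hom C X' Y"
  have "f = (f \<cdot> p) \<cdot> i" using Comp_assoc[OF i(1,2) f] i(3) Comp_Ident[OF f] by simp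
  also have "f \<cdot> p = Zero C X Y" using o Comp_in_Hom[OF i(2) f] by (simp add: orthogonal_def)
  finally show "f = Zero C X' Y" using Zero_Comp[OF Hom_Ob(2)[OF f] i(1)] by simp
qed

lemma orthogonal_isomorphic_left:
  assumes "orthogonal C X Y" "isomorphic C X X'" shows "orthogonal C X' Y"
proof -
  obtain f where f: "f \<in> Hom C X X'" "isomorphism C f" using assms by (auto simp: isomorphic_def)
  then show ?thesis using isomorphismE[OF f(2,1)] orthogonal_retract[OF assms(1)] by metis
qed

lemma orthogonal_isomorphic_right:
  assumes o: "orthogonal C X Y" and "isomorphic C Y Y'" shows "orthogonal C X Y'"
  unfolding orthogonal_def
proof
  fix k assume k: "k \<in> Hom C X Y'"
  obtain f where f: "f \<in> Hom C Y Y'" "isomorphism C f" using assms by (auto simp: isomorphic_def)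
  obtain g where g: "g \<in> Hom C Y' Y" "f \<cdot> g = Ident C Y'" using isomorphismE[OF f(2,1)] by metis
  have "k = f \<cdot> (g \<cdot> k)" using Comp_assoc[OF k g(1) f(1)] g(2) Ident_Comp[OF k] by simp
  also have "g \<cdot> k = Zero C X Y" using o Comp_in_Hom[OF k g(1)] by (simp add: orthogonal_def)
  finally show "k = Zero C X Y'" using Comp_Zero[OF Hom_Ob(1)[OF k] f(1)] by simp
qed

lemma orthogonal_shift:
  assumes "X \<in> Ob C" "Y \<in> Ob C"
  shows "orthogonal C (Sh C X) (Sh C Y) \<longleftrightarrow> orthogonal C X Y"
proof
  assume o: "orthogonal C (Sh C X) (Sh C Y)"
  show "orthogonal C X Y" unfolding orthogonal_def
    using o ShA_in_Hom ShA_eq_Zero by (auto simp: orthogonal_def)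
next
  assume o: "orthogonal C X Y"
  show "orthogonal C (Sh C X) (Sh C Y)" unfolding orthogonal_def
  proof
    fix g assume "g \<in> Hom C (Sh C X) (Sh C Y)"
    then obtain f where f: "f \<in> Hom C X Y" "ShA C f = g" using ShA_full[OF assms] by blast
    then show "g = Zero C (Sh C X) (Sh C Y)" using o ShA_Zero[OF assms] by (auto simp: orthogonal_def)
  qed
qed

lemma orthogonal_cone:
  assumes t: "(f, g, h) \<in> Tri C" "f \<in> Hom C X Y" "g \<in> Hom C Y Z"
    and o: "orthogonal C Y W" "orthogonal C (Sh C X) W"
  shows "orthogonal C Z W"
  unfolding orthogonal_def
proof
  fix k assume k: "k \<in> Hom C Z W"
  have "k \<cdot> g = Zero C Y W" using o(1) Comp_in_Hom[OF t(3) k] by (simp add: orthogonal_def)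
  then obtain l where l: "l \<in> Hom C (Sh C X) W" "l \<cdot> h = k" using Tri_weak_cokernel'[OF t k] by blast
  have h: "h \<in> Hom C Z (Sh C X)" using Tri_Hom[OF t(1,2)] t(3) HomD by metis
  have "l = Zero C (Sh C X) W" using o(2) l(1) by (simp add: orthogonal_def)
  then show "k = Zero C Z W" using l Zero_Comp[OF Hom_Ob(2)[OF k] h] by simp
qed

lemma orthogonal_coproduct:
  assumes A: "coproduct C I X A \<iota>" and o: "\<And>i. i \<in> I \<Longrightarrow> orthogonal C (X i) Y" and Y: "Y \<in> Ob C"
  shows "orthogonal C A Y"
  unfolding orthogonal_def
proof
  fix k assume k: "k \<in> Hom C A Y"
  have \<iota>: "\<iota> i \<in> Hom C (X i) A" if "i \<in> I" for i using coproductD(2)[OF A that] .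
  show "k = Zero C A Y"
  proof (rule coproduct_eqI[OF A k Zero_in_Hom[OF coproductD(1)[OF A] Y]])
    fix i assume i: "i \<in> I"
    have "k \<cdot> \<iota> i = Zero C (X i) Y" using o[OF i] Comp_in_Hom[OF \<iota>[OF i] k] by (simp add: orthogonal_def)
    then show "k \<cdot> \<iota> i = Zero C A Y \<cdot> \<iota> i" using Zero_Comp[OF Y \<iota>[OF i]] by simp
  qed
qed

text \<open>A suspension on the left argument becomes a desuspension on the right one, which stays
  in \<open>B\<close> up to isomorphism.\<close>

lemma left_orthogonal_shift:
  assumes B: "shift_stable C B" and X: "X \<in> Ob C"
  shows "Sh C X \<in> left_orthogonal C B \<longleftrightarrow> X \<in> left_orthogonal C B"
proof
  assume S: "Sh C X \<in> left_orthogonal C B"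
  show "X \<in> left_orthogonal C B" unfolding left_orthogonal_def
  proof (intro CollectI conjI ballI X)
    fix Y assume Y: "Y \<in> B"
    then have YO: "Y \<in> Ob C" using B by (auto simp: shift_stable_def)
    obtain Y' where Y': "Y' \<in> B" "isomorphic C (Sh C Y) Y'" using B Y unfolding shift_stable_def by blast
    have "orthogonal C (Sh C X) Y'" using S Y' by (auto simp: left_orthogonal_def)
    then have "orthogonal C (Sh C X) (Sh C Y)"
      using orthogonal_isomorphic_right isomorphic_sym[OF Y'(2)] by blast
    then show "orthogonal C X Y" using orthogonal_shift[OF X YO] by simp
  qed
next
  assume S: "X \<in> left_orthogonal C B"
  show "Sh C X \<in> left_orthogonal C B" unfolding left_orthogonal_def
  proof (intro CollectI conjI ballI Sh_in_Ob X)
    fix Y assume Y: "Y \<in> B"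
    obtain Y' where Y': "Y' \<in> B" "isomorphic C (Sh C Y') Y" using B Y unfolding shift_stable_def by blast
    then have YO: "Y' \<in> Ob C" using B by (auto simp: shift_stable_def)
    have "orthogonal C X Y'" using S Y' by (auto simp: left_orthogonal_def)
    then show "orthogonal C (Sh C X) Y"
      using orthogonal_isomorphic_right[OF _ Y'(2)] orthogonal_shift[OF X YO] by simp
  qed
qed

text \<open>Left orthogonals are the localizing subcategories against which \<open>Loc\<close> is
  tested below.\<close>

lemma left_orthogonal_localizing:
  assumes B: "shift_stable C B"
  shows "localizing \<kappa> C (left_orthogonal C B)"
  unfolding localizing_def triangulated_subcategory_def
proof (intro conjI allI impI ballI)
  have BO: "B \<subseteq> Ob C" using B by (simp add: shift_stable_def)
  show "left_orthogonal C B \<subseteq> Ob C" by (auto simp: left_orthogonal_def)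
  show "Z \<in> left_orthogonal C B" if "zero_object C Z" for Z
    using zero_object_Hom(1)[OF that] that by (auto simp: left_orthogonal_def orthogonal_def zero_object_def)
  show "Y \<in> left_orthogonal C B" if "X \<in> left_orthogonal C B" "Y \<in> Ob C" "isomorphic C X Y" for X Y
    using that orthogonal_isomorphic_left by (auto simp: left_orthogonal_def)
  show "X \<in> left_orthogonal C B \<longleftrightarrow> Sh C X \<in> left_orthogonal C B" if "X \<in> Ob C" for X
    using left_orthogonal_shift[OF B that] by simp
  show "Cod C g \<in> left_orthogonal C B"
    if t: "(f, g, h) \<in> Tri C" "Dom C f \<in> left_orthogonal C B" "Cod C f \<in> left_orthogonal C B" for f g h
  proof -
    obtain X Y Z where fg: "f \<in> Hom C X Y" "g \<in> Hom C Y Z" "h \<in> Hom C Z (Sh C X)" using TriD[OF t(1)] .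
    have "X \<in> left_orthogonal C B" "Y \<in> left_orthogonal C B" using t fg HomD by auto
    then have "Sh C X \<in> left_orthogonal C B" "Y \<in> left_orthogonal C B"
      using left_orthogonal_shift[OF B Hom_Ob(1)[OF fg(1)]] by auto
    then have "Z \<in> left_orthogonal C B"
      using orthogonal_cone[OF t(1) fg(1,2)] Hom_Ob(2)[OF fg(2)] by (auto simp: left_orthogonal_def)
    then show ?thesis using fg HomD by auto
  qed
  show "A \<in> left_orthogonal C B" if "X ` I \<subseteq> left_orthogonal C B" "coproduct C I X A \<iota>" for I X A \<iota>
    using orthogonal_coproduct[OF that(2)] that(1) coproductD(1)[OF that(2)] BO
    by (auto simp: left_orthogonal_def)
qed

lemma left_orthogonal_retract:
  assumes "X \<in> left_orthogonal C B" "i \<in> Hom C X' X" "p \<in> Hom C X X'" "p \<cdot> i = Ident C X'"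
  shows "X' \<in> left_orthogonal C B"
  using assms orthogonal_retract Hom_Ob(1)[OF assms(2)] by (auto simp: left_orthogonal_def)

lemma right_orthogonal_shift_stable:
  assumes A: "shift_stable C A"
  shows "shift_stable C (right_orthogonal C A)"
  unfolding shift_stable_def
proof (intro conjI ballI)
  have AO: "A \<subseteq> Ob C" using A by (simp add: shift_stable_def)
  show "right_orthogonal C A \<subseteq> Ob C" by (auto simp: right_orthogonal_def)
  fix Y assume Y: "Y \<in> right_orthogonal C A"
  then have YO: "Y \<in> Ob C" by (simp add: right_orthogonal_def)
  have "Sh C Y \<in> right_orthogonal C A" unfolding right_orthogonal_def
  proof (intro CollectI conjI ballI Sh_in_Ob YO)
    fix X assume "X \<in> A"
    then obtain X' where X': "X' \<in> A" "isomorphic C (Sh C X') X" using A unfolding shift_stable_def by blast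
    have "orthogonal C (Sh C X') (Sh C Y)"
      using orthogonal_shift AO X'(1) YO Y by (auto simp: right_orthogonal_def)
    then show "orthogonal C X (Sh C Y)" using orthogonal_isomorphic_left X' by blast
  qed
  then show "\<exists>Y'\<in>right_orthogonal C A. isomorphic C (Sh C Y) Y'"
    using isomorphic_refl[OF Sh_in_Ob[OF YO]] by blast
  obtain Y' where Y': "Y' \<in> Ob C" "isomorphic C (Sh C Y') Y" using ex_desuspension[OF YO] by blast
  have "Y' \<in> right_orthogonal C A" unfolding right_orthogonal_def
  proof (intro CollectI conjI ballI Y'(1))
    fix X assume X: "X \<in> A"
    then obtain X' where X': "X' \<in> A" "isomorphic C (Sh C X) X'" using A unfolding shift_stable_def by blast
    have "orthogonal C X' Y" using Y X' by (auto simp: right_orthogonal_def)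
    then have "orthogonal C (Sh C X) (Sh C Y')"
      using orthogonal_isomorphic_left[OF _ isomorphic_sym[OF X'(2)]]
        orthogonal_isomorphic_right[OF _ isomorphic_sym[OF Y'(2)]] by blast
    then show "orthogonal C X Y'" using orthogonal_shift AO X Y' by auto
  qed
  then show "\<exists>Y'\<in>right_orthogonal C A. isomorphic C (Sh C Y') Y" using Y' by blast
qed

section \<open>Arrows with cone in a subcategory\<close>

lemma triangulated_subcategoryD:
  assumes "triangulated_subcategory C L"
  shows "X \<in> L \<Longrightarrow> X \<in> Ob C" "zero_object C Z \<Longrightarrow> Z \<in> L" "X \<in> L \<Longrightarrow> isomorphic C X Y \<Longrightarrow> Y \<in> L"
    "X \<in> Ob C \<Longrightarrow> Sh C X \<in> L \<longleftrightarrow> X \<in> L"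
    "(f, g, h) \<in> Tri C \<Longrightarrow> Dom C f \<in> L \<Longrightarrow> Cod C f \<in> L \<Longrightarrow> Cod C g \<in> L"
  using assms isomorphic_Ob unfolding triangulated_subcategory_def by blast+

lemma triangulated_subcategory_two_of_three:
  assumes L: "triangulated_subcategory C L" and t: "(f, g, h) \<in> Tri C" "f \<in> Hom C X Y" "g \<in> Hom C Y Z"
  shows "X \<in> L \<Longrightarrow> Y \<in> L \<Longrightarrow> Z \<in> L" "Y \<in> L \<Longrightarrow> Z \<in> L \<Longrightarrow> X \<in> L" "X \<in> L \<Longrightarrow> Z \<in> L \<Longrightarrow> Y \<in> L"
proof -
  note [simp] = HomD[OF t(2)] HomD[OF t(3)]
  have h: "h \<in> Hom C Z (Sh C X)" using Tri_Hom[OF t(1,2)] by simp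
  note [simp] = HomD[OF h] HomD[OF neg_in_Hom[OF ShA_in_Hom[OF t(2)]]]
  note O = Hom_Ob(1)[OF t(2)] Hom_Ob(2)[OF t(2)]
  show "X \<in> L \<Longrightarrow> Y \<in> L \<Longrightarrow> Z \<in> L"
    using triangulated_subcategoryD(5)[OF L t(1)] by simp
  show "Y \<in> L \<Longrightarrow> Z \<in> L \<Longrightarrow> X \<in> L"
    using triangulated_subcategoryD(5)[OF L Tri_rotate[OF t(1)]] triangulated_subcategoryD(4)[OF L O(1)] by simp
  show "X \<in> L \<Longrightarrow> Z \<in> L \<Longrightarrow> Y \<in> L"
    using triangulated_subcategoryD(5)[OF L Tri_rotate[OF Tri_rotate[OF t(1)]]]
      triangulated_subcategoryD(4)[OF L O(1)] triangulated_subcategoryD(4)[OF L O(2)] by simp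
qed

lemma octahedron:
  assumes s: "s \<in> Hom C X Y" "t \<in> Hom C Y Z"
    and T1: "(s, a, b) \<in> Tri C" "a \<in> Hom C Y Z1" and T2: "(t, c, d) \<in> Tri C" "c \<in> Hom C Z Z2"
    and T3: "(t \<cdot> s, p, q) \<in> Tri C" "p \<in> Hom C Z Z3"
  obtains u v w where "(u, v, w) \<in> Tri C" "u \<in> Hom C Z1 Z3" "v \<in> Hom C Z3 Z2"
  using TR4[OF _ T1(1) T2(1) T3(1)] HomD s T1(2) T2(2) T3(2) that by metis

lemma cone_inI: "(s, g, h) \<in> Tri C \<Longrightarrow> g \<in> Hom C Y Z \<Longrightarrow> Z \<in> L \<Longrightarrow> s \<in> cone_in C L"
  using Tri_candidate[of "(s, g, h)"] HomD(3)[of g Y Z] unfolding cone_in_def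
  by (auto simp: candidate_triangle_def)

lemma cone_inE:
  assumes "s \<in> cone_in C L" "s \<in> Hom C X Y"
  obtains Z g h where "(s, g, h) \<in> Tri C" "g \<in> Hom C Y Z" "h \<in> Hom C Z (Sh C X)" "Z \<in> L"
  using assms Tri_Hom unfolding cone_in_def by blast

lemma Ident_cone_in:
  assumes L: "triangulated_subcategory C L" and X: "X \<in> Ob C"
  shows "Ident C X \<in> cone_in C L"
proof -
  obtain Z where z: "zero_object C Z" using ex_zero_object by blast
  then have "Z \<in> Ob C" by (simp add: zero_object_def)
  then show ?thesis
    using cone_inI[OF TR1_Ident[OF X z] Zero_in_Hom[OF X]] triangulated_subcategoryD(2)[OF L z] by blast
qed

text \<open>By the octahedron the cones of \<open>s\<close>, \<open>t \<cdot> s\<close> and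
  \<open>t\<close> form a triangle, so two of them in \<open>L\<close> put the third there.\<close>

lemma cone_in_Comp:
  assumes L: "triangulated_subcategory C L" and s: "s \<in> Hom C X Y" "t \<in> Hom C Y Z"
  shows "s \<in> cone_in C L \<Longrightarrow> t \<in> cone_in C L \<Longrightarrow> t \<cdot> s \<in> cone_in C L"
    and "t \<in> cone_in C L \<Longrightarrow> t \<cdot> s \<in> cone_in C L \<Longrightarrow> s \<in> cone_in C L"
proof -
  have ts: "t \<cdot> s \<in> Hom C X Z" using Comp_in_Hom s by blast
  obtain Z1 a b where 1: "(s, a, b) \<in> Tri C" "a \<in> Hom C Y Z1" using complete_triangle[OF s(1)] by metis
  obtain Z3 p q where 3: "(t \<cdot> s, p, q) \<in> Tri C" "p \<in> Hom C Z Z3" using complete_triangle[OF ts] by metis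
  show "s \<in> cone_in C L \<Longrightarrow> t \<in> cone_in C L \<Longrightarrow> t \<cdot> s \<in> cone_in C L"
  proof -
    assume c: "s \<in> cone_in C L" "t \<in> cone_in C L"
    obtain Z1 a b where 1: "(s, a, b) \<in> Tri C" "a \<in> Hom C Y Z1" "Z1 \<in> L" using cone_inE[OF c(1) s(1)] by metis
    obtain Z2 k d where 2: "(t, k, d) \<in> Tri C" "k \<in> Hom C Z Z2" "Z2 \<in> L" using cone_inE[OF c(2) s(2)] by metis
    obtain u v w where t: "(u, v, w) \<in> Tri C" "u \<in> Hom C Z1 Z3" "v \<in> Hom C Z3 Z2"
      using octahedron[OF s 1(1,2) 2(1,2) 3] .
    show ?thesis using cone_inI[OF 3] triangulated_subcategory_two_of_three(3)[OF L t 1(3) 2(3)] by blast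
  qed
  show "t \<in> cone_in C L \<Longrightarrow> t \<cdot> s \<in> cone_in C L \<Longrightarrow> s \<in> cone_in C L"
  proof -
    assume c: "t \<in> cone_in C L" "t \<cdot> s \<in> cone_in C L"
    obtain Z3 p q where 3: "(t \<cdot> s, p, q) \<in> Tri C" "p \<in> Hom C Z Z3" "Z3 \<in> L" using cone_inE[OF c(2) ts] by metis
    obtain Z2 k d where 2: "(t, k, d) \<in> Tri C" "k \<in> Hom C Z Z2" "Z2 \<in> L" using cone_inE[OF c(1) s(2)] by metis
    obtain u v w where t: "(u, v, w) \<in> Tri C" "u \<in> Hom C Z1 Z3" "v \<in> Hom C Z3 Z2"
      using octahedron[OF s 1(1,2) 2(1,2) 3(1,2)] .
    show ?thesis using cone_inI[OF 1] triangulated_subcategory_two_of_three(2)[OF L t 3(3) 2(3)] by blast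
  qed
qed

text \<open>\<open>cone_in\<close> asks only for some cone in \<open>L\<close>. The octahedron for
  \<open>s \<cdot> Ident C X\<close> gives a triangle from a zero object to \<open>Z\<close> to the
  known cone, so every cone is in \<open>L\<close>.\<close>

lemma cone_in_triangle:
  assumes L: "triangulated_subcategory C L" and s: "s \<in> Hom C X Y" "s \<in> cone_in C L"
    and 3: "(s, p, q) \<in> Tri C" "p \<in> Hom C Y Z"
  shows "Z \<in> L"
proof -
  obtain O' where z: "zero_object C O'" using ex_zero_object by blast
  have X: "X \<in> Ob C" and O': "O' \<in> Ob C" using Hom_Ob(1)[OF s(1)] z by (auto simp: zero_object_def)
  obtain Z2 k d where 2: "(s, k, d) \<in> Tri C" "k \<in> Hom C Y Z2" "Z2 \<in> L" using cone_inE[OF s(2,1)] by metis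
  have 3: "(s \<cdot> Ident C X, p, q) \<in> Tri C" "p \<in> Hom C Y Z" using 3 Comp_Ident[OF s(1)] by auto
  obtain u v w where t: "(u, v, w) \<in> Tri C" "u \<in> Hom C O' Z" "v \<in> Hom C Z Z2"
    using octahedron[OF Ident_in_Hom[OF X] s(1) TR1_Ident[OF X z] Zero_in_Hom[OF X O'] 2(1,2) 3] .
  show ?thesis
    using triangulated_subcategory_two_of_three(3)[OF L t triangulated_subcategoryD(2)[OF L z] 2(3)] .
qed

lemma cone_in_desuspension:
  assumes L: "triangulated_subcategory C L" and s: "s \<in> Hom C X Y" "s \<in> cone_in C L"
  obtains V f h where "(f, s, h) \<in> Tri C" "f \<in> Hom C V X" "h \<in> Hom C Y (Sh C V)" "V \<in> L"
proof -
  obtain V f h where t: "(f, s, h) \<in> Tri C" "f \<in> Hom C V X" "h \<in> Hom C Y (Sh C V)"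
    using desuspension_triangle[OF s(1)] .
  have "Sh C V \<in> L" using cone_in_triangle[OF L s Tri_rotate[OF t(1)] t(3)] .
  then have "V \<in> L" using triangulated_subcategoryD(4)[OF L] Hom_Ob(1)[OF t(2)] by blast
  then show thesis using that t by blast
qed

text \<open>The fibre of \<open>s\<close> lies in \<open>L\<close>, so nothing on it maps to
  \<open>W\<close> and the weak cokernel property applies. Together with \<open>cone_in_epi\<close>
  this says that \<open>W\<close> is local for arrows with cone in \<open>L\<close>.\<close>

lemma cone_in_extend:
  assumes L: "triangulated_subcategory C L" and s: "s \<in> Hom C X Y" "s \<in> cone_in C L"
    and k: "k \<in> Hom C X W" and o: "\<And>V. V \<in> L \<Longrightarrow> orthogonal C V W"
  obtains l where "l \<in> Hom C Y W" "l \<cdot> s = k"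
proof -
  obtain V f h where t: "(f, s, h) \<in> Tri C" "f \<in> Hom C V X" "h \<in> Hom C Y (Sh C V)" "V \<in> L"
    using cone_in_desuspension[OF L s] .
  have "k \<cdot> f = Zero C V W" using o[OF t(4)] Comp_in_Hom[OF t(2) k] by (simp add: orthogonal_def)
  then show thesis using Tri_weak_cokernel[OF t(1,2) s(1) k] that by blast
qed

lemma cone_in_epi:
  assumes L: "triangulated_subcategory C L" and s: "s \<in> Hom C X Y" "s \<in> cone_in C L"
    and k: "k \<in> Hom C Y W" "k \<cdot> s = Zero C X W" and o: "\<And>V. V \<in> L \<Longrightarrow> orthogonal C V W"
  shows "k = Zero C Y W"
proof -
  obtain Z g h where t: "(s, g, h) \<in> Tri C" "g \<in> Hom C Y Z" "Z \<in> L" using cone_inE[OF s(2,1)] by metis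
  obtain l where l: "l \<in> Hom C Z W" "l \<cdot> g = k" using Tri_weak_cokernel[OF t(1) s(1) t(2) k] by blast
  then show ?thesis using o[OF t(3)] Zero_Comp[OF Hom_Ob(2)[OF k(1)] t(2)] by (simp add: orthogonal_def)
qed

text \<open>The Ore condition for roofs: \<open>t'\<close> is the fibre of
  \<open>c \<cdot> g\<close>, so that it has the same cone \<open>Z\<close> as
  \<open>t\<close>.\<close>

lemma cone_in_square:
  assumes L: "triangulated_subcategory C L" and s: "t \<in> Hom C V X" "t \<in> cone_in C L" and g: "g \<in> Hom C W X"
  obtains U t' g' where "t' \<in> Hom C U W" "g' \<in> Hom C U V" "t' \<in> cone_in C L" "g \<cdot> t' = t \<cdot> g'"
proof -
  obtain Z c d where t: "(t, c, d) \<in> Tri C" "c \<in> Hom C X Z" "Z \<in> L" using cone_inE[OF s(2,1)] by metis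
  note cg = Comp_in_Hom[OF g t(2)]
  obtain U t' h where t': "(t', c \<cdot> g, h) \<in> Tri C" "t' \<in> Hom C U W" using desuspension_triangle[OF cg] by metis
  have "(c \<cdot> g) \<cdot> t' = Zero C U Z" using Tri_Comp_Zero[OF t' cg] .
  then have "c \<cdot> (g \<cdot> t') = Zero C U Z" using Comp_assoc[OF t'(2) g t(2)] by simp
  then obtain g' where "g' \<in> Hom C U V" "t \<cdot> g' = g \<cdot> t'"
    using Tri_weak_kernel[OF t(1) s(1) t(2) Comp_in_Hom[OF t'(2) g]] by blast
  then show thesis using that[OF t'(2)] cone_inI[OF t'(1) cg t(3)] by metis
qed

section \<open>Coproducts of suspensions and of triangles\<close>

lemma coproduct_shift:
  assumes A: "coproduct C I X A \<iota>"
  shows "coproduct C I (\<lambda>i. Sh C (X i)) (Sh C A) (\<lambda>i. ShA C (\<iota> i))"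
proof (rule coproductI)
  have \<iota>: "\<iota> i \<in> Hom C (X i) A" "X i \<in> Ob C" if "i \<in> I" for i
    using coproductD(2)[OF A that] Hom_Ob(1) by auto
  have AO: "A \<in> Ob C" using coproductD(1)[OF A] .
  show "Sh C A \<in> Ob C" using AO Sh_in_Ob by blast
  show "ShA C (\<iota> i) \<in> Hom C (Sh C (X i)) (Sh C A)" if "i \<in> I" for i using ShA_in_Hom \<iota> that by blast
  fix Y assume Y: "Y \<in> Ob C"
  \<comment> \<open>An equivalence preserves coproducts: arrows out of the suspended coproduct are
    tested after writing their target as a suspension.\<close>
  obtain Y' m where Y': "Y' \<in> Ob C" and m: "m \<in> Hom C (Sh C Y') Y" "isomorphism C m"
    using ex_desuspension[OF Y] by (auto simp: isomorphic_def)
  obtain n where n: "n \<in> Hom C Y (Sh C Y')" "n \<cdot> m = Ident C (Sh C Y')" "m \<cdot> n = Ident C Y"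
    using isomorphismE[OF m(2,1)] by metis
  show "\<exists>h\<in>Hom C (Sh C A) Y. \<forall>i\<in>I. h \<cdot> ShA C (\<iota> i) = g i" if g: "\<And>i. i \<in> I \<Longrightarrow> g i \<in> Hom C (Sh C (X i)) Y" for g
  proof -
    have "\<exists>k. k \<in> Hom C (X i) Y' \<and> ShA C k = n \<cdot> g i" if "i \<in> I" for i
      using ShA_full[OF \<iota>(2)[OF that] Y' Comp_in_Hom[OF g[OF that] n(1)]] by metis
    then obtain k where k: "\<And>i. i \<in> I \<Longrightarrow> k i \<in> Hom C (X i) Y'" "\<And>i. i \<in> I \<Longrightarrow> ShA C (k i) = n \<cdot> g i" by metis
    obtain h where h: "h \<in> Hom C A Y'" "\<And>i. i \<in> I \<Longrightarrow> h \<cdot> \<iota> i = k i" using coproduct_arrow[OF A Y' k(1)] by metis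
    have "(m \<cdot> ShA C h) \<cdot> ShA C (\<iota> i) = g i" if i: "i \<in> I" for i
    proof -
      have "(m \<cdot> ShA C h) \<cdot> ShA C (\<iota> i) = m \<cdot> (n \<cdot> g i)"
        using Comp_assoc[OF ShA_in_Hom[OF \<iota>(1)[OF i]] ShA_in_Hom[OF h(1)] m(1)] ShA_Comp[OF \<iota>(1)[OF i] h(1)] h(2)[OF i] k(2)[OF i] by simp
      then show ?thesis using Comp_assoc[OF g[OF i] n(1) m(1)] n(3) Ident_Comp[OF g[OF i]] by simp
    qed
    then show ?thesis using Comp_in_Hom[OF ShA_in_Hom[OF h(1)] m(1)] by blast
  qed
  show "h = h'" if h: "h \<in> Hom C (Sh C A) Y" "h' \<in> Hom C (Sh C A) Y" "\<And>i. i \<in> I \<Longrightarrow> h \<cdot> ShA C (\<iota> i) = h' \<cdot> ShA C (\<iota> i)" for h h'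
  proof -
    obtain k where k: "k \<in> Hom C A Y'" "ShA C k = n \<cdot> h" using ShA_full[OF AO Y' Comp_in_Hom[OF h(1) n(1)]] .
    obtain k' where k': "k' \<in> Hom C A Y'" "ShA C k' = n \<cdot> h'" using ShA_full[OF AO Y' Comp_in_Hom[OF h(2) n(1)]] .
    have "k = k'"
    proof (rule coproduct_eqI[OF A k(1) k'(1)])
      fix i assume i: "i \<in> I"
      have "ShA C (k \<cdot> \<iota> i) = ShA C (k' \<cdot> \<iota> i)"
        using ShA_Comp[OF \<iota>(1)[OF i]] k k' h(3)[OF i] Comp_assoc[OF ShA_in_Hom[OF \<iota>(1)[OF i]] h(1) n(1)]
          Comp_assoc[OF ShA_in_Hom[OF \<iota>(1)[OF i]] h(2) n(1)] by simp
      then show "k \<cdot> \<iota> i = k' \<cdot> \<iota> i" using ShA_inj Comp_in_Hom[OF \<iota>(1)[OF i]] k k' by blast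
    qed
    then have "m \<cdot> (n \<cdot> h) = m \<cdot> (n \<cdot> h')" using k k' by simp
    then show ?thesis using Comp_assoc[OF h(1) n(1) m(1)] Comp_assoc[OF h(2) n(1) m(1)] n(3)
      Ident_Comp[OF h(1)] Ident_Comp[OF h(2)] by simp
  qed
qed

text \<open>A five lemma argument by hand: the arrows \<open>w i\<close> into the cone of
  \<open>F\<close> form a coproduct cocone. A family of arrows is first extended up to an error and
  then corrected; uniqueness runs one step further along the triangles.\<close>

lemma coproduct_triangle:
  assumes A: "coproduct C I X A \<iota>" and B: "coproduct C I Y B \<beta>"
    and t: "\<And>i. i \<in> I \<Longrightarrow> (f i, g i, h i) \<in> Tri C" "\<And>i. i \<in> I \<Longrightarrow> f i \<in> Hom C (X i) (Y i)"
      "\<And>i. i \<in> I \<Longrightarrow> g i \<in> Hom C (Y i) (Z i)"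
    and F: "F \<in> Hom C A B" "\<And>i. i \<in> I \<Longrightarrow> F \<cdot> \<iota> i = \<beta> i \<cdot> f i"
    and T: "(F, G, H) \<in> Tri C" "G \<in> Hom C B D"
  shows "\<exists>w. coproduct C I Z D w"
proof -
  have \<iota>: "\<iota> i \<in> Hom C (X i) A" "\<beta> i \<in> Hom C (Y i) B" if "i \<in> I" for i
    using coproductD(2)[OF A that] coproductD(2)[OF B that] by auto
  have h: "h i \<in> Hom C (Z i) (Sh C (X i))" if "i \<in> I" for i using Tri_Hom(2)[OF t(1,2)] HomD(3)[OF t(3)] that by metis
  have H: "H \<in> Hom C D (Sh C A)" using Tri_Hom(2)[OF T(1) F(1)] HomD(3)[OF T(2)] by simp
  have "\<exists>w. w \<in> Hom C (Z i) D \<and> w \<cdot> g i = G \<cdot> \<beta> i \<and> ShA C (\<iota> i) \<cdot> h i = H \<cdot> w" if i: "i \<in> I" for i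
    using TR3[OF t(1)[OF i] T(1), of "\<iota> i" "\<beta> i"] HomD[OF t(2)[OF i]] HomD[OF t(3)[OF i]] HomD[OF F(1)] HomD[OF T(2)]
      \<iota>[OF i] F(2)[OF i] by auto
  then obtain w where w: "\<And>i. i \<in> I \<Longrightarrow> w i \<in> Hom C (Z i) D" "\<And>i. i \<in> I \<Longrightarrow> w i \<cdot> g i = G \<cdot> \<beta> i"
    "\<And>i. i \<in> I \<Longrightarrow> ShA C (\<iota> i) \<cdot> h i = H \<cdot> w i" by metis
  note SA = coproduct_shift[OF A] and SB = coproduct_shift[OF B]
  have O: "D \<in> Ob C" "A \<in> Ob C" "B \<in> Ob C" using Hom_Ob H F(1) by auto
  have SF: "ShA C F \<cdot> ShA C (\<iota> i) = ShA C (\<beta> i) \<cdot> ShA C (f i)" if i: "i \<in> I" for i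
    using ShA_Comp[OF \<iota>(1)[OF i] F(1)] ShA_Comp[OF t(2)[OF i] \<iota>(2)[OF i]] F(2)[OF i] by simp
  have "coproduct C I Z D w"
  proof (rule coproductI[OF O(1) w(1)])
    fix W c assume W: "W \<in> Ob C" and c: "\<And>i. i \<in> I \<Longrightarrow> c i \<in> Hom C (Z i) W"
    obtain b where b: "b \<in> Hom C B W" "\<And>i. i \<in> I \<Longrightarrow> b \<cdot> \<beta> i = c i \<cdot> g i"
      using coproduct_arrow[OF B W, of "\<lambda>i. c i \<cdot> g i"] Comp_in_Hom[OF t(3) c] by blast
    have "b \<cdot> F = Zero C A W"
    proof (rule coproduct_eqI[OF A Comp_in_Hom[OF F(1) b(1)] Zero_in_Hom[OF O(2) W]])
      fix i assume i: "i \<in> I"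
      have "(b \<cdot> F) \<cdot> \<iota> i = (b \<cdot> \<beta> i) \<cdot> f i"
        using Comp_assoc[OF \<iota>(1)[OF i] F(1) b(1)] F(2)[OF i] Comp_assoc[OF t(2)[OF i] \<iota>(2)[OF i] b(1)] by simp
      also have "\<dots> = c i \<cdot> (g i \<cdot> f i)" using b(2)[OF i] Comp_assoc[OF t(2)[OF i] t(3)[OF i] c[OF i]] by simp
      also have "\<dots> = Zero C (X i) W"
        using Tri_Comp_Zero[OF t(1)[OF i] t(2)[OF i] t(3)[OF i]] Comp_Zero[OF Hom_Ob(1)[OF t(2)[OF i]] c[OF i]] by simp
      finally show "(b \<cdot> F) \<cdot> \<iota> i = Zero C A W \<cdot> \<iota> i" using Zero_Comp[OF W \<iota>(1)[OF i]] by simp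
    qed
    then obtain d where d: "d \<in> Hom C D W" "d \<cdot> G = b" using Tri_weak_cokernel[OF T(1) F(1) T(2) b(1)] by blast
    \<comment> \<open>The extension \<open>d\<close> agrees with \<open>c i\<close> only after
      \<open>g i\<close>. The difference factors through \<open>h i\<close>, and these factors
      assemble over the suspended coproduct into the correction \<open>e \<cdot> H\<close>.\<close>
    have "\<exists>e. e \<in> Hom C (Sh C (X i)) W \<and> e \<cdot> h i = c i \<boxplus> neg C (d \<cdot> w i)" if i: "i \<in> I" for i
    proof -
      note dw = Comp_in_Hom[OF w(1)[OF i] d(1)]
      have "(d \<cdot> w i) \<cdot> g i = c i \<cdot> g i"
        using Comp_assoc[OF t(3)[OF i] w(1)[OF i] d(1)] w(2)[OF i] Comp_assoc[OF \<iota>(2)[OF i] T(2) d(1)] d(2) b(2)[OF i] by simp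
      then have "(c i \<boxplus> neg C (d \<cdot> w i)) \<cdot> g i = Zero C (Y i) W"
        using Add_Comp[OF t(3)[OF i] c[OF i] neg_in_Hom[OF dw]] neg_Comp[OF t(3)[OF i] dw]
          Add_neg[OF Comp_in_Hom[OF t(3)[OF i] c[OF i]]] by simp
      then show ?thesis
        using Tri_weak_cokernel'[OF t(1)[OF i] t(2)[OF i] t(3)[OF i] Add_in_Hom[OF c[OF i] neg_in_Hom[OF dw]]] by metis
    qed
    then obtain e' where e': "\<And>i. i \<in> I \<Longrightarrow> e' i \<in> Hom C (Sh C (X i)) W"
      "\<And>i. i \<in> I \<Longrightarrow> e' i \<cdot> h i = c i \<boxplus> neg C (d \<cdot> w i)" by metis
    obtain e where e: "e \<in> Hom C (Sh C A) W" "\<And>i. i \<in> I \<Longrightarrow> e \<cdot> ShA C (\<iota> i) = e' i"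
      using coproduct_arrow[OF SA W e'(1)] by metis
    note eH = Comp_in_Hom[OF H e(1)]
    have "(d \<boxplus> e \<cdot> H) \<cdot> w i = c i" if i: "i \<in> I" for i
    proof -
      note dw = Comp_in_Hom[OF w(1)[OF i] d(1)]
      have "(e \<cdot> H) \<cdot> w i = (e \<cdot> ShA C (\<iota> i)) \<cdot> h i"
        using Comp_assoc[OF w(1)[OF i] H e(1)] w(3)[OF i] Comp_assoc[OF h[OF i] ShA_in_Hom[OF \<iota>(1)[OF i]] e(1)] by simp
      also have "\<dots> = c i \<boxplus> neg C (d \<cdot> w i)" using e(2)[OF i] e'(2)[OF i] by simp
      finally have "(d \<boxplus> e \<cdot> H) \<cdot> w i = d \<cdot> w i \<boxplus> (c i \<boxplus> neg C (d \<cdot> w i))"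
        using Add_Comp[OF w(1)[OF i] d(1) eH] by simp
      also have "\<dots> = (c i \<boxplus> neg C (d \<cdot> w i)) \<boxplus> d \<cdot> w i"
        using Add_commute[OF dw Add_in_Hom[OF c[OF i] neg_in_Hom[OF dw]]] .
      also have "\<dots> = c i \<boxplus> (neg C (d \<cdot> w i) \<boxplus> d \<cdot> w i)" using Add_assoc[OF c[OF i] neg_in_Hom[OF dw] dw] .
      also have "\<dots> = c i"
        using Add_commute[OF neg_in_Hom[OF dw] dw] Add_neg[OF dw] Add_Zero[OF c[OF i]] by simp
      finally show ?thesis .
    qed
    then show "\<exists>k\<in>Hom C D W. \<forall>i\<in>I. k \<cdot> w i = c i" using Add_in_Hom[OF d(1) eH] by blast
  next
    fix W d d' assume W: "W \<in> Ob C" and d: "d \<in> Hom C D W" "d' \<in> Hom C D W"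
      and eq: "\<And>i. i \<in> I \<Longrightarrow> d \<cdot> w i = d' \<cdot> w i"
    define a where "a = d \<boxplus> neg C d'"
    have a: "a \<in> Hom C D W" unfolding a_def using Add_in_Hom neg_in_Hom d by blast
    have aw: "a \<cdot> w i = Zero C (Z i) W" if i: "i \<in> I" for i
      unfolding a_def using Add_Comp[OF w(1)[OF i] d(1) neg_in_Hom[OF d(2)]] neg_Comp[OF w(1)[OF i] d(2)] eq[OF i]
        Add_neg[OF Comp_in_Hom[OF w(1)[OF i] d(2)]] by simp
    have "a \<cdot> G = Zero C B W"
    proof (rule coproduct_eqI[OF B Comp_in_Hom[OF T(2) a] Zero_in_Hom[OF O(3) W]])
      fix i assume i: "i \<in> I"
      have "(a \<cdot> G) \<cdot> \<beta> i = (a \<cdot> w i) \<cdot> g i"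
        using Comp_assoc[OF \<iota>(2)[OF i] T(2) a] w(2)[OF i] Comp_assoc[OF t(3)[OF i] w(1)[OF i] a] by simp
      then show "(a \<cdot> G) \<cdot> \<beta> i = Zero C B W \<cdot> \<beta> i"
        using aw[OF i] Zero_Comp[OF W t(3)[OF i]] Zero_Comp[OF W \<iota>(2)[OF i]] by simp
    qed
    then obtain e where e: "e \<in> Hom C (Sh C A) W" "e \<cdot> H = a" using Tri_weak_cokernel'[OF T(1) F(1) T(2) a] by blast
    \<comment> \<open>Each restriction of \<open>e\<close> vanishes on \<open>h i\<close>, so it
      factors through the suspension of \<open>f i\<close>. Assembled, \<open>e\<close> factors
      through the suspension of \<open>F\<close>, whose composite with \<open>H\<close> is
      zero.\<close>
    have "\<exists>k. k \<in> Hom C (Sh C (Y i)) W \<and> k \<cdot> neg C (ShA C (f i)) = e \<cdot> ShA C (\<iota> i)" if i: "i \<in> I" for i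
    proof -
      note eSi = Comp_in_Hom[OF ShA_in_Hom[OF \<iota>(1)[OF i]] e(1)]
      have "(e \<cdot> ShA C (\<iota> i)) \<cdot> h i = a \<cdot> w i"
        using Comp_assoc[OF h[OF i] ShA_in_Hom[OF \<iota>(1)[OF i]] e(1)] w(3)[OF i] Comp_assoc[OF w(1)[OF i] H e(1)] e(2) by simp
      then have "(e \<cdot> ShA C (\<iota> i)) \<cdot> h i = Zero C (Z i) W" using aw[OF i] by simp
      then show ?thesis
        using Tri_weak_cokernel'[OF Tri_rotate[OF t(1)[OF i]] t(3)[OF i] h[OF i] eSi] by metis
    qed
    then obtain k' where k': "\<And>i. i \<in> I \<Longrightarrow> k' i \<in> Hom C (Sh C (Y i)) W"
      "\<And>i. i \<in> I \<Longrightarrow> k' i \<cdot> neg C (ShA C (f i)) = e \<cdot> ShA C (\<iota> i)" by metis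
    obtain k where k: "k \<in> Hom C (Sh C B) W" "\<And>i. i \<in> I \<Longrightarrow> k \<cdot> ShA C (\<beta> i) = k' i"
      using coproduct_arrow[OF SB W k'(1)] by metis
    note SFH = ShA_in_Hom[OF F(1)]
    have "e = neg C (k \<cdot> ShA C F)"
    proof (rule coproduct_eqI[OF SA e(1) neg_in_Hom[OF Comp_in_Hom[OF SFH k(1)]]])
      fix i assume i: "i \<in> I"
      note Sf = ShA_in_Hom[OF t(2)[OF i]] and Si = ShA_in_Hom[OF \<iota>(1)[OF i]] and Sj = ShA_in_Hom[OF \<iota>(2)[OF i]]
      have "(k \<cdot> ShA C F) \<cdot> ShA C (\<iota> i) = k' i \<cdot> ShA C (f i)"
        using Comp_assoc[OF Si SFH k(1)] SF[OF i] Comp_assoc[OF Sf Sj k(1)] k(2)[OF i] by simp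
      then show "e \<cdot> ShA C (\<iota> i) = neg C (k \<cdot> ShA C F) \<cdot> ShA C (\<iota> i)"
        using neg_Comp[OF Si Comp_in_Hom[OF SFH k(1)]] k'(2)[OF i] Comp_neg[OF Sf k'(1)[OF i]] by simp
    qed
    then have "a = neg C ((k \<cdot> ShA C F) \<cdot> H)" using e(2) neg_Comp[OF H Comp_in_Hom[OF SFH k(1)]] by simp
    also have "(k \<cdot> ShA C F) \<cdot> H = Zero C D W"
      using Comp_assoc[OF H SFH k(1)] Tri_Comp_Zero'(2)[OF T(1) F(1) T(2)] Comp_Zero[OF O(1) k(1)] by simp
    finally have "a = Zero C D W" using neg_Zero[OF O(1) W] by simp
    then show "d = d'" using diff_eq_Zero[OF d] a_def by simp
  qed
  then show ?thesis by blast
qed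

end

section \<open>Compact objects\<close>

text \<open>The image of the direct sum of the groups \<open>Hom C X (Y i)\<close> in
  \<open>Hom C X A\<close>, generated by arrows through single summands. Induction on this set
  replaces computations with \<open>gfinprod\<close>.\<close>

inductive_set finite_sums ::
  "('o, 'm, 'x) tri_cat_scheme \<Rightarrow> 'o \<Rightarrow> 'o \<Rightarrow> 'i set \<Rightarrow> ('i \<Rightarrow> 'o) \<Rightarrow> ('i \<Rightarrow> 'm) \<Rightarrow> 'm set"
  for C :: "('o, 'm, 'x) tri_cat_scheme" and X A J Y \<iota> where
  zero: "Zero C X A \<in> finite_sums C X A J Y \<iota>"
| add: "i \<in> J \<Longrightarrow> \<phi> \<in> Hom C X (Y i) \<Longrightarrow> w \<in> finite_sums C X A J Y \<iota> \<Longrightarrow>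
    (\<iota> i \<cdot>\<^bsub>C\<^esub> \<phi>) \<boxplus>\<^bsub>C\<^esub> w \<in> finite_sums C X A J Y \<iota>"

context additive_category
begin

lemma finite_sums_Hom:
  assumes "coproduct C J Y A \<iota>" "X \<in> Ob C" "w \<in> finite_sums C X A J Y \<iota>"
  shows "w \<in> Hom C X A"
  using assms(3)
  by induction (use assms coproductD[OF assms(1)] in \<open>auto intro: Zero_in_Hom Add_in_Hom Comp_in_Hom\<close>)

lemma finite_sums_Add:
  assumes A: "coproduct C J Y A \<iota>" "X \<in> Ob C" and w: "w \<in> finite_sums C X A J Y \<iota>" "w' \<in> finite_sums C X A J Y \<iota>"
  shows "w \<boxplus> w' \<in> finite_sums C X A J Y \<iota>"
  using w(1)
proof induction
  case zero
  show ?case using w(2) finite_sums_Hom[OF A w(2)] Zero_Add by simp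
next
  case (add i \<phi> w)
  show ?case
    using Add_assoc[OF Comp_in_Hom[OF add(2) coproductD(2)[OF A(1) add(1)]] finite_sums_Hom[OF A add(3)] finite_sums_Hom[OF A w(2)]]
      finite_sums.add[OF add(1,2,4)] by simp
qed

lemma finite_sums_Comp:
  assumes A: "coproduct C J Y A \<iota>" and w: "w \<in> finite_sums C X A J Y \<iota>" and u: "u \<in> Hom C X' X"
  shows "w \<cdot> u \<in> finite_sums C X' A J Y \<iota>"
  using w
proof induction
  case zero
  show ?case using Zero_Comp[OF coproductD(1)[OF A] u] finite_sums.zero by simp
next
  case (add i \<phi> w)
  note \<iota> = coproductD(2)[OF A add(1)]
  have "((\<iota> i \<cdot> \<phi>) \<boxplus> w) \<cdot> u = (\<iota> i \<cdot> (\<phi> \<cdot> u)) \<boxplus> w \<cdot> u"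
    using Add_Comp[OF u Comp_in_Hom[OF add(2) \<iota>] finite_sums_Hom[OF A Hom_Ob(2)[OF u] add(3)]]
      Comp_assoc[OF u add(2) \<iota>] by simp
  then show ?case using finite_sums.add[OF add(1) Comp_in_Hom[OF u add(2)] add(4)] by simp
qed

text \<open>
  A finite sum is fixed by the idempotent \<open>e = \<iota> i\<^sub>1 \<cdot> \<pi> i\<^sub>1 + \<dots> + \<iota> i\<^sub>n \<cdot> \<pi> i\<^sub>n\<close> of the summands that occur.
\<close>

lemma finite_sums_idempotent:
  assumes A: "coproduct C J Y A \<iota>" and X: "X \<in> Ob C" and w: "w \<in> finite_sums C X A J Y \<iota>"
    and p: "\<And>i. i \<in> J \<Longrightarrow> p i \<in> Hom C A (Y i)" "\<And>i. i \<in> J \<Longrightarrow> p i \<cdot> \<iota> i = Ident C (Y i)"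
      "\<And>i j. i \<in> J \<Longrightarrow> j \<in> J \<Longrightarrow> i \<noteq> j \<Longrightarrow> p i \<cdot> \<iota> j = Zero C (Y j) (Y i)"
  shows "\<exists>e. e \<in> finite_sums C A A J Y \<iota> \<and> e \<cdot> w = w \<and> (\<forall>i\<in>J. e \<cdot> \<iota> i = \<iota> i \<or> e \<cdot> \<iota> i = Zero C (Y i) A) \<and>
    (\<forall>W v. v \<in> Hom C W A \<longrightarrow> (\<forall>i\<in>J. p i \<cdot> v = Zero C W (Y i)) \<longrightarrow> e \<cdot> v = Zero C W A)"
  using w
proof induction
  have AO: "A \<in> Ob C" using coproductD[OF A] by simp
  case zero
  show ?case
  proof (intro exI[of _ "Zero C A A"] conjI ballI allI impI)
    show "Zero C A A \<cdot> Zero C X A = Zero C X A" using Zero_Comp[OF AO Zero_in_Hom[OF X AO]] .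
    show "Zero C A A \<cdot> \<iota> i = \<iota> i \<or> Zero C A A \<cdot> \<iota> i = Zero C (Y i) A" if "i \<in> J" for i
      using Zero_Comp[OF AO coproductD(2)[OF A that]] by simp
  qed (use finite_sums.zero Zero_Comp[OF AO] in auto)
next
  have AO: "A \<in> Ob C" using coproductD[OF A] by simp
  case (add i \<phi> w)
  note \<iota> = coproductD(2)[OF A]
  note \<iota>\<phi> = Comp_in_Hom[OF add(2) \<iota>[OF add(1)]]
  note wH = finite_sums_Hom[OF A X add(3)]
  obtain e where e: "e \<in> finite_sums C A A J Y \<iota>" "e \<cdot> w = w"
    "\<And>i. i \<in> J \<Longrightarrow> e \<cdot> \<iota> i = \<iota> i \<or> e \<cdot> \<iota> i = Zero C (Y i) A"
    "\<And>W v. v \<in> Hom C W A \<Longrightarrow> (\<And>i. i \<in> J \<Longrightarrow> p i \<cdot> v = Zero C W (Y i)) \<Longrightarrow> e \<cdot> v = Zero C W A"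
    using add(4) by blast
  note eH = finite_sums_Hom[OF A AO e(1)]
  show ?case
  proof (cases "e \<cdot> \<iota> i = \<iota> i")
    \<comment> \<open>Summand \<open>i\<close> has already been counted in \<open>e\<close>; adding
      \<open>\<iota> i \<cdot> p i\<close> again would double it.\<close>
    case True
    have "e \<cdot> ((\<iota> i \<cdot> \<phi>) \<boxplus> w) = (\<iota> i \<cdot> \<phi>) \<boxplus> w"
      using Comp_Add[OF \<iota>\<phi> wH eH] Comp_assoc[OF add(2) \<iota>[OF add(1)] eH] True e(2) by simp
    then show ?thesis using e by blast
  next
    case False
    then have ei: "e \<cdot> \<iota> i = Zero C (Y i) A" using e(3) add(1) by blast
    define e' where "e' = (\<iota> i \<cdot> p i) \<boxplus> e"
    note ip = Comp_in_Hom[OF p(1)[OF add(1)] \<iota>[OF add(1)]]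
    have e'H: "e' \<in> Hom C A A" unfolding e'_def using Add_in_Hom[OF ip eH] .
    have Yi: "Y j \<in> Ob C" if "j \<in> J" for j using Hom_Ob(1)[OF \<iota>[OF that]] .
    \<comment> \<open>Since \<open>w\<close> is fixed by \<open>e\<close>, this makes
      \<open>p i \<cdot> w\<close> vanish, so the new term does not disturb the old sum.\<close>
    have pe: "p i \<cdot> e = Zero C A (Y i)"
    proof (rule coproduct_eqI[OF A Comp_in_Hom[OF eH p(1)[OF add(1)]] Zero_in_Hom[OF AO Yi[OF add(1)]]])
      fix j assume j: "j \<in> J"
      have "p i \<cdot> (e \<cdot> \<iota> j) = Zero C (Y j) (Y i)"
      proof (cases "e \<cdot> \<iota> j = \<iota> j")
        case True
        then have "i \<noteq> j" using False by blast
        then show ?thesis using True p(3)[OF add(1) j] by simp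
      next
        case False
        then show ?thesis using e(3)[OF j] Comp_Zero[OF Yi[OF j] p(1)[OF add(1)]] by simp
      qed
      then show "(p i \<cdot> e) \<cdot> \<iota> j = Zero C A (Y i) \<cdot> \<iota> j"
        using Comp_assoc[OF \<iota>[OF j] eH p(1)[OF add(1)]] Zero_Comp[OF Yi[OF add(1)] \<iota>[OF j]] by simp
    qed
    have e'v: "e' \<cdot> v = (\<iota> i \<cdot> (p i \<cdot> v)) \<boxplus> e \<cdot> v" if v: "v \<in> Hom C W A" for v W
      unfolding e'_def using Add_Comp[OF v ip eH] Comp_assoc[OF v p(1)[OF add(1)] \<iota>[OF add(1)]] by simp
    have "e' \<cdot> \<iota> i = \<iota> i"
      using e'v[OF \<iota>[OF add(1)]] p(2)[OF add(1)] ei Comp_Ident[OF \<iota>[OF add(1)]] Add_Zero[OF \<iota>[OF add(1)]] by simp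
    then have 1: "e' \<cdot> (\<iota> i \<cdot> \<phi>) = \<iota> i \<cdot> \<phi>" using Comp_assoc[OF add(2) \<iota>[OF add(1)] e'H] by simp
    have "p i \<cdot> w = (p i \<cdot> e) \<cdot> w" using Comp_assoc[OF wH eH p(1)[OF add(1)]] e(2) by simp
    then have "p i \<cdot> w = Zero C X (Y i)" using pe Zero_Comp[OF Yi[OF add(1)] wH] by simp
    then have 2: "e' \<cdot> w = w"
      using e'v[OF wH] e(2) Comp_Zero[OF X \<iota>[OF add(1)]] Zero_Add[OF wH] by simp
    have "e' \<cdot> \<iota> j = \<iota> j \<or> e' \<cdot> \<iota> j = Zero C (Y j) A" if j: "j \<in> J" for j
    proof (cases "i = j")
      case True
      then show ?thesis using \<open>e' \<cdot> \<iota> i = \<iota> i\<close> by simp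
    next
      case False
      then have "e' \<cdot> \<iota> j = e \<cdot> \<iota> j"
        using e'v[OF \<iota>[OF j]] p(3)[OF add(1) j] Comp_Zero[OF Yi[OF j] \<iota>[OF add(1)]]
          Zero_Add[OF Comp_in_Hom[OF \<iota>[OF j] eH]] by simp
      then show ?thesis using e(3)[OF j] by simp
    qed
    moreover have "e' \<cdot> v = Zero C W A" if v: "v \<in> Hom C W A" "\<And>i. i \<in> J \<Longrightarrow> p i \<cdot> v = Zero C W (Y i)" for v W
      using e'v[OF v(1)] v(2)[OF add(1)] e(4)[OF v] Comp_Zero[OF Hom_Ob(1)[OF v(1)] \<iota>[OF add(1)]]
        Zero_Add[OF Zero_in_Hom[OF Hom_Ob(1)[OF v(1)] AO]] by simp
    moreover have "e' \<in> finite_sums C A A J Y \<iota>"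
      unfolding e'_def using finite_sums.add[OF add(1) p(1)[OF add(1)] e(1)] .
    moreover have "e' \<cdot> ((\<iota> i \<cdot> \<phi>) \<boxplus> w) = (\<iota> i \<cdot> \<phi>) \<boxplus> w" using Comp_Add[OF \<iota>\<phi> wH e'H] 1 2 by simp
    ultimately show ?thesis by (intro exI[of _ e'] conjI) auto
  qed
qed

lemma gfinprod_finite_sums:
  assumes A: "coproduct C J Y A \<iota>" and X: "X \<in> Ob C" and \<phi>: "\<And>i. i \<in> J \<Longrightarrow> \<phi> i \<in> Hom C X (Y i)"
  shows "gfinprod (hom_group C X A) (\<lambda>i. \<iota> i \<cdot> \<phi> i) J \<in> finite_sums C X A J Y \<iota>"
proof -
  interpret G: comm_group "hom_group C X A" using hom_comm_group X coproductD[OF A] by simp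
  have H: "\<iota> i \<cdot> \<phi> i \<in> Hom C X A" if "i \<in> J" for i using Comp_in_Hom \<phi> coproductD(2)[OF A] that by blast
  have "finprod (hom_group C X A) (\<lambda>i. \<iota> i \<cdot> \<phi> i) K \<in> finite_sums C X A J Y \<iota>" if "finite K" "K \<subseteq> J" for K
    using that
  proof (induction K rule: finite_induct)
    case empty
    then show ?case using finite_sums.zero by (simp add: one_hom_group)
  next
    case (insert i K)
    have "finprod (hom_group C X A) (\<lambda>i. \<iota> i \<cdot> \<phi> i) (insert i K) =
      \<iota> i \<cdot> \<phi> i \<boxplus> finprod (hom_group C X A) (\<lambda>i. \<iota> i \<cdot> \<phi> i) K"
      using G.finprod_insert[OF insert(1,2), of "\<lambda>i. \<iota> i \<cdot> \<phi> i"] insert(4) H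
      by (auto simp: mult_hom_group carrier_hom_group)
    then show ?case
      using finite_sums.add[where C = C and X = X and Y = Y and A = A and \<iota> = \<iota> and \<phi> = "\<phi> i" and i = i, OF _ \<phi> insert(3)]
        insert(4) by simp
  qed
  then show ?thesis unfolding gfinprod_def using finite_sums.zero by (auto simp: one_hom_group)
qed

text \<open>The canonical map from the direct sum is always an injective homomorphism, since
  projections recover the components of a family. Compactness therefore reduces to surjectivity,
  that is, to every arrow being a finite sum.\<close>

lemma compact_objects_iff:
  fixes \<kappa> :: "'u rel"
  shows "X \<in> compact_objects \<kappa> C \<longleftrightarrow> X \<in> Ob C \<and>
    (\<forall>(I :: 'u set) Y A \<iota>. small \<kappa> I \<longrightarrow> coproduct C I Y A \<iota> \<longrightarrow> Hom C X A \<subseteq> finite_sums C X A I Y \<iota>)"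
proof (intro iffI conjI allI impI)
  assume X: "X \<in> compact_objects \<kappa> C"
  show XO: "X \<in> Ob C" using X by (simp add: compact_objects_def)
  fix I :: "'u set" and Y A \<iota>
  assume I: "small \<kappa> I" and A: "coproduct C I Y A \<iota>"
  have YO: "Y i \<in> Ob C" if "i \<in> I" for i using coproductD(2)[OF A that] Hom_Ob by blast
  have gr: "group (hom_group C X (Y i))" if "i \<in> I" for i
    using hom_comm_group[OF XO YO[OF that]] by (simp add: comm_group_def)
  have "(\<lambda>\<phi>. gfinprod (hom_group C X A) (\<lambda>i. \<iota> i \<cdot> \<phi> i) I)
          \<in> iso (sum_group I (\<lambda>i. hom_group C X (Y i))) (hom_group C X A)"
    using X I A by (simp add: compact_objects_def)
  then have im: "(\<lambda>\<phi>. gfinprod (hom_group C X A) (\<lambda>i. \<iota> i \<cdot> \<phi> i) I) ` carrier (sum_group I (\<lambda>i. hom_group C X (Y i)))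
      = Hom C X A"
    by (simp add: iso_def bij_betw_def carrier_hom_group)
  have "gfinprod (hom_group C X A) (\<lambda>i. \<iota> i \<cdot> \<phi> i) I \<in> finite_sums C X A I Y \<iota>"
    if "\<phi> \<in> carrier (sum_group I (\<lambda>i. hom_group C X (Y i)))" for \<phi>
    using gfinprod_finite_sums[OF A XO] that by (auto simp: carrier_sum_group[OF gr] carrier_hom_group PiE_iff)
  then show "Hom C X A \<subseteq> finite_sums C X A I Y \<iota>" unfolding im[symmetric] by (rule image_subsetI)
next
  assume X: "X \<in> Ob C \<and> (\<forall>(I :: 'u set) Y A \<iota>. small \<kappa> I \<longrightarrow> coproduct C I Y A \<iota> \<longrightarrow>
    Hom C X A \<subseteq> finite_sums C X A I Y \<iota>)"
  then have XO: "X \<in> Ob C" by blast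
  have "(\<lambda>\<phi>. gfinprod (hom_group C X A) (\<lambda>i. \<iota> i \<cdot> \<phi> i) I)
          \<in> iso (sum_group I (\<lambda>i. hom_group C X (Y i))) (hom_group C X A)"
    if I: "small \<kappa> I" and A: "coproduct C I Y A \<iota>" for I :: "'u set" and Y A \<iota>
  proof -
    have YO: "Y i \<in> Ob C" if "i \<in> I" for i using coproductD(2)[OF A that] Hom_Ob by blast
    note \<iota> = coproductD(2)[OF A]
    interpret G: comm_group "hom_group C X A" using hom_comm_group XO coproductD[OF A] by simp
    have gr: "group (hom_group C X (Y i))" if "i \<in> I" for i
      using hom_comm_group[OF XO YO[OF that]] by (simp add: comm_group_def)
    define S where "S = sum_group I (\<lambda>i. hom_group C X (Y i))"
    have S: "\<phi> \<in> carrier S \<longleftrightarrow> \<phi> \<in> extensional I \<and> (\<forall>i\<in>I. \<phi> i \<in> Hom C X (Y i)) \<and> finite {i \<in> I. \<phi> i \<noteq> Zero C X (Y i)}" for \<phi>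
      unfolding S_def by (auto simp: carrier_sum_group[OF gr] carrier_hom_group one_hom_group PiE_iff)
    have Sgr: "group S" unfolding S_def using gr by simp
    define F where "F = (\<lambda>\<phi>. gfinprod (hom_group C X A) (\<lambda>i. \<iota> i \<cdot> \<phi> i) I)"
    have fin: "finite {i \<in> I. \<iota> i \<cdot> \<phi> i \<noteq> \<one>\<^bsub>hom_group C X A\<^esub>}" if "\<phi> \<in> carrier S" for \<phi>
      by (rule finite_subset[of _ "{i \<in> I. \<phi> i \<noteq> Zero C X (Y i)}"])
        (use that S Comp_Zero[OF XO \<iota>] in \<open>auto simp: one_hom_group\<close>)
    have Hm: "(\<lambda>i. \<iota> i \<cdot> \<phi> i) \<in> I \<rightarrow> carrier (hom_group C X A)" if "\<phi> \<in> carrier S" for \<phi>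
      using that S Comp_in_Hom[OF _ \<iota>] by (auto simp: carrier_hom_group)
    have Fmult: "F (\<phi> \<otimes>\<^bsub>S\<^esub> \<psi>) = F \<phi> \<boxplus> F \<psi>" if \<phi>: "\<phi> \<in> carrier S" "\<psi> \<in> carrier S" for \<phi> \<psi>
    proof -
      have "F (\<phi> \<otimes>\<^bsub>S\<^esub> \<psi>) = gfinprod (hom_group C X A) (\<lambda>i. (\<iota> i \<cdot> \<phi> i) \<otimes>\<^bsub>hom_group C X A\<^esub> (\<iota> i \<cdot> \<psi> i)) I"
        unfolding F_def
      proof (rule G.gfinprod_cong)
        show "(\<lambda>i. \<iota> i \<cdot> (\<phi> \<otimes>\<^bsub>S\<^esub> \<psi>) i) \<in> I \<rightarrow> carrier (hom_group C X A)"
          using Hm[of "\<phi> \<otimes>\<^bsub>S\<^esub> \<psi>"] Sgr \<phi> by (simp add: group.is_monoid monoid.m_closed)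
        show "i \<in> I =simp=> \<iota> i \<cdot> (\<phi> \<otimes>\<^bsub>S\<^esub> \<psi>) i = (\<iota> i \<cdot> \<phi> i) \<otimes>\<^bsub>hom_group C X A\<^esub> (\<iota> i \<cdot> \<psi> i)" for i
          unfolding simp_implies_def using \<phi> S Comp_Add[of "\<phi> i" X "Y i" "\<psi> i" "\<iota> i" A] \<iota>
          by (simp add: S_def mult_hom_group)
      qed simp
      also have "\<dots> = F \<phi> \<boxplus> F \<psi>"
        unfolding F_def using G.gfinprod_distrib[OF fin[OF \<phi>(1)] fin[OF \<phi>(2)] Hm[OF \<phi>(1)] Hm[OF \<phi>(2)]]
        by (simp add: mult_hom_group)
      finally show ?thesis .
    qed
    have Fhom: "F \<in> hom S (hom_group C X A)"
      unfolding hom_def using Fmult G.gfinprod_closed[OF Hm] by (auto simp: mult_hom_group F_def)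
    obtain p where p: "\<And>i. i \<in> I \<Longrightarrow> p i \<in> Hom C A (Y i)" "\<And>i. i \<in> I \<Longrightarrow> p i \<cdot> \<iota> i = Ident C (Y i)"
      "\<And>i j. i \<in> I \<Longrightarrow> j \<in> I \<Longrightarrow> i \<noteq> j \<Longrightarrow> p i \<cdot> \<iota> j = Zero C (Y j) (Y i)"
      using coproduct_projections[OF A YO] by metis
    have Fsing: "F (\<lambda>i\<in>I. if i = j then \<psi> else Zero C X (Y i)) = \<iota> j \<cdot> \<psi>" if j: "j \<in> I" "\<psi> \<in> Hom C X (Y j)" for j \<psi>
    proof -
      define g where "g = (\<lambda>i. \<iota> i \<cdot> (\<lambda>i\<in>I. if i = j then \<psi> else Zero C X (Y i)) i)"
      have g0: "g i = \<one>\<^bsub>hom_group C X A\<^esub>" if "i \<in> I - {j}" for i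
        using that Comp_Zero[OF XO \<iota>] by (auto simp: g_def one_hom_group)
      have gj: "g j = \<iota> j \<cdot> \<psi>" using j by (simp add: g_def)
      have gc: "g \<in> I \<rightarrow> carrier (hom_group C X A)"
        using g0 gj Comp_in_Hom[OF j(2) \<iota>[OF j(1)]] G.one_closed by (auto simp: carrier_hom_group) (metis carrier_hom_group Diff_iff empty_iff insert_iff)
      have "gfinprod (hom_group C X A) g I = gfinprod (hom_group C X A) g {j}"
        using G.gfinprod_mono_neutral_cong_left[of "{j}" I g g] j g0 gc by auto
      also have "\<dots> = \<iota> j \<cdot> \<psi>"
      proof -
        have g: "g \<in> {j} \<rightarrow> carrier (hom_group C X A)" "g j \<in> carrier (hom_group C X A)" using gc j by auto
        have "gfinprod (hom_group C X A) g {j} = finprod (hom_group C X A) g {j}"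
          by (rule G.gfinprod_eq_finprod) (use g in auto)
        also have "\<dots> = g j \<otimes>\<^bsub>hom_group C X A\<^esub> finprod (hom_group C X A) g {}"
          by (rule G.finprod_insert) (use g in auto)
        finally show ?thesis using gj g by simp
      qed
      finally show ?thesis unfolding F_def g_def .
    qed
    \<comment> \<open>The family is split into its \<open>j\<close>-th component \<open>s\<close>
      and the rest \<open>\<phi>'\<close>; the rest gives a finite sum over the other indices, which
      \<open>p j\<close> kills.\<close>
    have Fp: "p j \<cdot> F \<phi> = \<phi> j" if \<phi>: "\<phi> \<in> carrier S" and j: "j \<in> I" for \<phi> j
    proof -
      have \<phi>j: "\<phi> j \<in> Hom C X (Y j)" using \<phi> S j by blast
      define \<phi>' where "\<phi>' = (\<lambda>i\<in>I. if i = j then Zero C X (Y j) else \<phi> i)"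
      define s where "s = (\<lambda>i\<in>I. if i = j then \<phi> j else Zero C X (Y i))"
      have \<phi>': "\<phi>' \<in> carrier S"
        using \<phi> Zero_in_Hom[OF XO YO] unfolding S \<phi>'_def
        by (auto intro: finite_subset[of _ "{i \<in> I. \<phi> i \<noteq> Zero C X (Y i)}"])
      have s: "s \<in> carrier S"
        using \<phi>j Zero_in_Hom[OF XO YO] unfolding S s_def
        by (auto intro: finite_subset[of _ "{j}"])
      have "\<phi> = s \<otimes>\<^bsub>S\<^esub> \<phi>'"
      proof
        fix i show "\<phi> i = (s \<otimes>\<^bsub>S\<^esub> \<phi>') i"
          using \<phi>[unfolded S] Add_Zero[OF \<phi>j] Zero_Add[of "\<phi> i" X "Y i"]
          by (auto simp: S_def s_def \<phi>'_def mult_hom_group extensional_def)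
      qed
      then have 1: "F \<phi> = \<iota> j \<cdot> \<phi> j \<boxplus> F \<phi>'" using Fmult[OF s \<phi>'] Fsing[OF j \<phi>j] by (simp add: s_def)
      have "p j \<cdot> w = Zero C X (Y j)" if "w \<in> finite_sums C X A (I - {j}) Y \<iota>" "w \<in> Hom C X A" for w
        using that
      proof induction
        case zero
        show ?case using Comp_Zero[OF XO p(1)[OF j]] .
      next
        case (add i \<psi> w)
        have wH: "w \<in> Hom C X A" using add(3)
          by induction (use XO coproductD[OF A] in \<open>auto intro: Zero_in_Hom Add_in_Hom Comp_in_Hom\<close>)
        have i: "i \<in> I" "j \<noteq> i" using add(1) by auto
        have "p j \<cdot> (\<iota> i \<cdot> \<psi>) = Zero C X (Y j)"
          using Comp_assoc[OF add(2) \<iota>[OF i(1)] p(1)[OF j]] p(3)[OF j i] Zero_Comp[OF YO[OF j] add(2)] by simp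
        then show ?case
          using Comp_Add[OF Comp_in_Hom[OF add(2) \<iota>[OF i(1)]] wH p(1)[OF j]] add(4)[OF wH]
            Zero_Add[OF Zero_in_Hom[OF XO YO[OF j]]] by simp
      qed
      note z = this
      have F\<phi>': "F \<phi>' \<in> Hom C X A" using Fhom \<phi>' by (auto simp: hom_def carrier_hom_group)
      have "finite {i \<in> I. \<iota> i \<cdot> \<phi>' i \<noteq> \<one>\<^bsub>hom_group C X A\<^esub>}" using fin[OF \<phi>'] .
      have jz: "\<iota> j \<cdot> \<phi>' j = \<one>\<^bsub>hom_group C X A\<^esub>"
        using j Comp_Zero[OF XO \<iota>[OF j]] by (simp add: \<phi>'_def one_hom_group)
      have "finprod (hom_group C X A) (\<lambda>i. \<iota> i \<cdot> \<phi>' i) K \<in> finite_sums C X A (I - {j}) Y \<iota>"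
        if "finite K" "K \<subseteq> I - {j}" for K
        using that
      proof (induction K rule: finite_induct)
        case empty
        then show ?case using finite_sums.zero by (simp add: one_hom_group)
      next
        case (insert i K)
        have "finprod (hom_group C X A) (\<lambda>i. \<iota> i \<cdot> \<phi>' i) (insert i K) =
          \<iota> i \<cdot> \<phi>' i \<boxplus> finprod (hom_group C X A) (\<lambda>i. \<iota> i \<cdot> \<phi>' i) K"
          using G.finprod_insert[OF insert(1,2), of "\<lambda>i. \<iota> i \<cdot> \<phi>' i"] insert(4) Hm[OF \<phi>']
          by (auto simp: mult_hom_group)
        moreover have "\<phi>' i \<in> Hom C X (Y i)" using \<phi>' S insert(4) by auto
        ultimately show ?case
          using finite_sums.add[where C = C and X = X and Y = Y and A = A and \<iota> = \<iota> and \<phi> = "\<phi>' i" and i = i and J = "I - {j}"]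
            insert(3,4) by simp
      qed
      then have "F \<phi>' \<in> finite_sums C X A (I - {j}) Y \<iota>"
        using fin[OF \<phi>'] jz unfolding F_def gfinprod_def by (auto simp: subset_iff)
      then have "p j \<cdot> F \<phi>' = Zero C X (Y j)" using z F\<phi>' by blast
      then show ?thesis
        using 1 Comp_Add[OF Comp_in_Hom[OF \<phi>j \<iota>[OF j]] F\<phi>' p(1)[OF j]] Comp_assoc[OF \<phi>j \<iota>[OF j] p(1)[OF j]]
          p(2)[OF j] Ident_Comp[OF \<phi>j] Add_Zero[OF \<phi>j] by simp
    qed
    have "inj_on F (carrier S)"
    proof (rule inj_onI)
      fix \<phi> \<psi> assume \<phi>: "\<phi> \<in> carrier S" "\<psi> \<in> carrier S" "F \<phi> = F \<psi>"
      then show "\<phi> = \<psi>" using Fp S by (intro extensionalityI[of _ I]) metis+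
    qed
    moreover have "F ` carrier S = Hom C X A"
    proof
      show "F ` carrier S \<subseteq> Hom C X A" using Fhom by (auto simp: hom_def carrier_hom_group)
      have "w \<in> F ` carrier S" if "w \<in> finite_sums C X A I Y \<iota>" for w
        using that
      proof induction
        case zero
        have "F \<one>\<^bsub>S\<^esub> = Zero C X A" using group_hom.hom_one[of S "hom_group C X A" F] Sgr G.is_group Fhom
          by (simp add: group_hom_def group_hom_axioms_def one_hom_group)
        then show ?case using Sgr group.is_monoid monoid.one_closed by (metis imageI)
      next
        case (add i \<psi> w)
        then obtain \<phi> where \<phi>: "\<phi> \<in> carrier S" "w = F \<phi>" by blast
        define s where "s = (\<lambda>k\<in>I. if k = i then \<psi> else Zero C X (Y k))"
        have s: "s \<in> carrier S"
          using add(1,2) Zero_in_Hom[OF XO YO] unfolding S s_def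
          by (auto intro: finite_subset[of _ "{i}"])
        have "F (s \<otimes>\<^bsub>S\<^esub> \<phi>) = \<iota> i \<cdot> \<psi> \<boxplus> w" using Fmult[OF s \<phi>(1)] Fsing[OF add(1,2)] \<phi>(2) by (simp add: s_def)
        moreover have "s \<otimes>\<^bsub>S\<^esub> \<phi> \<in> carrier S" using Sgr s \<phi> by (simp add: group.is_monoid monoid.m_closed)
        ultimately show ?case by (metis imageI)
      qed
      then show "Hom C X A \<subseteq> F ` carrier S" using X I A by blast
    qed
    ultimately have "F \<in> iso S (hom_group C X A)" using Fhom by (simp add: iso_def bij_betw_def carrier_hom_group)
    then show ?thesis by (simp add: F_def S_def)
  qed
  then show "X \<in> compact_objects \<kappa> C" using XO by (simp add: compact_objects_def)
qed

lemma compact_finite_sums: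
  fixes J :: "'j set" and \<kappa> :: "'u rel"
  assumes \<kappa>: "inaccessible \<kappa>" and X: "X \<in> compact_objects \<kappa> C" and J: "small \<kappa> J"
    and A: "coproduct C J Y A \<iota>" and w: "w \<in> Hom C X A"
  shows "w \<in> finite_sums C X A J Y \<iota>"
proof -
  obtain I :: "'u set" and b where I: "small \<kappa> I" "bij_betw b I J" using small_index[OF \<kappa> J] .
  have "coproduct C I (Y \<circ> b) A (\<iota> \<circ> b)" using coproduct_reindex[OF A I(2)] .
  then have "w \<in> finite_sums C X A I (Y \<circ> b) (\<iota> \<circ> b)" using X w I(1) unfolding compact_objects_iff by blast
  then show ?thesis
  proof induction
    case (add i \<phi> w)
    then show ?case using finite_sums.add[of "b i" J \<phi> C X Y w A \<iota>] I(2) by (auto simp: bij_betw_def)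
  qed (rule finite_sums.zero)
qed

end

section \<open>Generation by compact objects\<close>

context triangulated_category
begin

text \<open>The cone of \<open>F\<close> is a coproduct of the cones of the \<open>s i\<close> by
  \<open>coproduct_triangle\<close>, hence lies in \<open>L\<close>.\<close>

lemma coproduct_cone_in:
  assumes \<kappa>: "inaccessible \<kappa>" and L: "localizing \<kappa> C L" and I: "small \<kappa> I"
    and A: "coproduct C I X A \<iota>" and B: "coproduct C I Y B \<beta>"
    and s: "\<And>i. i \<in> I \<Longrightarrow> s i \<in> Hom C (X i) (Y i)" "\<And>i. i \<in> I \<Longrightarrow> s i \<in> cone_in C L"
    and F: "F \<in> Hom C A B" "\<And>i. i \<in> I \<Longrightarrow> F \<cdot> \<iota> i = \<beta> i \<cdot> s i"
  shows "F \<in> cone_in C L"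
proof -
  have "\<exists>Z g h. (s i, g, h) \<in> Tri C \<and> g \<in> Hom C (Y i) Z \<and> Z \<in> L" if "i \<in> I" for i
    using cone_inE[OF s(2)[OF that] s(1)[OF that]] by metis
  then obtain Z g h where t: "\<And>i. i \<in> I \<Longrightarrow> (s i, g i, h i) \<in> Tri C" "\<And>i. i \<in> I \<Longrightarrow> g i \<in> Hom C (Y i) (Z i)"
    "\<And>i. i \<in> I \<Longrightarrow> Z i \<in> L" by metis
  obtain D G H where T: "(F, G, H) \<in> Tri C" "G \<in> Hom C B D" using complete_triangle[OF F(1)] by metis
  obtain w where w: "coproduct C I Z D w" using coproduct_triangle[OF A B t(1) s(1) t(2) F T] by blast
  have "D \<in> L" using localizing_coproduct[OF category_axioms \<kappa> L I t(3) w] by blast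
  then show ?thesis using cone_inI[OF T] by blast
qed

text \<open>A compact object sees only finitely many summands: \<open>v\<close> is fixed by the
  idempotent of those summands, and that idempotent kills every arrow whose components
  vanish.\<close>

lemma compact_arrow_eq_Zero:
  assumes \<kappa>: "inaccessible \<kappa>" and g: "g \<in> compact_objects \<kappa> C" and J: "small \<kappa> J"
    and A: "coproduct C J Y A \<iota>" and v: "v \<in> Hom C g A"
    and p: "\<And>i. i \<in> J \<Longrightarrow> p i \<in> Hom C A (Y i)" "\<And>i. i \<in> J \<Longrightarrow> p i \<cdot> \<iota> i = Ident C (Y i)"
      "\<And>i j. i \<in> J \<Longrightarrow> j \<in> J \<Longrightarrow> i \<noteq> j \<Longrightarrow> p i \<cdot> \<iota> j = Zero C (Y j) (Y i)"
    and z: "\<And>i. i \<in> J \<Longrightarrow> p i \<cdot> v = Zero C g (Y i)"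
  shows "v = Zero C g A"
proof -
  have w: "v \<in> finite_sums C g A J Y \<iota>" using compact_finite_sums[OF \<kappa> g J A v] .
  have "\<exists>e. e \<in> finite_sums C A A J Y \<iota> \<and> e \<cdot> v = v \<and> (\<forall>i\<in>J. e \<cdot> \<iota> i = \<iota> i \<or> e \<cdot> \<iota> i = Zero C (Y i) A) \<and>
    (\<forall>W v. v \<in> Hom C W A \<longrightarrow> (\<forall>i\<in>J. p i \<cdot> v = Zero C W (Y i)) \<longrightarrow> e \<cdot> v = Zero C W A)"
    by (rule finite_sums_idempotent[OF A Hom_Ob(1)[OF v] w]) (use p in auto)
  then obtain e where e: "e \<cdot> v = v"
    "\<forall>W v. v \<in> Hom C W A \<longrightarrow> (\<forall>i\<in>J. p i \<cdot> v = Zero C W (Y i)) \<longrightarrow> e \<cdot> v = Zero C W A"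
    by (elim exE conjE)
  have "\<forall>i\<in>J. p i \<cdot> v = Zero C g (Y i)" using z by blast
  then show ?thesis using e(2)[THEN spec, THEN spec, THEN mp, OF v] e(1) by simp
qed

text \<open>\<open>t\<close> is the cofibre of the sum of all arrows from objects of
  \<open>G\<close> to \<open>Y\<close>; its own cone is the suspension of a coproduct of objects of
  \<open>G\<close>. Local smallness keeps the index set of all these arrows small.\<close>

lemma ex_cone_killing:
  assumes \<kappa>: "inaccessible \<kappa>" and C: "has_small_coproducts \<kappa> C" "locally_small \<kappa> C"
    and G: "small \<kappa> G" "G \<subseteq> Ob C" and L: "localizing \<kappa> C L" "G \<subseteq> L" and Y: "Y \<in> Ob C"
  shows "\<exists>Y' t. t \<in> Hom C Y Y' \<and> t \<in> cone_in C L \<and> (\<forall>g\<in>G. \<forall>u\<in>Hom C g Y. t \<cdot> u = Zero C g Y')"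
proof -
  define J where "J = Sigma G (\<lambda>g. Hom C g Y)"
  have sJ: "small \<kappa> J" unfolding J_def
    by (rule small_Sigma[OF \<kappa> G(1)]) (use C(2) G(2) Y in \<open>auto simp: locally_small_def\<close>)
  have J: "fst j \<in> G" "snd j \<in> Hom C (fst j) Y" if "j \<in> J" for j using that by (auto simp: J_def)
  have JO: "fst j \<in> Ob C" if "j \<in> J" for j using J(1)[OF that] G(2) by blast
  have JL: "fst j \<in> L" if "j \<in> J" for j using J(1)[OF that] L(2) by blast
  obtain P \<iota> where P: "coproduct C J fst P \<iota>" using ex_coproduct[OF \<kappa> C(1) sJ JO] .
  have PL: "P \<in> L" using localizing_coproduct[OF category_axioms \<kappa> L(1) sJ JL P] .
  obtain e where e: "e \<in> Hom C P Y" "\<And>j. j \<in> J \<Longrightarrow> e \<cdot> \<iota> j = snd j"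
    using coproduct_arrow[OF P Y J(2)] by metis
  obtain Y' t h where t: "(e, t, h) \<in> Tri C" "t \<in> Hom C Y Y'" "h \<in> Hom C Y' (Sh C P)" using complete_triangle[OF e(1)] .
  have tL: "triangulated_subcategory C L" using L(1) by (simp add: localizing_def)
  have "Sh C P \<in> L" using triangulated_subcategoryD(4)[OF tL Hom_Ob(1)[OF e(1)]] PL by simp
  then have "t \<in> cone_in C L" using cone_inI[OF Tri_rotate[OF t(1)] t(3)] by simp
  moreover have "t \<cdot> u = Zero C g Y'" if "g \<in> G" "u \<in> Hom C g Y" for g u
  proof -
    have j: "(g, u) \<in> J" using that by (simp add: J_def)
    have \<iota>: "\<iota> (g, u) \<in> Hom C g P" using coproductD(2)[OF P j] by simp
    have "t \<cdot> u = (t \<cdot> e) \<cdot> \<iota> (g, u)" using e(2)[OF j] Comp_assoc[OF \<iota> e(1) t(2)] by simp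
    then show ?thesis using Tri_Comp_Zero[OF t(1) e(1) t(2)] Zero_Comp[OF Hom_Ob(2)[OF t(2)] \<iota>] by simp
  qed
  ultimately show ?thesis using t(2) by blast
qed

text \<open>
  If \<open>X \<rightarrow> X\<^sub>1 \<rightarrow> X\<^sub>2 \<rightarrow> \<dots>\<close> kills every arrow from \<open>G\<close> at each step, its homotopy colimit is right
  orthogonal to \<open>G\<close> and hence zero, so \<open>1 - shift\<close> is invertible on \<open>\<Oplus>X\<^sub>n\<close>. As each \<open>X \<rightarrow> X\<^sub>n\<close> has
  its cone in \<open>L\<close>, so has \<open>1 - shift\<close> on \<open>\<Oplus>X\<close>; but the latter cone is \<open>X\<close>.
\<close>

lemma localizing_contains_generated:
  assumes \<kappa>: "inaccessible \<kappa>" and C: "has_small_coproducts \<kappa> C" "locally_small \<kappa> C"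
    and G: "small \<kappa> G" "G \<subseteq> compact_objects \<kappa> C" "\<And>g. g \<in> G \<Longrightarrow> \<exists>g'\<in>G. isomorphic C (Sh C g') g"
    and L: "localizing \<kappa> C L" "G \<subseteq> L"
    and orth: "\<And>Y. Y \<in> right_orthogonal C G \<Longrightarrow> zero_object C Y" and X: "X \<in> Ob C"
  shows "X \<in> L"
proof -
  have tL: "triangulated_subcategory C L" using L(1) by (simp add: localizing_def)
  have GO: "G \<subseteq> Ob C" using G(2) by (auto simp: compact_objects_def)
  have "\<exists>Y' t. Y \<in> Ob C \<longrightarrow> (t \<in> Hom C Y Y' \<and> t \<in> cone_in C L \<and> (\<forall>g\<in>G. \<forall>u\<in>Hom C g Y. t \<cdot> u = Zero C g Y'))" for Y
    using ex_cone_killing[OF \<kappa> C G(1) GO L, of Y] by blast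
  then obtain nx nt where n: "\<And>Y. Y \<in> Ob C \<Longrightarrow> nt Y \<in> Hom C Y (nx Y)"
    "\<And>Y. Y \<in> Ob C \<Longrightarrow> nt Y \<in> cone_in C L" "\<And>Y g u. Y \<in> Ob C \<Longrightarrow> g \<in> G \<Longrightarrow> u \<in> Hom C g Y \<Longrightarrow> nt Y \<cdot> u = Zero C g (nx Y)"
    by metis
  define x where "x = (\<lambda>k. (nx ^^ k) X)"
  define t where "t k = nt (x k)" for k
  have x: "x k \<in> Ob C" for k
    by (induction k) (use X n(1) Hom_Ob(2) in \<open>auto simp: x_def\<close>)
  have t: "t k \<in> Hom C (x k) (x (Suc k))" "t k \<in> cone_in C L"
    "\<And>g u. g \<in> G \<Longrightarrow> u \<in> Hom C g (x k) \<Longrightarrow> t k \<cdot> u = Zero C g (x (Suc k))" for k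
    using n[OF x] by (simp_all add: t_def) (simp_all add: x_def)
  \<comment> \<open>\<open>\<tau> k\<close> is the composite from \<open>X\<close> to stage
    \<open>k\<close>. It has its cone in \<open>L\<close> and compares the constant sequence on
    \<open>X\<close> with the telescope.\<close>
  define \<tau> where "\<tau> = rec_nat (Ident C X) (\<lambda>k a. t k \<cdot> a)"
  have \<tau>S: "\<tau> (Suc k) = t k \<cdot> \<tau> k" for k by (simp add: \<tau>_def)
  have \<tau>: "\<tau> k \<in> Hom C X (x k) \<and> \<tau> k \<in> cone_in C L" for k
  proof (induction k)
    case 0
    then show ?case using Ident_in_Hom[OF X] Ident_cone_in[OF tL X] by (simp add: \<tau>_def x_def)
  next
    case (Suc k)
    then show ?case using Comp_in_Hom[of "\<tau> k" X "x k"] cone_in_Comp(1)[OF tL, of "\<tau> k" X "x k" "t k"] t(1)[of k] t(2)[of k] \<tau>S by auto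
  qed
  have sN: "small \<kappa> (UNIV :: nat set)" using small_nat[OF \<kappa>] .
  obtain A \<iota> where A: "coproduct C (UNIV :: nat set) x A \<iota>" using ex_coproduct[OF \<kappa> C(1) sN x] .
  obtain B \<beta> where B: "coproduct C (UNIV :: nat set) (\<lambda>_. X) B \<beta>" using ex_coproduct[OF \<kappa> C(1) sN X] .
  have \<iota>: "\<iota> k \<in> Hom C (x k) A" for k using coproductD(2)[OF A] by simp
  have \<beta>: "\<beta> k \<in> Hom C X B" for k using coproductD(2)[OF B] by simp
  have AB: "A \<in> Ob C" "B \<in> Ob C" using coproductD(1)[OF A] coproductD(1)[OF B] by auto
  note \<iota>t = Comp_in_Hom[OF t(1) \<iota>]
  have SH: "\<iota> k \<boxplus> neg C (\<iota> (Suc k) \<cdot> t k) \<in> Hom C (x k) A" for k using Add_in_Hom[OF \<iota> neg_in_Hom[OF \<iota>t]] .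
  have ZH: "\<beta> k \<boxplus> neg C (\<beta> (Suc k)) \<in> Hom C X B" for k using Add_in_Hom[OF \<beta> neg_in_Hom[OF \<beta>]] .
  \<comment> \<open>\<open>S\<close> and \<open>Z\<close> are 1 minus shift, on the telescope and on
    the constant sequence; the cone of \<open>S\<close> is the homotopy colimit.\<close>
  obtain S where S: "S \<in> Hom C A A" "\<And>k. S \<cdot> \<iota> k = \<iota> k \<boxplus> neg C (\<iota> (Suc k) \<cdot> t k)"
    using coproduct_arrow[OF A AB(1), of "\<lambda>k. \<iota> k \<boxplus> neg C (\<iota> (Suc k) \<cdot> t k)"] SH by auto
  obtain Z where Z: "Z \<in> Hom C B B" "\<And>k. Z \<cdot> \<beta> k = \<beta> k \<boxplus> neg C (\<beta> (Suc k))"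
    using coproduct_arrow[OF B AB(2), of "\<lambda>k. \<beta> k \<boxplus> neg C (\<beta> (Suc k))"] ZH by auto
  obtain Y q h where T: "(S, q, h) \<in> Tri C" "q \<in> Hom C A Y" "h \<in> Hom C Y (Sh C A)" using complete_triangle[OF S(1)] .
  have YO: "Y \<in> Ob C" using Hom_Ob T by blast
  have telescope: "c \<cdot> a = c \<cdot> b" if e: "c \<cdot> (a \<boxplus> neg C b) = Zero C U V" and H: "a \<in> Hom C U W" "b \<in> Hom C U W" "c \<in> Hom C W V" for a b c U V W
  proof -
    have "(c \<cdot> a) \<boxplus> neg C (c \<cdot> b) = Zero C U V"
      using e Comp_Add[OF H(1) neg_in_Hom[OF H(2)] H(3)] Comp_neg[OF H(2,3)] by simp
    then show ?thesis using diff_eq_Zero[OF Comp_in_Hom[OF H(1,3)] Comp_in_Hom[OF H(2,3)]] by simp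
  qed
  have q\<iota>: "q \<cdot> \<iota> k = q \<cdot> (\<iota> (Suc k) \<cdot> t k)" for k
  proof (rule telescope[OF _ \<iota> \<iota>t T(2)])
    have "q \<cdot> (S \<cdot> \<iota> k) = Zero C (x k) Y"
      using Comp_assoc[OF \<iota> S(1) T(2), symmetric] Tri_Comp_Zero[OF T(1) S(1) T(2)] Zero_Comp[OF YO \<iota>] by simp
    then show "q \<cdot> (\<iota> k \<boxplus> neg C (\<iota> (Suc k) \<cdot> t k)) = Zero C (x k) Y" using S(2) by simp
  qed
  obtain p where p: "\<And>i. p i \<in> Hom C A (x i)" "\<And>i. p i \<cdot> \<iota> i = Ident C (x i)"
      "\<And>i j. i \<noteq> j \<Longrightarrow> p i \<cdot> \<iota> j = Zero C (x j) (x i)"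
    using coproduct_projections[OF A x] by (metis UNIV_I)
  have p\<iota>t: "p i \<cdot> (\<iota> (Suc k) \<cdot> t k) = (p i \<cdot> \<iota> (Suc k)) \<cdot> t k" for i k
    using Comp_assoc[OF t(1) \<iota> p(1)] by simp
  have tp\<iota>: "(t m \<cdot> p m) \<cdot> \<iota> k = t m \<cdot> (p m \<cdot> \<iota> k)" for m k
    using Comp_assoc[OF \<iota> p(1) t(1)] by simp
  \<comment> \<open>Rows of \<open>S\<close> as a lower triangular matrix: row 0 has only its
    diagonal entry, row \<open>m + 1\<close> also the entry from stage \<open>m\<close>. Forward
    substitution then shows that \<open>S\<close> is injective on arrows out of objects of
    \<open>G\<close>.\<close>
  have pS0: "p 0 \<cdot> S = p 0"
  proof (rule coproduct_eqI[OF A Comp_in_Hom[OF S(1) p(1)] p(1)])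
    fix k
    have "p 0 \<cdot> (\<iota> (Suc k) \<cdot> t k) = Zero C (x k) (x 0)"
      using p\<iota>t[of 0 k] p(3)[of 0 "Suc k"] Zero_Comp[OF x t(1)] by simp
    then show "(p 0 \<cdot> S) \<cdot> \<iota> k = p 0 \<cdot> \<iota> k"
      using Comp_assoc[OF \<iota> S(1) p(1)] S(2) Comp_Add[OF \<iota> neg_in_Hom[OF \<iota>t] p(1)] Comp_neg[OF \<iota>t p(1)]
        neg_Zero[OF x x] Add_Zero[OF Comp_in_Hom[OF \<iota> p(1)]] by simp
  qed
  note tp = Comp_in_Hom[OF p(1) t(1)]
  have pS: "p (Suc m) \<cdot> S = p (Suc m) \<boxplus> neg C (t m \<cdot> p m)" for m
  proof (rule coproduct_eqI[OF A Comp_in_Hom[OF S(1) p(1)] Add_in_Hom[OF p(1) neg_in_Hom[OF tp]]])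
    fix k
    have "p (Suc m) \<cdot> (\<iota> (Suc k) \<cdot> t k) = (t m \<cdot> p m) \<cdot> \<iota> k"
    proof (cases "k = m")
      case True
      then show ?thesis
        by (simp add: p\<iota>t tp\<iota> p(2) Ident_Comp[OF t(1)] Comp_Ident[OF t(1)])
    next
      case False
      then show ?thesis
        by (simp add: p\<iota>t tp\<iota> p(3) Zero_Comp[OF x t(1)] Comp_Zero[OF x t(1)])
    qed
    then show "(p (Suc m) \<cdot> S) \<cdot> \<iota> k = (p (Suc m) \<boxplus> neg C (t m \<cdot> p m)) \<cdot> \<iota> k"
      using Comp_assoc[OF \<iota> S(1) p(1)] S(2) Comp_Add[OF \<iota> neg_in_Hom[OF \<iota>t] p(1)] Comp_neg[OF \<iota>t p(1)]
        Add_Comp[OF \<iota> p(1) neg_in_Hom[OF tp]] neg_Comp[OF \<iota> tp] by simp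
  qed
  have S_mono: "v = Zero C g A" if g: "g \<in> G" and v: "v \<in> Hom C g A" and Sv: "S \<cdot> v = Zero C g A" for g v
  proof (rule compact_arrow_eq_Zero[OF \<kappa> _ sN A v p])
    show "g \<in> compact_objects \<kappa> C" using g G by blast
    have gO: "g \<in> Ob C" using g GO by blast
    have z: "(p k \<cdot> S) \<cdot> v = Zero C g (x k)" for k
      using Comp_assoc[OF v S(1) p(1)] Sv Comp_Zero[OF gO p(1)] by simp
    show "p k \<cdot> v = Zero C g (x k)" for k
    proof (induction k)
      case 0
      then show ?case using z[of 0] pS0 by simp
    next
      case (Suc k)
      have "(t k \<cdot> p k) \<cdot> v = Zero C g (x (Suc k))"
        using Comp_assoc[OF v p(1) t(1)] Suc Comp_Zero[OF gO t(1)] by simp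
      then show ?case
        using z[of "Suc k"] pS Add_Comp[OF v p(1) neg_in_Hom[OF tp]] neg_Comp[OF v tp] neg_Zero[OF gO x]
          Add_Zero[OF Comp_in_Hom[OF v p(1)]] by simp
    qed
  qed auto
  have "Y \<in> right_orthogonal C G" unfolding right_orthogonal_def orthogonal_def
  proof (intro CollectI conjI ballI YO)
    fix g u assume g: "g \<in> G" and u: "u \<in> Hom C g Y"
    have gO: "g \<in> Ob C" using g GO by blast
    obtain g' m where g': "g' \<in> G" and m: "m \<in> Hom C (Sh C g') g" "isomorphism C m"
      using G(3)[OF g] unfolding isomorphic_def by blast
    have g'O: "g' \<in> Ob C" using g' GO by blast
    obtain m' where m': "m' \<in> Hom C g (Sh C g')" "m \<cdot> m' = Ident C g" using isomorphismE[OF m(2,1)] by metis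
    note hu = Comp_in_Hom[OF u T(3)] and hum = Comp_in_Hom[OF m(1) Comp_in_Hom[OF u T(3)]]
    obtain v where v: "v \<in> Hom C g' A" "ShA C v = (h \<cdot> u) \<cdot> m" using ShA_full[OF g'O AB(1) hum] .
    \<comment> \<open>Up to an isomorphism of the source, \<open>h \<cdot> u\<close> is the
      suspension of an arrow \<open>v\<close> killed by \<open>S\<close>. Injectivity makes it
      vanish, so \<open>u\<close> lifts to \<open>A\<close>.\<close>
    have "ShA C (S \<cdot> v) = (ShA C S \<cdot> (h \<cdot> u)) \<cdot> m"
      using ShA_Comp[OF v(1) S(1)] v(2) Comp_assoc[OF m(1) hu ShA_in_Hom[OF S(1)]] by simp
    also have "ShA C S \<cdot> (h \<cdot> u) = Zero C g (Sh C A)"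
      using Comp_assoc[OF u T(3) ShA_in_Hom[OF S(1)]] Tri_Comp_Zero'(2)[OF T(1) S(1) T(2)]
        Zero_Comp[OF Sh_in_Ob[OF AB(1)] u] by simp
    finally have "S \<cdot> v = Zero C g' A"
      using ShA_eq_Zero[OF Comp_in_Hom[OF v(1) S(1)]] Zero_Comp[OF Sh_in_Ob[OF AB(1)] m(1)] by simp
    then have "v = Zero C g' A" using S_mono[OF g' v(1)] by simp
    then have hum0: "(h \<cdot> u) \<cdot> m = Zero C (Sh C g') (Sh C A)" using v(2) ShA_Zero[OF g'O AB(1)] by simp
    have "h \<cdot> u = ((h \<cdot> u) \<cdot> m) \<cdot> m'" using Comp_assoc[OF m'(1) m(1) hu] m'(2) Comp_Ident[OF hu] by simp
    then have "h \<cdot> u = Zero C g (Sh C A)" using hum0 Zero_Comp[OF Sh_in_Ob[OF AB(1)] m'(1)] by simp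
    then obtain w where w: "w \<in> Hom C g A" "q \<cdot> w = u" using Tri_weak_kernel'[OF T(1) S(1) T(2) u] by metis
    have "w \<in> finite_sums C g A UNIV x \<iota>" using compact_finite_sums[OF \<kappa> _ sN A w(1)] g G(2) by blast
    then have "q \<cdot> w = Zero C g Y"
    proof induction
      case zero
      show ?case using Comp_Zero[OF gO T(2)] .
    next
      case (add k \<phi> w)
      \<comment> \<open>In the homotopy colimit a summand may be moved one stage further, where
        \<open>t k\<close> has killed \<open>\<phi>\<close>.\<close>
      have "q \<cdot> (\<iota> k \<cdot> \<phi>) = (q \<cdot> (\<iota> (Suc k) \<cdot> t k)) \<cdot> \<phi>" using Comp_assoc[OF add(2) \<iota> T(2)] q\<iota> by simp
      also have "\<dots> = q \<cdot> (\<iota> (Suc k) \<cdot> (t k \<cdot> \<phi>))"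
        using Comp_assoc[OF add(2) \<iota>t T(2)] Comp_assoc[OF add(2) t(1) \<iota>] by simp
      also have "\<dots> = Zero C g Y"
        using t(3)[OF g add(2)] Comp_Zero[OF gO \<iota>] Comp_Zero[OF gO T(2)] by simp
      finally show ?case
        using Comp_Add[OF Comp_in_Hom[OF add(2) \<iota>] finite_sums_Hom[OF A gO add(3)] T(2)] add(4)
          Add_Zero[OF Zero_in_Hom[OF gO YO]] by simp
    qed
    then show "u = Zero C g Y" using w by simp
  qed
  then have "zero_object C Y" using orth by blast
  then have S_cone: "S \<in> cone_in C L" using cone_inI[OF T(1,2)] triangulated_subcategoryD(2)[OF tL] by blast
  obtain \<alpha> where \<alpha>: "\<alpha> \<in> Hom C B A" "\<And>k. \<alpha> \<cdot> \<beta> k = \<iota> k \<cdot> \<tau> k"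
    using coproduct_arrow[OF B AB(1), of "\<lambda>k. \<iota> k \<cdot> \<tau> k"] Comp_in_Hom[OF _ \<iota>] \<tau> by auto
  have \<alpha>_cone: "\<alpha> \<in> cone_in C L"
    using coproduct_cone_in[OF \<kappa> L(1) sN B A, of \<tau> \<alpha>] \<tau> \<alpha> by simp
  have \<tau>H: "\<tau> k \<in> Hom C X (x k)" for k using \<tau> by blast
  \<comment> \<open>\<open>\<alpha>\<close> is the ladder from the constant sequence to the
    telescope. As \<open>\<alpha>\<close> and \<open>S\<close> have their cones in \<open>L\<close>,
    the commuting square passes this on to \<open>Z\<close>.\<close>
  have "\<alpha> \<cdot> Z = S \<cdot> \<alpha>"
  proof (rule coproduct_eqI[OF B Comp_in_Hom[OF Z(1) \<alpha>(1)] Comp_in_Hom[OF \<alpha>(1) S(1)]])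
    fix k
    have "(\<alpha> \<cdot> Z) \<cdot> \<beta> k = (\<iota> k \<cdot> \<tau> k) \<boxplus> neg C (\<iota> (Suc k) \<cdot> \<tau> (Suc k))"
      using Comp_assoc[OF \<beta> Z(1) \<alpha>(1)] Z(2) Comp_Add[OF \<beta> neg_in_Hom[OF \<beta>] \<alpha>(1)] Comp_neg[OF \<beta> \<alpha>(1)] \<alpha>(2) by simp
    also have "\<dots> = (\<iota> k \<boxplus> neg C (\<iota> (Suc k) \<cdot> t k)) \<cdot> \<tau> k"
      using Add_Comp[OF \<tau>H \<iota> neg_in_Hom[OF \<iota>t]] neg_Comp[OF \<tau>H \<iota>t] Comp_assoc[OF \<tau>H t(1) \<iota>] \<tau>S by simp
    also have "\<dots> = (S \<cdot> \<alpha>) \<cdot> \<beta> k"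
      using Comp_assoc[OF \<beta> \<alpha>(1) S(1)] \<alpha>(2) Comp_assoc[OF \<tau>H \<iota> S(1)] S(2) by simp
    finally show "(\<alpha> \<cdot> Z) \<cdot> \<beta> k = (S \<cdot> \<alpha>) \<cdot> \<beta> k" .
  qed
  then have Z_cone: "Z \<in> cone_in C L"
    using cone_in_Comp(2)[OF tL Z(1) \<alpha>(1) \<alpha>_cone] cone_in_Comp(1)[OF tL \<alpha>(1) S(1) \<alpha>_cone S_cone] by simp
  obtain E g0 h0 where E: "(Z, g0, h0) \<in> Tri C" "g0 \<in> Hom C B E" "E \<in> L" using cone_inE[OF Z_cone Z(1)] by metis
  \<comment> \<open>Minus the partial sums of \<open>\<beta> 0, \<dots>, \<beta> (k - 1)\<close>,
    with value zero at 0. They define a retraction of \<open>Z\<close> because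
    \<open>r k - r (k + 1) = \<beta> k\<close>.\<close>
  define r where "r = rec_nat (Zero C X B) (\<lambda>k a. a \<boxplus> neg C (\<beta> k))"
  have r: "r k \<in> Hom C X B" for k
    by (induction k) (auto simp: r_def Zero_in_Hom[OF X AB(2)] Add_in_Hom neg_in_Hom[OF \<beta>])
  have rS: "r (Suc k) = r k \<boxplus> neg C (\<beta> k)" for k by (simp add: r_def)
  obtain \<rho> where \<rho>: "\<rho> \<in> Hom C B B" "\<And>k. \<rho> \<cdot> \<beta> k = r k" using coproduct_arrow[OF B AB(2), of r] r by auto
  have "\<rho> \<cdot> Z = Ident C B"
  proof (rule coproduct_eqI[OF B Comp_in_Hom[OF Z(1) \<rho>(1)] Ident_in_Hom[OF AB(2)]])
    fix k
    have "(\<rho> \<cdot> Z) \<cdot> \<beta> k = r k \<boxplus> neg C (r (Suc k))"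
      using Comp_assoc[OF \<beta> Z(1) \<rho>(1)] Z(2) Comp_Add[OF \<beta> neg_in_Hom[OF \<beta>] \<rho>(1)] Comp_neg[OF \<beta> \<rho>(1)] \<rho>(2) by simp
    also have "\<dots> = \<beta> k"
    proof (rule Add_right_cancel[OF Add_in_Hom[OF r neg_in_Hom[OF r]] \<beta> r[of "Suc k"]])
      have "(r k \<boxplus> neg C (r (Suc k))) \<boxplus> r (Suc k) = r k"
        using Add_assoc[OF r neg_in_Hom[OF r] r] Add_commute[OF neg_in_Hom[OF r] r] Add_neg[OF r] Add_Zero[OF r] by simp
      also have "\<dots> = \<beta> k \<boxplus> (neg C (\<beta> k) \<boxplus> r k)"
        using Add_assoc[OF \<beta>[of k] neg_in_Hom[OF \<beta>[of k]] r[of k]] Add_neg[OF \<beta>[of k]] Zero_Add[OF r[of k]] by simp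
      also have "\<dots> = \<beta> k \<boxplus> r (Suc k)" using rS Add_commute[OF neg_in_Hom[OF \<beta>] r] by simp
      finally show "(r k \<boxplus> neg C (r (Suc k))) \<boxplus> r (Suc k) = \<beta> k \<boxplus> r (Suc k)" .
    qed
    finally show "(\<rho> \<cdot> Z) \<cdot> \<beta> k = Ident C B \<cdot> \<beta> k" using Ident_Comp[OF \<beta>] by simp
  qed
  then have epi: "d = d'" if "d \<in> Hom C E W" "d' \<in> Hom C E W" "d \<cdot> g0 = d' \<cdot> g0" for d d' W
    using split_triangle[OF E(1) Z(1) E(2) \<rho>(1)] that by metis
  have g\<beta>: "g0 \<cdot> \<beta> k = g0 \<cdot> \<beta> (Suc k)" for k
  proof (rule telescope[OF _ \<beta> \<beta> E(2)])
    have "g0 \<cdot> (Z \<cdot> \<beta> k) = Zero C X E"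
      using Comp_assoc[OF \<beta> Z(1) E(2), symmetric] Tri_Comp_Zero[OF E(1) Z(1) E(2)] Zero_Comp[OF Hom_Ob(2)[OF E(2)] \<beta>] by simp
    then show "g0 \<cdot> (\<beta> k \<boxplus> neg C (\<beta> (Suc k))) = Zero C X E" using Z(2) by simp
  qed
  have g\<beta>0: "g0 \<cdot> \<beta> k = g0 \<cdot> \<beta> 0" for k by (induction k) (use g\<beta> in auto)
  \<comment> \<open>The codiagonal induces an arrow from the cone \<open>E\<close> to
    \<open>X\<close>; its inverse is the common value \<open>f\<close> of all
    \<open>g0 \<cdot> \<beta> k\<close>.\<close>
  obtain \<gamma> where \<gamma>: "\<gamma> \<in> Hom C B X" "\<And>k. \<gamma> \<cdot> \<beta> k = Ident C X"
    using coproduct_arrow[OF B X, of "\<lambda>_. Ident C X"] Ident_in_Hom[OF X] by auto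
  have "\<gamma> \<cdot> Z = Zero C B X"
  proof (rule coproduct_eqI[OF B Comp_in_Hom[OF Z(1) \<gamma>(1)] Zero_in_Hom[OF AB(2) X]])
    fix k
    show "(\<gamma> \<cdot> Z) \<cdot> \<beta> k = Zero C B X \<cdot> \<beta> k"
      using Comp_assoc[OF \<beta> Z(1) \<gamma>(1)] Z(2) Comp_Add[OF \<beta> neg_in_Hom[OF \<beta>] \<gamma>(1)] Comp_neg[OF \<beta> \<gamma>(1)] \<gamma>(2)
        Add_neg[OF Ident_in_Hom[OF X]] Zero_Comp[OF X \<beta>] by simp
  qed
  then obtain e where e: "e \<in> Hom C E X" "e \<cdot> g0 = \<gamma>" using Tri_weak_cokernel[OF E(1) Z(1) E(2) \<gamma>(1)] by metis
  define f where "f = g0 \<cdot> \<beta> 0"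
  have f: "f \<in> Hom C X E" unfolding f_def using Comp_in_Hom[OF \<beta> E(2)] .
  have ef: "e \<cdot> f = Ident C X" unfolding f_def using Comp_assoc[OF \<beta> E(2) e(1)] e(2) \<gamma>(2) by simp
  have "f \<cdot> \<gamma> = g0"
  proof (rule coproduct_eqI[OF B Comp_in_Hom[OF \<gamma>(1) f] E(2)])
    show "(f \<cdot> \<gamma>) \<cdot> \<beta> k = g0 \<cdot> \<beta> k" for k
      using Comp_assoc[OF \<beta> \<gamma>(1) f] \<gamma>(2) Comp_Ident[OF f] g\<beta>0[of k, folded f_def] by simp
  qed
  then have "(f \<cdot> e) \<cdot> g0 = Ident C E \<cdot> g0" using Comp_assoc[OF E(2) e(1) f] e(2) Ident_Comp[OF E(2)] by simp
  then have "f \<cdot> e = Ident C E" using epi Comp_in_Hom[OF e(1) f] Ident_in_Hom[OF Hom_Ob(2)[OF E(2)]] by blast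
  then have "isomorphic C E X" using isomorphicI[OF e(1) isomorphismI[OF e(1) f _ ef]] by blast
  then show ?thesis using triangulated_subcategoryD(3)[OF tL E(3)] by blast
qed

end

section \<open>Orthogonality in a Verdier quotient\<close>

text \<open>The two stages of the quotient differ only in their triangles, so Homs and isomorphisms
  may be taken in either.\<close>

lemma verdier_quotient_simps:
  "Ob (verdier_quotient C L) = Ob C" "Arr (verdier_quotient C L) = roofs C L // roof_rel C L"
  "Sh (verdier_quotient C L) = Sh C" "Unit (verdier_quotient C L) = Unit C"
  "Ident (verdier_quotient C L) = (\<lambda>X. quotient_arrow C L (Ident C X))"
  "Hom (pre_verdier_quotient C L) = Hom (verdier_quotient C L)"
  "isomorphism (pre_verdier_quotient C L) = isomorphism (verdier_quotient C L)"
  "Dom (pre_verdier_quotient C L) = Dom (verdier_quotient C L)"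
  "Cod (pre_verdier_quotient C L) = Cod (verdier_quotient C L)"
  by (simp_all add: verdier_quotient_def pre_verdier_quotient_def fun_eq_iff Hom_def isomorphism_def inverse_arrows_def)

text \<open>The objects of \<open>B\<close> are local for arrows with cone in \<open>L\<close>, so
  arrows into them can be compared between \<open>C\<close> and the quotient directly on
  roofs.\<close>

locale quotient_orthogonal = triangulated_category C
  for C :: "('o, 'm, 'x) tt_cat_scheme" (structure) +
  fixes L B :: "'o set"
  assumes L: "triangulated_subcategory C L" and B: "shift_stable C B"
    and L_orthogonal: "L \<subseteq> left_orthogonal C B"
begin

abbreviation Q :: "('o, ('m \<times> 'm) set) tt_cat" where "Q \<equiv> verdier_quotient C L"

lemma orthogonal_L: "Y \<in> B \<Longrightarrow> V \<in> L \<Longrightarrow> orthogonal C V Y"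
  using L_orthogonal by (auto simp: left_orthogonal_def)

lemma roofsI: "s \<in> Hom C W X \<Longrightarrow> s \<in> cone_in C L \<Longrightarrow> f \<in> Hom C W Y \<Longrightarrow> (s, f) \<in> roofs C L"
  by (auto simp: roofs_def Hom_def)

lemma roofsE:
  assumes "(s, f) \<in> roofs C L"
  obtains W X Y where "s \<in> Hom C W X" "f \<in> Hom C W Y" "s \<in> cone_in C L"
  using assms by (auto simp: roofs_def cone_in_def Hom_def)

lemma roof_relI:
  assumes "s \<in> Hom C W X" "s \<in> cone_in C L" "f \<in> Hom C W Y" "s' \<in> Hom C W' X" "s' \<in> cone_in C L" "f' \<in> Hom C W' Y"
    and "u \<in> Hom C U W" "u' \<in> Hom C U W'" "s \<cdot> u = s' \<cdot> u'" "s \<cdot> u \<in> cone_in C L" "f \<cdot> u = f' \<cdot> u'"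
  shows "((s, f), (s', f')) \<in> roof_rel C L"
proof -
  have "\<exists>W\<in>Ob C. \<exists>u\<in>Hom C W (Dom C s). \<exists>u'\<in>Hom C W (Dom C s').
      s \<cdot> u = s' \<cdot> u' \<and> s \<cdot> u \<in> cone_in C L \<and> f \<cdot> u = f' \<cdot> u'"
    by (rule bexI[OF _ Hom_Ob(1)[OF assms(7)]], rule bexI[of _ u], rule bexI[of _ u'])
      (use assms HomD[OF assms(1)] HomD[OF assms(4)] in auto)
  then show ?thesis unfolding roof_rel_def
    using roofsI[OF assms(1-3)] roofsI[OF assms(4-6)] HomD[OF assms(1)] HomD[OF assms(4)] HomD[OF assms(3)] HomD[OF assms(6)]
    by simp
qed

lemma roof_rel_refl: "(s, f) \<in> roofs C L \<Longrightarrow> ((s, f), (s, f)) \<in> roof_rel C L"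
proof -
  assume r: "(s, f) \<in> roofs C L"
  then obtain W X Y where s: "s \<in> Hom C W X" "f \<in> Hom C W Y" "s \<in> cone_in C L" by (rule roofsE)
  note i = Ident_in_Hom[OF Hom_Ob(1)[OF s(1)]]
  show ?thesis using roof_relI[OF s(1,3,2,1,3,2) i i] s(3) Comp_Ident[OF s(1)] by simp
qed

lemma roof_class_mem: "(s', f') \<in> roof_class C L s f \<longleftrightarrow> ((s, f), (s', f')) \<in> roof_rel C L"
  by (simp add: roof_class_def)

lemma roof_relD:
  assumes "((s, f), (s', f')) \<in> roof_rel C L"
  shows "(s', f') \<in> roofs C L" "Cod C s' = Cod C s" "Cod C f' = Cod C f"
  using assms by (auto simp: roof_rel_def)

lemma class_Dom_Cod:
  assumes r: "(s, f) \<in> roofs C L" and a: "a = roof_class C L s f"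
  shows "Dom Q a = Cod C s" "Cod Q a = Cod C f"
proof -
  have m: "(s, f) \<in> a" using roof_rel_refl[OF r] a by (simp add: roof_class_mem)
  have e: "Cod C s' = Cod C s" "Cod C f' = Cod C f" if "(s', f') \<in> a" for s' f'
    using that roof_relD(2,3)[of s f s' f'] by (simp_all add: a roof_class_mem)
  have "(\<lambda>(s, f). Cod C s) ` a = (\<lambda>_. Cod C s) ` a" by (rule image_cong) (use e in auto)
  moreover have "(\<lambda>(s, f). Cod C f) ` a = (\<lambda>_. Cod C f) ` a" by (rule image_cong) (use e in auto)
  ultimately have "(\<lambda>(s, f). Cod C s) ` a = {Cod C s}" "(\<lambda>(s, f). Cod C f) ` a = {Cod C f}"
    using m by auto
  then show "Dom Q a = Cod C s" "Cod Q a = Cod C f"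
    by (simp_all add: verdier_quotient_def pre_verdier_quotient_def)
qed

lemma roof_class_Hom:
  assumes "s \<in> Hom C W X" "s \<in> cone_in C L" "f \<in> Hom C W Y"
  shows "roof_class C L s f \<in> Hom Q X Y" "(s, f) \<in> roof_class C L s f"
proof -
  note r = roofsI[OF assms]
  show "(s, f) \<in> roof_class C L s f" using roof_rel_refl[OF r] by (simp add: roof_class_mem)
  have "roof_class C L s f \<in> Arr Q" using r by (auto simp: verdier_quotient_simps roof_class_def quotient_def)
  then show "roof_class C L s f \<in> Hom Q X Y"
    using class_Dom_Cod[OF r refl] HomD(3)[OF assms(1)] HomD(3)[OF assms(3)] by (simp add: Hom_def)
qed

lemma quotient_HomD:
  assumes "a \<in> Hom Q X Y" "(s, f) \<in> a"
  obtains W where "s \<in> Hom C W X" "s \<in> cone_in C L" "f \<in> Hom C W Y"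
proof -
  obtain s0 f0 where r: "(s0, f0) \<in> roofs C L" "a = roof_class C L s0 f0"
    using assms(1) by (auto simp: Hom_def verdier_quotient_simps quotient_def roof_class_def)
  have X: "X = Cod C s0" "Y = Cod C f0" using class_Dom_Cod[OF r] assms(1) by (auto simp: Hom_def)
  have "((s0, f0), (s, f)) \<in> roof_rel C L" using assms(2) r by (simp add: roof_class_mem)
  then have "(s, f) \<in> roofs C L" "Cod C s = X" "Cod C f = Y" using roof_relD X by auto
  then show thesis using that[of "Dom C s"] by (auto simp: roofs_def cone_in_def Hom_def)
qed

lemma quotient_Hom_nonempty:
  assumes "a \<in> Hom Q X Y" shows "a \<noteq> {}"
proof -
  obtain s0 f0 where r: "(s0, f0) \<in> roofs C L" "a = roof_class C L s0 f0"
    using assms(1) by (auto simp: Hom_def verdier_quotient_simps quotient_def roof_class_def)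
  have "(s0, f0) \<in> a" using roof_rel_refl[OF r(1)] r(2) by (simp add: roof_class_mem)
  then show ?thesis by blast
qed

lemma quotient_arrow_Hom:
  assumes "f \<in> Hom C X Y"
  shows "quotient_arrow C L f = roof_class C L (Ident C X) f" "quotient_arrow C L f \<in> Hom Q X Y"
    "(Ident C X, f) \<in> quotient_arrow C L f"
proof -
  have X: "X \<in> Ob C" using Hom_Ob assms by blast
  show e: "quotient_arrow C L f = roof_class C L (Ident C X) f" using HomD[OF assms] by (simp add: quotient_arrow_def)
  show "quotient_arrow C L f \<in> Hom Q X Y" "(Ident C X, f) \<in> quotient_arrow C L f"
    unfolding e using roof_class_Hom[OF Ident_in_Hom[OF X] Ident_cone_in[OF L X] assms] by auto
qed

lemma quotient_Comp:
  "Comp Q b a = (\<Union>(s, f) \<in> a. \<Union>(t, g) \<in> b.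
       \<Union>(t', f') \<in> {(t', f'). t' \<in> cone_in C L \<and> Cod C t' = Dom C f \<and>
                       f' \<in> Hom C (Dom C t') (Dom C t) \<and> f \<cdot> t' = t \<cdot> f'}.
         roof_class C L (s \<cdot> t') (g \<cdot> f'))"
  by (simp add: verdier_quotient_def pre_verdier_quotient_def)

text \<open>Composition in the quotient is a union over all representatives and all squares. One
  member, built from a single Ore square, is what the argument on isomorphic objects
  consumes.\<close>

lemma quotient_Comp_mem:
  assumes a: "a \<in> Hom Q X Y" and b: "b \<in> Hom Q Y Z"
  obtains s f t g t' f' U V W where "s \<in> Hom C W X" "s \<in> cone_in C L" "f \<in> Hom C W Y"
    "t \<in> Hom C V Y" "t \<in> cone_in C L" "g \<in> Hom C V Z" "t' \<in> Hom C U W" "t' \<in> cone_in C L" "f' \<in> Hom C U V"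
    "f \<cdot> t' = t \<cdot> f'" "(s \<cdot> t', g \<cdot> f') \<in> Comp Q b a"
proof -
  obtain s f where sf: "(s, f) \<in> a" using quotient_Hom_nonempty[OF a] by auto
  obtain t g where tg: "(t, g) \<in> b" using quotient_Hom_nonempty[OF b] by auto
  obtain W where s: "s \<in> Hom C W X" "s \<in> cone_in C L" "f \<in> Hom C W Y" using quotient_HomD[OF a sf] .
  obtain V where t: "t \<in> Hom C V Y" "t \<in> cone_in C L" "g \<in> Hom C V Z" using quotient_HomD[OF b tg] .
  obtain U t' f' where t': "t' \<in> Hom C U W" "f' \<in> Hom C U V" "t' \<in> cone_in C L" "f \<cdot> t' = t \<cdot> f'"
    using cone_in_square[OF L t(1,2) s(3)] .
  have "(s \<cdot> t', g \<cdot> f') \<in> roof_class C L (s \<cdot> t') (g \<cdot> f')"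
    using roof_class_Hom(2)[OF Comp_in_Hom[OF t'(1) s(1)] cone_in_Comp(1)[OF L t'(1) s(1) t'(3) s(2)] Comp_in_Hom[OF t'(2) t(3)]] .
  moreover have "Cod C t' = Dom C f" "f' \<in> Hom C (Dom C t') (Dom C t)"
    using HomD[OF t'(1)] HomD[OF s(3)] HomD[OF t(1)] t'(2) by auto
  ultimately have "(s \<cdot> t', g \<cdot> f') \<in> Comp Q b a"
    unfolding quotient_Comp using sf tg t'(3,4) by fast
  then show thesis using that s t t' by blast
qed

text \<open>The numerator extends along the denominator to an arrow
  \<open>X \<rightarrow> Y\<close>, which vanishes by orthogonality.\<close>

lemma roof_zero:
  assumes X: "X \<in> left_orthogonal C B" and Y: "Y \<in> B" and s: "s \<in> Hom C W X" "s \<in> cone_in C L" and f: "f \<in> Hom C W Y"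
  shows "f = Zero C W Y"
proof -
  obtain l where l: "l \<in> Hom C X Y" "l \<cdot> s = f" using cone_in_extend[OF L s f orthogonal_L[OF Y]] by blast
  have "l = Zero C X Y" using X Y l(1) by (auto simp: left_orthogonal_def orthogonal_def)
  then show ?thesis using l(2) Zero_Comp[OF Hom_Ob(2)[OF f] s(1)] by simp
qed

text \<open>All numerators vanish, so any two roofs agree on a common refinement of their
  denominators: there is only one class from \<open>X\<close> to \<open>Y\<close>, given here as an
  explicit set.\<close>

lemma roof_class_eq:
  assumes X: "X \<in> left_orthogonal C B" and Y: "Y \<in> B" and s: "s \<in> Hom C W X" "s \<in> cone_in C L" and f: "f \<in> Hom C W Y"
  shows "roof_class C L s f = {(s', f') \<in> roofs C L. Cod C s' = X \<and> Cod C f' = Y}" (is "_ = ?R")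
proof
  show "roof_class C L s f \<subseteq> ?R"
    using roof_relD[of s f] HomD[OF s(1)] HomD[OF f] by (auto simp: roof_class_mem)
  show "?R \<subseteq> roof_class C L s f"
  proof clarify
    fix s' f' assume r: "(s', f') \<in> roofs C L" and e: "X = Cod C s'" "Y = Cod C f'"
    then obtain W' where s': "s' \<in> Hom C W' X" "s' \<in> cone_in C L" and f': "f' \<in> Hom C W' Y"
      by (auto simp: roofs_def cone_in_def Hom_def)
    obtain U u u' where u: "u \<in> Hom C U W" "u' \<in> Hom C U W'" "u \<in> cone_in C L" "s \<cdot> u = s' \<cdot> u'"
      using cone_in_square[OF L s' s(1)] .
    have "f \<cdot> u = f' \<cdot> u'"
      using roof_zero[OF X Y s f] roof_zero[OF X Y s' f'] Zero_Comp[OF Hom_Ob(2)[OF f] u(1)] Zero_Comp[OF Hom_Ob(2)[OF f] u(2)] by simp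
    moreover have "s \<cdot> u \<in> cone_in C L" using cone_in_Comp(1)[OF L u(1) s(1) u(3) s(2)] .
    ultimately have "((s, f), (s', f')) \<in> roof_rel C L"
      using roof_relI[OF s f s' f' u(1,2,4)] by simp
    then show "(s', f') \<in> roof_class C L s f" by (simp add: roof_class_mem)
  qed
qed

text \<open>Every class occurring in the union is the single class of \<open>roof_class_eq\<close>,
  and at least one occurs. So the composite does not depend on \<open>f\<close>, which is what the
  coproduct argument uses.\<close>

lemma quotient_Comp_zero:
  assumes X: "X \<in> left_orthogonal C B" and Y: "Y \<in> B" and a: "a \<in> Hom Q X Z" and f: "f \<in> Hom C Z Y"
  shows "Comp Q (quotient_arrow C L f) a = {(s', f') \<in> roofs C L. Cod C s' = X \<and> Cod C f' = Y}" (is "_ = ?R")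
proof
  note b = quotient_arrow_Hom(2)[OF f]
  show "Comp Q (quotient_arrow C L f) a \<subseteq> ?R"
  proof
    fix x assume "x \<in> Comp Q (quotient_arrow C L f) a"
    then obtain s k t g t' k' where m: "(s, k) \<in> a" "(t, g) \<in> quotient_arrow C L f" "t' \<in> cone_in C L" "Cod C t' = Dom C k"
      "k' \<in> Hom C (Dom C t') (Dom C t)" and x: "x \<in> roof_class C L (s \<cdot> t') (g \<cdot> k')"
      unfolding quotient_Comp by auto
    obtain W where s: "s \<in> Hom C W X" "s \<in> cone_in C L" "k \<in> Hom C W Z" using quotient_HomD[OF a m(1)] .
    obtain V where t: "t \<in> Hom C V Z" "t \<in> cone_in C L" "g \<in> Hom C V Y" using quotient_HomD[OF b m(2)] .
    have t': "t' \<in> Hom C (Dom C t') W" using m(3,4) HomD[OF s(3)] by (auto simp: cone_in_def Hom_def)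
    have k': "k' \<in> Hom C (Dom C t') V" using m(5) HomD[OF t(1)] by simp
    show "x \<in> ?R"
      using x roof_class_eq[OF X Y Comp_in_Hom[OF t' s(1)] cone_in_Comp(1)[OF L t' s(1) m(3) s(2)] Comp_in_Hom[OF k' t(3)]] by simp
  qed
  obtain s k where sk: "(s, k) \<in> a" using quotient_Hom_nonempty[OF a] by auto
  obtain W where s: "s \<in> Hom C W X" "s \<in> cone_in C L" "k \<in> Hom C W Z" using quotient_HomD[OF a sk] .
  have O: "W \<in> Ob C" "Z \<in> Ob C" using Hom_Ob s by auto
  have "roof_class C L (s \<cdot> Ident C W) (f \<cdot> k) \<subseteq> Comp Q (quotient_arrow C L f) a"
  proof
    fix x assume x: "x \<in> roof_class C L (s \<cdot> Ident C W) (f \<cdot> k)"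
    have "(Ident C W, k) \<in> {(t', f'). t' \<in> cone_in C L \<and> Cod C t' = Dom C k \<and>
        f' \<in> Hom C (Dom C t') (Dom C (Ident C Z)) \<and> k \<cdot> t' = Ident C Z \<cdot> f'}"
      using Ident_cone_in[OF L O(1)] HomD[OF s(3)] s(3) O Comp_Ident[OF s(3)] Ident_Comp[OF s(3)]
      by (simp add: Dom_Ident Cod_Ident)
    then show "x \<in> Comp Q (quotient_arrow C L f) a"
      unfolding quotient_Comp using sk quotient_arrow_Hom(3)[OF f] x by fast
  qed
  moreover have "roof_class C L (s \<cdot> Ident C W) (f \<cdot> k) = ?R"
    using roof_class_eq[OF X Y s(1,2) Comp_in_Hom[OF s(3) f]] Comp_Ident[OF s(1)] by simp
  ultimately show "?R \<subseteq> Comp Q (quotient_arrow C L f) a" by simp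
qed

text \<open>Equality of classes means that \<open>f\<close> vanishes after some arrow with cone in
  \<open>L\<close>, and such arrows can be cancelled before local targets.\<close>

lemma quotient_arrow_eq_Zero:
  assumes Y: "Y \<in> B" and f: "f \<in> Hom C X Y" and e: "quotient_arrow C L f = quotient_arrow C L (Zero C X Y)"
  shows "f = Zero C X Y"
proof -
  have O: "X \<in> Ob C" "Y \<in> Ob C" using Hom_Ob f by auto
  have "(Ident C X, Zero C X Y) \<in> roof_class C L (Ident C X) f"
    using quotient_arrow_Hom(3)[OF Zero_in_Hom[OF O]] e quotient_arrow_Hom(1)[OF f] by simp
  then obtain W u u' where u: "u \<in> Hom C W (Dom C (Ident C X))" "u' \<in> Hom C W (Dom C (Ident C X))"
    "Ident C X \<cdot> u \<in> cone_in C L" "f \<cdot> u = Zero C X Y \<cdot> u'"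
    unfolding roof_class_mem roof_rel_def by blast
  have u': "u \<in> Hom C W X" "u' \<in> Hom C W X" using u O by (auto simp: Dom_Ident)
  have "f \<cdot> u = Zero C W Y" using u(4) Zero_Comp[OF O(2) u'(2)] by simp
  moreover have "u \<in> cone_in C L" using u(3) Ident_Comp[OF u'(1)] by simp
  ultimately show ?thesis using cone_in_epi[OF L u'(1) _ f _ orthogonal_L[OF Y]] by blast
qed

text \<open>The identity of \<open>X'\<close> factors through \<open>X\<close> in the quotient. On
  roofs, \<open>f \<cdot> u\<close> then contains the factor \<open>f \<cdot> g\<close>, the
  numerator of a roof from \<open>X\<close> to \<open>Y\<close>, which is zero.\<close>

lemma left_orthogonal_quotient_isomorphic:
  assumes X: "X \<in> left_orthogonal C B" and i: "isomorphism Q a" "a \<in> Hom Q X X' \<or> a \<in> Hom Q X' X"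
  shows "X' \<in> left_orthogonal C B"
proof -
  obtain a' where a': "a' \<in> Hom Q (Cod Q a) (Dom Q a)" "Comp Q a' a = Ident Q (Dom Q a)" "Comp Q a a' = Ident Q (Cod Q a)"
    using i(1) by (auto simp: isomorphism_def inverse_arrows_def)
  obtain b c where b: "b \<in> Hom Q X' X" and c: "c \<in> Hom Q X X'" and cb: "Comp Q c b = Ident Q X'"
    using i(2) a' by (auto simp: Hom_def)
  obtain s k t g t' k' U V W where m: "s \<in> Hom C W X'" "s \<in> cone_in C L" "k \<in> Hom C W X"
    "t \<in> Hom C V X" "t \<in> cone_in C L" "g \<in> Hom C V X'" "t' \<in> Hom C U W" "t' \<in> cone_in C L" "k' \<in> Hom C U V"
    and eq: "(s \<cdot> t', g \<cdot> k') \<in> Comp Q c b"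
    using quotient_Comp_mem[OF b c] by metis
  have X': "X' \<in> Ob C" using Hom_Ob m by blast
  have "(s \<cdot> t', g \<cdot> k') \<in> roof_class C L (Ident C X') (Ident C X')"
    using eq cb quotient_arrow_Hom(1)[OF Ident_in_Hom[OF X']] by (simp add: verdier_quotient_simps)
  then obtain W' u u' where u: "u \<in> Hom C W' (Dom C (Ident C X'))" "u' \<in> Hom C W' (Dom C (s \<cdot> t'))"
    "Ident C X' \<cdot> u \<in> cone_in C L" "Ident C X' \<cdot> u = (g \<cdot> k') \<cdot> u'"
    unfolding roof_class_mem roof_rel_def by blast
  have u1: "u \<in> Hom C W' X'" using u X' by (simp add: Dom_Ident)
  have u2: "u' \<in> Hom C W' U" using u(2) HomD[OF Comp_in_Hom[OF m(7) m(1)]] by simp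
  have u3: "u \<in> cone_in C L" "u = (g \<cdot> k') \<cdot> u'" using u(3,4) Ident_Comp[OF u1] by auto
  show ?thesis unfolding left_orthogonal_def orthogonal_def
  proof (intro CollectI conjI ballI X')
    fix Y f assume Y: "Y \<in> B" and f: "f \<in> Hom C X' Y"
    have "f \<cdot> g = Zero C V Y" using roof_zero[OF X Y m(4,5) Comp_in_Hom[OF m(6) f]] .
    moreover have "f \<cdot> u = (f \<cdot> g) \<cdot> (k' \<cdot> u')"
      using u3(2) f m(6,9) u2 by (simp add: Hom_def cat_simps)
    ultimately have "f \<cdot> u = Zero C W' Y"
      using Zero_Comp[OF Hom_Ob(2)[OF f] Comp_in_Hom[OF u2 m(9)]] by simp
    then show "f = Zero C X' Y" using cone_in_epi[OF L u1 u3(1) f _ orthogonal_L[OF Y]] by blast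
  qed
qed

text \<open>
  The coproduct case uses only the uniqueness part of the universal property, so that coproducts in
  the quotient need not be compared with coproducts in \<open>C\<close>.
\<close>

lemma left_orthogonal_localizing_quotient:
  "localizing \<kappa> Q (left_orthogonal C B)"
  unfolding localizing_def triangulated_subcategory_def verdier_quotient_simps
proof (intro conjI allI impI ballI)
  show "left_orthogonal C B \<subseteq> Ob C" by (auto simp: left_orthogonal_def)
  show "X \<in> left_orthogonal C B \<longleftrightarrow> Sh C X \<in> left_orthogonal C B" if "X \<in> Ob C" for X
    using left_orthogonal_shift[OF B that] by simp
  show "Y \<in> left_orthogonal C B" if "X \<in> left_orthogonal C B" "Y \<in> Ob C" "isomorphic Q X Y" for X Y
    using that left_orthogonal_quotient_isomorphic unfolding isomorphic_def by blast
  show "Z \<in> left_orthogonal C B" if z: "zero_object Q Z" for Z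
  proof -
    have Z: "Z \<in> Ob C" using z by (simp add: zero_object_def verdier_quotient_simps)
    have "f = Zero C Z Y" if Y: "Y \<in> B" and f: "f \<in> Hom C Z Y" for f Y
    proof (rule quotient_arrow_eq_Zero[OF Y f])
      have YO: "Y \<in> Ob C" using Hom_Ob f by blast
      have "\<exists>!k. k \<in> Hom Q Z Y" using z YO by (simp add: zero_object_def verdier_quotient_simps)
      then show "quotient_arrow C L f = quotient_arrow C L (Zero C Z Y)"
        using quotient_arrow_Hom(2)[OF f] quotient_arrow_Hom(2)[OF Zero_in_Hom[OF Z YO]] by blast
    qed
    then show ?thesis using Z by (simp add: left_orthogonal_def orthogonal_def)
  qed
  show "Cod Q g \<in> left_orthogonal C B"
    if t: "(f, g, h) \<in> Tri Q" "Dom Q f \<in> left_orthogonal C B" "Cod Q f \<in> left_orthogonal C B" for f g h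
  proof -
    \<comment> \<open>Distinguished triangles of the quotient are by definition isomorphic to images
      of triangles in \<open>C\<close>, so the cone is checked there and carried across the
      isomorphism.\<close>
    obtain f0 g0 h0 where t0: "(f0, g0, h0) \<in> Tri C"
      and i: "triangles_isomorphic (pre_verdier_quotient C L)
         (quotient_arrow C L f0, quotient_arrow C L g0, quotient_arrow C L h0) (f, g, h)"
      using t(1) by (auto simp: verdier_quotient_def)
    obtain X Y Z where fg: "f0 \<in> Hom C X Y" "g0 \<in> Hom C Y Z" "h0 \<in> Hom C Z (Sh C X)" using TriD[OF t0] .
    note d = quotient_arrow_Hom(2)[OF fg(1)] quotient_arrow_Hom(2)[OF fg(2)] quotient_arrow_Hom(2)[OF fg(3)]
    have d': "Dom Q (quotient_arrow C L f0) = X" "Dom Q (quotient_arrow C L g0) = Y" "Dom Q (quotient_arrow C L h0) = Z"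
      using d by (auto simp: Hom_def)
    obtain u v w where u: "u \<in> Hom Q X (Dom Q f)" "isomorphism Q u" and v: "v \<in> Hom Q Y (Dom Q g)" "isomorphism Q v"
      and w: "w \<in> Hom Q Z (Dom Q h)" "isomorphism Q w"
      using i unfolding triangles_isomorphic_def verdier_quotient_simps by (auto simp: d')
    have c: "Cod Q f = Dom Q g" "Cod Q g = Dom Q h"
      using i unfolding triangles_isomorphic_def candidate_triangle_def verdier_quotient_simps by auto
    have "X \<in> left_orthogonal C B" using left_orthogonal_quotient_isomorphic[OF t(2) u(2)] u(1) by blast
    moreover have "Y \<in> left_orthogonal C B" using left_orthogonal_quotient_isomorphic[OF t(3) v(2)] v(1) c by simp
    moreover have "triangulated_subcategory C (left_orthogonal C B)"
      using left_orthogonal_localizing[OF B, of \<kappa>] by (simp add: localizing_def)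
    ultimately have "Z \<in> left_orthogonal C B"
      using triangulated_subcategory_two_of_three(1)[OF _ t0 fg(1,2)] by blast
    then show ?thesis using left_orthogonal_quotient_isomorphic[OF _ w(2)] w(1) c by simp
  qed
  show "A \<in> left_orthogonal C B" if X: "X ` I \<subseteq> left_orthogonal C B" and A: "coproduct Q I X A \<iota>" for I X A \<iota>
  proof -
    have AO: "A \<in> Ob C" using A by (simp add: coproduct_def verdier_quotient_simps)
    have \<iota>: "\<iota> i \<in> Hom Q (X i) A" if "i \<in> I" for i using A that by (simp add: coproduct_def)
    have "f = Zero C A Y" if Y: "Y \<in> B" and f: "f \<in> Hom C A Y" for f Y
    proof (rule quotient_arrow_eq_Zero[OF Y f])
      have YO: "Y \<in> Ob C" using Hom_Ob f by blast
      \<comment> \<open>The only class from \<open>X i\<close> to \<open>Y\<close>. Both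
        \<open>f\<close> and the zero arrow induce this family on the summands, so uniqueness of the
        induced arrow identifies their classes.\<close>
      define R where "R i = {(s', f') \<in> roofs C L. Cod C s' = X i \<and> Cod C f' = Y}" for i
      have XO: "X i \<in> left_orthogonal C B" "X i \<in> Ob C" if "i \<in> I" for i
        using X that by (auto simp: left_orthogonal_def)
      have Ri: "R i \<in> Hom Q (X i) Y" if i: "i \<in> I" for i
        using roof_class_eq[OF XO(1)[OF i] Y Ident_in_Hom[OF XO(2)[OF i]] Ident_cone_in[OF L XO(2)[OF i]] Zero_in_Hom[OF XO(2)[OF i] YO]]
          roof_class_Hom(1)[OF Ident_in_Hom[OF XO(2)[OF i]] Ident_cone_in[OF L XO(2)[OF i]] Zero_in_Hom[OF XO(2)[OF i] YO]]
        by (simp add: R_def)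
      have "\<exists>!h. h \<in> Hom Q A Y \<and> (\<forall>i\<in>I. Comp Q h (\<iota> i) = R i)"
        using A Ri YO unfolding coproduct_def verdier_quotient_simps by blast
      moreover have "Comp Q (quotient_arrow C L k) (\<iota> i) = R i" if "k \<in> Hom C A Y" "i \<in> I" for k i
        using quotient_Comp_zero[OF XO(1)[OF that(2)] Y \<iota>[OF that(2)] that(1)] by (simp add: R_def)
      ultimately show "quotient_arrow C L f = quotient_arrow C L (Zero C A Y)"
        using quotient_arrow_Hom(2)[OF f] quotient_arrow_Hom(2)[OF Zero_in_Hom[OF AO YO]] f Zero_in_Hom[OF AO YO] by blast
    qed
    then show ?thesis using AO by (simp add: left_orthogonal_def orthogonal_def)
  qed
qed

text \<open>The left orthogonal is localizing in the quotient and contains the unit, hence contains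
  every object, \<open>Y\<close> included; so \<open>Y\<close> is orthogonal to itself.\<close>

lemma unigenic_quotient_zero:
  assumes "unigenic \<kappa> Q" "Unit C \<in> left_orthogonal C B" "Y \<in> B"
  shows "zero_object C Y"
proof -
  have "Loc \<kappa> Q {Unit C} = Ob C" using assms(1) by (simp add: unigenic_def verdier_quotient_simps)
  moreover have "Loc \<kappa> Q {Unit C} \<subseteq> left_orthogonal C B"
    unfolding Loc_def using left_orthogonal_localizing_quotient assms(2) by blast
  moreover have Y: "Y \<in> Ob C" using B assms(3) by (auto simp: shift_stable_def)
  ultimately have "Y \<in> left_orthogonal C B" by blast
  then show ?thesis using zero_object_orthogonal[OF Y] assms(3) by (simp add: left_orthogonal_def)
qed

end

section \<open>Symmetric monoidal categories\<close>

context symmetric_monoidal_category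
begin

lemma Arr_TensA: "f \<in> Arr C \<Longrightarrow> g \<in> Arr C \<Longrightarrow> f \<star> g \<in> Arr C"
  and Dom_TensA: "f \<in> Arr C \<Longrightarrow> g \<in> Arr C \<Longrightarrow> Dom C (f \<star> g) = Dom C f \<boxtimes> Dom C g"
  and Cod_TensA: "f \<in> Arr C \<Longrightarrow> g \<in> Arr C \<Longrightarrow> Cod C (f \<star> g) = Cod C f \<boxtimes> Cod C g"
  using TensA_in_Hom[of f "Dom C f" "Cod C f" g "Dom C g" "Cod C g"] by (auto simp: Hom_def)

lemma TensA_Comp_Arr:
  assumes "f \<in> Arr C" "f' \<in> Arr C" "g \<in> Arr C" "g' \<in> Arr C" "Dom C f' = Cod C f" "Dom C g' = Cod C g"
  shows "(f' \<star> g') \<cdot> (f \<star> g) = (f' \<cdot> f) \<star> (g' \<cdot> g)"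
  using TensA_Comp[of f "Dom C f" "Cod C f" f' "Cod C f'" g "Dom C g" "Cod C g" g' "Cod C g'"] assms
  by (auto simp: Hom_def)

lemma Assoc_simps:
  assumes "X \<in> Ob C" "Y \<in> Ob C" "Z \<in> Ob C"
  shows "Assoc C X Y Z \<in> Arr C" "Dom C (Assoc C X Y Z) = (X \<boxtimes> Y) \<boxtimes> Z" "Cod C (Assoc C X Y Z) = X \<boxtimes> (Y \<boxtimes> Z)"
    "Assoc C X Y Z \<in> Hom C ((X \<boxtimes> Y) \<boxtimes> Z) (X \<boxtimes> (Y \<boxtimes> Z))" "isomorphism C (Assoc C X Y Z)"
  using Assoc_in_Hom[OF assms] by (auto simp: Hom_def)

lemma LUnit_simps:
  assumes "X \<in> Ob C"
  shows "LUnit C X \<in> Arr C" "Dom C (LUnit C X) = Unit C \<boxtimes> X" "Cod C (LUnit C X) = X"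
    "LUnit C X \<in> Hom C (Unit C \<boxtimes> X) X" "isomorphism C (LUnit C X)"
  using LUnit_in_Hom[OF assms] by (auto simp: Hom_def)

lemma RUnit_simps:
  assumes "X \<in> Ob C"
  shows "RUnit C X \<in> Arr C" "Dom C (RUnit C X) = X \<boxtimes> Unit C" "Cod C (RUnit C X) = X"
    "RUnit C X \<in> Hom C (X \<boxtimes> Unit C) X" "isomorphism C (RUnit C X)"
  using RUnit_in_Hom[OF assms] by (auto simp: Hom_def)

lemma Braid_simps:
  assumes "X \<in> Ob C" "Y \<in> Ob C"
  shows "Braid C X Y \<in> Arr C" "Dom C (Braid C X Y) = X \<boxtimes> Y" "Cod C (Braid C X Y) = Y \<boxtimes> X"
    "Braid C X Y \<in> Hom C (X \<boxtimes> Y) (Y \<boxtimes> X)" "isomorphism C (Braid C X Y)"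
  using Braid_in_Hom[OF assms] isomorphismI[OF Braid_in_Hom[OF assms] Braid_in_Hom[OF assms(2,1)]
      Braid_symmetric[OF assms] Braid_symmetric[OF assms(2,1)]] by (auto simp: Hom_def)

lemmas mon_simps = cat_simps Arr_TensA Dom_TensA Cod_TensA Tens_in_Ob Unit_in_Ob
  Assoc_simps(1-3) LUnit_simps(1-3) RUnit_simps(1-3) Braid_simps(1-3)

lemma isomorphism_TensA:
  assumes "isomorphism C f" "isomorphism C g" "f \<in> Hom C X X'" "g \<in> Hom C Y Y'"
  shows "isomorphism C (f \<star> g)"
proof -
  obtain f' where f': "f' \<in> Hom C X' X" "f' \<cdot> f = Ident C X" "f \<cdot> f' = Ident C X'"
    using isomorphismE[OF assms(1,3)] by metis
  obtain g' where g': "g' \<in> Hom C Y' Y" "g' \<cdot> g = Ident C Y" "g \<cdot> g' = Ident C Y'"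
    using isomorphismE[OF assms(2,4)] by metis
  have O: "X \<in> Ob C" "X' \<in> Ob C" "Y \<in> Ob C" "Y' \<in> Ob C" using Hom_Ob assms(3,4) by auto
  show ?thesis
    by (rule isomorphismI[OF TensA_in_Hom[OF assms(3,4)] TensA_in_Hom[OF f'(1) g'(1)]])
      (use TensA_Comp[OF assms(3) f'(1) assms(4) g'(1)] TensA_Comp[OF f'(1) assms(3) g'(1) assms(4)]
        f' g' O TensA_Ident in auto)
qed

lemma isomorphic_TensA: "isomorphic C X X' \<Longrightarrow> isomorphic C Y Y' \<Longrightarrow> isomorphic C (X \<boxtimes> Y) (X' \<boxtimes> Y')"
  unfolding isomorphic_def using isomorphism_TensA TensA_in_Hom by metis

lemma isomorphic_Braid: "X \<in> Ob C \<Longrightarrow> Y \<in> Ob C \<Longrightarrow> isomorphic C (X \<boxtimes> Y) (Y \<boxtimes> X)"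
  using isomorphicI[OF Braid_simps(4,5)] .

lemma isomorphic_Assoc: "X \<in> Ob C \<Longrightarrow> Y \<in> Ob C \<Longrightarrow> Z \<in> Ob C \<Longrightarrow> isomorphic C ((X \<boxtimes> Y) \<boxtimes> Z) (X \<boxtimes> (Y \<boxtimes> Z))"
  using isomorphicI[OF Assoc_simps(4,5)] .

lemma isomorphic_LUnit: "X \<in> Ob C \<Longrightarrow> isomorphic C (Unit C \<boxtimes> X) X"
  using isomorphicI[OF LUnit_simps(4,5)] .

lemma isomorphic_RUnit: "X \<in> Ob C \<Longrightarrow> isomorphic C (X \<boxtimes> Unit C) X"
  using isomorphicI[OF RUnit_simps(4,5)] .

text \<open>Naturality of the left unitor makes tensoring with the unit faithful.\<close>

lemma Ident_Unit_TensA_inj: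
  assumes "f \<in> Hom C X Y" "g \<in> Hom C X Y" "Ident C (Unit C) \<star> f = Ident C (Unit C) \<star> g"
  shows "f = g"
proof (rule isomorphism_right_cancel[OF _ _ assms(1,2)])
  have X: "X \<in> Ob C" using Hom_Ob assms by blast
  show "isomorphism C (LUnit C X)" "LUnit C X \<in> Hom C (Unit C \<boxtimes> X) X" using LUnit_simps X by auto
  show "f \<cdot> LUnit C X = g \<cdot> LUnit C X"
    using LUnit_natural[OF assms(1)] LUnit_natural[OF assms(2)] assms(3) by simp
qed

text \<open>Kelly's argument: both sides agree after tensoring with the unit, by the pentagon and the triangle.\<close>

lemma LUnit_Tens:
  assumes X: "X \<in> Ob C" and Y: "Y \<in> Ob C"
  shows "LUnit C (X \<boxtimes> Y) \<cdot> Assoc C (Unit C) X Y = LUnit C X \<star> Ident C Y"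
proof (rule Ident_Unit_TensA_inj)
  let ?I = "Unit C"
  note U = Unit_in_Ob
  show 1: "LUnit C (X \<boxtimes> Y) \<cdot> Assoc C ?I X Y \<in> Hom C ((?I \<boxtimes> X) \<boxtimes> Y) (X \<boxtimes> Y)"
    "LUnit C X \<star> Ident C Y \<in> Hom C ((?I \<boxtimes> X) \<boxtimes> Y) (X \<boxtimes> Y)"
    using X Y U by (simp_all add: Hom_def mon_simps)
  define k where "k = Assoc C ?I (?I \<boxtimes> X) Y \<cdot> (Assoc C ?I ?I X \<star> Ident C Y)"
  have kH: "k \<in> Hom C (((?I \<boxtimes> ?I) \<boxtimes> X) \<boxtimes> Y) (?I \<boxtimes> ((?I \<boxtimes> X) \<boxtimes> Y))"
    unfolding k_def using X Y U by (simp add: Hom_def mon_simps)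
  have "isomorphism C (Assoc C ?I ?I X \<star> Ident C Y)"
    by (rule isomorphism_TensA[OF Assoc_simps(5)[OF U U X] isomorphism_Ident[OF Y] Assoc_simps(4)[OF U U X] Ident_in_Hom[OF Y]])
  then have ki: "isomorphism C k" unfolding k_def
    using isomorphism_Comp[OF _ Assoc_simps(5)[OF U Tens_in_Ob[OF U X] Y]
        TensA_in_Hom[OF Assoc_simps(4)[OF U U X] Ident_in_Hom[OF Y]] Assoc_simps(4)[OF U Tens_in_Ob[OF U X] Y]] by blast
  have "(Ident C ?I \<star> (LUnit C (X \<boxtimes> Y) \<cdot> Assoc C ?I X Y)) \<cdot> k =
    (Ident C ?I \<star> LUnit C (X \<boxtimes> Y)) \<cdot> ((Ident C ?I \<star> Assoc C ?I X Y) \<cdot> k)"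
    using X Y U kH TensA_Comp_Arr[of "Ident C ?I" "Ident C ?I" "Assoc C ?I X Y" "LUnit C (X \<boxtimes> Y)"]
      Comp_assoc_Arr[of k "Ident C ?I \<star> Assoc C ?I X Y" "Ident C ?I \<star> LUnit C (X \<boxtimes> Y)"]
    by (simp add: Hom_def mon_simps)
  also have "(Ident C ?I \<star> Assoc C ?I X Y) \<cdot> k = Assoc C ?I ?I (X \<boxtimes> Y) \<cdot> Assoc C (?I \<boxtimes> ?I) X Y"
    unfolding k_def using pentagon[OF U U X Y] by simp
  also have "(Ident C ?I \<star> LUnit C (X \<boxtimes> Y)) \<cdot> (Assoc C ?I ?I (X \<boxtimes> Y) \<cdot> Assoc C (?I \<boxtimes> ?I) X Y) =
      (RUnit C ?I \<star> Ident C (X \<boxtimes> Y)) \<cdot> Assoc C (?I \<boxtimes> ?I) X Y"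
    using X Y U Comp_rewrite[OF triangle[OF U Tens_in_Ob[OF X Y]]] by (simp add: mon_simps)
  also have "\<dots> = Assoc C ?I X Y \<cdot> ((RUnit C ?I \<star> Ident C X) \<star> Ident C Y)"
    using Assoc_natural[OF RUnit_simps(4)[OF U] Ident_in_Hom[OF X] Ident_in_Hom[OF Y]] TensA_Ident[OF X Y] by simp
  also have "RUnit C ?I \<star> Ident C X = (Ident C ?I \<star> LUnit C X) \<cdot> Assoc C ?I ?I X" using triangle[OF U X] by simp
  also have "\<dots> \<star> Ident C Y = ((Ident C ?I \<star> LUnit C X) \<star> Ident C Y) \<cdot> (Assoc C ?I ?I X \<star> Ident C Y)"
    using X Y U by (simp add: TensA_Comp_Arr mon_simps)
  also have "Assoc C ?I X Y \<cdot> \<dots> = (Assoc C ?I X Y \<cdot> ((Ident C ?I \<star> LUnit C X) \<star> Ident C Y)) \<cdot> (Assoc C ?I ?I X \<star> Ident C Y)"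
    using X Y U by (simp add: mon_simps)
  also have "Assoc C ?I X Y \<cdot> ((Ident C ?I \<star> LUnit C X) \<star> Ident C Y) =
      (Ident C ?I \<star> (LUnit C X \<star> Ident C Y)) \<cdot> Assoc C ?I (?I \<boxtimes> X) Y"
    using Assoc_natural[OF Ident_in_Hom[OF U] LUnit_simps(4)[OF X] Ident_in_Hom[OF Y]] .
  also have "\<dots> \<cdot> (Assoc C ?I ?I X \<star> Ident C Y) = (Ident C ?I \<star> (LUnit C X \<star> Ident C Y)) \<cdot> k"
    unfolding k_def using X Y U by (simp add: mon_simps)
  finally have "(Ident C ?I \<star> (LUnit C (X \<boxtimes> Y) \<cdot> Assoc C ?I X Y)) \<cdot> k = (Ident C ?I \<star> (LUnit C X \<star> Ident C Y)) \<cdot> k" .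
  then show "Ident C ?I \<star> (LUnit C (X \<boxtimes> Y) \<cdot> Assoc C ?I X Y) = Ident C ?I \<star> (LUnit C X \<star> Ident C Y)"
    by (rule isomorphism_right_cancel[OF ki kH TensA_in_Hom[OF Ident_in_Hom[OF U] 1(1)] TensA_in_Hom[OF Ident_in_Hom[OF U] 1(2)]])
qed

text \<open>Naturality of the left unitor at itself computes it on the square of the unit; then
  \<open>LUnit_Tens\<close> and the triangle axiom make both unitors agree after tensoring with the
  unit, which naturality of \<open>RUnit\<close> cancels. This is needed for the self-duality of the
  unit.\<close>

lemma LUnit_Unit_eq_RUnit: "LUnit C (Unit C) = RUnit C (Unit C)"
proof -
  let ?I = "Unit C"
  note U = Unit_in_Ob
  have 1: "LUnit C (?I \<boxtimes> ?I) = Ident C ?I \<star> LUnit C ?I"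
    using isomorphism_left_cancel[OF LUnit_simps(5)[OF U] LUnit_simps(4)[OF U], of "LUnit C (?I \<boxtimes> ?I)" "?I \<boxtimes> (?I \<boxtimes> ?I)" "Ident C ?I \<star> LUnit C ?I"]
      LUnit_natural[OF LUnit_simps(4)[OF U]] LUnit_simps(4)[OF Tens_in_Ob[OF U U]]
      TensA_in_Hom[OF Ident_in_Hom[OF U] LUnit_simps(4)[OF U]] by simp
  have e: "LUnit C ?I \<star> Ident C ?I = RUnit C ?I \<star> Ident C ?I"
    using LUnit_Tens[OF U U] 1 triangle[OF U U] by simp
  show ?thesis
  proof (rule isomorphism_right_cancel[OF RUnit_simps(5)[OF Tens_in_Ob[OF U U]] RUnit_simps(4)[OF Tens_in_Ob[OF U U]] LUnit_simps(4)[OF U] RUnit_simps(4)[OF U]])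
    show "LUnit C ?I \<cdot> RUnit C (?I \<boxtimes> ?I) = RUnit C ?I \<cdot> RUnit C (?I \<boxtimes> ?I)"
      using RUnit_natural[OF LUnit_simps(4)[OF U]] RUnit_natural[OF RUnit_simps(4)[OF U]] e by simp
  qed
qed

text \<open>Additivity and preservation of coproducts are established for tensoring on the right;
  conjugation with the braiding moves them to the left.\<close>

lemma left_TensA_Braid:
  assumes "f \<in> Hom C X Y" "W \<in> Ob C"
  shows "Ident C W \<star> f = Braid C Y W \<cdot> ((f \<star> Ident C W) \<cdot> Braid C W X)"
proof -
  have O: "X \<in> Ob C" "Y \<in> Ob C" using Hom_Ob assms by auto
  have "Braid C Y W \<cdot> ((f \<star> Ident C W) \<cdot> Braid C W X) = ((Ident C W \<star> f) \<cdot> Braid C X W) \<cdot> Braid C W X"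
    using Comp_rewrite[OF Braid_natural[OF assms(1) Ident_in_Hom[OF assms(2)]]] assms O by (simp add: Hom_def mon_simps)
  also have "\<dots> = Ident C W \<star> f"
    using assms O Braid_symmetric[OF assms(2) O(1)] by (simp add: Hom_def mon_simps)
  finally show ?thesis by simp
qed

end

section \<open>Tensor products in a tt-category\<close>

context tt_category
begin

lemma TensA_Ident_in_Hom: "f \<in> Hom C X Y \<Longrightarrow> W \<in> Ob C \<Longrightarrow> f \<star> Ident C W \<in> Hom C (X \<boxtimes> W) (Y \<boxtimes> W)"
  and Ident_TensA_in_Hom: "f \<in> Hom C X Y \<Longrightarrow> W \<in> Ob C \<Longrightarrow> Ident C W \<star> f \<in> Hom C (W \<boxtimes> X) (W \<boxtimes> Y)"
  using TensA_in_Hom Ident_in_Hom by blast+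

lemma TensA_Add:
  assumes "f \<in> Hom C X Y" "g \<in> Hom C X Y" "W \<in> Ob C"
  shows "(f \<boxplus> g) \<star> Ident C W = (f \<star> Ident C W) \<boxplus> (g \<star> Ident C W)"
proof -
  have "FArr (tensor_right C W) \<in> hom (hom_group C X Y) (hom_group C (X \<boxtimes> W) (Y \<boxtimes> W))"
    using Tens_exact[OF assms(3)] Hom_Ob[OF assms(1)] by (simp add: exact_functor_def tensor_right_def)
  then show ?thesis using assms by (auto simp: hom_def carrier_hom_group mult_hom_group tensor_right_def)
qed

lemma TensA_Zero:
  assumes "X \<in> Ob C" "Y \<in> Ob C" "W \<in> Ob C"
  shows "Zero C X Y \<star> Ident C W = Zero C (X \<boxtimes> W) (Y \<boxtimes> W)"
proof -
  note z = Zero_in_Hom[OF assms(1,2)]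
  note zW = TensA_Ident_in_Hom[OF z assms(3)]
  have "(Zero C X Y \<star> Ident C W) \<boxplus> (Zero C X Y \<star> Ident C W) = Zero C X Y \<star> Ident C W"
    using TensA_Add[OF z z assms(3)] Add_Zero[OF z] by simp
  then show ?thesis
    using Add_right_cancel[OF zW Zero_in_Hom zW] Zero_Add[OF zW] Hom_Ob[OF zW] by simp
qed

lemma left_TensA_Add:
  assumes "f \<in> Hom C X Y" "g \<in> Hom C X Y" "W \<in> Ob C"
  shows "Ident C W \<star> (f \<boxplus> g) = (Ident C W \<star> f) \<boxplus> (Ident C W \<star> g)"
proof -
  have O: "X \<in> Ob C" "Y \<in> Ob C" using Hom_Ob assms by auto
  note fW = TensA_Ident_in_Hom[OF assms(1,3)] and gW = TensA_Ident_in_Hom[OF assms(2,3)]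
  note b = Braid_simps(4)[OF assms(3) O(1)] and b' = Braid_simps(4)[OF O(2) assms(3)]
  show ?thesis
    unfolding left_TensA_Braid[OF Add_in_Hom[OF assms(1,2)] assms(3)] left_TensA_Braid[OF assms(1,3)]
      left_TensA_Braid[OF assms(2,3)] TensA_Add[OF assms]
    using Add_Comp[OF b fW gW] Comp_Add[OF Comp_in_Hom[OF b fW] Comp_in_Hom[OF b gW] b'] by simp
qed

lemma left_TensA_Zero:
  assumes "X \<in> Ob C" "Y \<in> Ob C" "W \<in> Ob C"
  shows "Ident C W \<star> Zero C X Y = Zero C (W \<boxtimes> X) (W \<boxtimes> Y)"
  using left_TensA_Braid[OF Zero_in_Hom[OF assms(1,2)] assms(3)] TensA_Zero[OF assms]
    Zero_Comp[OF Tens_in_Ob[OF assms(2,3)] Braid_simps(4)[OF assms(3,1)]]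
    Comp_Zero[OF Tens_in_Ob[OF assms(3,1)] Braid_simps(4)[OF assms(2,3)]] by simp

lemma Susp_simps:
  assumes "X \<in> Ob C" "W \<in> Ob C"
  shows "Susp C X W \<in> Hom C (Sh C X \<boxtimes> W) (Sh C (X \<boxtimes> W))" "isomorphism C (Susp C X W)"
proof -
  have "natural_isomorphism C C (comp_fun (tensor_right C W) (shift_fun C)) (comp_fun (shift_fun C) (tensor_right C W)) (\<lambda>X. Susp C X W)"
    using Tens_exact[OF assms(2)] by (simp add: exact_functor_def)
  from natural_isomorphismD(1,2)[OF this assms(1)]
  show "Susp C X W \<in> Hom C (Sh C X \<boxtimes> W) (Sh C (X \<boxtimes> W))" "isomorphism C (Susp C X W)"
    by (simp_all add: comp_fun_def tensor_right_def shift_fun_def)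
qed

lemma isomorphic_Susp: "X \<in> Ob C \<Longrightarrow> W \<in> Ob C \<Longrightarrow> isomorphic C (Sh C X \<boxtimes> W) (Sh C (X \<boxtimes> W))"
  using isomorphicI[OF Susp_simps] .

lemma tensor_triangle:
  assumes t: "(f, g, h) \<in> Tri C" "f \<in> Hom C X Y" and W: "W \<in> Ob C"
  shows "(f \<star> Ident C W, g \<star> Ident C W, Susp C X W \<cdot> (h \<star> Ident C W)) \<in> Tri C"
proof -
  have "\<forall>f g h. (f, g, h) \<in> Tri C \<longrightarrow> (f \<star> Ident C W, g \<star> Ident C W, Susp C (Dom C f) W \<cdot> (h \<star> Ident C W)) \<in> Tri C"
    using Tens_exact[OF W] by (simp add: exact_functor_def tensor_right_def)
  then show ?thesis using t HomD(2)[OF t(2)] by auto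
qed

text \<open>The suspension is additive because it is naturally isomorphic to \<open>\<Sigma>\<one> \<boxtimes> -\<close>.\<close>

lemma ShA_Add:
  assumes f: "f \<in> Hom C X Y" and g: "g \<in> Hom C X Y"
  shows "ShA C (f \<boxplus> g) = ShA C f \<boxplus> ShA C g"
proof -
  let ?I = "Unit C"
  note U = Unit_in_Ob
  note SU = Sh_in_Ob[OF U]
  have O: "X \<in> Ob C" "Y \<in> Ob C" using Hom_Ob f by auto
  define k where "k Z = ShA C (LUnit C Z) \<cdot> Susp C ?I Z" for Z
  have k: "k Z \<in> Hom C (Sh C ?I \<boxtimes> Z) (Sh C Z)" "isomorphism C (k Z)" if "Z \<in> Ob C" for Z
  proof -
    note l = LUnit_simps(4,5)[OF that] and s = Susp_simps[OF U that]
    show "k Z \<in> Hom C (Sh C ?I \<boxtimes> Z) (Sh C Z)" unfolding k_def using Comp_in_Hom[OF s(1) ShA_in_Hom[OF l(1)]] .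
    show "isomorphism C (k Z)" unfolding k_def
      using isomorphism_Comp[OF s(2) shift_isomorphism[OF l] s(1) ShA_in_Hom[OF l(1)]] .
  qed
  have nat: "ShA C u \<cdot> k X = k Y \<cdot> (Ident C (Sh C ?I) \<star> u)" if u: "u \<in> Hom C X Y" for u
  proof -
    note lX = LUnit_simps(4)[OF O(1)] and lY = LUnit_simps(4)[OF O(2)] and sX = Susp_simps(1)[OF U O(1)] and sY = Susp_simps(1)[OF U O(2)]
    note Iu = Ident_TensA_in_Hom[OF u U] and SIu = Ident_TensA_in_Hom[OF u SU]
    have "ShA C u \<cdot> k X = ShA C (u \<cdot> LUnit C X) \<cdot> Susp C ?I X"
      unfolding k_def using Comp_assoc[OF sX ShA_in_Hom[OF lX] ShA_in_Hom[OF u]] ShA_Comp[OF lX u] by simp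
    also have "u \<cdot> LUnit C X = LUnit C Y \<cdot> (Ident C ?I \<star> u)" using LUnit_natural[OF u] by simp
    also have "ShA C (LUnit C Y \<cdot> (Ident C ?I \<star> u)) \<cdot> Susp C ?I X = ShA C (LUnit C Y) \<cdot> (ShA C (Ident C ?I \<star> u) \<cdot> Susp C ?I X)"
      using ShA_Comp[OF Iu lY] Comp_assoc[OF sX ShA_in_Hom[OF Iu] ShA_in_Hom[OF lY]] by simp
    also have "ShA C (Ident C ?I \<star> u) \<cdot> Susp C ?I X = Susp C ?I Y \<cdot> (Ident C (Sh C ?I) \<star> u)" using Susp_natural[OF U u] by simp
    also have "ShA C (LUnit C Y) \<cdot> \<dots> = k Y \<cdot> (Ident C (Sh C ?I) \<star> u)"
      unfolding k_def using Comp_assoc[OF SIu sY ShA_in_Hom[OF lY]] by simp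
    finally show ?thesis .
  qed
  have "(ShA C f \<boxplus> ShA C g) \<cdot> k X = k Y \<cdot> (Ident C (Sh C ?I) \<star> (f \<boxplus> g))"
    using Add_Comp[OF k(1)[OF O(1)] ShA_in_Hom[OF f] ShA_in_Hom[OF g]] nat[OF f] nat[OF g] left_TensA_Add[OF f g SU]
      Comp_Add[OF Ident_TensA_in_Hom[OF f SU] Ident_TensA_in_Hom[OF g SU] k(1)[OF O(2)]] by simp
  then show ?thesis
    using isomorphism_right_cancel[OF k(2)[OF O(1)] k(1)[OF O(1)] ShA_in_Hom[OF Add_in_Hom[OF f g]]
        Add_in_Hom[OF ShA_in_Hom[OF f] ShA_in_Hom[OF g]]] nat[OF Add_in_Hom[OF f g]] by simp
qed

text \<open>Tensoring has a right adjoint: arrows out of \<open>A \<boxtimes> W\<close> are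
  transposed to arrows into \<open>H\<close>, where the universal property of \<open>A\<close>
  applies.\<close>

lemma tensor_coproduct:
  assumes A: "coproduct C I X A \<iota>" and W: "W \<in> Ob C"
  shows "coproduct C I (\<lambda>i. X i \<boxtimes> W) (A \<boxtimes> W) (\<lambda>i. \<iota> i \<star> Ident C W)"
proof (rule coproductI)
  have AO: "A \<in> Ob C" using coproductD(1)[OF A] .
  note \<iota> = coproductD(2)[OF A]
  show "A \<boxtimes> W \<in> Ob C" using Tens_in_Ob AO W by blast
  show "\<iota> i \<star> Ident C W \<in> Hom C (X i \<boxtimes> W) (A \<boxtimes> W)" if "i \<in> I" for i using TensA_Ident_in_Hom[OF \<iota>[OF that] W] .
  fix Y assume Y: "Y \<in> Ob C"
  obtain H e where H: "H \<in> Ob C" and e: "e \<in> Hom C (H \<boxtimes> W) Y"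
    and u: "\<And>V g. V \<in> Ob C \<Longrightarrow> g \<in> Hom C (V \<boxtimes> W) Y \<Longrightarrow> \<exists>!k. k \<in> Hom C V H \<and> e \<cdot> (k \<star> Ident C W) = g"
    using closed[unfolded closed_monoidal_def, rule_format, OF W Y] by blast
  have comp: "(e \<cdot> (k \<star> Ident C W)) \<cdot> (\<iota> i \<star> Ident C W) = e \<cdot> ((k \<cdot> \<iota> i) \<star> Ident C W)" if "k \<in> Hom C A H" "i \<in> I" for k i
    using that \<iota>[OF that(2)] e W H by (simp add: Hom_def mon_simps TensA_Comp_Arr)
  show "\<exists>h\<in>Hom C (A \<boxtimes> W) Y. \<forall>i\<in>I. h \<cdot> (\<iota> i \<star> Ident C W) = g i" if g: "\<And>i. i \<in> I \<Longrightarrow> g i \<in> Hom C (X i \<boxtimes> W) Y" for g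
  proof -
    have "\<exists>k. k \<in> Hom C (X i) H \<and> e \<cdot> (k \<star> Ident C W) = g i" if "i \<in> I" for i
      using u[OF Hom_Ob(1)[OF \<iota>[OF that]] g[OF that]] by blast
    then obtain k where k: "\<And>i. i \<in> I \<Longrightarrow> k i \<in> Hom C (X i) H" "\<And>i. i \<in> I \<Longrightarrow> e \<cdot> (k i \<star> Ident C W) = g i" by metis
    obtain l where l: "l \<in> Hom C A H" "\<And>i. i \<in> I \<Longrightarrow> l \<cdot> \<iota> i = k i" using coproduct_arrow[OF A H k(1)] by metis
    show ?thesis
      by (rule bexI[of _ "e \<cdot> (l \<star> Ident C W)"])
        (use comp[OF l(1)] l(2) k(2) Comp_in_Hom[OF TensA_Ident_in_Hom[OF l(1) W] e] in auto)
  qed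
  show "h = h'" if h: "h \<in> Hom C (A \<boxtimes> W) Y" "h' \<in> Hom C (A \<boxtimes> W) Y"
    "\<And>i. i \<in> I \<Longrightarrow> h \<cdot> (\<iota> i \<star> Ident C W) = h' \<cdot> (\<iota> i \<star> Ident C W)" for h h'
  proof -
    obtain k where k: "k \<in> Hom C A H" "e \<cdot> (k \<star> Ident C W) = h" using u[OF AO h(1)] by blast
    obtain k' where k': "k' \<in> Hom C A H" "e \<cdot> (k' \<star> Ident C W) = h'" using u[OF AO h(2)] by blast
    have "k = k'"
    proof (rule coproduct_eqI[OF A k(1) k'(1)])
      fix i assume i: "i \<in> I"
      have "e \<cdot> ((k \<cdot> \<iota> i) \<star> Ident C W) = e \<cdot> ((k' \<cdot> \<iota> i) \<star> Ident C W)"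
        using comp[OF k(1) i] comp[OF k'(1) i] k(2) k'(2) h(3)[OF i] by simp
      then show "k \<cdot> \<iota> i = k' \<cdot> \<iota> i"
        using u[OF Hom_Ob(1)[OF \<iota>[OF i]] Comp_in_Hom[OF TensA_Ident_in_Hom[OF Comp_in_Hom[OF \<iota>[OF i] k'(1)] W] e]]
          Comp_in_Hom[OF \<iota>[OF i] k(1)] Comp_in_Hom[OF \<iota>[OF i] k'(1)] by blast
    qed
    then show ?thesis using k k' by simp
  qed
qed

lemma left_tensor_coproduct:
  assumes A: "coproduct C I X A \<iota>" and W: "W \<in> Ob C"
  shows "coproduct C I (\<lambda>i. W \<boxtimes> X i) (W \<boxtimes> A) (\<lambda>i. Ident C W \<star> \<iota> i)"
proof -
  note \<iota> = coproductD(2)[OF A]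
  have XO: "X i \<in> Ob C" if "i \<in> I" for i using Hom_Ob(1)[OF \<iota>[OF that]] .
  have "coproduct C I (\<lambda>i. W \<boxtimes> X i) (W \<boxtimes> A) (\<lambda>i. Braid C A W \<cdot> ((\<iota> i \<star> Ident C W) \<cdot> Braid C W (X i)))"
    using coproduct_cong_iso[OF tensor_coproduct[OF A W] Braid_simps(4)[OF W XO] Braid_simps(5)[OF W XO]
        Braid_simps(4)[OF coproductD(1)[OF A] W] Braid_simps(5)[OF coproductD(1)[OF A] W]] by simp
  then show ?thesis using left_TensA_Braid[OF \<iota> W] unfolding coproduct_def by simp
qed

end

section \<open>Compact and dualizable objects\<close>

context tt_category
begin

lemma TensA_split:
  assumes "f \<in> Arr C" "g \<in> Arr C" "Dom C g = Cod C f" "W \<in> Ob C"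
  shows "(g \<cdot> f) \<star> Ident C W = (g \<star> Ident C W) \<cdot> (f \<star> Ident C W)"
    and "Ident C W \<star> (g \<cdot> f) = (Ident C W \<star> g) \<cdot> (Ident C W \<star> f)"
  using assms by (simp_all add: TensA_Comp_Arr mon_simps)

text \<open>\<open>P\<close> stands for an additive transposition of arrows; it only has to take an
  arrow through a summand to an arrow through the corresponding summand.\<close>

lemma finite_sums_transport:
  assumes A': "coproduct C J Y' A' \<iota>'" and X': "X' \<in> Ob C" and w: "w \<in> finite_sums C X' A' J Y' \<iota>'"
    and add: "\<And>u v. u \<in> Hom C X' A' \<Longrightarrow> v \<in> Hom C X' A' \<Longrightarrow> P (u \<boxplus> v) = P u \<boxplus> P v"
    and z: "P (Zero C X' A') = Zero C X A"
    and s: "\<And>i \<phi>. i \<in> J \<Longrightarrow> \<phi> \<in> Hom C X' (Y' i) \<Longrightarrow> \<exists>\<psi>. \<psi> \<in> Hom C X (Y i) \<and> P (\<iota>' i \<cdot> \<phi>) = \<iota> i \<cdot> \<psi>"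
  shows "P w \<in> finite_sums C X A J Y \<iota>"
  using w
proof induction
  case zero
  show ?case using z finite_sums.zero by simp
next
  case (add i \<phi> w)
  obtain \<psi> where \<psi>: "\<psi> \<in> Hom C X (Y i)" "P (\<iota>' i \<cdot> \<phi>) = \<iota> i \<cdot> \<psi>" using s[OF add(1,2)] by blast
  have "P ((\<iota>' i \<cdot> \<phi>) \<boxplus> w) = (\<iota> i \<cdot> \<psi>) \<boxplus> P w"
    using assms(4)[OF Comp_in_Hom[OF add(2) coproductD(2)[OF A' add(1)]] finite_sums_Hom[OF A' X' add(3)]] \<psi>(2) by simp
  then show ?case
    using finite_sums.add[where C = C and X = X and Y = Y and A = A and \<iota> = \<iota>, OF add(1) \<psi>(1) add(4)] by simp
qed

text \<open>
  A half dual of \<open>X\<close> satisfies the first triangle identity only up to an automorphism of \<open>X\<close>; this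
  suffices for compactness and is easily transported along functors.
\<close>

definition half_dual :: "'o \<Rightarrow> 'o \<Rightarrow> 'm \<Rightarrow> 'm \<Rightarrow> bool" where
  "half_dual X D \<eta> \<epsilon> \<longleftrightarrow> X \<in> Ob C \<and> D \<in> Ob C \<and> \<eta> \<in> Hom C (Unit C) (X \<boxtimes> D) \<and> \<epsilon> \<in> Hom C (D \<boxtimes> X) (Unit C) \<and>
     isomorphism C (RUnit C X \<cdot> (Ident C X \<star> \<epsilon>) \<cdot> Assoc C X D X \<cdot> (\<eta> \<star> Ident C X))"

text \<open>Up to associators and unitors the composite without \<open>\<theta>\<close> is
  \<open>W\<close> tensored with the automorphism of \<open>X\<close> from \<open>half_dual\<close>,
  hence an automorphism; \<open>\<theta>\<close> is its inverse.\<close>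

lemma half_dual_transpose:
  assumes h: "half_dual X D \<eta> \<epsilon>" and W: "W \<in> Ob C"
  obtains \<beta> \<theta> where "\<beta> \<in> Hom C W ((W \<boxtimes> X) \<boxtimes> D)" "\<theta> \<in> Hom C (W \<boxtimes> X) (W \<boxtimes> X)"
    "RUnit C (W \<boxtimes> X) \<cdot> (Ident C (W \<boxtimes> X) \<star> \<epsilon>) \<cdot> Assoc C (W \<boxtimes> X) D X \<cdot> (\<beta> \<star> Ident C X) \<cdot> \<theta> = Ident C (W \<boxtimes> X)"
proof -
  have O: "X \<in> Ob C" "D \<in> Ob C" and \<eta>: "\<eta> \<in> Hom C (Unit C) (X \<boxtimes> D)" and \<epsilon>: "\<epsilon> \<in> Hom C (D \<boxtimes> X) (Unit C)"
    and i: "isomorphism C (RUnit C X \<cdot> (Ident C X \<star> \<epsilon>) \<cdot> Assoc C X D X \<cdot> (\<eta> \<star> Ident C X))"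
    using h by (auto simp: half_dual_def)
  note U = Unit_in_Ob
  note T = Tens_in_Ob[OF W O(1)] Tens_in_Ob[OF O(1,2)] Tens_in_Ob[OF O(2,1)]
  obtain b where b: "b \<in> Hom C (W \<boxtimes> (X \<boxtimes> D)) ((W \<boxtimes> X) \<boxtimes> D)"
    "b \<cdot> Assoc C W X D = Ident C ((W \<boxtimes> X) \<boxtimes> D)" "Assoc C W X D \<cdot> b = Ident C (W \<boxtimes> (X \<boxtimes> D))"
    using isomorphismE[OF Assoc_simps(5,4)[OF W O]] by metis
  obtain b' where b': "b' \<in> Hom C (W \<boxtimes> (X \<boxtimes> (D \<boxtimes> X))) ((W \<boxtimes> X) \<boxtimes> (D \<boxtimes> X))"
    "b' \<cdot> Assoc C W X (D \<boxtimes> X) = Ident C ((W \<boxtimes> X) \<boxtimes> (D \<boxtimes> X))" "Assoc C W X (D \<boxtimes> X) \<cdot> b' = Ident C (W \<boxtimes> (X \<boxtimes> (D \<boxtimes> X)))"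
    using isomorphismE[OF Assoc_simps(5,4)[OF W O(1) T(3)]] by metis
  obtain b1 where b1: "b1 \<in> Hom C (W \<boxtimes> (X \<boxtimes> Unit C)) ((W \<boxtimes> X) \<boxtimes> Unit C)"
    "b1 \<cdot> Assoc C W X (Unit C) = Ident C ((W \<boxtimes> X) \<boxtimes> Unit C)" "Assoc C W X (Unit C) \<cdot> b1 = Ident C (W \<boxtimes> (X \<boxtimes> Unit C))"
    "isomorphism C b1"
    using isomorphismE[OF Assoc_simps(5,4)[OF W O(1) U]] by metis
  obtain r where r: "r \<in> Hom C W (W \<boxtimes> Unit C)" "isomorphism C r"
    using isomorphismE[OF RUnit_simps(5,4)[OF W]] by metis
  define \<delta> where "\<delta> = (Ident C X \<star> \<epsilon>) \<cdot> Assoc C X D X \<cdot> (\<eta> \<star> Ident C X)"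
  have \<delta>H: "\<delta> \<in> Hom C (Unit C \<boxtimes> X) (X \<boxtimes> Unit C)" unfolding \<delta>_def using O \<eta> \<epsilon> U by (simp add: Hom_def mon_simps)
  have r\<delta>: "isomorphism C (RUnit C X \<cdot> \<delta>)" using i by (simp add: \<delta>_def)
  obtain r' where r': "r' \<in> Hom C X (X \<boxtimes> Unit C)" "r' \<cdot> RUnit C X = Ident C (X \<boxtimes> Unit C)" "isomorphism C r'"
    using isomorphismE[OF RUnit_simps(5,4)[OF O(1)]] by metis
  have "r' \<cdot> (RUnit C X \<cdot> \<delta>) = \<delta>"
    using Comp_assoc[OF \<delta>H RUnit_simps(4)[OF O(1)] r'(1)] r'(2) Ident_Comp[OF \<delta>H] by simp
  then have \<delta>i: "isomorphism C \<delta>"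
    using isomorphism_Comp[OF r\<delta> r'(3) Comp_in_Hom[OF \<delta>H RUnit_simps(4)[OF O(1)]] r'(1)] by simp
  define \<beta> where "\<beta> = b \<cdot> ((Ident C W \<star> \<eta>) \<cdot> r)"
  have \<beta>: "\<beta> \<in> Hom C W ((W \<boxtimes> X) \<boxtimes> D)" unfolding \<beta>_def using b(1) r(1) \<eta> O W U by (simp add: Hom_def mon_simps)
  let ?X = "Ident C X"
  \<comment> \<open>The pentagon moves the inverse associator \<open>b\<close> past the associator
    of the larger product, so that \<open>W\<close> ends up outermost.\<close>
  have 1: "Assoc C (W \<boxtimes> X) D X \<cdot> (b \<star> ?X) = b' \<cdot> ((Ident C W \<star> Assoc C X D X) \<cdot> Assoc C W (X \<boxtimes> D) X)"
  proof -
    have "Assoc C W X (D \<boxtimes> X) \<cdot> (Assoc C (W \<boxtimes> X) D X \<cdot> (b \<star> ?X)) = (Assoc C W X (D \<boxtimes> X) \<cdot> Assoc C (W \<boxtimes> X) D X) \<cdot> (b \<star> ?X)"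
      using b(1) O W by (simp add: Hom_def mon_simps)
    also have "\<dots> = ((Ident C W \<star> Assoc C X D X) \<cdot> Assoc C W (X \<boxtimes> D) X) \<cdot> ((Assoc C W X D \<star> ?X) \<cdot> (b \<star> ?X))"
      unfolding pentagon[OF W O O(1)] using b(1) O W by (simp add: Hom_def mon_simps)
    also have "(Assoc C W X D \<star> ?X) \<cdot> (b \<star> ?X) = Ident C ((W \<boxtimes> (X \<boxtimes> D)) \<boxtimes> X)"
      using b O W by (simp add: Hom_def mon_simps TensA_Comp_Arr TensA_Ident)
    finally have "Assoc C W X (D \<boxtimes> X) \<cdot> (Assoc C (W \<boxtimes> X) D X \<cdot> (b \<star> ?X)) = (Ident C W \<star> Assoc C X D X) \<cdot> Assoc C W (X \<boxtimes> D) X"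
      using O W by (simp add: Hom_def mon_simps)
    then have "b' \<cdot> (Assoc C W X (D \<boxtimes> X) \<cdot> (Assoc C (W \<boxtimes> X) D X \<cdot> (b \<star> ?X))) = b' \<cdot> ((Ident C W \<star> Assoc C X D X) \<cdot> Assoc C W (X \<boxtimes> D) X)" by simp
    then show ?thesis using Comp_rewrite[OF b'(2)] b(1) b'(1) O W by (simp add: Hom_def mon_simps)
  qed
  have 2: "(Ident C (W \<boxtimes> X) \<star> \<epsilon>) \<cdot> b' = b1 \<cdot> (Ident C W \<star> (?X \<star> \<epsilon>))"
  proof -
    have n: "Assoc C W X (Unit C) \<cdot> (Ident C (W \<boxtimes> X) \<star> \<epsilon>) = (Ident C W \<star> (?X \<star> \<epsilon>)) \<cdot> Assoc C W X (D \<boxtimes> X)"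
      using Assoc_natural[OF Ident_in_Hom[OF W] Ident_in_Hom[OF O(1)] \<epsilon>] TensA_Ident[OF W O(1)] by simp
    have "(Ident C (W \<boxtimes> X) \<star> \<epsilon>) \<cdot> b' = (b1 \<cdot> Assoc C W X (Unit C)) \<cdot> ((Ident C (W \<boxtimes> X) \<star> \<epsilon>) \<cdot> b')"
      using b1 b'(1) \<epsilon> O W U by (simp add: Hom_def mon_simps)
    also have "\<dots> = b1 \<cdot> ((Assoc C W X (Unit C) \<cdot> (Ident C (W \<boxtimes> X) \<star> \<epsilon>)) \<cdot> b')"
      using b1(1) b'(1) \<epsilon> O W U by (simp add: Hom_def mon_simps)
    also have "\<dots> = b1 \<cdot> ((Ident C W \<star> (?X \<star> \<epsilon>)) \<cdot> (Assoc C W X (D \<boxtimes> X) \<cdot> b'))"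
      unfolding n using b1(1) b'(1) \<epsilon> O W U by (simp add: Hom_def mon_simps)
    also have "\<dots> = b1 \<cdot> (Ident C W \<star> (?X \<star> \<epsilon>))"
      unfolding b'(3) using b1(1) \<epsilon> O W U by (simp add: Hom_def mon_simps)
    finally show ?thesis .
  qed
  have 3: "Assoc C W (X \<boxtimes> D) X \<cdot> ((Ident C W \<star> \<eta>) \<star> ?X) = (Ident C W \<star> (\<eta> \<star> ?X)) \<cdot> Assoc C W (Unit C) X"
    using Assoc_natural[OF Ident_in_Hom[OF W] \<eta> Ident_in_Hom[OF O(1)]] .
  \<comment> \<open>The same composite with \<open>W\<close> pulled out, displayed as a product of
    isomorphisms.\<close>
  define t where "t = RUnit C (W \<boxtimes> X) \<cdot> (b1 \<cdot> ((Ident C W \<star> \<delta>) \<cdot> (Assoc C W (Unit C) X \<cdot> (r \<star> ?X))))"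
  have \<beta>X: "\<beta> \<star> ?X = (b \<star> ?X) \<cdot> (((Ident C W \<star> \<eta>) \<star> ?X) \<cdot> (r \<star> ?X))"
    unfolding \<beta>_def using b(1) r(1) \<eta> O W U by (simp add: Hom_def mon_simps TensA_Comp_Arr)
  have W\<delta>: "Ident C W \<star> \<delta> = (Ident C W \<star> (?X \<star> \<epsilon>)) \<cdot> ((Ident C W \<star> Assoc C X D X) \<cdot> (Ident C W \<star> (\<eta> \<star> ?X)))"
    unfolding \<delta>_def using \<epsilon> \<eta> O W U by (simp add: Hom_def mon_simps TensA_Comp_Arr)
  have eq: "RUnit C (W \<boxtimes> X) \<cdot> (Ident C (W \<boxtimes> X) \<star> \<epsilon>) \<cdot> Assoc C (W \<boxtimes> X) D X \<cdot> (\<beta> \<star> ?X) = t"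
  proof -
    have "Assoc C (W \<boxtimes> X) D X \<cdot> (\<beta> \<star> ?X) = (Assoc C (W \<boxtimes> X) D X \<cdot> (b \<star> ?X)) \<cdot> (((Ident C W \<star> \<eta>) \<star> ?X) \<cdot> (r \<star> ?X))"
      unfolding \<beta>X using b(1) r(1) \<eta> O W U by (simp add: Hom_def mon_simps)
    also have "\<dots> = b' \<cdot> ((Ident C W \<star> Assoc C X D X) \<cdot> ((Assoc C W (X \<boxtimes> D) X \<cdot> ((Ident C W \<star> \<eta>) \<star> ?X)) \<cdot> (r \<star> ?X)))"
      unfolding 1 using b'(1) r(1) \<eta> O W U by (simp add: Hom_def mon_simps)
    finally have e: "Assoc C (W \<boxtimes> X) D X \<cdot> (\<beta> \<star> ?X) =
       b' \<cdot> ((Ident C W \<star> Assoc C X D X) \<cdot> ((Ident C W \<star> (\<eta> \<star> ?X)) \<cdot> (Assoc C W (Unit C) X \<cdot> (r \<star> ?X))))"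
      unfolding 3 using b'(1) r(1) \<eta> O W U by (simp add: Hom_def mon_simps)
    have "(Ident C (W \<boxtimes> X) \<star> \<epsilon>) \<cdot> Assoc C (W \<boxtimes> X) D X \<cdot> (\<beta> \<star> ?X) =
       ((Ident C (W \<boxtimes> X) \<star> \<epsilon>) \<cdot> b') \<cdot> ((Ident C W \<star> Assoc C X D X) \<cdot> ((Ident C W \<star> (\<eta> \<star> ?X)) \<cdot> (Assoc C W (Unit C) X \<cdot> (r \<star> ?X))))"
      unfolding e using b'(1) r(1) \<eta> \<epsilon> O W U by (simp add: Hom_def mon_simps)
    also have "\<dots> = b1 \<cdot> ((Ident C W \<star> \<delta>) \<cdot> (Assoc C W (Unit C) X \<cdot> (r \<star> ?X)))"
      unfolding 2 W\<delta> using b1(1) r(1) \<eta> \<epsilon> O W U by (simp add: Hom_def mon_simps)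
    finally show ?thesis by (simp add: t_def)
  qed
  note I = Ident_in_Hom[OF W] isomorphism_Ident[OF W] Ident_in_Hom[OF O(1)] isomorphism_Ident[OF O(1)]
  note rX = TensA_in_Hom[OF r(1) I(3)] isomorphism_TensA[OF r(2) I(4) r(1) I(3)]
  note a1 = Assoc_simps(4,5)[OF W U O(1)]
  note c1 = Comp_in_Hom[OF rX(1) a1(1)] isomorphism_Comp[OF rX(2) a1(2) rX(1) a1(1)]
  note d1 = TensA_in_Hom[OF I(1) \<delta>H] isomorphism_TensA[OF I(2) \<delta>i I(1) \<delta>H]
  note c2 = Comp_in_Hom[OF c1(1) d1(1)] isomorphism_Comp[OF c1(2) d1(2) c1(1) d1(1)]
  note c3 = Comp_in_Hom[OF c2(1) b1(1)] isomorphism_Comp[OF c2(2) b1(4) c2(1) b1(1)]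
  note rr = RUnit_simps(4,5)[OF T(1)]
  note c4 = Comp_in_Hom[OF c3(1) rr(1)] isomorphism_Comp[OF c3(2) rr(2) c3(1) rr(1)]
  have tH: "t \<in> Hom C (W \<boxtimes> X) (W \<boxtimes> X)" "isomorphism C t" unfolding t_def using c4 by auto
  obtain \<theta> where \<theta>: "\<theta> \<in> Hom C (W \<boxtimes> X) (W \<boxtimes> X)" "t \<cdot> \<theta> = Ident C (W \<boxtimes> X)" using isomorphismE[OF tH(2,1)] by metis
  have "RUnit C (W \<boxtimes> X) \<cdot> (Ident C (W \<boxtimes> X) \<star> \<epsilon>) \<cdot> Assoc C (W \<boxtimes> X) D X \<cdot> (\<beta> \<star> ?X) \<cdot> \<theta> =
      (RUnit C (W \<boxtimes> X) \<cdot> (Ident C (W \<boxtimes> X) \<star> \<epsilon>) \<cdot> Assoc C (W \<boxtimes> X) D X \<cdot> (\<beta> \<star> ?X)) \<cdot> \<theta>"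
    using \<beta> \<theta>(1) \<epsilon> O W U by (simp add: Hom_def mon_simps)
  then show thesis using that[OF \<beta> \<theta>(1)] eq \<theta>(2) by simp
qed

text \<open>Evaluation \<open>(Z \<boxtimes> D) \<boxtimes> X \<rightarrow> Z\<close> is natural in
  \<open>Z\<close>, factor by factor. This lets the transposition commute with
  coprojections.\<close>

lemma counit_natural:
  assumes w: "w \<in> Hom C Y A" and O: "X \<in> Ob C" "D \<in> Ob C" and \<epsilon>: "\<epsilon> \<in> Hom C (D \<boxtimes> X) (Unit C)"
  shows "(RUnit C A \<cdot> (Ident C A \<star> \<epsilon>) \<cdot> Assoc C A D X) \<cdot> ((w \<star> Ident C D) \<star> Ident C X) =
    w \<cdot> (RUnit C Y \<cdot> (Ident C Y \<star> \<epsilon>) \<cdot> Assoc C Y D X)"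
proof -
  have YA: "Y \<in> Ob C" "A \<in> Ob C" using Hom_Ob w by auto
  note U = Unit_in_Ob
  have "(RUnit C A \<cdot> (Ident C A \<star> \<epsilon>) \<cdot> Assoc C A D X) \<cdot> ((w \<star> Ident C D) \<star> Ident C X) =
    RUnit C A \<cdot> ((Ident C A \<star> \<epsilon>) \<cdot> (Assoc C A D X \<cdot> ((w \<star> Ident C D) \<star> Ident C X)))"
    using w \<epsilon> O YA U by (simp add: Hom_def mon_simps)
  also have "Assoc C A D X \<cdot> ((w \<star> Ident C D) \<star> Ident C X) = (w \<star> Ident C (D \<boxtimes> X)) \<cdot> Assoc C Y D X"
    using Assoc_natural[OF w Ident_in_Hom[OF O(2)] Ident_in_Hom[OF O(1)]] TensA_Ident[OF O(2,1)] by simp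
  also have "(Ident C A \<star> \<epsilon>) \<cdot> ((w \<star> Ident C (D \<boxtimes> X)) \<cdot> Assoc C Y D X) = (w \<star> Ident C (Unit C)) \<cdot> ((Ident C Y \<star> \<epsilon>) \<cdot> Assoc C Y D X)"
  proof -
    have "(Ident C A \<star> \<epsilon>) \<cdot> (w \<star> Ident C (D \<boxtimes> X)) = (w \<star> Ident C (Unit C)) \<cdot> (Ident C Y \<star> \<epsilon>)"
      using w \<epsilon> O YA U by (simp add: Hom_def mon_simps TensA_Comp_Arr)
    from Comp_rewrite[OF this] show ?thesis using w \<epsilon> O YA U by (simp add: Hom_def mon_simps)
  qed
  also have "RUnit C A \<cdot> ((w \<star> Ident C (Unit C)) \<cdot> ((Ident C Y \<star> \<epsilon>) \<cdot> Assoc C Y D X)) =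
    (w \<cdot> RUnit C Y) \<cdot> ((Ident C Y \<star> \<epsilon>) \<cdot> Assoc C Y D X)"
    using Comp_rewrite[OF RUnit_natural[OF w]] w \<epsilon> O YA U by (simp add: Hom_def mon_simps)
  also have "\<dots> = w \<cdot> (RUnit C Y \<cdot> (Ident C Y \<star> \<epsilon>) \<cdot> Assoc C Y D X)"
    using w \<epsilon> O YA U by (simp add: Hom_def mon_simps)
  finally show ?thesis .
qed

text \<open>Duality turns an arrow \<open>W \<boxtimes> X \<rightarrow> A\<close> into
  \<open>W \<rightarrow> A \<boxtimes> D\<close>, and tensoring with \<open>D\<close> preserves
  coproducts, so compactness of \<open>W\<close> applies. \<open>P\<close> transposes back,
  corrected by \<open>\<theta>\<close>.\<close>

lemma compact_Tens_half_dual: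
  fixes \<kappa> :: "'u rel"
  assumes W: "W \<in> compact_objects \<kappa> C" and h: "half_dual X D \<eta> \<epsilon>"
  shows "W \<boxtimes> X \<in> compact_objects \<kappa> C"
  unfolding compact_objects_iff
proof (intro conjI allI impI subsetI)
  have WO: "W \<in> Ob C" using W by (simp add: compact_objects_def)
  have O: "X \<in> Ob C" "D \<in> Ob C" and \<epsilon>: "\<epsilon> \<in> Hom C (D \<boxtimes> X) (Unit C)" using h by (auto simp: half_dual_def)
  note U = Unit_in_Ob
  show "W \<boxtimes> X \<in> Ob C" using Tens_in_Ob WO O by blast
  fix I :: "'u set" and Y A \<iota> w
  assume I: "small \<kappa> I" and A: "coproduct C I Y A \<iota>" and w: "w \<in> Hom C (W \<boxtimes> X) A"
  have AO: "A \<in> Ob C" using coproductD(1)[OF A] .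
  note \<iota> = coproductD(2)[OF A]
  note WX = Tens_in_Ob[OF WO O(1)]
  obtain \<beta> \<theta> where \<beta>: "\<beta> \<in> Hom C W ((W \<boxtimes> X) \<boxtimes> D)" and \<theta>: "\<theta> \<in> Hom C (W \<boxtimes> X) (W \<boxtimes> X)"
    and eq: "RUnit C (W \<boxtimes> X) \<cdot> (Ident C (W \<boxtimes> X) \<star> \<epsilon>) \<cdot> Assoc C (W \<boxtimes> X) D X \<cdot> (\<beta> \<star> Ident C X) \<cdot> \<theta> = Ident C (W \<boxtimes> X)"
    using half_dual_transpose[OF h WO] .
  define K where "K Z = RUnit C Z \<cdot> (Ident C Z \<star> \<epsilon>) \<cdot> Assoc C Z D X" for Z
  have K: "K Z \<in> Hom C ((Z \<boxtimes> D) \<boxtimes> X) Z" if "Z \<in> Ob C" for Z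
    unfolding K_def using that O \<epsilon> U by (simp add: Hom_def mon_simps)
  define P where "P v = K A \<cdot> ((v \<star> Ident C X) \<cdot> \<theta>)" for v
  define v where "v = (w \<star> Ident C D) \<cdot> \<beta>"
  have AD: "coproduct C I (\<lambda>i. Y i \<boxtimes> D) (A \<boxtimes> D) (\<lambda>i. \<iota> i \<star> Ident C D)" using tensor_coproduct[OF A O(2)] .
  have v: "v \<in> Hom C W (A \<boxtimes> D)" unfolding v_def using Comp_in_Hom[OF \<beta> TensA_Ident_in_Hom[OF w O(2)]] .
  have vs: "v \<in> finite_sums C W (A \<boxtimes> D) I (\<lambda>i. Y i \<boxtimes> D) (\<lambda>i. \<iota> i \<star> Ident C D)"
    using W I AD v unfolding compact_objects_iff by blast
  have "P v = w"
  proof -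
    have "P v = (K A \<cdot> ((w \<star> Ident C D) \<star> Ident C X)) \<cdot> ((\<beta> \<star> Ident C X) \<cdot> \<theta>)"
      unfolding P_def v_def using K[OF AO] w \<beta> \<theta> O AO WX by (simp add: Hom_def mon_simps TensA_split)
    also have "\<dots> = (w \<cdot> K (W \<boxtimes> X)) \<cdot> ((\<beta> \<star> Ident C X) \<cdot> \<theta>)"
      unfolding K_def using counit_natural[OF w O \<epsilon>] by simp
    also have "\<dots> = w \<cdot> (K (W \<boxtimes> X) \<cdot> ((\<beta> \<star> Ident C X) \<cdot> \<theta>))"
      using K[OF WX] w \<beta> \<theta> O AO WX by (simp add: Hom_def mon_simps)
    also have "K (W \<boxtimes> X) \<cdot> ((\<beta> \<star> Ident C X) \<cdot> \<theta>) =
        RUnit C (W \<boxtimes> X) \<cdot> (Ident C (W \<boxtimes> X) \<star> \<epsilon>) \<cdot> Assoc C (W \<boxtimes> X) D X \<cdot> (\<beta> \<star> Ident C X) \<cdot> \<theta>"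
      unfolding K_def using \<epsilon> \<beta> \<theta> O WX U by (simp add: Hom_def mon_simps)
    also have "\<dots> = Ident C (W \<boxtimes> X)" by (rule eq)
    finally show ?thesis using Comp_Ident[OF w] by simp
  qed
  moreover have "P v \<in> finite_sums C (W \<boxtimes> X) A I Y \<iota>"
  proof (rule finite_sums_transport[OF AD WO vs])
    fix u1 u2 assume u: "u1 \<in> Hom C W (A \<boxtimes> D)" "u2 \<in> Hom C W (A \<boxtimes> D)"
    note uX = TensA_Ident_in_Hom[OF u(1) O(1)] TensA_Ident_in_Hom[OF u(2) O(1)]
    show "P (u1 \<boxplus> u2) = P u1 \<boxplus> P u2" unfolding P_def
      using TensA_Add[OF u O(1)] Add_Comp[OF \<theta> uX] Comp_Add[OF Comp_in_Hom[OF \<theta> uX(1)] Comp_in_Hom[OF \<theta> uX(2)] K[OF AO]] by simp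
  next
    have ADO: "A \<boxtimes> D \<in> Ob C" using Tens_in_Ob AO O by blast
    show "P (Zero C W (A \<boxtimes> D)) = Zero C (W \<boxtimes> X) A" unfolding P_def
      using TensA_Zero[OF WO ADO O(1)] Zero_Comp[OF Tens_in_Ob[OF ADO O(1)] \<theta>] Comp_Zero[OF WX K[OF AO]] by simp
  next
    fix i \<phi> assume i: "i \<in> I" and \<phi>: "\<phi> \<in> Hom C W (Y i \<boxtimes> D)"
    have YO: "Y i \<in> Ob C" using Hom_Ob(1)[OF \<iota>[OF i]] .
    define \<psi> where "\<psi> = K (Y i) \<cdot> ((\<phi> \<star> Ident C X) \<cdot> \<theta>)"
    have "\<psi> \<in> Hom C (W \<boxtimes> X) (Y i)" unfolding \<psi>_def
      using Comp_in_Hom[OF Comp_in_Hom[OF \<theta> TensA_Ident_in_Hom[OF \<phi> O(1)]] K[OF YO]] .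
    moreover have "P ((\<iota> i \<star> Ident C D) \<cdot> \<phi>) = \<iota> i \<cdot> \<psi>"
    proof -
      have "P ((\<iota> i \<star> Ident C D) \<cdot> \<phi>) = (K A \<cdot> ((\<iota> i \<star> Ident C D) \<star> Ident C X)) \<cdot> ((\<phi> \<star> Ident C X) \<cdot> \<theta>)"
        unfolding P_def using K[OF AO] \<iota>[OF i] \<phi> \<theta> O AO YO WX by (simp add: Hom_def mon_simps TensA_split)
      also have "\<dots> = (\<iota> i \<cdot> K (Y i)) \<cdot> ((\<phi> \<star> Ident C X) \<cdot> \<theta>)"
        unfolding K_def using counit_natural[OF \<iota>[OF i] O \<epsilon>] by simp
      also have "\<dots> = \<iota> i \<cdot> \<psi>"
        unfolding \<psi>_def using K[OF YO] \<iota>[OF i] \<phi> \<theta> O YO WX by (simp add: Hom_def mon_simps)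
      finally show ?thesis .
    qed
    ultimately show "\<exists>\<psi>. \<psi> \<in> Hom C (W \<boxtimes> X) (Y i) \<and> P ((\<iota> i \<star> Ident C D) \<cdot> \<phi>) = \<iota> i \<cdot> \<psi>" by blast
  qed
  ultimately show "w \<in> finite_sums C (W \<boxtimes> X) A I Y \<iota>" by simp
qed

text \<open>The unit is its own dual, with the unitor as evaluation and its inverse as coevaluation;
  both identities reduce to the triangle axiom and the equality of the two unitors at the
  unit.\<close>

lemma Unit_dualizable: "Unit C \<in> dualizable_objects C"
proof -
  let ?I = "Unit C" and ?r = "RUnit C (Unit C)"
  note U = Unit_in_Ob
  note r = RUnit_simps(4,5)[OF U]
  obtain s where s: "s \<in> Hom C ?I (?I \<boxtimes> ?I)" "s \<cdot> ?r = Ident C (?I \<boxtimes> ?I)" "?r \<cdot> s = Ident C ?I" "isomorphism C s"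
    using isomorphismE[OF r(2,1)] by metis
  have rs: "(?r \<star> Ident C ?I) \<cdot> (s \<star> Ident C ?I) = Ident C (?I \<boxtimes> ?I)"
    using TensA_Comp_Arr[of s ?r "Ident C ?I" "Ident C ?I"] s r U by (simp add: Hom_def mon_simps TensA_Ident)
  have tr: "(Ident C ?I \<star> ?r) \<cdot> Assoc C ?I ?I ?I = ?r \<star> Ident C ?I" using triangle[OF U U] LUnit_Unit_eq_RUnit by simp
  have 1: "?r \<cdot> (Ident C ?I \<star> ?r) \<cdot> Assoc C ?I ?I ?I \<cdot> (s \<star> Ident C ?I) = LUnit C ?I"
    using Comp_rewrite[OF tr, of "s \<star> Ident C ?I"] rs s(1) U LUnit_Unit_eq_RUnit by (simp add: Hom_def mon_simps)
  let ?a = "inverse_arrow C (Assoc C ?I ?I ?I)"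
  obtain a where a: "a \<in> Hom C (?I \<boxtimes> (?I \<boxtimes> ?I)) ((?I \<boxtimes> ?I) \<boxtimes> ?I)" "a \<cdot> Assoc C ?I ?I ?I = Ident C ((?I \<boxtimes> ?I) \<boxtimes> ?I)"
    "Assoc C ?I ?I ?I \<cdot> a = Ident C (?I \<boxtimes> (?I \<boxtimes> ?I))"
    using isomorphismE[OF Assoc_simps(5,4)[OF U U U]] by metis
  have ai: "?a = a" using inverse_arrow_eqI[OF Assoc_simps(4)[OF U U U] a] .
  have "(?r \<star> Ident C ?I) \<cdot> a = Ident C ?I \<star> ?r"
    unfolding tr[symmetric] using a U by (simp add: Hom_def mon_simps)
  then have "(?r \<star> Ident C ?I) \<cdot> (a \<cdot> (Ident C ?I \<star> s)) = (Ident C ?I \<star> ?r) \<cdot> (Ident C ?I \<star> s)"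
    using Comp_rewrite[of "?r \<star> Ident C ?I" a] a s(1) U by (simp add: Hom_def mon_simps)
  also have "\<dots> = Ident C (?I \<boxtimes> ?I)"
    using s r U by (simp add: Hom_def mon_simps TensA_Ident TensA_Comp_Arr)
  finally have 2: "LUnit C ?I \<cdot> (?r \<star> Ident C ?I) \<cdot> ?a \<cdot> (Ident C ?I \<star> s) = ?r"
    unfolding ai using U LUnit_Unit_eq_RUnit by (simp add: mon_simps)
  show ?thesis unfolding dualizable_objects_def using U r(1) s(1) 1 2 by blast
qed

lemma dualizable_half_dual:
  assumes "X \<in> dualizable_objects C"
  obtains D \<eta> \<epsilon> where "half_dual X D \<eta> \<epsilon>"
    "RUnit C X \<cdot> (Ident C X \<star> \<epsilon>) \<cdot> Assoc C X D X \<cdot> (\<eta> \<star> Ident C X) = LUnit C X"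
    "LUnit C D \<cdot> (\<epsilon> \<star> Ident C D) \<cdot> inverse_arrow C (Assoc C D X D) \<cdot> (Ident C D \<star> \<eta>) = RUnit C D"
proof -
  obtain D \<eta> \<epsilon> where "X \<in> Ob C" "D \<in> Ob C" "\<eta> \<in> Hom C (Unit C) (X \<boxtimes> D)" "\<epsilon> \<in> Hom C (D \<boxtimes> X) (Unit C)"
    "RUnit C X \<cdot> (Ident C X \<star> \<epsilon>) \<cdot> Assoc C X D X \<cdot> (\<eta> \<star> Ident C X) = LUnit C X"
    "LUnit C D \<cdot> (\<epsilon> \<star> Ident C D) \<cdot> inverse_arrow C (Assoc C D X D) \<cdot> (Ident C D \<star> \<eta>) = RUnit C D"
    using assms unfolding dualizable_objects_def by blast
  moreover from this have "half_dual X D \<eta> \<epsilon>" unfolding half_dual_def using LUnit_simps(5) by simp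
  ultimately show thesis using that by blast
qed

text \<open>By the second duality identity an arrow \<open>D \<rightarrow> A\<close> is recovered
  from its transpose \<open>Unit C \<rightarrow> X \<boxtimes> A\<close>, so compactness of the unit
  suffices. This supplies a compact dual that ideals absorb.\<close>

lemma dual_compact:
  fixes \<kappa> :: "'u rel"
  assumes U\<kappa>: "Unit C \<in> compact_objects \<kappa> C" and h: "half_dual X D \<eta> \<epsilon>"
    and e: "LUnit C D \<cdot> (\<epsilon> \<star> Ident C D) \<cdot> inverse_arrow C (Assoc C D X D) \<cdot> (Ident C D \<star> \<eta>) = RUnit C D"
  shows "D \<in> compact_objects \<kappa> C"
  unfolding compact_objects_iff
proof (intro conjI allI impI subsetI)
  have O: "X \<in> Ob C" "D \<in> Ob C" and \<epsilon>: "\<epsilon> \<in> Hom C (D \<boxtimes> X) (Unit C)" and \<eta>: "\<eta> \<in> Hom C (Unit C) (X \<boxtimes> D)"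
    using h by (auto simp: half_dual_def)
  note U = Unit_in_Ob
  show "D \<in> Ob C" using O by blast
  fix I :: "'u set" and Y A \<iota> w
  assume I: "small \<kappa> I" and A: "coproduct C I Y A \<iota>" and w: "w \<in> Hom C D A"
  have AO: "A \<in> Ob C" using coproductD(1)[OF A] .
  note \<iota> = coproductD(2)[OF A]
  obtain r where r: "r \<in> Hom C D (D \<boxtimes> Unit C)" "RUnit C D \<cdot> r = Ident C D" using isomorphismE[OF RUnit_simps(5,4)[OF O(2)]] by metis
  have "\<exists>a. a \<in> Hom C (D \<boxtimes> (X \<boxtimes> Z)) ((D \<boxtimes> X) \<boxtimes> Z) \<and> a \<cdot> Assoc C D X Z = Ident C ((D \<boxtimes> X) \<boxtimes> Z) \<and>
    Assoc C D X Z \<cdot> a = Ident C (D \<boxtimes> (X \<boxtimes> Z))" if "Z \<in> Ob C" for Z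
    using isomorphismE[OF Assoc_simps(5,4)[OF O(2,1) that]] by metis
  then obtain a where a: "\<And>Z. Z \<in> Ob C \<Longrightarrow> a Z \<in> Hom C (D \<boxtimes> (X \<boxtimes> Z)) ((D \<boxtimes> X) \<boxtimes> Z)"
    "\<And>Z. Z \<in> Ob C \<Longrightarrow> a Z \<cdot> Assoc C D X Z = Ident C ((D \<boxtimes> X) \<boxtimes> Z)"
    "\<And>Z. Z \<in> Ob C \<Longrightarrow> Assoc C D X Z \<cdot> a Z = Ident C (D \<boxtimes> (X \<boxtimes> Z))" by metis
  have aD: "inverse_arrow C (Assoc C D X D) = a D"
    using inverse_arrow_eqI[OF Assoc_simps(4)[OF O(2,1,2)] a(1-3)[OF O(2)]] .
  define K where "K Z = LUnit C Z \<cdot> ((\<epsilon> \<star> Ident C Z) \<cdot> a Z)" for Z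
  have K: "K Z \<in> Hom C (D \<boxtimes> (X \<boxtimes> Z)) Z" if "Z \<in> Ob C" for Z
    unfolding K_def using that O \<epsilon> U a(1)[OF that] by (simp add: Hom_def mon_simps)
  have K_nat: "K Z' \<cdot> (Ident C D \<star> (Ident C X \<star> u)) = u \<cdot> K Z" if u: "u \<in> Hom C Z Z'" for u Z Z'
  proof -
    have Z: "Z \<in> Ob C" "Z' \<in> Ob C" using Hom_Ob u by auto
    note aZ = a(1)[OF Z(1)] a(1)[OF Z(2)]
    have an: "a Z' \<cdot> (Ident C D \<star> (Ident C X \<star> u)) = (Ident C (D \<boxtimes> X) \<star> u) \<cdot> a Z"
    proof -
      have n: "Assoc C D X Z' \<cdot> (Ident C (D \<boxtimes> X) \<star> u) = (Ident C D \<star> (Ident C X \<star> u)) \<cdot> Assoc C D X Z"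
        using Assoc_natural[OF Ident_in_Hom[OF O(2)] Ident_in_Hom[OF O(1)] u] TensA_Ident[OF O(2,1)] by simp
      have "a Z' \<cdot> (Ident C D \<star> (Ident C X \<star> u)) = a Z' \<cdot> (((Ident C D \<star> (Ident C X \<star> u)) \<cdot> Assoc C D X Z) \<cdot> a Z)"
        using aZ u O Z a(3)[OF Z(1)] by (simp add: Hom_def mon_simps)
      also have "\<dots> = (a Z' \<cdot> Assoc C D X Z') \<cdot> ((Ident C (D \<boxtimes> X) \<star> u) \<cdot> a Z)"
        unfolding n[symmetric] using aZ u O Z by (simp add: Hom_def mon_simps)
      also have "\<dots> = (Ident C (D \<boxtimes> X) \<star> u) \<cdot> a Z"
        unfolding a(2)[OF Z(2)] using aZ u O Z by (simp add: Hom_def mon_simps)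
      finally show ?thesis .
    qed
    have en: "(\<epsilon> \<star> Ident C Z') \<cdot> (Ident C (D \<boxtimes> X) \<star> u) = (Ident C (Unit C) \<star> u) \<cdot> (\<epsilon> \<star> Ident C Z)"
      using \<epsilon> u O Z U by (simp add: Hom_def mon_simps TensA_Comp_Arr)
    have "K Z' \<cdot> (Ident C D \<star> (Ident C X \<star> u)) = LUnit C Z' \<cdot> ((\<epsilon> \<star> Ident C Z') \<cdot> (a Z' \<cdot> (Ident C D \<star> (Ident C X \<star> u))))"
      unfolding K_def using aZ \<epsilon> u O Z U by (simp add: Hom_def mon_simps)
    also have "\<dots> = LUnit C Z' \<cdot> (((\<epsilon> \<star> Ident C Z') \<cdot> (Ident C (D \<boxtimes> X) \<star> u)) \<cdot> a Z)"
      unfolding an using aZ \<epsilon> u O Z U by (simp add: Hom_def mon_simps)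
    also have "\<dots> = (LUnit C Z' \<cdot> (Ident C (Unit C) \<star> u)) \<cdot> ((\<epsilon> \<star> Ident C Z) \<cdot> a Z)"
      unfolding en using aZ \<epsilon> u O Z U by (simp add: Hom_def mon_simps)
    also have "\<dots> = u \<cdot> K Z"
      unfolding LUnit_natural[OF u] K_def using aZ \<epsilon> u O Z U by (simp add: Hom_def mon_simps)
    finally show ?thesis .
  qed
  define P where "P v = K A \<cdot> ((Ident C D \<star> v) \<cdot> r)" for v
  define v where "v = (Ident C X \<star> w) \<cdot> \<eta>"
  have XA: "coproduct C I (\<lambda>i. X \<boxtimes> Y i) (X \<boxtimes> A) (\<lambda>i. Ident C X \<star> \<iota> i)" using left_tensor_coproduct[OF A O(1)] .
  have v: "v \<in> Hom C (Unit C) (X \<boxtimes> A)" unfolding v_def using Comp_in_Hom[OF \<eta> Ident_TensA_in_Hom[OF w O(1)]] .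
  have vs: "v \<in> finite_sums C (Unit C) (X \<boxtimes> A) I (\<lambda>i. X \<boxtimes> Y i) (\<lambda>i. Ident C X \<star> \<iota> i)"
    using U\<kappa> I XA v unfolding compact_objects_iff by blast
  have "P v = w"
  proof -
    have "P v = (K A \<cdot> (Ident C D \<star> (Ident C X \<star> w))) \<cdot> ((Ident C D \<star> \<eta>) \<cdot> r)"
      unfolding P_def v_def using K[OF AO] w \<eta> r(1) O AO U by (simp add: Hom_def mon_simps TensA_split)
    also have "\<dots> = w \<cdot> ((K D \<cdot> (Ident C D \<star> \<eta>)) \<cdot> r)"
      unfolding K_nat[OF w] using K[OF O(2)] w \<eta> r(1) O AO U by (simp add: Hom_def mon_simps)
    also have "K D \<cdot> (Ident C D \<star> \<eta>) = RUnit C D"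
      unfolding K_def e[symmetric] aD using a(1)[OF O(2)] \<epsilon> \<eta> O U by (simp add: Hom_def mon_simps)
    finally show ?thesis using r(2) Comp_Ident[OF w] by simp
  qed
  moreover have "P v \<in> finite_sums C D A I Y \<iota>"
  proof (rule finite_sums_transport[OF XA U vs])
    fix u1 u2 assume u: "u1 \<in> Hom C (Unit C) (X \<boxtimes> A)" "u2 \<in> Hom C (Unit C) (X \<boxtimes> A)"
    note uX = Ident_TensA_in_Hom[OF u(1) O(2)] Ident_TensA_in_Hom[OF u(2) O(2)]
    show "P (u1 \<boxplus> u2) = P u1 \<boxplus> P u2" unfolding P_def
      using left_TensA_Add[OF u O(2)] Add_Comp[OF r(1) uX] Comp_Add[OF Comp_in_Hom[OF r(1) uX(1)] Comp_in_Hom[OF r(1) uX(2)] K[OF AO]] by simp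
  next
    have ADO: "X \<boxtimes> A \<in> Ob C" using Tens_in_Ob AO O by blast
    show "P (Zero C (Unit C) (X \<boxtimes> A)) = Zero C D A" unfolding P_def
      using left_TensA_Zero[OF U ADO O(2)] Zero_Comp[OF Tens_in_Ob[OF O(2) ADO] r(1)] Comp_Zero[OF O(2) K[OF AO]] by simp
  next
    fix i \<phi> assume i: "i \<in> I" and \<phi>: "\<phi> \<in> Hom C (Unit C) (X \<boxtimes> Y i)"
    have YO: "Y i \<in> Ob C" using Hom_Ob(1)[OF \<iota>[OF i]] .
    define \<psi> where "\<psi> = K (Y i) \<cdot> ((Ident C D \<star> \<phi>) \<cdot> r)"
    have "\<psi> \<in> Hom C D (Y i)" unfolding \<psi>_def
      using Comp_in_Hom[OF Comp_in_Hom[OF r(1) Ident_TensA_in_Hom[OF \<phi> O(2)]] K[OF YO]] .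
    moreover have "P ((Ident C X \<star> \<iota> i) \<cdot> \<phi>) = \<iota> i \<cdot> \<psi>"
    proof -
      have "P ((Ident C X \<star> \<iota> i) \<cdot> \<phi>) = (K A \<cdot> (Ident C D \<star> (Ident C X \<star> \<iota> i))) \<cdot> ((Ident C D \<star> \<phi>) \<cdot> r)"
        unfolding P_def using K[OF AO] \<iota>[OF i] \<phi> r(1) O AO YO U by (simp add: Hom_def mon_simps TensA_split)
      also have "\<dots> = \<iota> i \<cdot> \<psi>"
        unfolding \<psi>_def K_nat[OF \<iota>[OF i]] using K[OF YO] \<iota>[OF i] \<phi> r(1) O YO U by (simp add: Hom_def mon_simps)
      finally show ?thesis .
    qed
    ultimately show "\<exists>\<psi>. \<psi> \<in> Hom C D (Y i) \<and> P ((Ident C X \<star> \<iota> i) \<cdot> \<phi>) = \<iota> i \<cdot> \<psi>" by blast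
  qed
  ultimately show "w \<in> finite_sums C D A I Y \<iota>" by simp
qed

end

section \<open>Thick subcategories\<close>

context triangulated_category
begin

text \<open>Retracts and direct summands agree by \<open>retract_biproduct\<close>. Retracts pass
  through every functor, which makes this form easier to verify.\<close>

lemma thick_iff:
  "thick C A \<longleftrightarrow> triangulated_subcategory C A \<and>
    (\<forall>X B i p. B \<in> A \<longrightarrow> i \<in> Hom C X B \<longrightarrow> p \<in> Hom C B X \<longrightarrow> p \<cdot> i = Ident C X \<longrightarrow> X \<in> A)"
proof
  assume t: "thick C A"
  have "X \<in> A" if r: "B \<in> A" "i \<in> Hom C X B" "p \<in> Hom C B X" "p \<cdot> i = Ident C X" for X B i p
  proof -
    obtain Z i' p' where Z: "biproduct C X Z B" "i' \<in> Hom C Z B" using retract_biproduct[OF r(2-4)] .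
    show ?thesis using t r(1) Z(1) Hom_Ob(1)[OF r(2)] Hom_Ob(1)[OF Z(2)] unfolding thick_def by blast
  qed
  then show "triangulated_subcategory C A \<and>
    (\<forall>X B i p. B \<in> A \<longrightarrow> i \<in> Hom C X B \<longrightarrow> p \<in> Hom C B X \<longrightarrow> p \<cdot> i = Ident C X \<longrightarrow> X \<in> A)"
    using t unfolding thick_def by blast
next
  assume t: "triangulated_subcategory C A \<and>
    (\<forall>X B i p. B \<in> A \<longrightarrow> i \<in> Hom C X B \<longrightarrow> p \<in> Hom C B X \<longrightarrow> p \<cdot> i = Ident C X \<longrightarrow> X \<in> A)"
  show "thick C A" unfolding thick_def
  proof (intro conjI ballI impI)
    show "triangulated_subcategory C A" using t by blast
    fix X Y B assume "B \<in> A" "biproduct C X Y B"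
    then show "X \<in> A" "Y \<in> A" using t unfolding biproduct_def by metis+
  qed
qed

lemma thick_retract:
  "thick C A \<Longrightarrow> B \<in> A \<Longrightarrow> i \<in> Hom C X B \<Longrightarrow> p \<in> Hom C B X \<Longrightarrow> p \<cdot> i = Ident C X \<Longrightarrow> X \<in> A"
  unfolding thick_iff by blast

lemma thick_triangulated: "thick C A \<Longrightarrow> triangulated_subcategory C A"
  by (simp add: thick_def)

lemma thick_INT:
  assumes A: "\<And>i. i \<in> I \<Longrightarrow> thick C (A i)" and I: "I \<noteq> {}" shows "thick C (\<Inter>i\<in>I. A i)"
  unfolding thick_iff triangulated_subcategory_def
proof (intro conjI allI impI ballI)
  note dA = triangulated_subcategoryD[OF thick_triangulated[OF A]]
  show "(\<Inter>i\<in>I. A i) \<subseteq> Ob C" using dA(1) I by blast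
  show "Z \<in> (\<Inter>i\<in>I. A i)" if "zero_object C Z" for Z using dA(2)[OF _ that] by blast
  show "Y \<in> (\<Inter>i\<in>I. A i)" if "X \<in> (\<Inter>i\<in>I. A i)" "isomorphic C X Y" for X Y
    using dA(3)[OF _ _ that(2)] that(1) by blast
  show "X \<in> (\<Inter>i\<in>I. A i) \<longleftrightarrow> Sh C X \<in> (\<Inter>i\<in>I. A i)" if "X \<in> Ob C" for X using dA(4)[OF _ that] by blast
  show "Cod C g \<in> (\<Inter>i\<in>I. A i)"
    if "(f, g, h) \<in> Tri C" "Dom C f \<in> (\<Inter>i\<in>I. A i)" "Cod C f \<in> (\<Inter>i\<in>I. A i)" for f g h
    using dA(5)[OF _ that(1)] that(2,3) by blast
  show "X \<in> (\<Inter>i\<in>I. A i)"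
    if "V \<in> (\<Inter>i\<in>I. A i)" "k \<in> Hom C X V" "p \<in> Hom C V X" "p \<cdot> k = Ident C X" for X V k p
    using thick_retract[OF A _ that(2-4)] that(1) by blast
qed

lemma thick_Int: "thick C A \<Longrightarrow> thick C B \<Longrightarrow> thick C (A \<inter> B)"
  using thick_INT[of "{A, B}" "\<lambda>A. A"] by auto

text \<open>The split triangle puts the sum back together; this makes the basic open sets of the
  spectrum closed under intersection.\<close>

lemma thick_biproduct:
  assumes A: "thick C A" and b: "biproduct C X Y B"
  shows "B \<in> A \<longleftrightarrow> X \<in> A \<and> Y \<in> A"
proof
  have O: "X \<in> Ob C" "Y \<in> Ob C" using b Hom_Ob unfolding biproduct_def by blast+
  show "B \<in> A \<Longrightarrow> X \<in> A \<and> Y \<in> A" using A b O unfolding thick_def by blast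
  assume XY: "X \<in> A \<and> Y \<in> A"
  obtain i g h where t: "(i, g, h) \<in> Tri C" "Dom C i = X" "Cod C i = B" "isomorphic C (Cod C g) Y"
    using biproduct_triangle[OF b] .
  have i: "i \<in> Hom C X B" "g \<in> Hom C B (Cod C g)"
    using Tri_candidate[OF t(1)] t(2,3) by (auto simp: candidate_triangle_def Hom_def)
  have "Cod C g \<in> A" using triangulated_subcategoryD(3)[OF thick_triangulated[OF A]] XY isomorphic_sym[OF t(4)] by blast
  then show "B \<in> A" using triangulated_subcategory_two_of_three(3)[OF thick_triangulated[OF A] t(1) i] XY by blast
qed

lemma left_orthogonal_thick: "shift_stable C B \<Longrightarrow> thick C (left_orthogonal C B)"
  unfolding thick_iff using left_orthogonal_localizing[of B] left_orthogonal_retract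
  by (auto simp: localizing_def)

end

context tt_category
begin

lemma zero_object_TensA:
  assumes "zero_object C Z" "W \<in> Ob C" shows "zero_object C (Z \<boxtimes> W)"
proof -
  have Z: "Z \<in> Ob C" using assms by (simp add: zero_object_def)
  then show ?thesis
    using zero_object_iff[OF Z] zero_object_iff[OF Tens_in_Ob[OF Z assms(2)]] assms TensA_Ident[OF Z assms(2)]
      TensA_Zero[OF Z Z assms(2)] by simp
qed

text \<open>A preimage under the exact functor of tensoring with \<open>W\<close>; suspensions are
  compared through \<open>Susp\<close>.\<close>

lemma thick_tensor_preimage:
  assumes A: "thick C A" and W: "W \<in> Ob C"
  shows "thick C {X \<in> Ob C. X \<boxtimes> W \<in> A}"
  unfolding thick_iff triangulated_subcategory_def
proof (intro conjI allI impI ballI)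
  note tA = thick_triangulated[OF A]
  show "{X \<in> Ob C. X \<boxtimes> W \<in> A} \<subseteq> Ob C" by blast
  show "Z \<in> {X \<in> Ob C. X \<boxtimes> W \<in> A}" if "zero_object C Z" for Z
    using triangulated_subcategoryD(2)[OF tA zero_object_TensA[OF that W]] that by (simp add: zero_object_def)
  show "Y \<in> {X \<in> Ob C. X \<boxtimes> W \<in> A}" if "X \<in> {X \<in> Ob C. X \<boxtimes> W \<in> A}" "Y \<in> Ob C" "isomorphic C X Y" for X Y
    using that triangulated_subcategoryD(3)[OF tA _ isomorphic_TensA[OF that(3) isomorphic_refl[OF W]]] by blast
  show "X \<in> {X \<in> Ob C. X \<boxtimes> W \<in> A} \<longleftrightarrow> Sh C X \<in> {X \<in> Ob C. X \<boxtimes> W \<in> A}" if X: "X \<in> Ob C" for X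
    using triangulated_subcategoryD(4)[OF tA Tens_in_Ob[OF X W]]
      triangulated_subcategoryD(3)[OF tA _ isomorphic_Susp[OF X W]]
      triangulated_subcategoryD(3)[OF tA _ isomorphic_sym[OF isomorphic_Susp[OF X W]]] X Sh_in_Ob[OF X] by blast
  show "Cod C g \<in> {X \<in> Ob C. X \<boxtimes> W \<in> A}"
    if t: "(f, g, h) \<in> Tri C" "Dom C f \<in> {X \<in> Ob C. X \<boxtimes> W \<in> A}" "Cod C f \<in> {X \<in> Ob C. X \<boxtimes> W \<in> A}" for f g h
  proof -
    obtain X Y Z where fg: "f \<in> Hom C X Y" "g \<in> Hom C Y Z" "h \<in> Hom C Z (Sh C X)" using TriD[OF t(1)] .
    have "X \<boxtimes> W \<in> A" "Y \<boxtimes> W \<in> A" using t HomD[OF fg(1)] by auto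
    then have "Z \<boxtimes> W \<in> A"
      using triangulated_subcategory_two_of_three(1)[OF tA tensor_triangle[OF t(1) fg(1) W] TensA_Ident_in_Hom[OF fg(1) W] TensA_Ident_in_Hom[OF fg(2) W]] by blast
    then show ?thesis using HomD[OF fg(2)] Hom_Ob[OF fg(2)] by simp
  qed
  show "X \<in> {X \<in> Ob C. X \<boxtimes> W \<in> A}"
    if r: "B \<in> {X \<in> Ob C. X \<boxtimes> W \<in> A}" "i \<in> Hom C X B" "p \<in> Hom C B X" "p \<cdot> i = Ident C X" for X B i p
  proof -
    have X: "X \<in> Ob C" using Hom_Ob r by blast
    have "(p \<star> Ident C W) \<cdot> (i \<star> Ident C W) = Ident C (X \<boxtimes> W)"
      using TensA_Comp[OF r(2,3) Ident_in_Hom[OF W] Ident_in_Hom[OF W]] r(4) TensA_Ident[OF X W] Ident_Comp[OF Ident_in_Hom[OF W]] by simp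
    then have "X \<boxtimes> W \<in> A"
      using thick_retract[OF A _ TensA_Ident_in_Hom[OF r(2) W] TensA_Ident_in_Hom[OF r(3) W]] r(1) by blast
    then show ?thesis using X by blast
  qed
qed

end

section \<open>Rigidly-compactly generated categories and their spectra\<close>

lemma Hom_full_subcategory: "X \<in> K \<Longrightarrow> Y \<in> K \<Longrightarrow> Hom (full_subcategory C K) X Y = Hom C X Y"
  by (auto simp: Hom_def full_subcategory_def)

lemma full_subcategory_simps:
  "Ob (full_subcategory C K) = K" "Comp (full_subcategory C K) = Comp C" "Ident (full_subcategory C K) = Ident C"
  "Dom (full_subcategory C K) = Dom C" "Cod (full_subcategory C K) = Cod C" "Sh (full_subcategory C K) = Sh C"
  "Zero (full_subcategory C K) = Zero C" "Add (full_subcategory C K) = Add C" "Tens (full_subcategory C K) = Tens C"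
  "Tri (full_subcategory C K) = {(f, g, h) \<in> Tri C. Dom C f \<in> K \<and> Cod C f \<in> K \<and> Cod C g \<in> K}"
  by (simp_all add: full_subcategory_def)

locale rigid_category = tt_category C
  for C :: "('o, 'm, 'x) tt_cat_scheme" (structure) +
  fixes \<kappa> :: "'u rel"
  assumes inaccessible: "inaccessible \<kappa>" and rigidly_generated: "rigidly_compactly_generated \<kappa> C"
begin

abbreviation compact :: "'o set" where "compact \<equiv> compact_objects \<kappa> C"

lemma compact_Ob: "X \<in> compact \<Longrightarrow> X \<in> Ob C"
  by (simp add: compact_objects_def)

lemma compact_dualizable: "compact = dualizable_objects C"
  using rigidly_generated by (simp add: rigidly_compactly_generated_def)

lemma small_coproducts: "has_small_coproducts \<kappa> C" and local_smallness: "locally_small \<kappa> C"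
  using rigidly_generated by (auto simp: rigidly_compactly_generated_def)

lemma compact_Unit: "Unit C \<in> compact"
  using Unit_dualizable compact_dualizable by simp

section \<open>Closure properties of compact objects\<close>

lemma compact_Tens:
  assumes "X \<in> compact" "Y \<in> compact" shows "X \<boxtimes> Y \<in> compact"
proof -
  obtain D \<eta> \<epsilon> where "half_dual Y D \<eta> \<epsilon>" using dualizable_half_dual assms(2) compact_dualizable by metis
  then show ?thesis using compact_Tens_half_dual[OF assms(1)] by blast
qed

text \<open>The first duality identity, read as a retraction: coevaluation followed by evaluation is
  the identity of \<open>X\<close>.\<close>

lemma compact_dual:
  assumes "X \<in> compact"
  obtains D i q where "D \<in> compact" "i \<in> Hom C X ((X \<boxtimes> D) \<boxtimes> X)" "q \<in> Hom C ((X \<boxtimes> D) \<boxtimes> X) X" "q \<cdot> i = Ident C X"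
proof -
  obtain D \<eta> \<epsilon> where h: "half_dual X D \<eta> \<epsilon>"
    and e: "RUnit C X \<cdot> (Ident C X \<star> \<epsilon>) \<cdot> Assoc C X D X \<cdot> (\<eta> \<star> Ident C X) = LUnit C X"
    and e': "LUnit C D \<cdot> (\<epsilon> \<star> Ident C D) \<cdot> inverse_arrow C (Assoc C D X D) \<cdot> (Ident C D \<star> \<eta>) = RUnit C D"
    using dualizable_half_dual assms compact_dualizable by metis
  have O: "X \<in> Ob C" "D \<in> Ob C" and \<epsilon>: "\<epsilon> \<in> Hom C (D \<boxtimes> X) (Unit C)" and \<eta>: "\<eta> \<in> Hom C (Unit C) (X \<boxtimes> D)"
    using h by (auto simp: half_dual_def)
  note U = Unit_in_Ob
  obtain l where l: "l \<in> Hom C X (Unit C \<boxtimes> X)" "LUnit C X \<cdot> l = Ident C X" using isomorphismE[OF LUnit_simps(5,4)[OF O(1)]] by metis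
  define i where "i = (\<eta> \<star> Ident C X) \<cdot> l"
  define q where "q = RUnit C X \<cdot> (Ident C X \<star> \<epsilon>) \<cdot> Assoc C X D X"
  have "q \<cdot> i = (RUnit C X \<cdot> (Ident C X \<star> \<epsilon>) \<cdot> Assoc C X D X \<cdot> (\<eta> \<star> Ident C X)) \<cdot> l"
    unfolding q_def i_def using l(1) \<eta> \<epsilon> O U by (simp add: Hom_def mon_simps)
  then have "q \<cdot> i = Ident C X" using e l by simp
  moreover have "i \<in> Hom C X ((X \<boxtimes> D) \<boxtimes> X)" "q \<in> Hom C ((X \<boxtimes> D) \<boxtimes> X) X"
    unfolding q_def i_def using l(1) \<eta> \<epsilon> O U by (simp_all add: Hom_def mon_simps)
  ultimately show thesis using that[OF dual_compact[OF compact_Unit h e']] by blast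
qed

lemma compact_retract:
  assumes X: "X \<in> compact" and i: "i \<in> Hom C X' X" "p \<in> Hom C X X'" "p \<cdot> i = Ident C X'"
  shows "X' \<in> compact"
  unfolding compact_objects_iff
proof (intro conjI allI impI subsetI)
  show "X' \<in> Ob C" using Hom_Ob i by blast
  fix I :: "'u set" and Y A \<iota> w
  assume I: "small \<kappa> I" and A: "coproduct C I Y A \<iota>" and w: "w \<in> Hom C X' A"
  have "w \<cdot> p \<in> finite_sums C X A I Y \<iota>" using X I A Comp_in_Hom[OF i(2) w] unfolding compact_objects_iff by blast
  then have "(w \<cdot> p) \<cdot> i \<in> finite_sums C X' A I Y \<iota>" using finite_sums_Comp[OF A _ i(1)] by blast
  then show "w \<in> finite_sums C X' A I Y \<iota>" using Comp_assoc[OF i(1,2) w] i(3) Comp_Ident[OF w] by simp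
qed

lemma compact_isomorphic: "X \<in> compact \<Longrightarrow> isomorphic C X Y \<Longrightarrow> Y \<in> compact"
  unfolding isomorphic_def using compact_retract isomorphismE by metis

lemma compact_zero_object: "zero_object C Z \<Longrightarrow> Z \<in> compact"
  unfolding compact_objects_iff using zero_object_Hom(1)[of Z] finite_sums.zero by (fastforce simp: zero_object_def)

lemma compact_desuspension:
  assumes X: "X \<in> Ob C" "Sh C X \<in> compact" shows "X \<in> compact"
  unfolding compact_objects_iff
proof (intro conjI allI impI subsetI X)
  fix I :: "'u set" and Y A \<iota> w
  assume I: "small \<kappa> I" and A: "coproduct C I Y A \<iota>" and w: "w \<in> Hom C X A"
  have AO: "A \<in> Ob C" using coproductD(1)[OF A] .
  note \<iota> = coproductD(2)[OF A]
  have "ShA C w \<in> finite_sums C (Sh C X) (Sh C A) I (\<lambda>i. Sh C (Y i)) (\<lambda>i. ShA C (\<iota> i))"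
    using X(2) I coproduct_shift[OF A] ShA_in_Hom[OF w] unfolding compact_objects_iff by blast
  then have "\<exists>v \<in> finite_sums C X A I Y \<iota>. ShA C v = ShA C w"
  proof induction
    case zero
    show ?case using finite_sums.zero ShA_Zero[OF X(1) AO] by (intro bexI[of _ "Zero C X A"])
  next
    case (add i \<phi> w)
    obtain v where v: "v \<in> finite_sums C X A I Y \<iota>" "ShA C v = w" using add(4) by blast
    note YO = Hom_Ob(1)[OF \<iota>[OF add(1)]]
    obtain \<psi> where \<psi>: "\<psi> \<in> Hom C X (Y i)" "ShA C \<psi> = \<phi>" using ShA_full[OF X(1) YO add(2)] .
    have "ShA C ((\<iota> i \<cdot> \<psi>) \<boxplus> v) = (ShA C (\<iota> i) \<cdot> \<phi>) \<boxplus> w"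
      using ShA_Add[OF Comp_in_Hom[OF \<psi>(1) \<iota>[OF add(1)]] finite_sums_Hom[OF A X(1) v(1)]] ShA_Comp[OF \<psi>(1) \<iota>[OF add(1)]] v \<psi> by simp
    then show ?case using finite_sums.add[where C = C and X = X and Y = Y and A = A and \<iota> = \<iota>, OF add(1) \<psi>(1) v(1)] by blast
  qed
  then obtain v where v: "v \<in> finite_sums C X A I Y \<iota>" "ShA C v = ShA C w" by blast
  then show "w \<in> finite_sums C X A I Y \<iota>" using ShA_inj[OF finite_sums_Hom[OF A X(1) v(1)] w] by simp
qed

text \<open>The target \<open>A\<close> is a retract of the suspension of a coproduct
  \<open>B\<close> of desuspended summands. An arrow into that suspension desuspends, becomes a
  finite sum in \<open>B\<close>, and is suspended again.\<close>

lemma compact_shift: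
  assumes X: "X \<in> compact" shows "Sh C X \<in> compact"
  unfolding compact_objects_iff
proof (intro conjI allI impI subsetI)
  have XO: "X \<in> Ob C" using compact_Ob X by blast
  then show "Sh C X \<in> Ob C" using Sh_in_Ob by blast
  fix I :: "'u set" and Y A \<iota> w
  assume I: "small \<kappa> I" and A: "coproduct C I Y A \<iota>" and w: "w \<in> Hom C (Sh C X) A"
  note \<iota> = coproductD(2)[OF A]
  have "\<exists>Y' m. Y' \<in> Ob C \<and> m \<in> Hom C (Sh C Y') (Y i) \<and> isomorphism C m" if "i \<in> I" for i
    using ex_desuspension[OF Hom_Ob(1)[OF \<iota>[OF that]]] unfolding isomorphic_def by blast
  then obtain Y' m where Y': "\<And>i. i \<in> I \<Longrightarrow> Y' i \<in> Ob C" and m: "\<And>i. i \<in> I \<Longrightarrow> m i \<in> Hom C (Sh C (Y' i)) (Y i)"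
    "\<And>i. i \<in> I \<Longrightarrow> isomorphism C (m i)" by metis
  have "\<exists>n. n \<in> Hom C (Y i) (Sh C (Y' i)) \<and> m i \<cdot> n = Ident C (Y i)" if "i \<in> I" for i
    using isomorphismE[OF m(2)[OF that] m(1)[OF that]] by metis
  then obtain n where n: "\<And>i. i \<in> I \<Longrightarrow> n i \<in> Hom C (Y i) (Sh C (Y' i))" "\<And>i. i \<in> I \<Longrightarrow> m i \<cdot> n i = Ident C (Y i)" by metis
  obtain B \<beta> where B: "coproduct C I Y' B \<beta>" using ex_coproduct[OF inaccessible small_coproducts I Y'] .
  note SB = coproduct_shift[OF B]
  note \<beta> = coproductD(2)[OF B]
  have BO: "B \<in> Ob C" using coproductD(1)[OF B] .
  obtain c where c: "c \<in> Hom C (Sh C B) A" "\<And>i. i \<in> I \<Longrightarrow> c \<cdot> ShA C (\<beta> i) = \<iota> i \<cdot> m i"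
    using coproduct_arrow[OF SB coproductD(1)[OF A], of "\<lambda>i. \<iota> i \<cdot> m i"] Comp_in_Hom[OF m(1) \<iota>] by metis
  obtain d where d: "d \<in> Hom C A (Sh C B)" "\<And>i. i \<in> I \<Longrightarrow> d \<cdot> \<iota> i = ShA C (\<beta> i) \<cdot> n i"
    using coproduct_arrow[OF A coproductD(1)[OF SB], of "\<lambda>i. ShA C (\<beta> i) \<cdot> n i"] Comp_in_Hom[OF n(1) ShA_in_Hom[OF \<beta>]] by metis
  have cd: "c \<cdot> d = Ident C A"
  proof (rule coproduct_eqI[OF A Comp_in_Hom[OF d(1) c(1)] Ident_in_Hom[OF coproductD(1)[OF A]]])
    fix i assume i: "i \<in> I"
    have "(c \<cdot> d) \<cdot> \<iota> i = (c \<cdot> ShA C (\<beta> i)) \<cdot> n i"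
      using Comp_assoc[OF \<iota>[OF i] d(1) c(1)] d(2)[OF i] Comp_assoc[OF n(1)[OF i] ShA_in_Hom[OF \<beta>[OF i]] c(1)] by simp
    also have "\<dots> = Ident C A \<cdot> \<iota> i"
      using c(2)[OF i] Comp_assoc[OF n(1)[OF i] m(1)[OF i] \<iota>[OF i]] n(2)[OF i] Comp_Ident[OF \<iota>[OF i]] Ident_Comp[OF \<iota>[OF i]] by simp
    finally show "(c \<cdot> d) \<cdot> \<iota> i = Ident C A \<cdot> \<iota> i" .
  qed
  obtain v where v: "v \<in> Hom C X B" "ShA C v = d \<cdot> w" using ShA_full[OF XO BO Comp_in_Hom[OF w d(1)]] .
  have vs: "v \<in> finite_sums C X B I Y' \<beta>" using X I B v(1) unfolding compact_objects_iff by blast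
  have "c \<cdot> ShA C v \<in> finite_sums C (Sh C X) A I Y \<iota>"
  proof (rule finite_sums_transport[OF B XO vs])
    show "c \<cdot> ShA C (u \<boxplus> u') = c \<cdot> ShA C u \<boxplus> c \<cdot> ShA C u'" if "u \<in> Hom C X B" "u' \<in> Hom C X B" for u u'
      using ShA_Add[OF that] Comp_Add[OF ShA_in_Hom[OF that(1)] ShA_in_Hom[OF that(2)] c(1)] by simp
    show "c \<cdot> ShA C (Zero C X B) = Zero C (Sh C X) A"
      using ShA_Zero[OF XO BO] Comp_Zero[OF Sh_in_Ob[OF XO] c(1)] by simp
    fix i \<phi> assume i: "i \<in> I" and \<phi>: "\<phi> \<in> Hom C X (Y' i)"
    have "c \<cdot> ShA C (\<beta> i \<cdot> \<phi>) = \<iota> i \<cdot> (m i \<cdot> ShA C \<phi>)"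
      using ShA_Comp[OF \<phi> \<beta>[OF i]] Comp_assoc[OF ShA_in_Hom[OF \<phi>] ShA_in_Hom[OF \<beta>[OF i]] c(1)] c(2)[OF i]
        Comp_assoc[OF ShA_in_Hom[OF \<phi>] m(1)[OF i] \<iota>[OF i]] by simp
    then show "\<exists>\<psi>. \<psi> \<in> Hom C (Sh C X) (Y i) \<and> c \<cdot> ShA C (\<beta> i \<cdot> \<phi>) = \<iota> i \<cdot> \<psi>"
      using Comp_in_Hom[OF ShA_in_Hom[OF \<phi>] m(1)[OF i]] by blast
  qed
  then show "w \<in> finite_sums C (Sh C X) A I Y \<iota>"
    using v(2) Comp_assoc[OF w d(1) c(1)] cd Ident_Comp[OF w] by simp
qed

text \<open>The restriction of \<open>w\<close> to \<open>Y\<close> is fixed by an idempotent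
  \<open>e\<close> of finitely many summands, so \<open>w - e \<cdot> w\<close> factors through
  \<open>Sh C X\<close>. Both parts are finite sums: one because \<open>e\<close> is, the other
  because \<open>Sh C X\<close> is compact.\<close>

lemma compact_cone:
  assumes t: "(f, g, h) \<in> Tri C" "f \<in> Hom C X Y" "g \<in> Hom C Y Z" and XY: "X \<in> compact" "Y \<in> compact"
  shows "Z \<in> compact"
  unfolding compact_objects_iff
proof (intro conjI allI impI subsetI)
  show Z: "Z \<in> Ob C" using Hom_Ob t by blast
  have h: "h \<in> Hom C Z (Sh C X)" using Tri_Hom(2)[OF t(1,2)] HomD[OF t(3)] by simp
  fix I :: "'u set" and V A \<iota> w
  assume I: "small \<kappa> I" and A: "coproduct C I V A \<iota>" and w: "w \<in> Hom C Z A"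
  have AO: "A \<in> Ob C" using coproductD(1)[OF A] .
  have VO: "V i \<in> Ob C" if "i \<in> I" for i using Hom_Ob(1)[OF coproductD(2)[OF A that]] .
  obtain p where p: "\<And>i. i \<in> I \<Longrightarrow> p i \<in> Hom C A (V i)" "\<And>i. i \<in> I \<Longrightarrow> p i \<cdot> \<iota> i = Ident C (V i)"
      "\<And>i j. i \<in> I \<Longrightarrow> j \<in> I \<Longrightarrow> i \<noteq> j \<Longrightarrow> p i \<cdot> \<iota> j = Zero C (V j) (V i)"
    using coproduct_projections[OF A VO] by metis
  note wg = Comp_in_Hom[OF t(3) w]
  have wgs: "w \<cdot> g \<in> finite_sums C Y A I V \<iota>" using XY(2) I A wg unfolding compact_objects_iff by blast
  have "\<exists>e. e \<in> finite_sums C A A I V \<iota> \<and> e \<cdot> (w \<cdot> g) = w \<cdot> g \<and> (\<forall>i\<in>I. e \<cdot> \<iota> i = \<iota> i \<or> e \<cdot> \<iota> i = Zero C (V i) A) \<and>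
    (\<forall>W v. v \<in> Hom C W A \<longrightarrow> (\<forall>i\<in>I. p i \<cdot> v = Zero C W (V i)) \<longrightarrow> e \<cdot> v = Zero C W A)"
    by (rule finite_sums_idempotent[OF A Hom_Ob(1)[OF wg] wgs]) (use p in auto)
  then obtain e where e: "e \<in> finite_sums C A A I V \<iota>" "e \<cdot> (w \<cdot> g) = w \<cdot> g" by blast
  note eH = finite_sums_Hom[OF A AO e(1)]
  note ew = Comp_in_Hom[OF w eH]
  have "(w \<boxplus> neg C (e \<cdot> w)) \<cdot> g = Zero C Y A"
    using Add_Comp[OF t(3) w neg_in_Hom[OF ew]] neg_Comp[OF t(3) ew] Comp_assoc[OF t(3) w eH] e(2) Add_neg[OF wg] by simp
  then obtain v where v: "v \<in> Hom C (Sh C X) A" "v \<cdot> h = w \<boxplus> neg C (e \<cdot> w)"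
    using Tri_weak_cokernel'[OF t Add_in_Hom[OF w neg_in_Hom[OF ew]]] by metis
  have "v \<in> finite_sums C (Sh C X) A I V \<iota>" using compact_shift[OF XY(1)] I A v(1) unfolding compact_objects_iff by blast
  then have "v \<cdot> h \<in> finite_sums C Z A I V \<iota>" using finite_sums_Comp[OF A _ h] by blast
  moreover have "e \<cdot> w \<in> finite_sums C Z A I V \<iota>" using finite_sums_Comp[OF A e(1) w] .
  ultimately have "v \<cdot> h \<boxplus> e \<cdot> w \<in> finite_sums C Z A I V \<iota>" using finite_sums_Add[OF A Z] by blast
  moreover have "v \<cdot> h \<boxplus> e \<cdot> w = w"
    using v(2) Add_assoc[OF w neg_in_Hom[OF ew] ew] Add_commute[OF neg_in_Hom[OF ew] ew] Add_neg[OF ew] Add_Zero[OF w] by simp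
  ultimately show "w \<in> finite_sums C Z A I V \<iota>" by simp
qed

lemma thick_compact: "thick C compact"
  unfolding thick_iff triangulated_subcategory_def
proof (intro conjI allI impI ballI)
  show "compact \<subseteq> Ob C" using compact_Ob by blast
  show "X \<in> compact \<longleftrightarrow> Sh C X \<in> compact" if "X \<in> Ob C" for X using that compact_shift compact_desuspension by blast
  show "Cod C g \<in> compact" if t: "(f, g, h) \<in> Tri C" "Dom C f \<in> compact" "Cod C f \<in> compact" for f g h
  proof -
    obtain X Y Z where fg: "f \<in> Hom C X Y" "g \<in> Hom C Y Z" "h \<in> Hom C Z (Sh C X)" using TriD[OF t(1)] .
    then show ?thesis using compact_cone[OF t(1) fg(1,2)] t HomD[OF fg(1)] HomD[OF fg(2)] by simp
  qed
qed (use compact_zero_object compact_isomorphic compact_retract in blast)+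

section \<open>Thick ideals of compact objects\<close>

lemma isomorphism_compacts:
  assumes "X \<in> compact" "Y \<in> compact" "f \<in> Hom C X Y"
  shows "isomorphism (compacts \<kappa> C) f \<longleftrightarrow> isomorphism C f"
  using assms unfolding isomorphism_def inverse_arrows_def compacts_def
  by (auto simp: full_subcategory_simps Hom_full_subcategory HomD) (auto simp: full_subcategory_def Hom_def)

text \<open>Primes are defined inside the full subcategory of compact objects. This moves thickness
  to \<open>C\<close>, where cones are available; as compact objects are themselves thick, no cone
  or summand is lost.\<close>

lemma thick_compacts_iff: "thick (compacts \<kappa> C) A \<longleftrightarrow> A \<subseteq> compact \<and> thick C A"
proof
  let ?K = "compacts \<kappa> C"
  have Ob: "Ob ?K = compact" by (simp add: compacts_def full_subcategory_simps)
  have HomK: "Hom ?K X Y = Hom C X Y" if "X \<in> compact" "Y \<in> compact" for X Y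
    using that by (simp add: compacts_def Hom_full_subcategory)
  have z: "zero_object ?K Z \<longleftrightarrow> zero_object C Z" for Z
  proof
    assume z: "zero_object ?K Z"
    then have Z: "Z \<in> compact" by (simp add: zero_object_def Ob)
    have "\<exists>!f. f \<in> Hom ?K Z Z" using z Z unfolding zero_object_def Ob by blast
    then have u: "\<exists>!f. f \<in> Hom C Z Z" using HomK[OF Z Z] by simp
    then have "Ident C Z = Zero C Z Z" using Ident_in_Hom[OF compact_Ob[OF Z]] Zero_in_Hom compact_Ob[OF Z] by blast
    then show "zero_object C Z" using zero_object_iff[OF compact_Ob[OF Z]] by simp
  next
    assume z: "zero_object C Z"
    then show "zero_object ?K Z" using compact_zero_object[OF z] HomK[OF compact_zero_object[OF z]] HomK[OF _ compact_zero_object[OF z]] compact_Ob unfolding zero_object_def Ob by simp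
  qed
  have i: "isomorphic ?K X Y \<longleftrightarrow> isomorphic C X Y" if "X \<in> compact" "Y \<in> compact" for X Y
    using isomorphism_compacts[OF that] HomK[OF that] by (auto simp: isomorphic_def)
  have b: "biproduct ?K X Y B \<longleftrightarrow> biproduct C X Y B" if "X \<in> compact" "Y \<in> compact" "B \<in> compact" for X Y B
    unfolding biproduct_def HomK[OF that(1,3)] HomK[OF that(2,3)] HomK[OF that(3,1)] HomK[OF that(3,2)]
    by (simp add: compacts_def full_subcategory_simps)
  have s: "Sh ?K = Sh C" "Dom ?K = Dom C" "Cod ?K = Cod C"
    and T: "Tri ?K = {(f, g, h) \<in> Tri C. Dom C f \<in> compact \<and> Cod C f \<in> compact \<and> Cod C g \<in> compact}"
    by (simp_all add: compacts_def full_subcategory_simps)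
  note tK = thick_triangulated[OF thick_compact]
  show "A \<subseteq> compact \<and> thick C A" if th: "thick ?K A"
  proof
    have tA: "triangulated_subcategory ?K A" using th by (simp add: thick_def)
    then show AK: "A \<subseteq> compact" unfolding triangulated_subcategory_def Ob by blast
    show "thick C A" unfolding thick_def triangulated_subcategory_def
    proof (intro conjI allI impI ballI)
      show "A \<subseteq> Ob C" using AK compact_Ob by blast
      show "Z \<in> A" if "zero_object C Z" for Z using tA that z unfolding triangulated_subcategory_def by blast
      show "Y \<in> A" if "X \<in> A" "Y \<in> Ob C" "isomorphic C X Y" for X Y
        using tA that i[of X Y] AK compact_isomorphic[of X Y] unfolding triangulated_subcategory_def Ob by blast
      show "X \<in> A \<longleftrightarrow> Sh C X \<in> A" if "X \<in> Ob C" for X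
        using tA AK compact_desuspension[OF that] unfolding triangulated_subcategory_def Ob s by blast
      show "Cod C g \<in> A" if "(f, g, h) \<in> Tri C" "Dom C f \<in> A" "Cod C f \<in> A" for f g h
      proof -
        have "(f, g, h) \<in> Tri ?K" unfolding T using that AK triangulated_subcategoryD(5)[OF tK that(1)] by blast
        then show ?thesis using tA that unfolding triangulated_subcategory_def s by blast
      qed
      show "X \<in> A" "Y \<in> A" if "X \<in> Ob C" "Y \<in> Ob C" "B \<in> A" "biproduct C X Y B" for X Y B
        using th that b[of X Y B] AK thick_biproduct[OF thick_compact that(4)] unfolding thick_def Ob by blast+
    qed
  qed
  show "thick ?K A" if th: "A \<subseteq> compact \<and> thick C A"
    unfolding thick_def triangulated_subcategory_def Ob s
  proof (intro conjI allI impI ballI)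
    have AK: "A \<subseteq> compact" and tA: "triangulated_subcategory C A" using th thick_triangulated by auto
    show "A \<subseteq> compact" using AK .
    show "Z \<in> A" if "zero_object ?K Z" for Z using triangulated_subcategoryD(2)[OF tA] that z by blast
    show "Y \<in> A" if "X \<in> A" "Y \<in> compact" "isomorphic ?K X Y" for X Y
      using triangulated_subcategoryD(3)[OF tA] that i[of X Y] AK by blast
    show "X \<in> A \<longleftrightarrow> Sh C X \<in> A" if "X \<in> compact" for X
      using triangulated_subcategoryD(4)[OF tA] compact_Ob[OF that] by blast
    show "Cod C g \<in> A" if "(f, g, h) \<in> Tri ?K" "Dom C f \<in> A" "Cod C f \<in> A" for f g h
      using triangulated_subcategoryD(5)[OF tA] that unfolding T by blast
    show "X \<in> A" "Y \<in> A" if "X \<in> compact" "Y \<in> compact" "B \<in> A" "biproduct ?K X Y B" for X Y B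
      using thick_biproduct[of A X Y B] th that b[of X Y B] AK by blast+
  qed
qed

lemma thick_ideal_compacts_iff: "thick_ideal (compacts \<kappa> C) A \<longleftrightarrow>
    A \<subseteq> compact \<and> thick C A \<and> (\<forall>X \<in> compact. \<forall>Y \<in> A. X \<boxtimes> Y \<in> A)"
  unfolding thick_ideal_def thick_compacts_iff by (simp add: compacts_def full_subcategory_simps)

lemma thick_idealD:
  assumes "thick_ideal (compacts \<kappa> C) A"
  shows "A \<subseteq> compact" "thick C A" "X \<in> compact \<Longrightarrow> Y \<in> A \<Longrightarrow> X \<boxtimes> Y \<in> A" "X \<in> A \<Longrightarrow> isomorphic C X Y \<Longrightarrow> Y \<in> A"
  using assms triangulated_subcategoryD(3) thick_triangulated unfolding thick_ideal_compacts_iff by blast+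

text \<open>The colon ideal of \<open>J\<close> by \<open>Y\<close>: a preimage under an exact
  functor, and an ideal by associativity.\<close>

lemma thick_ideal_quotient:
  assumes J: "thick_ideal (compacts \<kappa> C) J" and Y: "Y \<in> compact"
  shows "thick_ideal (compacts \<kappa> C) {Z \<in> compact. Z \<boxtimes> Y \<in> J}"
  unfolding thick_ideal_compacts_iff
proof (intro conjI ballI)
  have "{Z \<in> compact. Z \<boxtimes> Y \<in> J} = compact \<inter> {Z \<in> Ob C. Z \<boxtimes> Y \<in> J}" using compact_Ob by blast
  then show "thick C {Z \<in> compact. Z \<boxtimes> Y \<in> J}"
    using thick_Int[OF thick_compact thick_tensor_preimage[OF thick_idealD(2)[OF J] compact_Ob[OF Y]]] by simp
  fix X Z assume X: "X \<in> compact" and Z: "Z \<in> {Z \<in> compact. Z \<boxtimes> Y \<in> J}"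
  have "isomorphic C (X \<boxtimes> (Z \<boxtimes> Y)) ((X \<boxtimes> Z) \<boxtimes> Y)"
    using isomorphic_sym[OF isomorphic_Assoc] X Z Y compact_Ob by blast
  then show "X \<boxtimes> Z \<in> {Z \<in> compact. Z \<boxtimes> Y \<in> J}"
    using thick_idealD(3)[OF J X] thick_idealD(4)[OF J] compact_Tens[OF X] Z by blast
qed blast

lemma thick_ideal_commute:
  assumes J: "thick_ideal (compacts \<kappa> C) J" and "X \<in> compact" "Y \<in> compact"
  shows "X \<boxtimes> Y \<in> J \<longleftrightarrow> Y \<boxtimes> X \<in> J"
  using thick_idealD(4)[OF J] isomorphic_Braid assms(2,3) compact_Ob by blast

text \<open>By rigidity, \<open>X\<close> is a retract of \<open>(X \<boxtimes> D) \<boxtimes> X\<close>, where \<open>D\<close> is its dual.\<close>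

lemma thick_ideal_radical:
  assumes J: "thick_ideal (compacts \<kappa> C) J" and X: "X \<in> compact" and XX: "X \<boxtimes> X \<in> J"
  shows "X \<in> J"
proof -
  obtain D i q where D: "D \<in> compact" and r: "i \<in> Hom C X ((X \<boxtimes> D) \<boxtimes> X)" "q \<in> Hom C ((X \<boxtimes> D) \<boxtimes> X) X" "q \<cdot> i = Ident C X"
    using compact_dual[OF X] .
  have O: "X \<in> Ob C" "D \<in> Ob C" using X D compact_Ob by auto
  have "D \<boxtimes> (X \<boxtimes> X) \<in> J" using thick_idealD(3)[OF J D XX] .
  moreover have "isomorphic C (D \<boxtimes> (X \<boxtimes> X)) ((D \<boxtimes> X) \<boxtimes> X)" using isomorphic_sym[OF isomorphic_Assoc[OF O(2,1,1)]] .
  moreover have "isomorphic C ((D \<boxtimes> X) \<boxtimes> X) ((X \<boxtimes> D) \<boxtimes> X)"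
    using isomorphic_TensA[OF isomorphic_Braid[OF O(2,1)] isomorphic_refl[OF O(1)]] .
  ultimately have "(X \<boxtimes> D) \<boxtimes> X \<in> J" using thick_idealD(4)[OF J] by blast
  then show ?thesis using thick_retract[OF thick_idealD(2)[OF J] _ r] by blast
qed

lemma thick_ideal_Union_chain:
  assumes c: "subset.chain {J. thick_ideal (compacts \<kappa> C) J} \<C>" and ne: "\<C> \<noteq> {}"
  shows "thick_ideal (compacts \<kappa> C) (\<Union>\<C>)"
proof -
  have J: "thick_ideal (compacts \<kappa> C) J" if "J \<in> \<C>" for J using c that by (auto simp: subset.chain_def)
  have pair: "\<exists>J\<in>\<C>. X \<in> J \<and> Y \<in> J" if "X \<in> \<Union>\<C>" "Y \<in> \<Union>\<C>" for X Y
    using that c unfolding subset.chain_def by blast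
  note tJ = thick_triangulated[OF thick_idealD(2)[OF J]]
  show ?thesis unfolding thick_ideal_compacts_iff thick_iff triangulated_subcategory_def
  proof (intro conjI allI impI ballI)
    show "\<Union>\<C> \<subseteq> compact" using thick_idealD(1)[OF J] by blast
    then show "\<Union>\<C> \<subseteq> Ob C" using compact_Ob by blast
    show "Z \<in> \<Union>\<C>" if "zero_object C Z" for Z using triangulated_subcategoryD(2)[OF tJ that] ne by blast
    show "Y \<in> \<Union>\<C>" if "X \<in> \<Union>\<C>" "isomorphic C X Y" for X Y using that thick_idealD(4)[OF J] by blast
    show "X \<in> \<Union>\<C> \<longleftrightarrow> Sh C X \<in> \<Union>\<C>" if "X \<in> Ob C" for X using triangulated_subcategoryD(4)[OF tJ that] by blast
    show "Cod C g \<in> \<Union>\<C>" if "(f, g, h) \<in> Tri C" "Dom C f \<in> \<Union>\<C>" "Cod C f \<in> \<Union>\<C>" for f g h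
      using pair[OF that(2,3)] triangulated_subcategoryD(5)[OF tJ that(1)] by blast
    show "X \<in> \<Union>\<C>" if "B \<in> \<Union>\<C>" "i \<in> Hom C X B" "p \<in> Hom C B X" "p \<cdot> i = Ident C X" for X B i p
      using thick_retract[OF thick_idealD(2)[OF J] _ that(2-4)] that(1) by blast
    show "X \<boxtimes> Y \<in> \<Union>\<C>" if "X \<in> compact" "Y \<in> \<Union>\<C>" for X Y using thick_idealD(3)[OF J that(1)] that(2) by blast
  qed
qed

section \<open>Primes and the topology of the spectrum\<close>

lemma primes_iff: "P \<in> primes (compacts \<kappa> C) \<longleftrightarrow> thick_ideal (compacts \<kappa> C) P \<and> P \<noteq> compact \<and>
    (\<forall>X \<in> compact. \<forall>Y \<in> compact. X \<boxtimes> Y \<in> P \<longrightarrow> X \<in> P \<or> Y \<in> P)"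
  unfolding primes_def by (simp add: compacts_def full_subcategory_simps)

text \<open>Zorn's lemma gives an ideal maximal among those containing \<open>J\<close> and avoiding
  \<open>X\<close>. Ideals are radical, so avoiding \<open>X\<close> takes the place of avoiding all
  its powers.\<close>

lemma ex_prime:
  assumes J: "thick_ideal (compacts \<kappa> C) J" and X: "X \<in> compact" "X \<notin> J"
  obtains P where "P \<in> primes (compacts \<kappa> C)" "J \<subseteq> P" "X \<notin> P"
proof -
  define \<A> where "\<A> = {I. thick_ideal (compacts \<kappa> C) I \<and> J \<subseteq> I \<and> X \<notin> I}"
  have "\<exists>M\<in>\<A>. \<forall>I\<in>\<A>. M \<subseteq> I \<longrightarrow> I = M"
  proof (rule subset_Zorn_nonempty)
    show "\<A> \<noteq> {}" using J X by (auto simp: \<A>_def)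
    fix \<C> assume ne: "\<C> \<noteq> {}" and c: "subset.chain \<A> \<C>"
    have "subset.chain {J. thick_ideal (compacts \<kappa> C) J} \<C>" using c by (auto simp: subset.chain_def \<A>_def)
    then show "\<Union>\<C> \<in> \<A>" using thick_ideal_Union_chain ne c by (auto simp: \<A>_def subset.chain_def)
  qed
  then obtain P where P: "P \<in> \<A>" "\<And>I. I \<in> \<A> \<Longrightarrow> P \<subseteq> I \<Longrightarrow> I = P" by blast
  have iP: "thick_ideal (compacts \<kappa> C) P" and JP: "J \<subseteq> P" and XP: "X \<notin> P" using P(1) by (auto simp: \<A>_def)
  have max: "X \<in> I" if "thick_ideal (compacts \<kappa> C) I" "P \<subseteq> I" "Y \<in> I" "Y \<notin> P" for I Y
    using P(2)[of I] that JP by (auto simp: \<A>_def)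
  have "Y \<in> P \<or> Z \<in> P" if Y: "Y \<in> compact" and Z: "Z \<in> compact" and YZ: "Y \<boxtimes> Z \<in> P" for Y Z
  proof (rule ccontr)
    assume n: "\<not> (Y \<in> P \<or> Z \<in> P)"
    have sub: "P \<subseteq> {V \<in> compact. V \<boxtimes> W \<in> P}" if W: "W \<in> compact" for W
      using thick_idealD(1)[OF iP] thick_idealD(3)[OF iP W] thick_ideal_commute[OF iP W] by blast
    \<comment> \<open>Two colon ideals in turn: the one by \<open>Z\<close> is larger than
      \<open>P\<close> because of \<open>Y\<close>, the one by \<open>X\<close> because of
      \<open>Z\<close>. By maximality both contain \<open>X\<close>, so
      \<open>X \<boxtimes> X\<close> lies in \<open>P\<close>.\<close>
    have "X \<in> {V \<in> compact. V \<boxtimes> Z \<in> P}"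
      by (rule max[OF thick_ideal_quotient[OF iP Z] sub[OF Z], of Y]) (use Y YZ n in auto)
    then have "Z \<in> {V \<in> compact. V \<boxtimes> X \<in> P}" using thick_ideal_commute[OF iP X(1) Z] Z by blast
    then have "X \<in> {V \<in> compact. V \<boxtimes> X \<in> P}"
      using max[OF thick_ideal_quotient[OF iP X(1)] sub[OF X(1)], of Z] n by blast
    then show False using thick_ideal_radical[OF iP X(1)] XP by blast
  qed
  then have "P \<in> primes (compacts \<kappa> C)" unfolding primes_iff using iP X XP by blast
  then show thesis using that JP XP by blast
qed

lemma supp_compacts: "supp (compacts \<kappa> C) X = {P \<in> primes (compacts \<kappa> C). X \<notin> P}"
  by (simp add: supp_def)

text \<open>A prime contains a direct sum exactly if it contains both summands; so the base is
  closed under binary intersections.\<close>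

lemma Spc_base_Int:
  assumes "X \<in> compact" "Y \<in> compact"
  obtains B where "B \<in> compact" "\<And>P. P \<in> primes (compacts \<kappa> C) \<Longrightarrow> B \<in> P \<longleftrightarrow> X \<in> P \<and> Y \<in> P"
proof -
  obtain B where B: "biproduct C X Y B" using ex_biproduct assms compact_Ob by blast
  then show thesis using that thick_biproduct[OF _ B] thick_compact assms thick_idealD(2) unfolding primes_iff by blast
qed

lemma openin_Spc: "openin (Spc (compacts \<kappa> C)) U \<longleftrightarrow>
    (arbitrary union_of (\<lambda>U. \<exists>X \<in> compact. U = {P \<in> primes (compacts \<kappa> C). X \<in> P})) U"
proof -
  have eq: "(\<lambda>U. \<exists>X \<in> Ob (compacts \<kappa> C). U = primes (compacts \<kappa> C) - supp (compacts \<kappa> C) X) =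
    (\<lambda>U. \<exists>X \<in> compact. U = {P \<in> primes (compacts \<kappa> C). X \<in> P})"
  proof -
    have "primes (compacts \<kappa> C) - supp (compacts \<kappa> C) X = {P \<in> primes (compacts \<kappa> C). X \<in> P}" for X
      by (auto simp: supp_def)
    then show ?thesis by (simp add: compacts_def full_subcategory_simps)
  qed
  have "istopology (arbitrary union_of (\<lambda>U. \<exists>X \<in> compact. U = {P \<in> primes (compacts \<kappa> C). X \<in> P}))"
  proof (rule istopology_base)
    fix U V assume "\<exists>X \<in> compact. U = {P \<in> primes (compacts \<kappa> C). X \<in> P}" "\<exists>X \<in> compact. V = {P \<in> primes (compacts \<kappa> C). X \<in> P}"
    then obtain X Y where XY: "X \<in> compact" "Y \<in> compact" and U: "U = {P \<in> primes (compacts \<kappa> C). X \<in> P}"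
      "V = {P \<in> primes (compacts \<kappa> C). Y \<in> P}" by blast
    obtain B where "B \<in> compact" "\<And>P. P \<in> primes (compacts \<kappa> C) \<Longrightarrow> B \<in> P \<longleftrightarrow> X \<in> P \<and> Y \<in> P"
      using Spc_base_Int[OF XY] by metis
    then show "\<exists>X \<in> compact. U \<inter> V = {P \<in> primes (compacts \<kappa> C). X \<in> P}" unfolding U by blast
  qed
  then show ?thesis unfolding Spc_def eq by (simp add: topology_inverse')
qed

lemma openin_Spc_base: "X \<in> compact \<Longrightarrow> openin (Spc (compacts \<kappa> C)) {P \<in> primes (compacts \<kappa> C). X \<in> P}"
  unfolding openin_Spc by (rule arbitrary_union_of_inc) blast

text \<open>A basic open set asks the prime to contain an object, which larger primes inherit.
  Larger primes are thus generizations, opposite to the order for rings.\<close>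

lemma openin_Spc_subset:
  assumes "openin (Spc (compacts \<kappa> C)) U" "P \<in> U"
  shows "P \<in> primes (compacts \<kappa> C)"
    and "P' \<in> primes (compacts \<kappa> C) \<Longrightarrow> P \<subseteq> P' \<Longrightarrow> P' \<in> U"
  using assms unfolding openin_Spc arbitrary_union_of_alt by blast+

lemma topspace_Spc: "topspace (Spc (compacts \<kappa> C)) = primes (compacts \<kappa> C)"
proof
  show "topspace (Spc (compacts \<kappa> C)) \<subseteq> primes (compacts \<kappa> C)"
    using openin_Spc_subset(1)[OF openin_topspace] by blast
  obtain Z where Z: "zero_object C Z" using ex_zero_object by blast
  have "Z \<in> P" if "P \<in> primes (compacts \<kappa> C)" for P
    using that triangulated_subcategoryD(2)[OF thick_triangulated Z] thick_idealD(2) unfolding primes_iff by blast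
  then show "primes (compacts \<kappa> C) \<subseteq> topspace (Spc (compacts \<kappa> C))"
    using openin_subset[OF openin_Spc_base[OF compact_zero_object[OF Z]]] by blast
qed

lemma closedin_supp: "X \<in> compact \<Longrightarrow> closedin (Spc (compacts \<kappa> C)) (supp (compacts \<kappa> C) X)"
proof -
  assume X: "X \<in> compact"
  have "supp (compacts \<kappa> C) X = topspace (Spc (compacts \<kappa> C)) - {P \<in> primes (compacts \<kappa> C). X \<in> P}"
    unfolding topspace_Spc supp_def by blast
  then show ?thesis using closedin_diff[OF closedin_topspace openin_Spc_base[OF X]] by simp
qed

end

section \<open>Fully faithful geometric functors\<close>

lemma localizing_small_coproduct:
  fixes I :: "'u set" and \<kappa> :: "'u rel"
  assumes "localizing \<kappa> C A" "small \<kappa> I" "X ` I \<subseteq> A" "coproduct C I X B \<iota>"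
  shows "B \<in> A"
proof -
  have "\<forall>(I :: 'u set) X B \<iota>. small \<kappa> I \<longrightarrow> X ` I \<subseteq> A \<longrightarrow> coproduct C I X B \<iota> \<longrightarrow> B \<in> A"
    using assms(1) by (simp add: localizing_def)
  then show ?thesis using assms(2-4) by metis
qed

section \<open>Uniqueness of coproducts and cones, generated localizing subcategories, internal
  homs\<close>

context category
begin

lemma coproduct_unique:
  assumes A: "coproduct C I X A \<iota>" and B: "coproduct C I X B \<beta>"
  shows "isomorphic C A B"
proof -
  have O: "A \<in> Ob C" "B \<in> Ob C" using coproductD(1)[OF A] coproductD(1)[OF B] by auto
  note \<iota> = coproductD(2)[OF A] and \<beta> = coproductD(2)[OF B]
  obtain m where m: "m \<in> Hom C A B" "\<And>i. i \<in> I \<Longrightarrow> m \<cdot> \<iota> i = \<beta> i" using coproduct_arrow[OF A O(2) \<beta>] by metis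
  obtain n where n: "n \<in> Hom C B A" "\<And>i. i \<in> I \<Longrightarrow> n \<cdot> \<beta> i = \<iota> i" using coproduct_arrow[OF B O(1) \<iota>] by metis
  have "n \<cdot> m = Ident C A"
    by (rule coproduct_eqI[OF A Comp_in_Hom[OF m(1) n(1)] Ident_in_Hom[OF O(1)]])
      (simp add: Comp_assoc[OF \<iota> m(1) n(1)] m(2) n(2) Ident_Comp[OF \<iota>])
  moreover have "m \<cdot> n = Ident C B"
    by (rule coproduct_eqI[OF B Comp_in_Hom[OF n(1) m(1)] Ident_in_Hom[OF O(2)]])
      (simp add: Comp_assoc[OF \<beta> n(1) m(1)] m(2) n(2) Ident_Comp[OF \<beta>])
  ultimately show ?thesis using isomorphicI[OF m(1) isomorphismI[OF m(1) n(1)]] by blast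
qed

end

context triangulated_category
begin

text \<open>The difference \<open>e = k - 1\<close> satisfies \<open>e \<cdot> e = 0\<close>, so that \<open>1 - e\<close> is inverse to \<open>k\<close>.\<close>

lemma cone_endomorphism_isomorphism:
  assumes t: "(f, g, h) \<in> Tri C" "f \<in> Hom C X Y" "g \<in> Hom C Y Z" and k: "k \<in> Hom C Z Z" "k \<cdot> g = g" "h \<cdot> k = h"
  shows "isomorphism C k"
proof -
  have O: "Y \<in> Ob C" "Z \<in> Ob C" using Hom_Ob t by auto
  have h: "h \<in> Hom C Z (Sh C X)" using Tri_Hom(2)[OF t(1,2)] HomD[OF t(3)] by simp
  note i = Ident_in_Hom[OF O(2)]
  define e where "e = k \<boxplus> neg C (Ident C Z)"
  have e: "e \<in> Hom C Z Z" unfolding e_def using Add_in_Hom[OF k(1) neg_in_Hom[OF i]] .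
  have "e \<cdot> g = Zero C Y Z" unfolding e_def
    using Add_Comp[OF t(3) k(1) neg_in_Hom[OF i]] neg_Comp[OF t(3) i] Ident_Comp[OF t(3)] k(2) Add_neg[OF t(3)] by simp
  then obtain x where x: "x \<in> Hom C (Sh C X) Z" "x \<cdot> h = e" using Tri_weak_cokernel'[OF t e] by blast
  have "h \<cdot> e = Zero C Z (Sh C X)" unfolding e_def
    using Comp_Add[OF k(1) neg_in_Hom[OF i] h] Comp_neg[OF i h] Comp_Ident[OF h] k(3) Add_neg[OF h] by simp
  then have ee: "e \<cdot> e = Zero C Z Z" using x Comp_assoc[OF e h x(1)] Comp_Zero[OF O(2) x(1)] by simp
  have k_eq: "k = e \<boxplus> Ident C Z" unfolding e_def
    using Add_assoc[OF k(1) neg_in_Hom[OF i] i] Add_commute[OF neg_in_Hom[OF i] i] Add_neg[OF i] Add_Zero[OF k(1)] by simp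
  define l where "l = Ident C Z \<boxplus> neg C e"
  have l: "l \<in> Hom C Z Z" unfolding l_def using Add_in_Hom[OF i neg_in_Hom[OF e]] .
  have le: "l \<cdot> e = e" "e \<cdot> l = e" unfolding l_def
    using Add_Comp[OF e i neg_in_Hom[OF e]] neg_Comp[OF e e] Comp_Add[OF i neg_in_Hom[OF e] e] Comp_neg[OF e e] ee
      Ident_Comp[OF e] Comp_Ident[OF e] neg_Zero[OF O(2,2)] Add_Zero[OF e] by simp_all
  have "e \<boxplus> l = Ident C Z" unfolding l_def
    using Add_commute[OF e Add_in_Hom[OF i neg_in_Hom[OF e]]] Add_assoc[OF i neg_in_Hom[OF e] e]
      Add_commute[OF neg_in_Hom[OF e] e] Add_neg[OF e] Add_Zero[OF i] by simp
  then have "l \<cdot> k = Ident C Z" "k \<cdot> l = Ident C Z" unfolding k_eq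
    using Comp_Add[OF e i l] Add_Comp[OF l e i] le Comp_Ident[OF l] Ident_Comp[OF l] by simp_all
  then show ?thesis using isomorphismI[OF k(1) l] by blast
qed

text \<open>TR3 gives comparison arrows in both directions. They need not be inverse to each other,
  but both composites are endomorphisms compatible with the triangle, hence automorphisms.\<close>

lemma cone_unique:
  assumes t: "(f, g, h) \<in> Tri C" "f \<in> Hom C X Y" "g \<in> Hom C Y Z" and t': "(f, g', h') \<in> Tri C" "g' \<in> Hom C Y Z'"
  shows "isomorphic C Z Z'"
proof -
  have O: "X \<in> Ob C" "Y \<in> Ob C" "Z \<in> Ob C" "Z' \<in> Ob C" using Hom_Ob t t' by auto
  have h: "h \<in> Hom C Z (Sh C X)" "h' \<in> Hom C Z' (Sh C X)"
    using Tri_Hom(2)[OF t(1,2)] HomD[OF t(3)] Tri_Hom(2)[OF t'(1) t(2)] HomD[OF t'(2)] by simp_all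
  note d = HomD[OF t(2)] HomD[OF t(3)] HomD[OF t'(2)]
  have eq: "Ident C Y \<cdot> f = f \<cdot> Ident C X" using Ident_Comp[OF t(2)] Comp_Ident[OF t(2)] by simp
  obtain w where w: "w \<in> Hom C Z Z'" "w \<cdot> g = g'" "h = h' \<cdot> w"
    using TR3[OF t(1) t'(1), of "Ident C X" "Ident C Y"] d eq Ident_in_Hom[OF O(1)] Ident_in_Hom[OF O(2)]
      Comp_Ident[OF t'(2)] ShA_Ident[OF O(1)] Ident_Comp[OF h(1)] by auto
  obtain v where v: "v \<in> Hom C Z' Z" "v \<cdot> g' = g" "h' = h \<cdot> v"
    using TR3[OF t'(1) t(1), of "Ident C X" "Ident C Y"] d eq Ident_in_Hom[OF O(1)] Ident_in_Hom[OF O(2)]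
      Comp_Ident[OF t(3)] ShA_Ident[OF O(1)] Ident_Comp[OF h(2)] by auto
  have i1: "isomorphism C (v \<cdot> w)"
    by (rule cone_endomorphism_isomorphism[OF t Comp_in_Hom[OF w(1) v(1)]])
      (simp_all add: Comp_assoc[OF t(3) w(1) v(1)] w(2) v(2) Comp_assoc[OF w(1) v(1) h(1), symmetric] v(3)[symmetric] w(3)[symmetric])
  have i2: "isomorphism C (w \<cdot> v)"
    by (rule cone_endomorphism_isomorphism[OF t'(1) t(2) t'(2) Comp_in_Hom[OF v(1) w(1)]])
      (simp_all add: Comp_assoc[OF t'(2) v(1) w(1)] w(2) v(2) Comp_assoc[OF v(1) w(1) h(2), symmetric] v(3)[symmetric] w(3)[symmetric])
  obtain a where a: "a \<in> Hom C Z Z" "a \<cdot> (v \<cdot> w) = Ident C Z" using isomorphismE[OF i1 Comp_in_Hom[OF w(1) v(1)]] by metis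
  obtain b where b: "b \<in> Hom C Z' Z'" "(w \<cdot> v) \<cdot> b = Ident C Z'" using isomorphismE[OF i2 Comp_in_Hom[OF v(1) w(1)]] by metis
  have l: "(a \<cdot> v) \<cdot> w = Ident C Z" using a(2) Comp_assoc[OF w(1) v(1) a(1)] by simp
  have r: "w \<cdot> (v \<cdot> b) = Ident C Z'" using b(2) Comp_assoc[OF b(1) v(1) w(1)] by simp
  note avH = Comp_in_Hom[OF v(1) a(1)] and vbH = Comp_in_Hom[OF b(1) v(1)]
  have "a \<cdot> v = (a \<cdot> v) \<cdot> (w \<cdot> (v \<cdot> b))" using r Comp_Ident[OF avH] by simp
  also have "\<dots> = v \<cdot> b" using Comp_assoc[OF vbH w(1) avH] l Ident_Comp[OF vbH] by simp
  finally have "w \<cdot> (a \<cdot> v) = Ident C Z'" using r by simp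
  then show ?thesis using isomorphicI[OF w(1) isomorphismI[OF w(1) avH l]] by blast
qed

lemma Loc_localizing:
  fixes \<kappa> :: "'u rel"
  assumes G: "G \<subseteq> Ob C" shows "localizing \<kappa> C (Loc \<kappa> C G)"
proof -
  have "Cod C g \<in> Ob C" if "(f, g, h) \<in> Tri C" for f g h using TriD[OF that] Hom_Ob HomD(3) by metis
  \<comment> \<open>This makes the family intersected in \<open>Loc\<close> nonempty.\<close>
  then have whole: "localizing \<kappa> C (Ob C)"
    unfolding localizing_def triangulated_subcategory_def
    using Sh_in_Ob coproductD(1) by (auto simp: zero_object_def)
  define \<L> where "\<L> = {A. localizing \<kappa> C A \<and> G \<subseteq> A}"
  have L: "localizing \<kappa> C A" "triangulated_subcategory C A" if "A \<in> \<L>" for A using that by (auto simp: \<L>_def localizing_def)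
  note D = triangulated_subcategoryD[OF L(2)]
  show ?thesis unfolding Loc_def \<L>_def[symmetric] unfolding localizing_def triangulated_subcategory_def
  proof (intro conjI allI impI ballI)
    show "\<Inter>\<L> \<subseteq> Ob C" using whole G by (auto simp: \<L>_def)
    show "Z \<in> \<Inter>\<L>" if "zero_object C Z" for Z using D(2)[OF _ that] by blast
    show "Y \<in> \<Inter>\<L>" if "X \<in> \<Inter>\<L>" "isomorphic C X Y" for X Y using D(3)[OF _ _ that(2)] that(1) by blast
    show "X \<in> \<Inter>\<L> \<longleftrightarrow> Sh C X \<in> \<Inter>\<L>" if "X \<in> Ob C" for X using D(4)[OF _ that] by blast
    show "Cod C g \<in> \<Inter>\<L>" if "(f, g, h) \<in> Tri C" "Dom C f \<in> \<Inter>\<L>" "Cod C f \<in> \<Inter>\<L>" for f g h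
      using D(5)[OF _ that(1)] that(2,3) by blast
    show "B \<in> \<Inter>\<L>" if "small \<kappa> I" "X ` I \<subseteq> \<Inter>\<L>" "coproduct C I X B \<iota>" for I :: "'u set" and X B \<iota>
    proof
      fix A assume A: "A \<in> \<L>"
      then have "X ` I \<subseteq> A" using that(2) by blast
      then show "B \<in> A" using localizing_small_coproduct[OF L(1)[OF A] that(1) _ that(3)] by blast
    qed
  qed
qed

lemma Loc_subset: "localizing \<kappa> C A \<Longrightarrow> G \<subseteq> A \<Longrightarrow> Loc \<kappa> C G \<subseteq> A"
  unfolding Loc_def by blast

end

context tt_category
begin

text \<open>Transposition along the closed structure is a bijection that matches zero arrows, so
  vanishing on one side is vanishing on the other. In this form the internal hom enters the main
  argument.\<close>

lemma internal_hom_orthogonal: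
  assumes "A \<in> Ob C" "Y \<in> Ob C"
  obtains H where "H \<in> Ob C" "\<And>W. W \<in> Ob C \<Longrightarrow> orthogonal C W H \<longleftrightarrow> orthogonal C (W \<boxtimes> A) Y"
proof -
  obtain H e where H: "H \<in> Ob C" and e: "e \<in> Hom C (H \<boxtimes> A) Y"
    and u: "\<And>W g. W \<in> Ob C \<Longrightarrow> g \<in> Hom C (W \<boxtimes> A) Y \<Longrightarrow> \<exists>!k. k \<in> Hom C W H \<and> e \<cdot> (k \<star> Ident C A) = g"
    using closed[unfolded closed_monoidal_def, rule_format, OF assms] by blast
  have z: "e \<cdot> (Zero C W H \<star> Ident C A) = Zero C (W \<boxtimes> A) Y" if "W \<in> Ob C" for W
    using TensA_Zero[OF that H assms(1)] Comp_Zero[OF Tens_in_Ob[OF that assms(1)] e] by simp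
  have "orthogonal C W H \<longleftrightarrow> orthogonal C (W \<boxtimes> A) Y" if W: "W \<in> Ob C" for W
  proof
    assume o: "orthogonal C W H"
    show "orthogonal C (W \<boxtimes> A) Y" unfolding orthogonal_def
    proof
      fix g assume "g \<in> Hom C (W \<boxtimes> A) Y"
      then obtain k where k: "k \<in> Hom C W H" "e \<cdot> (k \<star> Ident C A) = g" using u[OF W] by blast
      then show "g = Zero C (W \<boxtimes> A) Y" using o z[OF W] by (auto simp: orthogonal_def)
    qed
  next
    assume o: "orthogonal C (W \<boxtimes> A) Y"
    show "orthogonal C W H" unfolding orthogonal_def
    proof
      fix k assume k: "k \<in> Hom C W H"
      have "e \<cdot> (k \<star> Ident C A) = Zero C (W \<boxtimes> A) Y"
        using o Comp_in_Hom[OF TensA_Ident_in_Hom[OF k assms(1)] e] by (auto simp: orthogonal_def)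
      then show "k = Zero C W H"
        using u[OF W Zero_in_Hom[OF Tens_in_Ob[OF W assms(1)] assms(2)]] k z[OF W] Zero_in_Hom[OF W H] by blast
    qed
  qed
  then show thesis using that H by blast
qed

end

section \<open>Compact objects and the essential image under the functor\<close>

locale fully_faithful_geometric =
  T: rigid_category T \<kappa> + S: rigid_category S \<kappa>
  for T :: "('o, 'm, 'x) tt_cat_scheme" and S :: "('p, 'n, 'y) tt_cat_scheme" and \<kappa> :: "'u rel" +
  fixes f :: "('o, 'm, 'p, 'n, 'z) tt_fun_scheme"
  assumes geometric: "geometric_functor \<kappa> T S f" and full_faithful: "fully_faithful T S f"
begin

abbreviation F :: "'o \<Rightarrow> 'p" where "F \<equiv> FOb f"
abbreviation FA :: "'m \<Rightarrow> 'n" where "FA \<equiv> FArr f"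

lemma F_functor: "is_functor T S f"
  using geometric by (simp add: geometric_functor_def exact_functor_def)

lemma F_Ob: "X \<in> Ob T \<Longrightarrow> F X \<in> Ob S"
  and F_Hom: "k \<in> Hom T X Y \<Longrightarrow> FA k \<in> Hom S (F X) (F Y)"
  and F_Comp: "k \<in> Hom T X Y \<Longrightarrow> l \<in> Hom T Y Z \<Longrightarrow> FA (l \<cdot>\<^bsub>T\<^esub> k) = FA l \<cdot>\<^bsub>S\<^esub> FA k"
  and F_Ident: "X \<in> Ob T \<Longrightarrow> FA (Ident T X) = Ident S (F X)"
  and F_isomorphic: "isomorphic T X Y \<Longrightarrow> isomorphic S (F X) (F Y)"
  using functor_Ob[OF F_functor] functor_Hom[OF T.category_axioms F_functor] functor_Comp[OF F_functor]
    functor_Ident[OF F_functor] functor_isomorphic[OF T.category_axioms S.category_axioms F_functor] by blast+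

lemma F_shift:
  assumes "X \<in> Ob T" shows "isomorphic S (F (Sh T X)) (Sh S (F X))"
proof -
  have "natural_isomorphism T S (comp_fun f (shift_fun T)) (comp_fun (shift_fun S) f) (FSh f)"
    using geometric by (simp add: geometric_functor_def exact_functor_def)
  from natural_isomorphismD(1,2)[OF this assms] show ?thesis
    unfolding isomorphic_def by (auto simp: comp_fun_def shift_fun_def)
qed

lemma F_triangle:
  assumes "(k, l, h) \<in> Tri T" obtains h' where "(FA k, FA l, h') \<in> Tri S"
  using geometric assms unfolding geometric_functor_def exact_functor_def by blast

lemma F_coproduct: "small \<kappa> I \<Longrightarrow> coproduct T (I :: 'u set) X A \<iota> \<Longrightarrow> coproduct S I (\<lambda>i. F (X i)) (F A) (\<lambda>i. FA (\<iota> i))"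
  using geometric by (auto simp: geometric_functor_def preserves_small_coproducts_def comp_def)

lemma F_zero_object:
  assumes "zero_object T Z" shows "zero_object S (F Z)"
proof -
  have Z: "Z \<in> Ob T" using assms by (simp add: zero_object_def)
  have "FA \<in> hom (hom_group T Z Z) (hom_group S (F Z) (F Z))"
    using geometric Z by (simp add: geometric_functor_def exact_functor_def)
  then have "FA (Zero T Z Z \<boxplus>\<^bsub>T\<^esub> Zero T Z Z) = FA (Zero T Z Z) \<boxplus>\<^bsub>S\<^esub> FA (Zero T Z Z)"
    using T.Zero_in_Hom[OF Z Z] by (auto simp: hom_def carrier_hom_group mult_hom_group)
  moreover have "FA (Zero T Z Z) = Ident S (F Z)" using F_Ident[OF Z] T.zero_object_iff[OF Z] assms by simp
  ultimately have "Ident S (F Z) \<boxplus>\<^bsub>S\<^esub> Ident S (F Z) = Zero S (F Z) (F Z) \<boxplus>\<^bsub>S\<^esub> Ident S (F Z)"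
    using T.Add_Zero[OF T.Zero_in_Hom[OF Z Z]] S.Zero_Add[OF S.Ident_in_Hom[OF F_Ob[OF Z]]] by simp
  then have "Ident S (F Z) = Zero S (F Z) (F Z)"
    using S.Add_right_cancel S.Ident_in_Hom[OF F_Ob[OF Z]] S.Zero_in_Hom[OF F_Ob[OF Z] F_Ob[OF Z]] by blast
  then show ?thesis using S.zero_object_iff[OF F_Ob[OF Z]] by simp
qed

lemma monoidal: "strong_symmetric_monoidal T S f"
  using geometric by (simp add: geometric_functor_def)

lemma FUnit: "FUnit f \<in> Hom S (Unit S) (F (Unit T))" "isomorphism S (FUnit f)"
  using monoidal by (auto simp: strong_symmetric_monoidal_def)

lemma FTens:
  assumes "X \<in> Ob T" "Y \<in> Ob T"
  shows "FTens f X Y \<in> Hom S (F X \<boxtimes>\<^bsub>S\<^esub> F Y) (F (X \<boxtimes>\<^bsub>T\<^esub> Y))" "isomorphism S (FTens f X Y)"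
  using monoidal assms by (auto simp: strong_symmetric_monoidal_def)

lemma F_Unit: "isomorphic S (Unit S) (F (Unit T))"
  using S.isomorphicI[OF FUnit] .

lemma F_Tens: "X \<in> Ob T \<Longrightarrow> Y \<in> Ob T \<Longrightarrow> isomorphic S (F X \<boxtimes>\<^bsub>S\<^esub> F Y) (F (X \<boxtimes>\<^bsub>T\<^esub> Y))"
  using S.isomorphicI[OF FTens] .

lemma FTens_natural:
  assumes "k \<in> Hom T X X'" "l \<in> Hom T Y Y'"
  shows "FTens f X' Y' \<cdot>\<^bsub>S\<^esub> (FA k \<star>\<^bsub>S\<^esub> FA l) = FA (k \<star>\<^bsub>T\<^esub> l) \<cdot>\<^bsub>S\<^esub> FTens f X Y"
  using monoidal assms by (auto simp: strong_symmetric_monoidal_def Hom_def)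

text \<open>A strong monoidal functor carries a dual of \<open>X\<close> to a dual of
  \<open>F X\<close>. Transporting the first duality identity is enough, since a half dual already
  gives compactness.\<close>

lemma F_compact:
  assumes X: "X \<in> T.compact" shows "F X \<in> S.compact"
proof -
  obtain D \<eta> \<epsilon> where h: "T.half_dual X D \<eta> \<epsilon>"
    and e: "RUnit T X \<cdot>\<^bsub>T\<^esub> (Ident T X \<star>\<^bsub>T\<^esub> \<epsilon>) \<cdot>\<^bsub>T\<^esub> Assoc T X D X \<cdot>\<^bsub>T\<^esub> (\<eta> \<star>\<^bsub>T\<^esub> Ident T X) = LUnit T X"
    using T.dualizable_half_dual X T.compact_dualizable by metis
  have O: "X \<in> Ob T" "D \<in> Ob T" and \<epsilon>: "\<epsilon> \<in> Hom T (D \<boxtimes>\<^bsub>T\<^esub> X) (Unit T)" and \<eta>: "\<eta> \<in> Hom T (Unit T) (X \<boxtimes>\<^bsub>T\<^esub> D)"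
    using h by (auto simp: T.half_dual_def)
  note U = T.Unit_in_Ob
  note XD = T.Tens_in_Ob[OF O] and DX = T.Tens_in_Ob[OF O(2,1)]
  note FO = F_Ob[OF O(1)] F_Ob[OF O(2)] F_Ob[OF U] F_Ob[OF XD] F_Ob[OF DX] S.Unit_in_Ob
    F_Ob[OF T.Tens_in_Ob[OF XD O(1)]] F_Ob[OF T.Tens_in_Ob[OF O(1) DX]] F_Ob[OF T.Tens_in_Ob[OF U O(1)]] F_Ob[OF T.Tens_in_Ob[OF O(1) U]]
  define u where "u = FUnit f"
  define \<mu> where "\<mu> = FTens f"
  have u: "u \<in> Hom S (Unit S) (F (Unit T))" "isomorphism S u" unfolding u_def using FUnit by auto
  have \<mu>: "\<mu> A B \<in> Hom S (F A \<boxtimes>\<^bsub>S\<^esub> F B) (F (A \<boxtimes>\<^bsub>T\<^esub> B))" "isomorphism S (\<mu> A B)" if "A \<in> Ob T" "B \<in> Ob T" for A B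
    unfolding \<mu>_def using FTens[OF that] by auto
  obtain u' where u': "u' \<in> Hom S (F (Unit T)) (Unit S)" "u \<cdot>\<^bsub>S\<^esub> u' = Ident S (F (Unit T))"
    using S.isomorphismE[OF u(2,1)] by metis
  obtain \<mu>' where \<mu>': "\<mu>' \<in> Hom S (F (X \<boxtimes>\<^bsub>T\<^esub> D)) (F X \<boxtimes>\<^bsub>S\<^esub> F D)" "\<mu> X D \<cdot>\<^bsub>S\<^esub> \<mu>' = Ident S (F (X \<boxtimes>\<^bsub>T\<^esub> D))"
    using S.isomorphismE[OF \<mu>(2)[OF O] \<mu>(1)[OF O]] by metis
  \<comment> \<open>Coevaluation and evaluation of \<open>X\<close>, conjugated by the structure
    isomorphisms of the functor. Below, \<open>u\<close> and \<open>\<mu>\<close> are moved to the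
    left by naturality until \<open>RUnit S (F X)\<close> absorbs them.\<close>
  define \<eta>' where "\<eta>' = \<mu>' \<cdot>\<^bsub>S\<^esub> FA \<eta> \<cdot>\<^bsub>S\<^esub> u"
  define \<epsilon>' where "\<epsilon>' = u' \<cdot>\<^bsub>S\<^esub> FA \<epsilon> \<cdot>\<^bsub>S\<^esub> \<mu> D X"
  note F\<eta> = F_Hom[OF \<eta>] and F\<epsilon> = F_Hom[OF \<epsilon>]
  note \<mu>s = \<mu>(1)[OF O] \<mu>(1)[OF O(2,1)] \<mu>(1)[OF U O(1)] \<mu>(1)[OF O(1) U] \<mu>(1)[OF XD O(1)] \<mu>(1)[OF O(1) DX]
  have \<eta>': "\<eta>' \<in> Hom S (Unit S) (F X \<boxtimes>\<^bsub>S\<^esub> F D)" unfolding \<eta>'_def using \<mu>'(1) F\<eta> u(1) by (simp add: Hom_def S.mon_simps)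
  have \<epsilon>': "\<epsilon>' \<in> Hom S (F D \<boxtimes>\<^bsub>S\<^esub> F X) (Unit S)" unfolding \<epsilon>'_def using u'(1) F\<epsilon> \<mu>s by (simp add: Hom_def S.mon_simps)
  have \<eta>2: "FA \<eta> \<cdot>\<^bsub>S\<^esub> u = \<mu> X D \<cdot>\<^bsub>S\<^esub> \<eta>'"
    unfolding \<eta>'_def using S.Comp_rewrite[OF \<mu>'(2), of "FA \<eta> \<cdot>\<^bsub>S\<^esub> u"] \<mu>'(1) F\<eta> u(1) \<mu>s by (simp add: Hom_def S.mon_simps)
  have \<epsilon>2: "FA \<epsilon> \<cdot>\<^bsub>S\<^esub> \<mu> D X = u \<cdot>\<^bsub>S\<^esub> \<epsilon>'"
    unfolding \<epsilon>'_def using S.Comp_rewrite[OF u'(2), of "FA \<epsilon> \<cdot>\<^bsub>S\<^esub> \<mu> D X"] u(1) u'(1) F\<epsilon> \<mu>s by (simp add: Hom_def S.mon_simps)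
  let ?I = "Ident S (F X)"
  let ?r = "FA (RUnit T X)" and ?l = "FA (LUnit T X)" and ?a = "FA (Assoc T X D X)" and ?a' = "Assoc S (F X) (F D) (F X)"
  let ?e = "FA (Ident T X \<star>\<^bsub>T\<^esub> \<epsilon>)" and ?h = "FA (\<eta> \<star>\<^bsub>T\<^esub> Ident T X)"
  have H: "?r \<in> Hom S (F (X \<boxtimes>\<^bsub>T\<^esub> Unit T)) (F X)" "?l \<in> Hom S (F (Unit T \<boxtimes>\<^bsub>T\<^esub> X)) (F X)"
    "?a \<in> Hom S (F ((X \<boxtimes>\<^bsub>T\<^esub> D) \<boxtimes>\<^bsub>T\<^esub> X)) (F (X \<boxtimes>\<^bsub>T\<^esub> (D \<boxtimes>\<^bsub>T\<^esub> X)))"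
    "?e \<in> Hom S (F (X \<boxtimes>\<^bsub>T\<^esub> (D \<boxtimes>\<^bsub>T\<^esub> X))) (F (X \<boxtimes>\<^bsub>T\<^esub> Unit T))"
    "?h \<in> Hom S (F (Unit T \<boxtimes>\<^bsub>T\<^esub> X)) (F ((X \<boxtimes>\<^bsub>T\<^esub> D) \<boxtimes>\<^bsub>T\<^esub> X))"
    using F_Hom[OF T.RUnit_simps(4)[OF O(1)]] F_Hom[OF T.LUnit_simps(4)[OF O(1)]] F_Hom[OF T.Assoc_simps(4)[OF O O(1)]]
      F_Hom[OF T.Ident_TensA_in_Hom[OF \<epsilon> O(1)]] F_Hom[OF T.TensA_Ident_in_Hom[OF \<eta> O(1)]] by auto
  have m: "LUnit S (F X) = ?l \<cdot>\<^bsub>S\<^esub> \<mu> (Unit T) X \<cdot>\<^bsub>S\<^esub> (u \<star>\<^bsub>S\<^esub> ?I)"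
    "RUnit S (F X) = ?r \<cdot>\<^bsub>S\<^esub> \<mu> X (Unit T) \<cdot>\<^bsub>S\<^esub> (?I \<star>\<^bsub>S\<^esub> u)"
    "?a \<cdot>\<^bsub>S\<^esub> \<mu> (X \<boxtimes>\<^bsub>T\<^esub> D) X \<cdot>\<^bsub>S\<^esub> (\<mu> X D \<star>\<^bsub>S\<^esub> ?I) = \<mu> X (D \<boxtimes>\<^bsub>T\<^esub> X) \<cdot>\<^bsub>S\<^esub> (?I \<star>\<^bsub>S\<^esub> \<mu> D X) \<cdot>\<^bsub>S\<^esub> ?a'"
    using monoidal O unfolding strong_symmetric_monoidal_def \<mu>_def u_def by (simp_all del: split_paired_All)
  have n: "?h \<cdot>\<^bsub>S\<^esub> \<mu> (Unit T) X = \<mu> (X \<boxtimes>\<^bsub>T\<^esub> D) X \<cdot>\<^bsub>S\<^esub> (FA \<eta> \<star>\<^bsub>S\<^esub> ?I)"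
    "?e \<cdot>\<^bsub>S\<^esub> \<mu> X (D \<boxtimes>\<^bsub>T\<^esub> X) = \<mu> X (Unit T) \<cdot>\<^bsub>S\<^esub> (?I \<star>\<^bsub>S\<^esub> FA \<epsilon>)"
    unfolding \<mu>_def using FTens_natural[OF \<eta> T.Ident_in_Hom[OF O(1)]] FTens_natural[OF T.Ident_in_Hom[OF O(1)] \<epsilon>] F_Ident[OF O(1)] by simp_all
  have l: "?l = ?r \<cdot>\<^bsub>S\<^esub> ?e \<cdot>\<^bsub>S\<^esub> ?a \<cdot>\<^bsub>S\<^esub> ?h"
  proof -
    note h1 = T.TensA_Ident_in_Hom[OF \<eta> O(1)] and h2 = T.Assoc_simps(4)[OF O O(1)] and h3 = T.Ident_TensA_in_Hom[OF \<epsilon> O(1)]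
      and h4 = T.RUnit_simps(4)[OF O(1)]
    show ?thesis unfolding e[symmetric]
      using F_Comp[OF T.Comp_in_Hom[OF T.Comp_in_Hom[OF h1 h2] h3] h4] F_Comp[OF T.Comp_in_Hom[OF h1 h2] h3] F_Comp[OF h1 h2] by simp
  qed
  have "LUnit S (F X) = ?r \<cdot>\<^bsub>S\<^esub> ?e \<cdot>\<^bsub>S\<^esub> ?a \<cdot>\<^bsub>S\<^esub> ((?h \<cdot>\<^bsub>S\<^esub> \<mu> (Unit T) X) \<cdot>\<^bsub>S\<^esub> (u \<star>\<^bsub>S\<^esub> ?I))"
    unfolding m(1) l using H \<mu>s u(1) FO by (simp add: Hom_def S.mon_simps)
  also have "(?h \<cdot>\<^bsub>S\<^esub> \<mu> (Unit T) X) \<cdot>\<^bsub>S\<^esub> (u \<star>\<^bsub>S\<^esub> ?I) = \<mu> (X \<boxtimes>\<^bsub>T\<^esub> D) X \<cdot>\<^bsub>S\<^esub> ((FA \<eta> \<cdot>\<^bsub>S\<^esub> u) \<star>\<^bsub>S\<^esub> ?I)"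
    unfolding n using F\<eta> \<mu>s u(1) FO by (simp add: Hom_def S.mon_simps S.TensA_Comp_Arr)
  also have "\<dots> = \<mu> (X \<boxtimes>\<^bsub>T\<^esub> D) X \<cdot>\<^bsub>S\<^esub> (\<mu> X D \<star>\<^bsub>S\<^esub> ?I) \<cdot>\<^bsub>S\<^esub> (\<eta>' \<star>\<^bsub>S\<^esub> ?I)"
    unfolding \<eta>2 using \<eta>' \<mu>s FO by (simp add: Hom_def S.mon_simps S.TensA_split)
  also have "?a \<cdot>\<^bsub>S\<^esub> \<dots> = (?a \<cdot>\<^bsub>S\<^esub> \<mu> (X \<boxtimes>\<^bsub>T\<^esub> D) X \<cdot>\<^bsub>S\<^esub> (\<mu> X D \<star>\<^bsub>S\<^esub> ?I)) \<cdot>\<^bsub>S\<^esub> (\<eta>' \<star>\<^bsub>S\<^esub> ?I)"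
    using H \<eta>' \<mu>s FO by (simp add: Hom_def S.mon_simps)
  also have "\<dots> = \<mu> X (D \<boxtimes>\<^bsub>T\<^esub> X) \<cdot>\<^bsub>S\<^esub> (?I \<star>\<^bsub>S\<^esub> \<mu> D X) \<cdot>\<^bsub>S\<^esub> ?a' \<cdot>\<^bsub>S\<^esub> (\<eta>' \<star>\<^bsub>S\<^esub> ?I)"
    unfolding m(3) using \<eta>' \<mu>s FO by (simp add: Hom_def S.mon_simps)
  also have "?e \<cdot>\<^bsub>S\<^esub> \<dots> = (?e \<cdot>\<^bsub>S\<^esub> \<mu> X (D \<boxtimes>\<^bsub>T\<^esub> X)) \<cdot>\<^bsub>S\<^esub> (?I \<star>\<^bsub>S\<^esub> \<mu> D X) \<cdot>\<^bsub>S\<^esub> ?a' \<cdot>\<^bsub>S\<^esub> (\<eta>' \<star>\<^bsub>S\<^esub> ?I)"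
    using H \<eta>' \<mu>s FO by (simp add: Hom_def S.mon_simps)
  also have "\<dots> = \<mu> X (Unit T) \<cdot>\<^bsub>S\<^esub> (?I \<star>\<^bsub>S\<^esub> (FA \<epsilon> \<cdot>\<^bsub>S\<^esub> \<mu> D X)) \<cdot>\<^bsub>S\<^esub> ?a' \<cdot>\<^bsub>S\<^esub> (\<eta>' \<star>\<^bsub>S\<^esub> ?I)"
    unfolding n using F\<epsilon> \<eta>' \<mu>s FO by (simp add: Hom_def S.mon_simps S.TensA_split)
  also have "\<dots> = \<mu> X (Unit T) \<cdot>\<^bsub>S\<^esub> (?I \<star>\<^bsub>S\<^esub> u) \<cdot>\<^bsub>S\<^esub> (?I \<star>\<^bsub>S\<^esub> \<epsilon>') \<cdot>\<^bsub>S\<^esub> ?a' \<cdot>\<^bsub>S\<^esub> (\<eta>' \<star>\<^bsub>S\<^esub> ?I)"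
    unfolding \<epsilon>2 using u(1) \<epsilon>' \<eta>' \<mu>s FO by (simp add: Hom_def S.mon_simps S.TensA_split)
  also have "?r \<cdot>\<^bsub>S\<^esub> \<dots> = RUnit S (F X) \<cdot>\<^bsub>S\<^esub> (?I \<star>\<^bsub>S\<^esub> \<epsilon>') \<cdot>\<^bsub>S\<^esub> ?a' \<cdot>\<^bsub>S\<^esub> (\<eta>' \<star>\<^bsub>S\<^esub> ?I)"
    unfolding m(2) using H u(1) \<epsilon>' \<eta>' \<mu>s FO by (simp add: Hom_def S.mon_simps)
  finally have "isomorphism S (RUnit S (F X) \<cdot>\<^bsub>S\<^esub> (?I \<star>\<^bsub>S\<^esub> \<epsilon>') \<cdot>\<^bsub>S\<^esub> ?a' \<cdot>\<^bsub>S\<^esub> (\<eta>' \<star>\<^bsub>S\<^esub> ?I))"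
    using S.LUnit_simps(5)[OF FO(1)] by simp
  then have "S.half_dual (F X) (F D) \<eta>' \<epsilon>'" unfolding S.half_dual_def using FO \<eta>' \<epsilon>' by blast
  \<comment> \<open>The compactness criterion concerns products \<open>W \<boxtimes> X\<close>; here
    \<open>W\<close> is the unit.\<close>
  then have "Unit S \<boxtimes>\<^bsub>S\<^esub> F X \<in> S.compact" using S.compact_Tens_half_dual[OF S.compact_Unit] by blast
  then show ?thesis using S.compact_isomorphic S.isomorphic_LUnit[OF FO(1)] by blast
qed

lemma F_preimage_localizing:
  assumes A: "localizing \<kappa> S A" shows "localizing \<kappa> T {X \<in> Ob T. F X \<in> A}"
  unfolding localizing_def triangulated_subcategory_def
proof (intro conjI allI impI ballI)
  have tA: "triangulated_subcategory S A" using A by (simp add: localizing_def)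
  note D = S.triangulated_subcategoryD[OF tA]
  show "{X \<in> Ob T. F X \<in> A} \<subseteq> Ob T" by blast
  show "Z \<in> {X \<in> Ob T. F X \<in> A}" if "zero_object T Z" for Z
    using D(2)[OF F_zero_object[OF that]] that by (simp add: zero_object_def)
  show "Y \<in> {X \<in> Ob T. F X \<in> A}" if "X \<in> {X \<in> Ob T. F X \<in> A}" "Y \<in> Ob T" "isomorphic T X Y" for X Y
    using that D(3)[OF _ F_isomorphic[OF that(3)]] by blast
  show "X \<in> {X \<in> Ob T. F X \<in> A} \<longleftrightarrow> Sh T X \<in> {X \<in> Ob T. F X \<in> A}" if X: "X \<in> Ob T" for X
    using X T.Sh_in_Ob[OF X] D(3)[OF _ F_shift[OF X]] D(3)[OF _ S.isomorphic_sym[OF F_shift[OF X]]] D(4)[OF F_Ob[OF X]] by blast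
  show "Cod T l \<in> {X \<in> Ob T. F X \<in> A}"
    if t: "(k, l, h) \<in> Tri T" "Dom T k \<in> {X \<in> Ob T. F X \<in> A}" "Cod T k \<in> {X \<in> Ob T. F X \<in> A}" for k l h
  proof -
    obtain X Y Z where kl: "k \<in> Hom T X Y" "l \<in> Hom T Y Z" using T.TriD[OF t(1)] by metis
    obtain h' where h': "(FA k, FA l, h') \<in> Tri S" using F_triangle[OF t(1)] .
    have "F Z \<in> A"
      using S.triangulated_subcategory_two_of_three(1)[OF tA h' F_Hom[OF kl(1)] F_Hom[OF kl(2)]] t T.HomD[OF kl(1)] by auto
    then show ?thesis using T.HomD[OF kl(2)] T.Hom_Ob[OF kl(2)] by simp
  qed
  show "B \<in> {X \<in> Ob T. F X \<in> A}" if I: "small \<kappa> I" and X: "X ` I \<subseteq> {X \<in> Ob T. F X \<in> A}" and B: "coproduct T I X B \<iota>"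
    for I :: "'u set" and X B \<iota>
  proof -
    have "(\<lambda>i. F (X i)) ` I \<subseteq> A" using X by blast
    then have "F B \<in> A" using localizing_small_coproduct[OF A I _ F_coproduct[OF I B]] by blast
    then show ?thesis using T.coproductD(1)[OF B] by blast
  qed
qed

definition essential_image :: "'p set" where "essential_image = {X \<in> Ob S. \<exists>Y \<in> Ob T. isomorphic S (F Y) X}"

text \<open>Fullness lifts an arrow between objects of the image, and its cone in \<open>T\<close>
  maps to a cone of the given arrow; uniqueness of cones finishes. Coproducts are handled by lifting
  the summands.\<close>

lemma essential_image_localizing: "localizing \<kappa> S essential_image"
  unfolding localizing_def triangulated_subcategory_def
proof (intro conjI allI impI ballI)
  show "essential_image \<subseteq> Ob S" by (auto simp: essential_image_def)
  show "Z \<in> essential_image" if "zero_object S Z" for Z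
  proof -
    obtain O' where O': "zero_object T O'" using T.ex_zero_object by blast
    then show ?thesis
      using S.zero_object_isomorphic[OF F_zero_object[OF O'] that] that by (auto simp: essential_image_def zero_object_def)
  qed
  show "Y \<in> essential_image" if "X \<in> essential_image" "Y \<in> Ob S" "isomorphic S X Y" for X Y
    using that S.isomorphic_trans unfolding essential_image_def by blast
  show "X \<in> essential_image \<longleftrightarrow> Sh S X \<in> essential_image" if X: "X \<in> Ob S" for X
  proof
    assume "X \<in> essential_image"
    then obtain Y where Y: "Y \<in> Ob T" "isomorphic S (F Y) X" by (auto simp: essential_image_def)
    have "isomorphic S (F (Sh T Y)) (Sh S X)" using S.isomorphic_trans[OF F_shift[OF Y(1)] S.shift_isomorphic[OF Y(2)]] .
    then show "Sh S X \<in> essential_image" using S.Sh_in_Ob[OF X] T.Sh_in_Ob[OF Y(1)] by (auto simp: essential_image_def)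
  next
    assume "Sh S X \<in> essential_image"
    then obtain Y where Y: "Y \<in> Ob T" "isomorphic S (F Y) (Sh S X)" by (auto simp: essential_image_def)
    obtain Y' where Y': "Y' \<in> Ob T" "isomorphic T (Sh T Y') Y" using T.ex_desuspension[OF Y(1)] by blast
    have "isomorphic S (Sh S (F Y')) (Sh S X)"
      using S.isomorphic_trans[OF S.isomorphic_sym[OF F_shift[OF Y'(1)]] S.isomorphic_trans[OF F_isomorphic[OF Y'(2)] Y(2)]] .
    then have "isomorphic S (F Y') X" using S.isomorphic_desuspension[OF F_Ob[OF Y'(1)] X] by blast
    then show "X \<in> essential_image" using X Y'(1) by (auto simp: essential_image_def)
  qed
  show "Cod S v \<in> essential_image" if t: "(u, v, w) \<in> Tri S" "Dom S u \<in> essential_image" "Cod S u \<in> essential_image" for u v w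
  proof -
    obtain X Y Z where uv: "u \<in> Hom S X Y" "v \<in> Hom S Y Z" "w \<in> Hom S Z (Sh S X)" using S.TriD[OF t(1)] .
    have XY: "X \<in> essential_image" "Y \<in> essential_image" using t S.HomD[OF uv(1)] by auto
    obtain A m where A: "A \<in> Ob T" and m: "m \<in> Hom S (F A) X" "isomorphism S m" using XY(1) by (auto simp: essential_image_def isomorphic_def)
    obtain B n where B: "B \<in> Ob T" and n: "n \<in> Hom S (F B) Y" "isomorphism S n" using XY(2) by (auto simp: essential_image_def isomorphic_def)
    obtain n' where n': "n' \<in> Hom S Y (F B)" "n' \<cdot>\<^bsub>S\<^esub> n = Ident S (F B)" "n \<cdot>\<^bsub>S\<^esub> n' = Ident S Y" using S.isomorphismE[OF n(2,1)] by metis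
    note um = S.Comp_in_Hom[OF m(1) uv(1)]
    obtain k where k: "k \<in> Hom T A B" "FA k = n' \<cdot>\<^bsub>S\<^esub> (u \<cdot>\<^bsub>S\<^esub> m)"
      using fully_faithfulD(2)[OF full_faithful A B S.Comp_in_Hom[OF um n'(1)]] by blast
    obtain E l h where tT: "(k, l, h) \<in> Tri T" "l \<in> Hom T B E" using T.complete_triangle[OF k(1)] by metis
    obtain h' where h': "(FA k, FA l, h') \<in> Tri S" using F_triangle[OF tT(1)] .
    note Fk = F_Hom[OF k(1)] and Fl = F_Hom[OF tT(2)]
    have h'H: "h' \<in> Hom S (F E) (Sh S (F A))" using S.Tri_Hom(2)[OF h' Fk] S.HomD[OF Fl] by simp
    define v' where "v' = FA l \<cdot>\<^bsub>S\<^esub> n'"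
    define w' where "w' = ShA S m \<cdot>\<^bsub>S\<^esub> h'"
    have v': "v' \<in> Hom S Y (F E)" unfolding v'_def using S.Comp_in_Hom[OF n'(1) Fl] .
    have w': "w' \<in> Hom S (F E) (Sh S X)" unfolding w'_def using S.Comp_in_Hom[OF h'H S.ShA_in_Hom[OF m(1)]] .
    have FE: "F E \<in> Ob S" using S.Hom_Ob[OF Fl] by blast
    have sq: "n \<cdot>\<^bsub>S\<^esub> FA k = u \<cdot>\<^bsub>S\<^esub> m" "Ident S (F E) \<cdot>\<^bsub>S\<^esub> FA l = v' \<cdot>\<^bsub>S\<^esub> n" "ShA S m \<cdot>\<^bsub>S\<^esub> h' = w' \<cdot>\<^bsub>S\<^esub> Ident S (F E)"
      using S.Comp_assoc[OF um n'(1) n(1)] n'(3) S.Ident_Comp[OF um] k(2) S.Comp_assoc[OF n(1) n'(1) Fl] n'(2)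
        S.Comp_Ident[OF Fl] S.Ident_Comp[OF Fl] S.Comp_Ident[OF w'] by (simp_all add: v'_def w'_def)
    have c: "candidate_triangle S (u, v', w')" using uv(1) v' w' by (auto simp: candidate_triangle_def Hom_def)
    \<comment> \<open>The image triangle is carried along \<open>m\<close> and \<open>n\<close> to
      one that starts with \<open>u\<close> itself and keeps the third object \<open>F E\<close>;
      \<open>cone_unique\<close> then compares it with the given triangle.\<close>
    have "triangles_isomorphic S (FA k, FA l, h') (u, v', w')"
      unfolding triangles_isomorphic_def prod.case
      using S.Tri_candidate[OF h'] c m n sq S.Ident_in_Hom[OF FE] S.isomorphism_Ident[OF FE]
        S.HomD[OF Fk] S.HomD[OF Fl] S.HomD[OF h'H] S.HomD[OF uv(1)] S.HomD[OF v'] S.HomD[OF w'] by auto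
    then have "(u, v', w') \<in> Tri S" using S.TR1_iso[OF h'] by blast
    then have "isomorphic S (F E) Z" using S.cone_unique[OF _ uv(1) v' t(1) uv(2)] by blast
    moreover have "E \<in> Ob T" using T.Hom_Ob[OF tT(2)] by blast
    ultimately show ?thesis using S.HomD[OF uv(2)] S.Hom_Ob[OF uv(2)] by (auto simp: essential_image_def)
  qed
  show "B \<in> essential_image" if I: "small \<kappa> I" and X: "X ` I \<subseteq> essential_image" and B: "coproduct S I X B \<iota>"
    for I :: "'u set" and X B \<iota>
  proof -
    have "\<exists>Y k. Y \<in> Ob T \<and> k \<in> Hom S (X i) (F Y) \<and> isomorphism S k" if i: "i \<in> I" for i
    proof -
      have "X i \<in> essential_image" using X i by blast
      then obtain Y where "Y \<in> Ob T" "isomorphic S (F Y) (X i)" by (auto simp: essential_image_def)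
      then show ?thesis using S.isomorphic_sym unfolding isomorphic_def by blast
    qed
    then obtain Y k where Y: "\<And>i. i \<in> I \<Longrightarrow> Y i \<in> Ob T" and k: "\<And>i. i \<in> I \<Longrightarrow> k i \<in> Hom S (X i) (F (Y i))"
      "\<And>i. i \<in> I \<Longrightarrow> isomorphism S (k i)" by metis
    obtain A \<alpha> where A: "coproduct T I Y A \<alpha>" using T.ex_coproduct[OF T.inaccessible T.small_coproducts I Y] .
    note AO = T.coproductD(1)[OF A]
    have "coproduct S I X (F A) (\<lambda>i. Ident S (F A) \<cdot>\<^bsub>S\<^esub> (FA (\<alpha> i) \<cdot>\<^bsub>S\<^esub> k i))"
      using S.coproduct_cong_iso[OF F_coproduct[OF I A] k S.Ident_in_Hom[OF F_Ob[OF AO]] S.isomorphism_Ident[OF F_Ob[OF AO]]] .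
    then have "isomorphic S (F A) B" using S.coproduct_unique[OF _ B] by blast
    then show ?thesis using AO S.coproductD(1)[OF B] by (auto simp: essential_image_def)
  qed
qed

lemma F_image_shift_stable:
  assumes G: "shift_stable T G" shows "shift_stable S (F ` G)"
  unfolding shift_stable_def
proof (intro conjI ballI)
  have GO: "G \<subseteq> Ob T" using G by (simp add: shift_stable_def)
  show "F ` G \<subseteq> Ob S" using GO F_Ob by blast
  fix Y assume "Y \<in> F ` G"
  then obtain X where X: "X \<in> G" "Y = F X" by blast
  have XO: "X \<in> Ob T" using X GO by blast
  obtain X' where X': "X' \<in> G" "isomorphic T (Sh T X) X'" using G X unfolding shift_stable_def by blast
  show "\<exists>Y'\<in>F ` G. isomorphic S (Sh S Y) Y'"
    using S.isomorphic_trans[OF S.isomorphic_sym[OF F_shift[OF XO]] F_isomorphic[OF X'(2)]] X'(1) X(2) by blast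
  obtain X'' where X'': "X'' \<in> G" "isomorphic T (Sh T X'') X" using G X unfolding shift_stable_def by blast
  have "X'' \<in> Ob T" using X'' GO by blast
  then show "\<exists>Y'\<in>F ` G. isomorphic S (Sh S Y') Y"
    using S.isomorphic_trans[OF S.isomorphic_sym[OF F_shift] F_isomorphic[OF X''(2)]] X''(1) X(2) by blast
qed

lemma Ob_shift_stable: "shift_stable T (Ob T)"
  unfolding shift_stable_def using T.Sh_in_Ob T.isomorphic_refl T.ex_desuspension by blast

text \<open>The given generators need not be stable under suspension, as the orthogonality arguments
  require. Adding all iterated suspensions and desuspensions keeps the set small and its members
  compact.\<close>

lemma ex_generators:
  obtains G where "small \<kappa> G" "G \<subseteq> T.compact" "shift_stable T G" "Loc \<kappa> T G = Ob T"
proof -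
  obtain G0 where G0: "small \<kappa> G0" "G0 \<subseteq> T.compact" "Loc \<kappa> T G0 = Ob T"
    using T.rigidly_generated unfolding rigidly_compactly_generated_def compactly_generated_def by blast
  obtain d where d: "\<And>X. X \<in> Ob T \<Longrightarrow> d X \<in> Ob T" "\<And>X. X \<in> Ob T \<Longrightarrow> isomorphic T (Sh T (d X)) X"
    using T.ex_desuspension by metis
  have dC: "(d ^^ n) X \<in> T.compact" if "X \<in> T.compact" for n X
  proof (induction n)
    case (Suc n)
    have "Sh T (d ((d ^^ n) X)) \<in> T.compact"
      using T.compact_isomorphic[OF Suc T.isomorphic_sym[OF d(2)[OF T.compact_Ob[OF Suc]]]] .
    then show ?case using T.compact_desuspension[OF d(1)[OF T.compact_Ob[OF Suc]]] by simp
  qed (use that in simp)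
  have sC: "(Sh T ^^ n) X \<in> T.compact" if "X \<in> T.compact" for n X
    by (induction n) (use that T.compact_shift in auto)
  \<comment> \<open>Desuspend \<open>n\<close> times, then suspend \<open>m\<close> times.
    Suspending raises \<open>m\<close>; desuspending lowers \<open>m\<close>, or raises
    \<open>n\<close> when \<open>m\<close> is 0.\<close>
  define g where "g = (\<lambda>(m, n, X). (Sh T ^^ m) ((d ^^ n) X))"
  define G where "G = g ` (UNIV \<times> UNIV \<times> G0)"
  have "small \<kappa> (UNIV \<times> UNIV \<times> G0 :: (nat \<times> nat \<times> 'o) set)"
    using small_Sigma[OF T.inaccessible small_nat[OF T.inaccessible] small_Sigma[OF T.inaccessible small_nat[OF T.inaccessible] G0(1)]] .
  then have 1: "small \<kappa> G" unfolding G_def using small_image by blast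
  have gC: "g (m, n, X) \<in> T.compact" if "X \<in> G0" for m n X
    unfolding g_def using sC[OF dC] G0(2) that by auto
  have 2: "G \<subseteq> T.compact" unfolding G_def using gC by auto
  have "shift_stable T G" unfolding shift_stable_def
  proof (intro conjI ballI)
    show "G \<subseteq> Ob T" using 2 T.compact_Ob by blast
    fix Y assume "Y \<in> G"
    then obtain m n X where Y: "Y = g (m, n, X)" "X \<in> G0" by (auto simp: G_def)
    have "Sh T Y = g (Suc m, n, X)" by (simp add: Y g_def)
    moreover have "g (Suc m, n, X) \<in> G" unfolding G_def using Y(2) by blast
    ultimately show "\<exists>Y'\<in>G. isomorphic T (Sh T Y) Y'"
      using T.isomorphic_refl[OF T.compact_Ob[OF gC[OF Y(2)]]] by metis
    show "\<exists>Y'\<in>G. isomorphic T (Sh T Y') Y"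
    proof (cases m)
      case 0
      have "isomorphic T (Sh T (g (0, Suc n, X))) Y"
        using d(2)[OF T.compact_Ob[OF dC[of X n]]] G0(2) Y 0 by (auto simp: g_def)
      moreover have "g (0, Suc n, X) \<in> G" unfolding G_def using Y(2) by blast
      ultimately show ?thesis by blast
    next
      case (Suc k)
      have "Sh T (g (k, n, X)) = Y" by (simp add: Y Suc g_def)
      moreover have "g (k, n, X) \<in> G" unfolding G_def using Y(2) by blast
      ultimately show ?thesis using T.isomorphic_refl[OF T.compact_Ob[OF gC[OF Y(2)]]] Y by metis
    qed
  qed
  moreover have "Loc \<kappa> T G = Ob T"
  proof
    have "G0 \<subseteq> G"
    proof
      fix X assume "X \<in> G0"
      moreover have "X = g (0, 0, X)" by (simp add: g_def)
      ultimately show "X \<in> G" unfolding G_def by blast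
    qed
    then have "Loc \<kappa> T G0 \<subseteq> Loc \<kappa> T G" unfolding Loc_def by blast
    then show "Ob T \<subseteq> Loc \<kappa> T G" using G0(3) by simp
    have "localizing \<kappa> T (Loc \<kappa> T G)" using T.Loc_localizing 2 T.compact_Ob by blast
    then show "Loc \<kappa> T G \<subseteq> Ob T" by (simp add: localizing_def triangulated_subcategory_def)
  qed
  ultimately show thesis using that 1 2 by blast
qed

section \<open>The right orthogonal of the image and the negligible objects\<close>

abbreviation image_orthogonal :: "'p set" where "image_orthogonal \<equiv> right_orthogonal S (F ` Ob T)"

lemma image_orthogonal_shift_stable: "shift_stable S image_orthogonal"
  using S.right_orthogonal_shift_stable[OF F_image_shift_stable[OF Ob_shift_stable]] .

text \<open>The images of generators of \<open>T\<close> are compact, and once nothing nonzero is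
  right orthogonal to them they generate \<open>S\<close>; the essential image is localizing and
  contains them.\<close>

lemma essentially_surjective:
  assumes z: "\<And>Y. Y \<in> image_orthogonal \<Longrightarrow> zero_object S Y"
  shows "essential_image = Ob S"
proof
  show "essential_image \<subseteq> Ob S" by (auto simp: essential_image_def)
  obtain G where G: "small \<kappa> G" "G \<subseteq> T.compact" "shift_stable T G" "Loc \<kappa> T G = Ob T" using ex_generators .
  have GO: "G \<subseteq> Ob T" using G(2) T.compact_Ob by blast
  note FG = F_image_shift_stable[OF G(3)]
  show "Ob S \<subseteq> essential_image"
  proof
    fix X assume X: "X \<in> Ob S"
    show "X \<in> essential_image"
    proof (rule S.localizing_contains_generated[OF S.inaccessible S.small_coproducts S.local_smallness small_image[OF G(1)] _ _ essential_image_localizing _ _ X])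
      show "F ` G \<subseteq> S.compact" using F_compact G(2) by blast
      show "\<exists>g'\<in>F ` G. isomorphic S (Sh S g') g" if "g \<in> F ` G" for g using FG that unfolding shift_stable_def by blast
      show "F ` G \<subseteq> essential_image" using GO F_Ob S.isomorphic_refl by (auto simp: essential_image_def)
      fix Y assume Y: "Y \<in> right_orthogonal S (F ` G)"
      \<comment> \<open>Orthogonality to the images of generators extends to the whole image: the
        objects of \<open>T\<close> that are mapped into this left orthogonal form a localizing
        subcategory containing \<open>G\<close>.\<close>
      define L where "L = left_orthogonal S (right_orthogonal S (F ` G))"
      have "localizing \<kappa> S L" unfolding L_def using S.left_orthogonal_localizing[OF S.right_orthogonal_shift_stable[OF FG]] .
      from F_preimage_localizing[OF this] have "Loc \<kappa> T G \<subseteq> {X \<in> Ob T. F X \<in> L}"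
      proof (rule T.Loc_subset)
        show "G \<subseteq> {X \<in> Ob T. F X \<in> L}"
          using GO F_Ob by (auto simp: L_def left_orthogonal_def right_orthogonal_def)
      qed
      then have "orthogonal S (F X) Y" if "X \<in> Ob T" for X
        using G(4) that Y by (auto simp: L_def left_orthogonal_def)
      then have "Y \<in> image_orthogonal" using Y by (auto simp: right_orthogonal_def)
      then show "zero_object S Y" using z by blast
    qed
  qed
qed

text \<open>The quantifier over \<open>W\<close> turns a left orthogonal, which need not absorb
  tensor products, into a tensor ideal. Noncompact \<open>W\<close> matter: in the end
  \<open>W\<close> is an object of \<open>image_orthogonal\<close> itself.\<close>

definition negligible :: "'p set" where
  "negligible = {X \<in> Ob S. \<forall>W \<in> Ob S. X \<boxtimes>\<^bsub>S\<^esub> W \<in> left_orthogonal S image_orthogonal}"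

lemma negligible_thick: "thick S negligible"
proof -
  have "negligible = (\<Inter>W\<in>Ob S. {X \<in> Ob S. X \<boxtimes>\<^bsub>S\<^esub> W \<in> left_orthogonal S image_orthogonal})"
    using S.Unit_in_Ob by (auto simp: negligible_def)
  moreover have "thick S \<dots>"
    by (rule S.thick_INT[OF S.thick_tensor_preimage[OF S.left_orthogonal_thick[OF image_orthogonal_shift_stable]]])
      (use S.Unit_in_Ob in auto)
  ultimately show ?thesis by simp
qed

lemma negligible_isomorphic: "X \<in> negligible \<Longrightarrow> isomorphic S X Y \<Longrightarrow> Y \<in> negligible"
  using S.triangulated_subcategoryD(3)[OF S.thick_triangulated[OF negligible_thick]] .

lemma left_orthogonal_isomorphic:
  "X \<in> left_orthogonal S image_orthogonal \<Longrightarrow> isomorphic S X Y \<Longrightarrow> Y \<in> left_orthogonal S image_orthogonal"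
  using S.triangulated_subcategoryD(3)[OF S.thick_triangulated[OF S.left_orthogonal_thick[OF image_orthogonal_shift_stable]]] .

lemma negligible_left_orthogonal: "X \<in> negligible \<Longrightarrow> X \<in> left_orthogonal S image_orthogonal"
  using left_orthogonal_isomorphic[OF _ S.isomorphic_RUnit] S.Unit_in_Ob by (auto simp: negligible_def)

lemma negligible_ideal: "thick_ideal (compacts \<kappa> S) (negligible \<inter> S.compact)"
  unfolding S.thick_ideal_compacts_iff
proof (intro conjI ballI)
  show "thick S (negligible \<inter> S.compact)" using S.thick_Int[OF negligible_thick S.thick_compact] .
  fix X Y assume X: "X \<in> S.compact" and Y: "Y \<in> negligible \<inter> S.compact"
  have O: "X \<in> Ob S" "Y \<in> Ob S" using X Y S.compact_Ob by auto
  have "(X \<boxtimes>\<^bsub>S\<^esub> Y) \<boxtimes>\<^bsub>S\<^esub> W \<in> left_orthogonal S image_orthogonal" if W: "W \<in> Ob S" for W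
  proof (rule left_orthogonal_isomorphic)
    show "Y \<boxtimes>\<^bsub>S\<^esub> (X \<boxtimes>\<^bsub>S\<^esub> W) \<in> left_orthogonal S image_orthogonal"
      using Y S.Tens_in_Ob[OF O(1) W] by (auto simp: negligible_def)
    show "isomorphic S (Y \<boxtimes>\<^bsub>S\<^esub> (X \<boxtimes>\<^bsub>S\<^esub> W)) ((X \<boxtimes>\<^bsub>S\<^esub> Y) \<boxtimes>\<^bsub>S\<^esub> W)"
      using S.isomorphic_trans[OF S.isomorphic_sym[OF S.isomorphic_Assoc[OF O(2,1) W]]
          S.isomorphic_TensA[OF S.isomorphic_Braid[OF O(2,1)] S.isomorphic_refl[OF W]]] .
  qed
  then show "X \<boxtimes>\<^bsub>S\<^esub> Y \<in> negligible \<inter> S.compact"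
    using S.Tens_in_Ob[OF O] S.compact_Tens[OF X] Y by (auto simp: negligible_def)
qed blast

text \<open>Taking \<open>W = Y\<close> in the negligibility of the unit shows that \<open>Y\<close>
  is orthogonal to itself.\<close>

lemma zero_object_image_orthogonal:
  assumes "Unit S \<in> negligible" "Y \<in> image_orthogonal" shows "zero_object S Y"
proof -
  have Y: "Y \<in> Ob S" using assms(2) by (simp add: right_orthogonal_def)
  have "Unit S \<boxtimes>\<^bsub>S\<^esub> Y \<in> left_orthogonal S image_orthogonal" using assms(1) Y by (simp add: negligible_def)
  then have "Y \<in> left_orthogonal S image_orthogonal" using left_orthogonal_isomorphic S.isomorphic_LUnit[OF Y] by blast
  then show ?thesis using S.zero_object_orthogonal[OF Y] assms(2) by (simp add: left_orthogonal_def)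
qed

text \<open>The unit is isomorphic to \<open>F (Unit T)\<close>, hence left orthogonal to
  \<open>image_orthogonal\<close>; orthogonality to \<open>P\<close> makes \<open>Y\<close> local
  for the quotient, where the unit generates.\<close>

lemma local_orthogonal_zero:
  assumes lu: "locally_unigenic \<kappa> S" and P: "P \<in> primes (compacts \<kappa> S)"
    and Y: "Y \<in> image_orthogonal" "\<And>p. p \<in> P \<Longrightarrow> orthogonal S p Y"
  shows "zero_object S Y"
proof -
  have iP: "thick_ideal (compacts \<kappa> S) P" using P by (simp add: S.primes_iff)
  note PK = S.thick_idealD(1)[OF iP] and tP = S.thick_triangulated[OF S.thick_idealD(2)[OF iP]]
  have PO: "P \<subseteq> Ob S" using PK S.compact_Ob by blast
  have "shift_stable S P" unfolding shift_stable_def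
  proof (intro conjI ballI PO)
    fix X assume X: "X \<in> P"
    then have XO: "X \<in> Ob S" using PO by blast
    show "\<exists>Y'\<in>P. isomorphic S (Sh S X) Y'"
      using S.triangulated_subcategoryD(4)[OF tP XO] X S.isomorphic_refl[OF S.Sh_in_Ob[OF XO]] by blast
    obtain X' where X': "X' \<in> Ob S" "isomorphic S (Sh S X') X" using S.ex_desuspension[OF XO] by blast
    have "Sh S X' \<in> P" using S.triangulated_subcategoryD(3)[OF tP X S.isomorphic_sym[OF X'(2)]] .
    then show "\<exists>Y'\<in>P. isomorphic S (Sh S Y') X" using S.triangulated_subcategoryD(4)[OF tP X'(1)] X'(2) by blast
  qed
  then have st: "shift_stable S (P \<union> F ` Ob T)"
    using F_image_shift_stable[OF Ob_shift_stable] unfolding shift_stable_def by blast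
  \<comment> \<open>Both conditions on \<open>Y\<close> in one family: orthogonality to
    \<open>P\<close> gives locality, orthogonality to the image puts the unit in the left
    orthogonal.\<close>
  define B where "B = right_orthogonal S (P \<union> F ` Ob T)"
  have B: "shift_stable S B" unfolding B_def using S.right_orthogonal_shift_stable[OF st] .
  have PB: "P \<union> F ` Ob T \<subseteq> left_orthogonal S B"
    using st unfolding shift_stable_def B_def left_orthogonal_def right_orthogonal_def by blast
  define L where "L = Loc \<kappa> S P"
  have "localizing \<kappa> S L" unfolding L_def using S.Loc_localizing[OF PO] .
  then have L: "triangulated_subcategory S L" by (simp add: localizing_def)
  have "L \<subseteq> left_orthogonal S B" unfolding L_def
    using S.Loc_subset[OF S.left_orthogonal_localizing[OF B]] PB by blast
  then interpret quotient_orthogonal S L B using L B by unfold_locales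
  have "unigenic \<kappa> (verdier_quotient S L)"
    using lu P by (simp add: locally_unigenic_def local_category_def L_def)
  moreover have "Unit S \<in> left_orthogonal S B"
    using S.triangulated_subcategoryD(3)[OF S.thick_triangulated[OF S.left_orthogonal_thick[OF B]] _ S.isomorphic_sym[OF F_Unit]]
      PB T.Unit_in_Ob by blast
  moreover have "Y \<in> B" using Y by (auto simp: B_def right_orthogonal_def)
  ultimately show ?thesis using unigenic_quotient_zero by blast
qed

text \<open>Every prime containing \<open>F a\<close> contains the product; \<open>P\<close>
  contains the product but not \<open>F a\<close>, which makes the inclusion strict.\<close>

lemma supp_F_Tens:
  assumes a: "a \<in> T.compact" and b: "b \<in> T.compact" and P: "P \<in> primes (compacts \<kappa> S)" "F a \<notin> P" "F b \<in> P"
  shows "supp (compacts \<kappa> S) (F (b \<boxtimes>\<^bsub>T\<^esub> a)) \<subset> supp (compacts \<kappa> S) (F a)"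
proof -
  have O: "a \<in> Ob T" "b \<in> Ob T" using a b T.compact_Ob by auto
  note iso = F_Tens[OF O(2,1)]
  have ideal: "thick_ideal (compacts \<kappa> S) R" if "R \<in> primes (compacts \<kappa> S)" for R using that by (simp add: S.primes_iff)
  have "F (b \<boxtimes>\<^bsub>T\<^esub> a) \<in> R" if R: "R \<in> primes (compacts \<kappa> S)" "F a \<in> R" for R
    using S.thick_idealD(4)[OF ideal[OF R(1)] _ iso] S.thick_idealD(3)[OF ideal[OF R(1)] F_compact[OF b] R(2)] by blast
  moreover have "F (b \<boxtimes>\<^bsub>T\<^esub> a) \<in> P"
    using S.thick_idealD(4)[OF ideal[OF P(1)] _ iso] S.thick_idealD(3)[OF ideal[OF P(1)] F_compact[OF a] P(3)]
      S.thick_ideal_commute[OF ideal[OF P(1)] F_compact[OF a] F_compact[OF b]] by blast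
  ultimately show ?thesis using P unfolding S.supp_compacts by blast
qed

lemma Unit_negligible:
  assumes homeo: "homeomorphic_map (Spc (compacts \<kappa> S)) (Spc (compacts \<kappa> T)) (Spc_map \<kappa> T f)"
    and noeth: "noetherian_space (Spc (compacts \<kappa> S))" and lu: "locally_unigenic \<kappa> S"
  shows "Unit S \<in> negligible"
proof (rule ccontr)
  assume "Unit S \<notin> negligible"
  \<comment> \<open>The unit is replaced by an object of the image, so that the minimal choice below
    can be made among objects \<open>F a\<close>.\<close>
  then have "F (Unit T) \<notin> negligible" using negligible_isomorphic S.isomorphic_sym[OF F_Unit] by blast
  define N where "N = {a \<in> T.compact. F a \<notin> negligible}"
  have N0: "Unit T \<in> N" using \<open>F (Unit T) \<notin> negligible\<close> T.compact_Unit by (simp add: N_def)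
  define Z where "Z a = supp (compacts \<kappa> S) (F a)" for a
  \<comment> \<open>Supports of compact objects are closed, so a noetherian spectrum admits no
    strictly decreasing sequence of them.\<close>
  have "\<exists>a\<in>N. \<forall>b\<in>N. \<not> Z b \<subset> Z a"
  proof (rule ccontr)
    assume "\<not> (\<exists>a\<in>N. \<forall>b\<in>N. \<not> Z b \<subset> Z a)"
    then have step: "\<exists>b. b \<in> N \<and> Z b \<subset> Z a" if "a \<in> N" for a using that by blast
    obtain s where s: "\<And>n. s n \<in> N" "\<And>n. Z (s (Suc n)) \<subset> Z (s n)"
      using dependent_nat_choice[of "\<lambda>_ a. a \<in> N" "\<lambda>_ a b. Z b \<subset> Z a"] N0 step by metis
    have "decseq (\<lambda>n. Z (s n))" using s(2) by (intro decseq_SucI) blast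
    moreover have "closedin (Spc (compacts \<kappa> S)) (Z (s n))" for n
      unfolding Z_def using S.closedin_supp F_compact s(1) by (simp add: N_def)
    ultimately obtain M where "\<forall>n\<ge>M. Z (s n) = Z (s M)"
      using noeth[unfolded noetherian_space_def, THEN spec, of "\<lambda>n. Z (s n)"] by blast
    then show False using s(2)[of M] by (metis le_SucI order_refl psubset_eq)
  qed
  then obtain a where a: "a \<in> T.compact" "F a \<notin> negligible" and min: "\<And>b. b \<in> N \<Longrightarrow> \<not> Z b \<subset> Z a" by (auto simp: N_def)
  note Fa = F_compact[OF a(1)]
  note FaO = S.compact_Ob[OF Fa] and aO = T.compact_Ob[OF a(1)]
  obtain P where P: "P \<in> primes (compacts \<kappa> S)" "negligible \<inter> S.compact \<subseteq> P" "F a \<notin> P"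
    using S.ex_prime[OF negligible_ideal Fa] a(2) by blast
  \<comment> \<open>The colon ideal of the negligible compact objects by \<open>F a\<close>; the aim
    is \<open>P \<subseteq> J\<close>.\<close>
  define J where "J = {p \<in> S.compact. p \<boxtimes>\<^bsub>S\<^esub> F a \<in> negligible \<inter> S.compact}"
  have J: "thick_ideal (compacts \<kappa> S) J" unfolding J_def using S.thick_ideal_quotient[OF negligible_ideal Fa] .
  have FJ: "F b \<in> J" if b: "b \<in> T.compact" "F b \<in> P" for b
  proof -
    \<comment> \<open>The support of \<open>F (b \<boxtimes> a)\<close> is strictly smaller because
      it omits \<open>P\<close>; by minimality this object must be negligible.\<close>
    have "b \<boxtimes>\<^bsub>T\<^esub> a \<notin> N" using min supp_F_Tens[OF a(1) b(1) P(1,3) b(2)] unfolding Z_def by blast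
    then have "F (b \<boxtimes>\<^bsub>T\<^esub> a) \<in> negligible" using T.compact_Tens[OF b(1) a(1)] by (simp add: N_def)
    then have "F b \<boxtimes>\<^bsub>S\<^esub> F a \<in> negligible"
      using negligible_isomorphic S.isomorphic_sym[OF F_Tens[OF T.compact_Ob[OF b(1)] aO]] by blast
    then show ?thesis using S.compact_Tens[OF F_compact[OF b(1)] Fa] F_compact[OF b(1)] by (simp add: J_def)
  qed
  have PJ: "p \<in> J" if p: "p \<in> P" for p
  proof (rule ccontr)
    assume "p \<notin> J"
    moreover have pK: "p \<in> S.compact" using S.thick_idealD(1) P(1) p unfolding S.primes_iff by blast
    \<comment> \<open>Test \<open>p\<close> on a prime above \<open>J\<close> that omits it. The
      previous step gives \<open>?\<phi> P \<subseteq> ?\<phi> P'\<close>. The image of the basic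
      open set of \<open>p\<close> is open, hence stable under larger primes, so it contains
      \<open>?\<phi> P'\<close>; injectivity puts \<open>P'\<close> into the basic open set
      itself.\<close>
    ultimately obtain P' where P': "P' \<in> primes (compacts \<kappa> S)" "J \<subseteq> P'" "p \<notin> P'" using S.ex_prime[OF J] by blast
    let ?\<phi> = "Spc_map \<kappa> T f"
    define U where "U = {R \<in> primes (compacts \<kappa> S). p \<in> R}"
    have "open_map (Spc (compacts \<kappa> S)) (Spc (compacts \<kappa> T)) ?\<phi>" using homeomorphic_imp_open_map[OF homeo] .
    then have "openin (Spc (compacts \<kappa> T)) (?\<phi> ` U)" using S.openin_Spc_base[OF pK] by (simp add: open_map_def U_def)
    moreover have "?\<phi> P \<in> ?\<phi> ` U" using P(1) p by (simp add: U_def)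
    moreover have "?\<phi> P' \<in> primes (compacts \<kappa> T)"
      using homeomorphic_imp_surjective_map[OF homeo] P'(1) unfolding S.topspace_Spc T.topspace_Spc by blast
    moreover have "?\<phi> P \<subseteq> ?\<phi> P'" using FJ P'(2) by (auto simp: Spc_map_def)
    ultimately have "?\<phi> P' \<in> ?\<phi> ` U" using T.openin_Spc_subset(2) by blast
    then have "P' \<in> U"
      using homeomorphic_imp_injective_map[OF homeo] P'(1) unfolding S.topspace_Spc by (auto simp: U_def dest: inj_onD)
    then show False using P'(3) by (simp add: U_def)
  qed
  have "orthogonal S (F a \<boxtimes>\<^bsub>S\<^esub> W) Y" if W: "W \<in> Ob S" and Y: "Y \<in> image_orthogonal" for W Y
  proof -
    have YO: "Y \<in> Ob S" using Y by (simp add: right_orthogonal_def)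
    obtain H where H: "H \<in> Ob S" "\<And>W. W \<in> Ob S \<Longrightarrow> orthogonal S W H \<longleftrightarrow> orthogonal S (W \<boxtimes>\<^bsub>S\<^esub> F a) Y"
      using S.internal_hom_orthogonal[OF FaO YO] by metis
    have "orthogonal S (F X) H" if X: "X \<in> Ob T" for X
    proof -
      \<comment> \<open>The isomorphism between \<open>F X \<boxtimes> F a\<close> and
        \<open>F (X \<boxtimes> a)\<close> keeps the internal hom right orthogonal to the
        image.\<close>
      have "orthogonal S (F (X \<boxtimes>\<^bsub>T\<^esub> a)) Y" using Y T.Tens_in_Ob[OF X aO] by (auto simp: right_orthogonal_def)
      then show ?thesis
        using H(2)[OF F_Ob[OF X]] S.orthogonal_isomorphic_left[OF _ S.isomorphic_sym[OF F_Tens[OF X aO]]] by blast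
    qed
    then have "H \<in> image_orthogonal" using H(1) by (auto simp: right_orthogonal_def)
    moreover have "orthogonal S p H" if "p \<in> P" for p
    proof -
      \<comment> \<open>Here \<open>P \<subseteq> J\<close> enters: it makes the internal hom right
        orthogonal to \<open>P\<close>, hence local at \<open>P\<close>.\<close>
      have "p \<in> S.compact" "p \<boxtimes>\<^bsub>S\<^esub> F a \<in> left_orthogonal S image_orthogonal"
        using PJ[OF that] negligible_left_orthogonal by (auto simp: J_def)
      then show ?thesis using H(2)[OF S.compact_Ob] Y by (auto simp: left_orthogonal_def)
    qed
    ultimately have "zero_object S H" using local_orthogonal_zero[OF lu P(1)] by blast
    then have "orthogonal S W H" using S.zero_object_Hom(2) by (auto simp: orthogonal_def)
    then have "orthogonal S (W \<boxtimes>\<^bsub>S\<^esub> F a) Y" using H(2)[OF W] by simp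
    \<comment> \<open>Negligibility has \<open>F a\<close> on the left, while the internal hom was
      taken with \<open>F a\<close> on the right.\<close>
    then show ?thesis using S.orthogonal_isomorphic_left S.isomorphic_Braid[OF W FaO] by blast
  qed
  then have "F a \<in> negligible" using FaO S.Tens_in_Ob[OF FaO] by (auto simp: negligible_def left_orthogonal_def)
  then show False using a(2) by blast
qed

end

theorem proposition15p3:
  fixes \<kappa> :: "'u rel"
    and T :: "('o, 'm) tt_cat"
    and S :: "('p, 'n) tt_cat"
    and f :: "('o, 'm, 'p, 'n) tt_fun"
  assumes "inaccessible \<kappa>"
    and "rigidly_compactly_generated \<kappa> T"
    and "rigidly_compactly_generated \<kappa> S"
    and "geometric_functor \<kappa> T S f"
    and "fully_faithful T S f"
    and "homeomorphic_map (Spc (compacts \<kappa> S)) (Spc (compacts \<kappa> T)) (Spc_map \<kappa> T f)"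
    and "noetherian_space (Spc (compacts \<kappa> S))"
    and "locally_unigenic \<kappa> S"
  shows "is_equivalence T S f"
proof -
  interpret T: tt_category T using assms(2) by (simp add: rigidly_compactly_generated_def)
  interpret S: tt_category S using assms(3) by (simp add: rigidly_compactly_generated_def)
  interpret fully_faithful_geometric T S \<kappa> f using assms(1-5) by unfold_locales
  \<comment> \<open>A negligible unit makes every object right orthogonal to the image vanish, so
    the telescope argument reaches all of \<open>S\<close>.\<close>
  have "essential_image = Ob S"
    using essentially_surjective zero_object_image_orthogonal[OF Unit_negligible[OF assms(6-8)]] by blast
  then have "\<exists>X\<in>Ob T. isomorphic S (FOb f X) Y" if "Y \<in> Ob S" for Y using that by (auto simp: essential_image_def)
  then show ?thesis
    using fully_faithful_equivalence[OF T.category_axioms S.category_axioms F_functor full_faithful] by blast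
qed

end
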